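(* Let $1<p<\infty$, let $(a,b)\in L^\infty\times L^\infty$ be a Fredholm matching pair with subordinated pair $(c,d)$, $\kappa_1:=\operatorname{ind}T(c)$, $\kappa_2:=\operatorname{ind}T(d)$ on $H^p$, and let $(\kappa_1,\kappa_2)\in\mathbb{Z}_-\times\mathbb{Z}_+$. Let $n\in\mathbb{N}$ be the unique integer with $1\ge 2n+\kappa_1\ge0$, and write $\varphi_\pm=\varphi_\pm^{at^{-n},bt^n}$. Then for the operators $T(a)\pm H(b)$ on $H^p$: (i) If $\kappa_1$ is odd, then $$\ker(T(a)\pm H(b))=T(t^{-n})\left(\left\{\frac{1\mp\boldsymbol\sigma(c)}{2}c_+^{-1}\mathbb{C}\dotplus\varphi_\pm(\operatorname{im}\mathbf{P}_d^\pm)\right\}\cap\operatorname{im}T(t^n)\right)$$ $$=\left\{T(t^{-n})u:\ u\in\frac{1\mp\boldsymbol\sigma(c)}{2}c_+^{-1}\mathbb{C}\dotplus\varphi_\pm(\operatorname{im}\mathbf{P}_d^\pm)\ \text{and}\ \widehat u_0=\dots=\widehat u_{n-1}=0\right\},$$ where $\widehat u_k$, $k=0,1,\dots,n-1$, are the Fourier coefficients of $u$. (ii) If $\kappa_1$ is even, then $$\ker(T(a)\pm H(b))=T(t^{-n})\left(\varphi_\pm(\operatorname{im}\mathbf{P}_d^\pm)\cap\operatorname{im}T(t^n)\right)$$ $$=\left\{T(t^{-n})u:\ u\in\varphi_\pm(\operatorname{im}\mathbf{P}_d^\pm)\ \text{and}\ \widehat u_0=\dots=\widehat u_{n-1}=0\right\}.$$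 (In each formula either all upper or all lower signs are taken.)
   Context: $\mathbb{T}$ is the unit circle, $L^p=L^p(\mathbb{T})$, $1/p+1/q=1$, $H^p=\{f\in L^p:\widehat f_n=0\text{ for }n<0\}$, $\overline{H^p}=\{f\in L^p:\widehat f_n=0\text{ for }n>0\}$; $f(0)=\widehat f_0$ for $f\in H^p$, $f(\infty)=\widehat f_0$ for $f\in\overline{H^p}$. $P$ is the Riesz projection of $L^p$ onto $H^p$, $Q=I-P$, $(Jf)(t)=\overline tf(\overline t)$, $\widetilde a(t)=a(1/t)$; $T(a)f=P(af)$, $H(a)f=PaQJf$ on $H^p$ for $a\in L^\infty$. $\mathbb{Z}_+=\mathbb{N}\cup\{0\}$, $\mathbb{Z}_-$ is the set of negative integers. The index is $\dim\ker-\dim\operatorname{coker}$. A matching pair $(a,b)$ consists of $a\in L^\infty$ invertible in $L^\infty$ and $b\in L^\infty$ with $a\widetilde a=b\widetilde b$ (then $b$ is invertible too). Its subordinated pair is $(c,d)$ with $c=ab^{-1}=\widetilde b\widetilde a^{-1}$, $d=b\widetilde a^{-1}=a\widetilde b^{-1}$. It is Fredholm if $T(c)$ and $T(d)$ are Fredholm on $H^p$. The pair $(at^{-n},bt^n)$ is a matching pair with subordinated pair $(ct^{-2n},d)$. Wiener--Hopf factorization of $g\in L^\infty$ in $H^p$: $g=g_-t^{\nu}g_+$ with $\nu\in\mathbb{Z}$, $g_+\in H^q$, $g_+^{-1}\in H^p$, $g_-\in\overline{H^p}$, $g_-^{-1}\in\overline{H^q}$, $g_-(\infty)=1$, such that $g_+^{-1}Pg_-^{-1}I$,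 defined on $\operatorname{span}\{t^k:k\ge0\}$, extends boundedly to $H^p$. It is unique and exists iff $T(g)$ is Fredholm on $H^p$; then $\nu=-\operatorname{ind}T(g)$. $c_+$ is the plus-factor of $c$. If $g\widetilde g=1$ and $T(g)$ is Fredholm, then $\boldsymbol\sigma(g):=g_+(0)\in\{1,-1\}$ is the factorization signature. For $g\in L^\infty$ with $g\widetilde g=1$, $\mathbf{P}_g:=JQgP|_{\ker T(g)}$ maps $\ker T(g)$ into itself, $\mathbf{P}_g^2=I$, and $\mathbf{P}_g^{\pm}:=\frac12(I\pm\mathbf{P}_g)$. For $g$ with $T(g)$ Fredholm of index $\kappa\ge0$, $T_r^{-1}(g):=T^{-1}(gt^{\kappa})T(t^{\kappa})$, a right inverse of $T(g)$. For a matching pair $(\alpha,\beta)$ with subordinated pair $(\gamma,\delta)$ such that $T(\gamma)$ is Fredholm of nonnegative index, for $s\in\ker T(\delta)$, $$\varphi_\pm^{\alpha,\beta}(s):=T_r^{-1}(\gamma)T(\widetilde\alpha^{-1})s\mp JQ\gamma P\,T_r^{-1}(\gamma)T(\widetilde\alpha^{-1})s\pm JQ\widetilde\alpha^{-1}s.$$ *)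

theory Defs
  imports "HOL-Analysis.Analysis" "HOL-Library.Set_Algebras"
begin

definition circle_measure :: "complex measure" where
  "circle_measure = distr (uniform_measure lborel {-pi..pi}) borel cis"

definition circle_eq :: "(complex \<Rightarrow> complex) \<Rightarrow> (complex \<Rightarrow> complex) \<Rightarrow> bool" where
  "circle_eq f g \<longleftrightarrow> f \<in> borel_measurable borel \<and> g \<in> borel_measurable borel \<and>
     (AE t in circle_measure. f t = g t)"

lemma space_circle_measure [simp]: "space circle_measure = UNIV"
  and sets_circle_measure [simp, measurable_cong]: "sets circle_measure = sets borel"
  by (simp_all add: circle_measure_def)

lemma cis_borel [measurable]: "cis \<in> borel_measurable borel"
  by (intro borel_measurable_continuous_onI continuous_intros)

lemma AE_circle_measure_iff:
  assumes [measurable]: "Measurable.pred borel P"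
  shows "(AE t in circle_measure. P t) \<longleftrightarrow> (AE x in lborel. x \<in> {-pi..pi} \<longrightarrow> P (cis x))"
proof -
  have "(AE t in circle_measure. P t) \<longleftrightarrow> (AE x in uniform_measure lborel {-pi..pi}. P (cis x))"
    unfolding circle_measure_def by (subst AE_distr_iff) auto
  also have "\<dots> \<longleftrightarrow> (AE x in lborel. x \<in> {-pi..pi} \<longrightarrow> P (cis x))"
    by (subst AE_uniform_measure) auto
  finally show ?thesis .
qed

lemma AE_circle_measure_reflect:
  assumes [measurable]: "Measurable.pred borel P"
    and P: "AE t in circle_measure. P t"
  shows "AE t in circle_measure. P (1 / t)" "AE t in circle_measure. P (cnj t)"
proof -
  have [measurable]: "cnj \<in> borel_measurable borel"
    by (intro borel_measurable_continuous_onI continuous_intros)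
  have "AE x in distr lborel borel uminus. x \<in> {-pi..pi} \<longrightarrow> P (cis x)"
    unfolding lborel_distr_uminus using P by (simp only: AE_circle_measure_iff [OF assms(1)])
  then have *: "AE x in lborel. - x \<in> {-pi..pi} \<longrightarrow> P (cis (- x))"
    by (subst (asm) AE_distr_iff) auto
  have "AE x in lborel. x \<in> {-pi..pi} \<longrightarrow> P (1 / cis x)"
    using * by (rule AE_mp) (auto simp: cis_inverse [symmetric] inverse_eq_divide)
  then show "AE t in circle_measure. P (1 / t)"
    by (subst AE_circle_measure_iff) auto
  have "AE x in lborel. x \<in> {-pi..pi} \<longrightarrow> P (cnj (cis x))"
    using * by (rule AE_mp) (auto simp: cis_cnj)
  then show "AE t in circle_measure. P (cnj t)"
    by (subst AE_circle_measure_iff) auto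
qed

lemma part_equivp_circle_eq: "part_equivp circle_eq"
proof (rule part_equivpI)
  show "\<exists>f. circle_eq f f"
    by (rule exI [of _ "\<lambda>_. 0"]) (simp add: circle_eq_def)
  show "symp circle_eq"
    by (auto simp: symp_def circle_eq_def eq_commute)
  show "transp circle_eq"
    unfolding transp_def circle_eq_def by (auto elim: AE_mp)
qed

(* Classes of complex-valued Borel functions; only the values on the unit circle matter. *)
quotient_type circle_fun = "complex \<Rightarrow> complex" / partial: circle_eq
  by (rule part_equivp_circle_eq)

instantiation circle_fun :: "{comm_ring_1, inverse}"
begin

lift_definition zero_circle_fun :: circle_fun is "\<lambda>_. 0"
  by (simp add: circle_eq_def)

lift_definition one_circle_fun :: circle_fun is "\<lambda>_. 1"
  by (simp add: circle_eq_def)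

lift_definition plus_circle_fun :: "circle_fun \<Rightarrow> circle_fun \<Rightarrow> circle_fun"
  is "\<lambda>f g t. f t + g t"
  unfolding circle_eq_def by auto

lift_definition minus_circle_fun :: "circle_fun \<Rightarrow> circle_fun \<Rightarrow> circle_fun"
  is "\<lambda>f g t. f t - g t"
  unfolding circle_eq_def by auto

lift_definition uminus_circle_fun :: "circle_fun \<Rightarrow> circle_fun"
  is "\<lambda>f t. - f t"
  unfolding circle_eq_def by auto

lift_definition times_circle_fun :: "circle_fun \<Rightarrow> circle_fun \<Rightarrow> circle_fun"
  is "\<lambda>f g t. f t * g t"
  unfolding circle_eq_def by auto

(* Pointwise, so f * inverse f = 1 holds only if f is nonzero almost everywhere. *)
lift_definition inverse_circle_fun :: "circle_fun \<Rightarrow> circle_fun"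
  is "\<lambda>f t. inverse (f t)"
  unfolding circle_eq_def by auto

definition divide_circle_fun :: "circle_fun \<Rightarrow> circle_fun \<Rightarrow> circle_fun" where
  "divide_circle_fun f g = f * inverse g"

instance
proof
  have "\<not> (AE x in lborel. x \<in> {-pi..pi} \<longrightarrow> False)"
  proof
    assume "AE x in lborel. x \<in> {-pi..pi} \<longrightarrow> False"
    then have "emeasure lborel {x::real. x \<in> {-pi..pi}} = 0"
      by (subst (asm) AE_iff_measurable [OF _ refl]) auto
    then have "emeasure lborel {-pi..pi} = 0"
      by (simp only: Collect_mem_eq)
    then show False
      using pi_gt_zero by (simp add: ennreal_eq_0_iff)
  qed
  then have "\<not> circle_eq (\<lambda>_. 0) (\<lambda>_. 1)"
    unfolding circle_eq_def by (subst AE_circle_measure_iff) auto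
  then show "(0::circle_fun) \<noteq> 1"
    by transfer
qed (transfer; auto simp: circle_eq_def algebra_simps)+

end

lift_definition const_fun :: "complex \<Rightarrow> circle_fun" is "\<lambda>z _. z"
  by (simp add: circle_eq_def)

lift_definition tpow :: "int \<Rightarrow> circle_fun" is "\<lambda>n t. t powi n"
  by (auto simp: circle_eq_def power_int_def)

lift_definition tilde :: "circle_fun \<Rightarrow> circle_fun" is "\<lambda>f t. f (1 / t)"
proof -
  fix f g assume fg: "circle_eq f g"
  have [measurable]: "f \<in> borel_measurable borel" "g \<in> borel_measurable borel"
    using fg by (auto simp: circle_eq_def)
  have "AE t in circle_measure. f (1 / t) = g (1 / t)"
    using fg by (intro AE_circle_measure_reflect(1)) (auto simp: circle_eq_def)
  then show "circle_eq (\<lambda>t. f (1 / t)) (\<lambda>t. g (1 / t))"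
    by (auto simp: circle_eq_def)
qed

lift_definition flip_J :: "circle_fun \<Rightarrow> circle_fun" is "\<lambda>f t. cnj t * f (cnj t)"
proof -
  fix f g assume fg: "circle_eq f g"
  have [measurable]: "cnj \<in> borel_measurable borel"
    by (intro borel_measurable_continuous_onI continuous_intros)
  have [measurable]: "f \<in> borel_measurable borel" "g \<in> borel_measurable borel"
    using fg by (auto simp: circle_eq_def)
  have "AE t in circle_measure. f (cnj t) = g (cnj t)"
    using fg by (intro AE_circle_measure_reflect(2)) (auto simp: circle_eq_def)
  then show "circle_eq (\<lambda>t. cnj t * f (cnj t)) (\<lambda>t. cnj t * g (cnj t))"
    by (auto simp: circle_eq_def elim: AE_mp)
qed

definition cscale :: "complex \<Rightarrow> circle_fun \<Rightarrow> circle_fun" where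
  "cscale z f = const_fun z * f"

global_interpretation circ: vector_space cscale
  unfolding cscale_def
  by unfold_locales (transfer; auto simp: circle_eq_def algebra_simps)+

lift_definition p_integrable :: "real \<Rightarrow> circle_fun \<Rightarrow> bool"
  is "\<lambda>p f. integrable circle_measure (\<lambda>t. norm (f t) powr p)"
  by (intro integrable_cong_AE) (auto simp: circle_eq_def)

definition Lp :: "real \<Rightarrow> circle_fun set" where
  "Lp p = {f. p_integrable p f}"

lift_definition lp_norm :: "real \<Rightarrow> circle_fun \<Rightarrow> real"
  is "\<lambda>p f. (\<integral>t. norm (f t) powr p \<partial>circle_measure) powr (1 / p)"
  by (intro arg_cong2 [where f = "(powr)"] integral_cong_AE) (auto simp: circle_eq_def)

lift_definition essentially_bounded :: "circle_fun \<Rightarrow> bool"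
  is "\<lambda>f. \<exists>C. AE t in circle_measure. norm (f t) \<le> C"
proof -
  fix f g assume "circle_eq f g"
  then have eq: "AE t in circle_measure. f t = g t"
    by (simp add: circle_eq_def)
  have "(AE t in circle_measure. norm (f t) \<le> C) = (AE t in circle_measure. norm (g t) \<le> C)" for C
    using eq by (intro AE_cong_simp eventually_subst) (auto elim: AE_mp)
  then show "(\<exists>C. AE t in circle_measure. norm (f t) \<le> C) = (\<exists>C. AE t in circle_measure. norm (g t) \<le> C)"
    by simp
qed

definition Linf :: "circle_fun set" where
  "Linf = {f. essentially_bounded f}"

(* Meaningful on L^1 only: the integral of a non-integrable function is 0. *)
lift_definition fcoeff :: "circle_fun \<Rightarrow> int \<Rightarrow> complex"
  is "\<lambda>f n. \<integral>t. f t * t powi (- n) \<partial>circle_measure"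
  by (intro ext integral_cong_AE) (auto simp: circle_eq_def power_int_def)

definition hardy :: "real \<Rightarrow> circle_fun set" where
  "hardy p = {f \<in> Lp p. \<forall>n<0. fcoeff f n = 0}"

definition conj_hardy :: "real \<Rightarrow> circle_fun set" where
  "conj_hardy p = {f \<in> Lp p. \<forall>n>0. fcoeff f n = 0}"

(* On every L^p with 1 < p < \<infinity> this is the projection onto H^p along the functions whose Fourier
   coefficients of nonnegative index vanish: by M. Riesz's theorem the g below exists and lies in
   H^p. Describing g in H^1 gives one operator P for all these exponents at once. *)
definition riesz_P :: "circle_fun \<Rightarrow> circle_fun" where
  "riesz_P f = (THE g. g \<in> hardy 1 \<and> (\<forall>n\<ge>0. fcoeff g n = fcoeff f n))"

definition riesz_Q :: "circle_fun \<Rightarrow> circle_fun" where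
  "riesz_Q f = f - riesz_P f"

definition bounded_operator :: "real \<Rightarrow> circle_fun set \<Rightarrow> (circle_fun \<Rightarrow> circle_fun) \<Rightarrow> bool" where
  "bounded_operator p V A \<longleftrightarrow>
     (\<forall>f\<in>V. A f \<in> V) \<and>
     (\<forall>f\<in>V. \<forall>g\<in>V. A (f + g) = A f + A g) \<and>
     (\<forall>z. \<forall>f\<in>V. A (cscale z f) = cscale z (A f)) \<and>
     (\<exists>C. \<forall>f\<in>V. lp_norm p (A f) \<le> C * lp_norm p f)"

definition lp_closed_in :: "real \<Rightarrow> circle_fun set \<Rightarrow> circle_fun set \<Rightarrow> bool" where
  "lp_closed_in p V W \<longleftrightarrow>
     (\<forall>h f. (\<forall>k. h k \<in> W) \<and> f \<in> V \<and> (\<lambda>k::nat. lp_norm p (h k - f)) \<longlonglongrightarrow> 0 \<longrightarrow> f \<in> W)"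

definition ker_on :: "circle_fun set \<Rightarrow> (circle_fun \<Rightarrow> circle_fun) \<Rightarrow> circle_fun set" where
  "ker_on V A = {f \<in> V. A f = 0}"

definition spans_modulo :: "circle_fun set \<Rightarrow> circle_fun set \<Rightarrow> circle_fun set \<Rightarrow> bool" where
  "spans_modulo V W B \<longleftrightarrow> finite B \<and> B \<subseteq> V \<and> V \<subseteq> circ.span (W \<union> B)"

(* The dimension of the quotient space V / W: the least number of vectors of V whose classes
   span V / W. *)
definition codim_in :: "circle_fun set \<Rightarrow> circle_fun set \<Rightarrow> nat" where
  "codim_in V W = (LEAST m. \<exists>B. spans_modulo V W B \<and> card B = m)"

definition fredholm :: "real \<Rightarrow> circle_fun set \<Rightarrow> (circle_fun \<Rightarrow> circle_fun) \<Rightarrow> bool" where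
  "fredholm p V A \<longleftrightarrow>
     bounded_operator p V A \<and>
     lp_closed_in p V (A ` V) \<and>
     (\<exists>B. finite B \<and> ker_on V A \<subseteq> circ.span B) \<and>
     (\<exists>B. spans_modulo V (A ` V) B)"

definition index_on :: "circle_fun set \<Rightarrow> (circle_fun \<Rightarrow> circle_fun) \<Rightarrow> int" where
  "index_on V A = int (circ.dim (ker_on V A)) - int (codim_in V (A ` V))"

definition toeplitz :: "circle_fun \<Rightarrow> circle_fun \<Rightarrow> circle_fun" where
  "toeplitz a f = riesz_P (a * f)"

definition hankel :: "circle_fun \<Rightarrow> circle_fun \<Rightarrow> circle_fun" where
  "hankel a f = riesz_P (a * riesz_Q (flip_J f))"

abbreviation ind_T :: "real \<Rightarrow> circle_fun \<Rightarrow> int" where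
  "ind_T p g \<equiv> index_on (hardy p) (toeplitz g)"

definition matching_pair :: "circle_fun \<Rightarrow> circle_fun \<Rightarrow> bool" where
  "matching_pair a b \<longleftrightarrow>
     a \<in> Linf \<and> (\<exists>a'\<in>Linf. a * a' = 1) \<and> b \<in> Linf \<and> a * tilde a = b * tilde b"

(* For a matching pair b is nonzero almost everywhere too, since a * tilde a is. *)
definition sub_c :: "circle_fun \<Rightarrow> circle_fun \<Rightarrow> circle_fun" where
  "sub_c a b = a * inverse b"

definition sub_d :: "circle_fun \<Rightarrow> circle_fun \<Rightarrow> circle_fun" where
  "sub_d a b = b * inverse (tilde a)"

definition fredholm_matching_pair :: "real \<Rightarrow> circle_fun \<Rightarrow> circle_fun \<Rightarrow> bool" where
  "fredholm_matching_pair p a b \<longleftrightarrow>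
     matching_pair a b \<and>
     fredholm p (hardy p) (toeplitz (sub_c a b)) \<and>
     fredholm p (hardy p) (toeplitz (sub_d a b))"

abbreviation conj_exponent :: "real \<Rightarrow> real" where
  "conj_exponent p \<equiv> p / (p - 1)"

(* The conditions x * inverse x = 1 say that the two factors are nonzero almost everywhere. *)
definition wh_factorization ::
    "real \<Rightarrow> circle_fun \<Rightarrow> circle_fun \<Rightarrow> int \<Rightarrow> circle_fun \<Rightarrow> bool" where
  "wh_factorization p g gm \<nu> gp \<longleftrightarrow>
     g = gm * tpow \<nu> * gp \<and>
     gp * inverse gp = 1 \<and> gm * inverse gm = 1 \<and>
     gp \<in> hardy (conj_exponent p) \<and> inverse gp \<in> hardy p \<and>
     gm \<in> conj_hardy p \<and> inverse gm \<in> conj_hardy (conj_exponent p) \<and>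
     fcoeff gm 0 = 1 \<and>
     (\<exists>A. bounded_operator p (hardy p) A \<and>
        (\<forall>u \<in> circ.span {tpow k | k. k \<ge> 0}. A u = inverse gp * riesz_P (inverse gm * u)))"

definition plus_factor :: "real \<Rightarrow> circle_fun \<Rightarrow> circle_fun" where
  "plus_factor p g = (THE gp. \<exists>gm \<nu>. wh_factorization p g gm \<nu> gp)"

definition signature :: "real \<Rightarrow> circle_fun \<Rightarrow> complex" where
  "signature p g = fcoeff (plus_factor p g) 0"

definition proj_P :: "circle_fun \<Rightarrow> circle_fun \<Rightarrow> circle_fun" where
  "proj_P g f = flip_J (riesz_Q (g * riesz_P f))"

(* Here and below \<epsilon> = 1 gives the upper and \<epsilon> = -1 the lower of the signs. *)
definition proj_sign :: "complex \<Rightarrow> circle_fun \<Rightarrow> circle_fun \<Rightarrow> circle_fun" where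
  "proj_sign \<epsilon> g f = cscale (1 / 2) (f + cscale \<epsilon> (proj_P g f))"

definition im_proj_sign :: "real \<Rightarrow> complex \<Rightarrow> circle_fun \<Rightarrow> circle_fun set" where
  "im_proj_sign p \<epsilon> g = proj_sign \<epsilon> g ` ker_on (hardy p) (toeplitz g)"

definition toeplitz_inv :: "real \<Rightarrow> circle_fun \<Rightarrow> circle_fun \<Rightarrow> circle_fun" where
  "toeplitz_inv p g = inv_into (hardy p) (toeplitz g)"

definition toeplitz_rinv :: "real \<Rightarrow> circle_fun \<Rightarrow> circle_fun \<Rightarrow> circle_fun" where
  "toeplitz_rinv p g f =
     toeplitz_inv p (g * tpow (ind_T p g)) (toeplitz (tpow (ind_T p g)) f)"

definition phi :: "real \<Rightarrow> complex \<Rightarrow> circle_fun \<Rightarrow> circle_fun \<Rightarrow> circle_fun \<Rightarrow> circle_fun" where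
  "phi p \<epsilon> \<alpha> \<beta> s =
     (let \<gamma> = sub_c \<alpha> \<beta>;
          w = toeplitz_rinv p \<gamma> (toeplitz (inverse (tilde \<alpha>)) s)
      in w - cscale \<epsilon> (flip_J (riesz_Q (\<gamma> * riesz_P w)))
           + cscale \<epsilon> (flip_J (riesz_Q (inverse (tilde \<alpha>) * s))))"

definition ker_TH :: "real \<Rightarrow> complex \<Rightarrow> circle_fun \<Rightarrow> circle_fun \<Rightarrow> circle_fun set" where
  "ker_TH p \<epsilon> a b = ker_on (hardy p) (\<lambda>f. toeplitz a f + cscale \<epsilon> (hankel b f))"

end

theory Submission
  imports Defs "HOL-Complex_Analysis.Cauchy_Integral_Formula"
begin

text \<open>
  Write \<open>J\<close> for the flip. A function \<open>f\<close> lies in the kernel of \<open>T(a) \<plusminus> H(b)\<close> iff \<open>a f \<plusminus> b J f = J g\<close> for some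
  \<open>g\<close> in \<open>H\<^sup>p\<close>. Multiplying by units and applying \<open>J\<close> turns this into \<open>c f \<plusminus> J f = \<plusminus> a(1/t)\<^sup>-\<^sup>1 g\<close>, which
  forces \<open>d g = \<plusminus> J g\<close>, i.e. \<open>g\<close> lies in the image of the projection for \<open>d\<close>; \<open>\<phi>(s)\<close> is a solution with
  \<open>g = \<plusminus> 2 s\<close>, and what remains are the solutions of the homogeneous equation \<open>c f \<plusminus> J f = 0\<close>. Passing to
  \<open>(a t\<^sup>-\<^sup>n, b t\<^sup>n)\<close> moves the index of \<open>T(c)\<close> to 0 or 1. For index 0 the homogeneous equation has only
  the zero solution; for index 1 the kernel of \<open>T(c)\<close> is spanned by the inverse of the plus-factor, and since
  the two factors of \<open>c\<close> are flips of each other up to the signature, that sign decides whether it solves the equation.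

  M. Riesz's theorem comes from Calderon's inequality for
  \<open>1 < p \<le> 2\<close> and duality; Coburn's lemma from the invariance of the range under the backward shift. The
  factorization is obtained from \<open>h = T(G)\<^sup>-\<^sup>1 1\<close> with \<open>T(G)\<close> invertible: the functional \<open>f \<mapsto> (T(G)\<^sup>-\<^sup>1 f)(0)\<close>
  gives the Taylor coefficients of the reciprocal of the minus-factor, its boundedness bounds their Abel means
  in \<open>L\<^sup>q\<close>, and Fatou's lemma carries the bound to the boundary.
\<close>

section \<open>The circle and classes of functions on it\<close>

text \<open>The passage to the shifted pair loses nothing: the flip turns t^n into t^(-n), so
  \<open>a * tpow (- n)\<close> on t^n f and \<open>b * tpow n\<close> on the flip of t^n f give the
  same functions as \<open>a\<close> on f and \<open>b\<close> on the flip of f. Hence f solves the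
  original problem iff t^n f solves the shifted one, and the vanishing of the first n coefficients
  says that a solution of the shifted problem has the form t^n f. Both members of the pair move, so
  the index of T(c) moves in steps of two, and its parity decides between 1 and 0.

  The plus-factor and the signature are given by description, so a factorization of c has to be
  built from Fredholmness alone. Its two candidates are at hand once \<open>T(G) h = 1\<close> is
  solved: G h and 1/h. What is not visible is that their reciprocal partners are integrable to the
  power q and analytic on the correct side. Bounded functionals on H^p, determined by their values
  on monomials, carry this information; no representation of the dual of H^p is involved.\<close>

lemma emeasure_circle_measure: "emeasure circle_measure UNIV = 1"
proof -
  have "emeasure circle_measure UNIV = emeasure (uniform_measure lborel {-pi..pi}) UNIV"
    unfolding circle_measure_def by (subst emeasure_distr) auto
  also have "\<dots> = emeasure lborel {-pi..pi} / emeasure lborel {-pi..pi}"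
    by (subst emeasure_uniform_measure) auto
  also have "\<dots> = 1"
    using pi_gt_zero by (intro ennreal_divide_self) (simp_all add: ennreal_eq_0_iff not_le)
  finally show ?thesis .
qed

interpretation circle: finite_measure circle_measure
  by (rule finite_measureI) (simp add: emeasure_circle_measure)

interpretation circle_pair: pair_sigma_finite circle_measure circle_measure
  by unfold_locales

lemma measure_circle_measure: "measure circle_measure UNIV = 1"
  by (simp add: measure_def emeasure_circle_measure)

lemma AE_circle_norm: "AE t in circle_measure. norm t = 1"
  by (subst AE_circle_measure_iff) auto

lemma AE_circle_inverse: "AE t in circle_measure. t \<noteq> 0 \<and> inverse t = cnj t"
  using AE_circle_norm
proof eventually_elim
  case (elim t)
  then have "t * cnj t = 1" by (simp add: complex_norm_square [symmetric])
  then show ?case by (metis inverse_unique mult_zero_left zero_neq_one)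
qed

lemma cnj_borel [measurable]: "cnj \<in> borel_measurable borel"
  by (intro borel_measurable_continuous_onI continuous_intros)

lemma distr_circle_cnj: "distr circle_measure borel cnj = circle_measure"
proof (rule measure_eqI)
  fix A :: "complex set" assume "A \<in> sets (distr circle_measure borel cnj)"
  then have [measurable]: "A \<in> sets borel" by simp
  define B where "B = {-pi..pi} \<inter> cis -` A"
  have [measurable]: "B \<in> sets borel"
    unfolding B_def using measurable_sets_borel [OF cis_borel, of A] by auto
  have "emeasure (distr circle_measure borel cnj) A = emeasure circle_measure (cnj -` A)"
    by (subst emeasure_distr) auto
  also have "\<dots> = emeasure (uniform_measure lborel {-pi..pi}) (cis -` cnj -` A)"
    unfolding circle_measure_def
    using measurable_sets_borel [OF cnj_borel, of A] by (subst emeasure_distr) auto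
  also have "\<dots> = emeasure lborel ({-pi..pi} \<inter> (cis -` cnj -` A)) / emeasure lborel {-pi..pi}"
  proof (rule emeasure_uniform_measure)
    show "cis -` cnj -` A \<in> sets lborel"
      using measurable_sets_borel [OF cis_borel, of "cnj -` A"]
        measurable_sets_borel [OF cnj_borel, of A] by auto
  qed auto
  also have "{-pi..pi} \<inter> (cis -` cnj -` A) = uminus -` B"
    by (auto simp: B_def cis_cnj)
  also have "emeasure lborel (uminus -` B) = emeasure (distr lborel borel uminus) B"
    by (subst emeasure_distr) auto
  also have "\<dots> = emeasure lborel B"
    by (simp add: lborel_distr_uminus)
  also have "emeasure lborel B / emeasure lborel {-pi..pi} = emeasure (uniform_measure lborel {-pi..pi}) (cis -` A)"
    unfolding B_def using measurable_sets_borel [OF cis_borel, of "A"]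
    by (subst emeasure_uniform_measure) auto
  also have "\<dots> = emeasure circle_measure A"
    unfolding circle_measure_def by (subst emeasure_distr) auto
  finally show "emeasure (distr circle_measure borel cnj) A = emeasure circle_measure A" .
qed simp

lemma integral_circle_cnj:
  fixes f :: "complex \<Rightarrow> 'a :: {banach, second_countable_topology}"
  assumes [measurable]: "f \<in> borel_measurable borel"
  shows "(\<integral>t. f (cnj t) \<partial>circle_measure) = (\<integral>t. f t \<partial>circle_measure)"
  using integral_distr [of cnj circle_measure borel f] by (simp add: distr_circle_cnj)

lemma integrable_circle_cnj:
  fixes f :: "complex \<Rightarrow> 'a :: {banach, second_countable_topology}"
  assumes [measurable]: "f \<in> borel_measurable borel"
  shows "integrable circle_measure (\<lambda>t. f (cnj t)) \<longleftrightarrow> integrable circle_measure f"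
  using integrable_distr_eq [of cnj circle_measure borel f] by (simp add: distr_circle_cnj)

lemma integral_circle_eq:
  fixes f :: "complex \<Rightarrow> 'a :: {banach, second_countable_topology}"
  assumes [measurable]: "f \<in> borel_measurable borel"
  shows "(\<integral>t. f t \<partial>circle_measure)
    = (1 / (2 * pi)) *\<^sub>R (\<integral>x. indicator {-pi..pi} x *\<^sub>R f (cis x) \<partial>lborel)"
proof -
  have *: "uniform_measure lborel {-pi..pi} = density lborel (\<lambda>x. ennreal (indicator {-pi..pi} x / (2 * pi)))"
    unfolding uniform_measure_def
    using pi_gt_zero
    by (intro density_cong) (auto simp: divide_ennreal [symmetric] ennreal_indicator indicator_def)
  have "(\<integral>t. f t \<partial>circle_measure) = (\<integral>x. f (cis x) \<partial>uniform_measure lborel {-pi..pi})"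
    unfolding circle_measure_def by (rule integral_distr) auto
  also have "\<dots> = (\<integral>x. (indicator {-pi..pi} x / (2 * pi)) *\<^sub>R f (cis x) \<partial>lborel)"
    unfolding * by (subst integral_density) auto
  also have "\<dots> = (\<integral>x. (1 / (2 * pi)) *\<^sub>R (indicator {-pi..pi} x *\<^sub>R f (cis x)) \<partial>lborel)"
    by (intro Bochner_Integration.integral_cong) auto
  finally show ?thesis
    unfolding integral_scaleR_right .
qed

lemma powi_borel [measurable]: "(\<lambda>t::complex. t powi n) \<in> borel_measurable borel"
  by (auto simp: power_int_def)

lemma integral_circle_powi:
  "(\<integral>t. t powi n \<partial>circle_measure) = (if n = 0 then 1 else 0)"
proof (cases "n = 0")
  case True
  then show ?thesis by (simp add: measure_circle_measure)
next
  case False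
  define F where "F = (\<lambda>x. cis (of_int n * x) / (\<i> * of_int n))"
  have cis_powi: "cis x powi n = cis (of_int n * x)" for x
    by (simp add: power_int_def Complex.DeMoivre cis_inverse)
  have "(\<integral>x. indicator {-pi..pi} x *\<^sub>R cis x powi n \<partial>lborel) = F pi - F (- pi)"
  proof (rule integral_FTC_Icc)
    show "continuous_on {-pi..pi} (\<lambda>x. cis x powi n)"
      unfolding cis_powi by (intro continuous_intros)
    have "((\<lambda>z. exp (\<i> * of_int n * z) / (\<i> * of_int n)) has_field_derivative exp (\<i> * of_int n * of_real x))
        (at (of_real x))" for x
      using False by (auto intro!: derivative_eq_intros)
    from has_vector_derivative_real_field [OF this]
    show "(F has_vector_derivative cis x powi n) (at x within {-pi..pi})" for x
      unfolding F_def cis_powi unfolding cis_conv_exp by (simp add: mult.assoc)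
  qed simp
  also have "F pi - F (- pi) = 0"
  proof -
    have "sin (of_int n * pi) = 0"
      using sin_zero_iff_int2 by blast
    then have "cis (of_int n * pi) = cis (of_int n * (- pi))"
      by (simp add: complex_eq_iff)
    then show ?thesis by (simp add: F_def)
  qed
  finally show ?thesis using False
    by (subst integral_circle_eq) auto
qed


section \<open>Algebra of classes, by almost everywhere identities between representatives\<close>

abbreviation "rep \<equiv> rep_circle_fun"
abbreviation "cls \<equiv> abs_circle_fun"

lemma rep_borel [measurable]: "rep f \<in> borel_measurable borel"
  using Quotient_rep_reflp [OF Quotient_circle_fun, of f] by (simp add: circle_eq_def)

lemma circle_fun_eq_iff: "f = g \<longleftrightarrow> (AE t in circle_measure. rep f t = rep g t)"
  using Quotient_rel_rep [OF Quotient_circle_fun, of f g] by (auto simp: circle_eq_def)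

lemma rep_cls:
  assumes "f \<in> borel_measurable borel"
  shows "AE t in circle_measure. rep (cls f) t = f t"
  using Quotient_rep_abs [OF Quotient_circle_fun, of f] assms by (auto simp: circle_eq_def)

lemma cls_rep [simp]: "cls (rep f) = f"
  by (rule Quotient_abs_rep [OF Quotient_circle_fun])

lemma cls_eqI:
  assumes "f \<in> borel_measurable borel" "AE t in circle_measure. rep g t = f t"
  shows "cls f = g"
  unfolding circle_fun_eq_iff using rep_cls [OF assms(1)] assms(2) by eventually_elim simp

lemma circle_eq_rep [simp]: "circle_eq (rep f) (rep f)"
  by (simp add: circle_eq_def)

lemma rep_zero: "AE t in circle_measure. rep 0 t = 0"
  unfolding zero_circle_fun_def by (rule rep_cls) simp

lemma rep_one: "AE t in circle_measure. rep 1 t = 1"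
  unfolding one_circle_fun_def by (rule rep_cls) simp

lemma rep_add: "AE t in circle_measure. rep (f + g) t = rep f t + rep g t"
  using rep_cls [of "\<lambda>t. rep f t + rep g t"]
    plus_circle_fun.abs_eq [OF circle_eq_rep [of f] circle_eq_rep [of g]] by simp

lemma rep_diff: "AE t in circle_measure. rep (f - g) t = rep f t - rep g t"
  using rep_cls [of "\<lambda>t. rep f t - rep g t"]
    minus_circle_fun.abs_eq [OF circle_eq_rep [of f] circle_eq_rep [of g]] by simp

lemma rep_uminus: "AE t in circle_measure. rep (- f) t = - rep f t"
  using rep_cls [of "\<lambda>t. - rep f t"]
    uminus_circle_fun.abs_eq [OF circle_eq_rep [of f]] by simp

lemma rep_mult: "AE t in circle_measure. rep (f * g) t = rep f t * rep g t"
  using rep_cls [of "\<lambda>t. rep f t * rep g t"]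
    times_circle_fun.abs_eq [OF circle_eq_rep [of f] circle_eq_rep [of g]] by simp

lemma rep_inverse: "AE t in circle_measure. rep (inverse f) t = inverse (rep f t)"
  using rep_cls [of "\<lambda>t. inverse (rep f t)"]
    inverse_circle_fun.abs_eq [OF circle_eq_rep [of f]] by simp

lemma rep_const: "AE t in circle_measure. rep (const_fun z) t = z"
  unfolding const_fun_def by (simp add: rep_cls)

lemma rep_tpow: "AE t in circle_measure. rep (tpow n) t = t powi n"
  unfolding tpow_def by (simp add: rep_cls)

lemma rep_tilde: "AE t in circle_measure. rep (tilde f) t = rep f (cnj t)"
proof -
  have "AE t in circle_measure. rep (tilde f) t = rep f (1 / t)"
    using rep_cls [of "\<lambda>t. rep f (1 / t)"] tilde.abs_eq [OF circle_eq_rep [of f]] by simp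
  with AE_circle_inverse show ?thesis
    by eventually_elim (simp add: inverse_eq_divide)
qed

lemma rep_flip_J: "AE t in circle_measure. rep (flip_J f) t = cnj t * rep f (cnj t)"
  using rep_cls [of "\<lambda>t. cnj t * rep f (cnj t)"] flip_J.abs_eq [OF circle_eq_rep [of f]] by simp

lemma rep_cscale: "AE t in circle_measure. rep (cscale z f) t = z * rep f t"
  using rep_mult [of "const_fun z" f] rep_const [of z]
  unfolding cscale_def by eventually_elim simp

lemma AE_rep_cnj:
  assumes "AE t in circle_measure. rep f t = g t" "g \<in> borel_measurable borel"
  shows "AE t in circle_measure. rep f (cnj t) = g (cnj t)"
  by (rule AE_circle_measure_reflect(2) [of "\<lambda>t. rep f t = g t"]) (use assms in auto)

lemma tilde_mult: "tilde (f * g) = tilde f * tilde g"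
  unfolding circle_fun_eq_iff
  using rep_tilde [of "f * g"] rep_mult [of "tilde f" "tilde g"] rep_tilde [of f] rep_tilde [of g]
    AE_rep_cnj [OF rep_mult [of f g], simplified]
  by eventually_elim simp_all

lemma tilde_inverse: "tilde (inverse f) = inverse (tilde f)"
  unfolding circle_fun_eq_iff
  using rep_tilde [of "inverse f"] rep_inverse [of "tilde f"] rep_tilde [of f]
    AE_rep_cnj [OF rep_inverse [of f], simplified]
  by eventually_elim simp_all

lemma tilde_add: "tilde (f + g) = tilde f + tilde g"
  unfolding circle_fun_eq_iff
  using rep_tilde [of "f + g"] rep_add [of "tilde f" "tilde g"] rep_tilde [of f] rep_tilde [of g]
    AE_rep_cnj [OF rep_add [of f g], simplified]
  by eventually_elim simp_all

lemma tilde_diff: "tilde (f - g) = tilde f - tilde g"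
  unfolding circle_fun_eq_iff
  using rep_tilde [of "f - g"] rep_diff [of "tilde f" "tilde g"] rep_tilde [of f] rep_tilde [of g]
    AE_rep_cnj [OF rep_diff [of f g], simplified]
  by eventually_elim simp_all

lemma tilde_tilde [simp]: "tilde (tilde f) = f"
  unfolding circle_fun_eq_iff
  using rep_tilde [of "tilde f"] AE_rep_cnj [OF rep_tilde [of f], simplified]
  by eventually_elim simp_all

lemma tilde_const [simp]: "tilde (const_fun z) = const_fun z"
  unfolding circle_fun_eq_iff
  using rep_tilde [of "const_fun z"] AE_rep_cnj [OF rep_const [of z], simplified] rep_const [of z]
  by eventually_elim simp_all

lemma tilde_tpow [simp]: "tilde (tpow n) = tpow (- n)"
  unfolding circle_fun_eq_iff
  using rep_tilde [of "tpow n"] AE_rep_cnj [OF rep_tpow [of n], simplified] rep_tpow [of "- n"] AE_circle_inverse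
  by eventually_elim (simp_all add: power_int_minus flip: power_int_inverse)

lemma flip_J_eq: "flip_J f = tpow (- 1) * tilde f"
  unfolding circle_fun_eq_iff
  using rep_flip_J [of f] rep_mult [of "tpow (- 1)" "tilde f"] rep_tilde [of f] rep_tpow [of "- 1"] AE_circle_inverse
  by eventually_elim (simp_all add: power_int_minus)

lemma tpow_0 [simp]: "tpow 0 = 1"
  unfolding circle_fun_eq_iff using rep_tpow [of 0] rep_one by eventually_elim simp

lemma tpow_mult_tpow: "tpow m * tpow n = tpow (m + n)"
  unfolding circle_fun_eq_iff
  using rep_mult [of "tpow m" "tpow n"] rep_tpow [of m] rep_tpow [of n] rep_tpow [of "m + n"] AE_circle_inverse
  by eventually_elim (simp_all add: power_int_add)

lemma tpow_mult_tpow_left: "tpow m * (tpow n * f) = tpow (m + n) * f"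
  by (simp add: mult.assoc [symmetric] tpow_mult_tpow)

lemma inverse_tpow [simp]: "inverse (tpow n) = tpow (- n)"
  unfolding circle_fun_eq_iff
  using rep_inverse [of "tpow n"] rep_tpow [of n] rep_tpow [of "- n"]
  by eventually_elim (simp_all add: power_int_minus)

text \<open>Zeros do no harm: the inverse is taken pointwise and the inverse of 0 is 0.\<close>

lemma inverse_mult_circle: "inverse (f * g) = inverse f * inverse (g :: circle_fun)"
  unfolding circle_fun_eq_iff
  using rep_inverse [of "f * g"] rep_mult [of f g] rep_mult [of "inverse f" "inverse g"] rep_inverse [of f] rep_inverse [of g]
  by eventually_elim simp_all

lemma inverse_inverse_circle [simp]: "inverse (inverse f) = (f :: circle_fun)"
  unfolding circle_fun_eq_iff
  using rep_inverse [of "inverse f"] rep_inverse [of f]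
  by eventually_elim simp_all

lemma inverse_circle_unique:
  assumes "f * g = (1 :: circle_fun)"
  shows "inverse f = g"
proof -
  have "AE t in circle_measure. rep f t * rep g t = 1"
    using rep_mult [of f g] rep_one unfolding assms by eventually_elim simp
  then show ?thesis unfolding circle_fun_eq_iff
    using rep_inverse [of f] by eventually_elim (simp add: inverse_unique)
qed

lemma const_fun_mult: "const_fun x * const_fun y = const_fun (x * y)"
  unfolding circle_fun_eq_iff
  using rep_mult [of "const_fun x" "const_fun y"] rep_const [of x] rep_const [of y] rep_const [of "x * y"]
  by eventually_elim simp

lemma const_fun_0 [simp]: "const_fun 0 = 0" and const_fun_1 [simp]: "const_fun 1 = 1"
  by (auto simp: zero_circle_fun_def one_circle_fun_def const_fun_def)

section \<open>Fourier coefficients\<close>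

lemma fcoeff_eq: "fcoeff f n = (\<integral>t. rep f t * t powi (- n) \<partial>circle_measure)"
  by (simp add: fcoeff.rep_eq)

text \<open>No integrability is asked for: the integrands agree almost everywhere, so the integrals
  agree even if both take the default value 0.\<close>

lemma fcoeff_tpow_mult: "fcoeff (tpow k * f) n = fcoeff f (n - k)"
  unfolding fcoeff_eq
proof (intro integral_cong_AE)
  show "AE t in circle_measure. rep (tpow k * f) t * t powi - n = rep f t * t powi - (n - k)"
    using rep_mult [of "tpow k" f] rep_tpow [of k] AE_circle_inverse
  proof eventually_elim
    case (elim t)
    then have "t powi (k - n) = t powi k * t powi (- n)"
      by (simp add: power_int_add [symmetric])
    then show ?case using elim by simp
  qed
qed auto

lemma fcoeff_tilde: "fcoeff (tilde f) n = fcoeff f (- n)"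
proof -
  have "fcoeff (tilde f) n = (\<integral>t. rep f (cnj t) * cnj t powi n \<partial>circle_measure)"
    unfolding fcoeff_eq
  proof (intro integral_cong_AE)
    show "AE t in circle_measure. rep (tilde f) t * t powi - n = rep f (cnj t) * cnj t powi n"
      using rep_tilde [of f] AE_circle_inverse
      by eventually_elim (simp add: power_int_minus flip: power_int_inverse)
  qed auto
  also have "\<dots> = (\<integral>t. rep f t * t powi n \<partial>circle_measure)"
    by (rule integral_circle_cnj [of "\<lambda>t. rep f t * t powi n"]) measurable
  finally show ?thesis by (simp add: fcoeff_eq)
qed

text \<open>The offset by one comes from the factor 1/t in J. It makes J exchange the indices n
  \<ge> 0 with the indices n < 0, hence H^p with the range of Q.\<close>

lemma fcoeff_flip_J: "fcoeff (flip_J f) n = fcoeff f (- n - 1)"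
  unfolding flip_J_eq fcoeff_tpow_mult fcoeff_tilde by simp

lemma fcoeff_cscale: "fcoeff (cscale z f) n = z * fcoeff f n"
proof -
  have "fcoeff (cscale z f) n = (\<integral>t. z * (rep f t * t powi (- n)) \<partial>circle_measure)"
    unfolding fcoeff_eq
  proof (intro integral_cong_AE)
    show "AE t in circle_measure. rep (cscale z f) t * t powi - n = z * (rep f t * t powi - n)"
      using rep_cscale [of z f] by eventually_elim simp
  qed auto
  then show ?thesis unfolding fcoeff_eq by simp
qed

lemma fcoeff_one: "fcoeff 1 n = (if n = 0 then 1 else 0)"
proof -
  have "fcoeff 1 n = (\<integral>t. t powi (- n) \<partial>circle_measure)"
    unfolding fcoeff_eq
  proof (intro integral_cong_AE)
    show "AE t in circle_measure. rep 1 t * t powi - n = t powi - n"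
      using rep_one by eventually_elim simp
  qed auto
  then show ?thesis by (simp add: integral_circle_powi)
qed

lemma fcoeff_tpow: "fcoeff (tpow k) n = (if n = k then 1 else 0)"
  using fcoeff_tpow_mult [of k 1 n] by (simp add: fcoeff_one)

lemma fcoeff_0 [simp]: "fcoeff 0 n = 0"
  using fcoeff_cscale [of 0 0 n] by simp

section \<open>The spaces \<open>L\<^sup>p\<close>\<close>

text \<open>The tangent of the convex function x^p at y, taken from Young's inequality instead of
  derivatives so that y = 0 is included. Convexity of x^p and Jensen's inequality for the Poisson
  kernel are both read off from it.\<close>

lemma powr_tangent:
  fixes x y p :: real
  assumes "1 \<le> p" "0 \<le> x" "0 \<le> y"
  shows "y powr p + p * y powr (p - 1) * (x - y) \<le> x powr p"
proof (cases "p = 1")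
  case True
  then show ?thesis using assms by (cases "y = 0") auto
next
  case False
  with assms have p: "1 < p" by simp
  have yy: "y powr (p - 1) * y = y powr p"
    using assms by (cases "y = 0") (auto simp: powr_mult_base mult.commute)
  have "x * y powr (p - 1) \<le> x powr p / p + (y powr (p - 1)) powr (p / (p - 1)) / (p / (p - 1))"
    using p assms by (intro Youngs_inequality) (auto simp: field_simps)
  also have "(y powr (p - 1)) powr (p / (p - 1)) = y powr p"
    using p by (simp add: powr_powr)
  finally have "p * (x * y powr (p - 1)) \<le> x powr p + (p - 1) * y powr p"
    using p by (simp add: field_simps)
  with yy show ?thesis by (simp add: algebra_simps)
qed

lemma powr_convex_combination:
  fixes x y p s :: real
  assumes "1 \<le> p" "0 \<le> x" "0 \<le> y" "0 \<le> s" "s \<le> 1"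
  shows "(s * x + (1 - s) * y) powr p \<le> s * x powr p + (1 - s) * y powr p"
proof -
  \<comment> \<open>With tangents at the mean \<open>m\<close>, the slope terms cancel in the convex
    combination.\<close>
  define m where "m = s * x + (1 - s) * y"
  have "0 \<le> m" unfolding m_def using assms by simp
  have "m powr p = s * (m powr p + p * m powr (p - 1) * (x - m)) + (1 - s) * (m powr p + p * m powr (p - 1) * (y - m))"
    by (simp add: m_def algebra_simps)
  also have "\<dots> \<le> s * x powr p + (1 - s) * y powr p"
    using assms \<open>0 \<le> m\<close> by (intro add_mono mult_left_mono powr_tangent) auto
  finally show ?thesis by (simp add: m_def)
qed

lemma powr_add_le:
  fixes x y p :: real
  assumes "1 \<le> p" "0 \<le> x" "0 \<le> y"
  shows "(x + y) powr p \<le> 2 powr p * (x powr p + y powr p)"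
proof -
  have "(x + y) powr p \<le> (2 * max x y) powr p"
    using assms by (intro powr_mono2) auto
  also have "\<dots> = 2 powr p * max x y powr p"
    using assms by (simp add: powr_mult)
  also have "\<dots> \<le> 2 powr p * (x powr p + y powr p)"
    by (intro mult_left_mono) (auto simp: max_def)
  finally show ?thesis .
qed

definition lp_integral :: "real \<Rightarrow> circle_fun \<Rightarrow> real" where
  "lp_integral p f = (\<integral>t. norm (rep f t) powr p \<partial>circle_measure)"

lemma Lp_iff: "f \<in> Lp p \<longleftrightarrow> integrable circle_measure (\<lambda>t. norm (rep f t) powr p)"
  by (simp add: Lp_def p_integrable.rep_eq)

lemma lp_norm_eq: "lp_norm p f = lp_integral p f powr (1 / p)"
  by (simp add: lp_norm.rep_eq lp_integral_def)

lemma lp_integral_nonneg [simp]: "0 \<le> lp_integral p f"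
  by (simp add: lp_integral_def)

lemma lp_norm_nonneg [simp]: "0 \<le> lp_norm p f"
  by (simp add: lp_norm_eq)

lemma lp_integral_eq_lp_norm: "0 < p \<Longrightarrow> lp_integral p f = lp_norm p f powr p"
  by (simp add: lp_norm_eq powr_powr)

lemma lp_norm_leI:
  assumes "0 < p" "0 \<le> C" "lp_integral p f \<le> C powr p"
  shows "lp_norm p f \<le> C"
proof -
  have "lp_norm p f \<le> (C powr p) powr (1 / p)"
    unfolding lp_norm_eq using assms by (intro powr_mono2) auto
  then show ?thesis using assms by (simp add: powr_powr)
qed

lemma lp_norm_one_eq: "lp_norm 1 f = (\<integral>t. norm (rep f t) \<partial>circle_measure)"
  by (simp add: lp_norm_eq lp_integral_def)

lemma Lp_1_iff: "f \<in> Lp 1 \<longleftrightarrow> integrable circle_measure (rep f)"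
  unfolding Lp_iff by (simp add: integrable_norm_iff)

lemma Lp_dominated:
  assumes "1 \<le> p" "g \<in> Lp p" "AE t in circle_measure. norm (rep f t) \<le> C * norm (rep g t)" "0 \<le> C"
  shows "f \<in> Lp p" "lp_norm p f \<le> C * lp_norm p g"
proof -
  have le: "AE t in circle_measure. norm (rep f t) powr p \<le> C powr p * norm (rep g t) powr p"
    using assms(3)
  proof eventually_elim
    case (elim t)
    then have "norm (rep f t) powr p \<le> (C * norm (rep g t)) powr p"
      using assms by (intro powr_mono2) auto
    then show ?case using assms by (simp add: powr_mult)
  qed
  have int: "integrable circle_measure (\<lambda>t. C powr p * norm (rep g t) powr p)"
    using assms by (simp add: Lp_iff)
  show "f \<in> Lp p"
    unfolding Lp_iff using le by (intro Bochner_Integration.integrable_bound [OF int]) auto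
  then have "lp_integral p f \<le> (\<integral>t. C powr p * norm (rep g t) powr p \<partial>circle_measure)"
    unfolding lp_integral_def Lp_iff using le int by (intro integral_mono_AE) auto
  also have "\<dots> = (C * lp_norm p g) powr p"
    using assms by (simp add: powr_mult lp_integral_eq_lp_norm [symmetric] lp_integral_def)
  finally show "lp_norm p f \<le> C * lp_norm p g"
    using assms by (intro lp_norm_leI) auto
qed

lemma Lp_cscale:
  assumes "1 \<le> p" "f \<in> Lp p"
  shows "cscale z f \<in> Lp p"
proof (rule Lp_dominated(1) [OF assms])
  show "AE t in circle_measure. norm (rep (cscale z f) t) \<le> norm z * norm (rep f t)"
    using rep_cscale [of z f] by eventually_elim (simp add: norm_mult)
qed simp

lemma lp_norm_cscale:
  assumes "1 \<le> p"
  shows "lp_norm p (cscale z f) = norm z * lp_norm p f"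
proof -
  have "lp_integral p (cscale z f) = (\<integral>t. norm z powr p * norm (rep f t) powr p \<partial>circle_measure)"
    unfolding lp_integral_def
    by (intro integral_cong_AE) (use rep_cscale [of z f] in \<open>auto elim!: eventually_mono simp: norm_mult powr_mult\<close>)
  then show ?thesis using assms
    by (simp add: lp_norm_eq lp_integral_def powr_mult powr_powr)
qed

lemma Lp_0 [simp]: "0 \<in> Lp p"
proof -
  have "integrable circle_measure (\<lambda>t. norm (rep 0 t) powr p) \<longleftrightarrow> integrable circle_measure (\<lambda>_. 0 :: real)"
    by (intro integrable_cong_AE) (use rep_zero in \<open>auto elim!: eventually_mono\<close>)
  then show ?thesis by (simp add: Lp_iff)
qed

lemma lp_norm_0 [simp]: "lp_norm p 0 = 0"
proof -
  have "lp_integral p 0 = (\<integral>t. 0 \<partial>circle_measure)"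
    unfolding lp_integral_def by (intro integral_cong_AE) (use rep_zero in \<open>auto elim!: eventually_mono\<close>)
  then show ?thesis by (simp add: lp_norm_eq)
qed

lemma lp_norm_eq_0:
  assumes "1 \<le> p" "f \<in> Lp p" "lp_norm p f = 0"
  shows "f = 0"
proof -
  have "lp_integral p f = 0" using assms by (simp add: lp_integral_eq_lp_norm)
  then have "AE t in circle_measure. norm (rep f t) powr p = 0"
    using assms unfolding lp_integral_def Lp_iff by (subst (asm) integral_nonneg_eq_0_iff_AE) auto
  then show ?thesis
    unfolding circle_fun_eq_iff using rep_zero by eventually_elim (use assms in auto)
qed

lemma Lp_add:
  assumes "1 \<le> p" "f \<in> Lp p" "g \<in> Lp p"
  shows "f + g \<in> Lp p"
proof -
  have "integrable circle_measure (\<lambda>t. 2 powr p * (norm (rep f t) powr p + norm (rep g t) powr p))"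
    using assms unfolding Lp_iff by auto
  moreover have "AE t in circle_measure. norm (norm (rep (f + g) t) powr p)
      \<le> norm (2 powr p * (norm (rep f t) powr p + norm (rep g t) powr p))"
    using rep_add [of f g]
  proof eventually_elim
    case (elim t)
    have "norm (rep (f + g) t) powr p \<le> (norm (rep f t) + norm (rep g t)) powr p"
      unfolding elim using assms by (intro powr_mono2 norm_triangle_ineq) auto
    also note powr_add_le [OF assms(1) norm_ge_zero norm_ge_zero]
    finally show ?case by simp
  qed
  ultimately show ?thesis
    unfolding Lp_iff using Bochner_Integration.integrable_bound [of circle_measure
      "\<lambda>t. 2 powr p * (norm (rep f t) powr p + norm (rep g t) powr p)" "\<lambda>t. norm (rep (f + g) t) powr p"]
    by (simp del: norm_powr_real_powr)
qed

text \<open>After division by the norms \<alpha> and \<beta>, the function (|f| + |g|) / (\<alpha> +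
  \<beta>) is a convex combination of two functions of norm one, so the integral of its p-th power
  is at most one. Vanishing norms are split off because of the divisions.\<close>

lemma lp_norm_triangle:
  assumes "1 \<le> p" "f \<in> Lp p" "g \<in> Lp p"
  shows "lp_norm p (f + g) \<le> lp_norm p f + lp_norm p g"
proof (cases "lp_norm p f = 0 \<or> lp_norm p g = 0")
  case True
  then have "f = 0 \<or> g = 0" using lp_norm_eq_0 [OF assms(1)] assms by blast
  then show ?thesis by auto
next
  case False
  define \<alpha> \<beta> where "\<alpha> = lp_norm p f" and "\<beta> = lp_norm p g"
  have pos: "0 < \<alpha>" "0 < \<beta>" using False unfolding \<alpha>_def \<beta>_def by (auto simp: less_le)
  define s where "s = \<alpha> / (\<alpha> + \<beta>)"
  have s: "0 \<le> s" "s \<le> 1" "1 - s = \<beta> / (\<alpha> + \<beta>)" using pos by (auto simp: s_def field_simps)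
  let ?h = "\<lambda>t. (\<alpha> + \<beta>) powr p * (s * (norm (rep f t) powr p / \<alpha> powr p) + (1 - s) * (norm (rep g t) powr p / \<beta> powr p))"
  have int: "integrable circle_measure ?h"
    using assms unfolding Lp_iff by auto
  have "AE t in circle_measure. norm (rep (f + g) t) powr p \<le> ?h t"
    using rep_add [of f g]
  proof eventually_elim
    case (elim t)
    have "norm (rep (f + g) t) powr p \<le> (norm (rep f t) + norm (rep g t)) powr p"
      unfolding elim using assms by (intro powr_mono2 norm_triangle_ineq) auto
    also have "norm (rep f t) + norm (rep g t) = (\<alpha> + \<beta>) * (s * (norm (rep f t) / \<alpha>) + (1 - s) * (norm (rep g t) / \<beta>))"
    proof -
      have "s * (norm (rep f t) / \<alpha>) = norm (rep f t) / (\<alpha> + \<beta>)"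
        "(1 - s) * (norm (rep g t) / \<beta>) = norm (rep g t) / (\<alpha> + \<beta>)"
        using pos unfolding s(3) by (simp_all add: s_def)
      then show ?thesis using pos by (simp add: add_divide_distrib [symmetric])
    qed
    also have "\<dots> powr p = (\<alpha> + \<beta>) powr p * (s * (norm (rep f t) / \<alpha>) + (1 - s) * (norm (rep g t) / \<beta>)) powr p"
      using pos s by (intro powr_mult) 
    also have "\<dots> \<le> (\<alpha> + \<beta>) powr p * (s * (norm (rep f t) / \<alpha>) powr p + (1 - s) * (norm (rep g t) / \<beta>) powr p)"
      using pos s assms by (intro mult_left_mono powr_convex_combination) auto
    also have "\<dots> = ?h t" using pos by (simp add: powr_divide)
    finally show ?case .
  qed
  then have "lp_integral p (f + g) \<le> (\<integral>t. ?h t \<partial>circle_measure)"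
    unfolding lp_integral_def using int Lp_add [OF assms] by (intro integral_mono_AE) (auto simp: Lp_iff)
  also have "\<dots> = (\<alpha> + \<beta>) powr p * (s * (lp_integral p f / \<alpha> powr p) + (1 - s) * (lp_integral p g / \<beta> powr p))"
    using assms unfolding Lp_iff lp_integral_def by simp
  also have "\<dots> = (\<alpha> + \<beta>) powr p"
    using pos assms(1) by (simp add: lp_integral_eq_lp_norm \<alpha>_def [symmetric] \<beta>_def [symmetric])
  finally show ?thesis
    using pos assms by (intro lp_norm_leI) (auto simp: \<alpha>_def \<beta>_def)
qed

lemma Lp_uminus: "1 \<le> p \<Longrightarrow> f \<in> Lp p \<Longrightarrow> - f \<in> Lp p"
  and lp_norm_uminus: "1 \<le> p \<Longrightarrow> lp_norm p (- f) = lp_norm p f"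
  using Lp_cscale [of p f "-1"] lp_norm_cscale [of p "-1" f] by simp_all

lemma Lp_diff:
  assumes "1 \<le> p" "f \<in> Lp p" "g \<in> Lp p"
  shows "f - g \<in> Lp p"
  using Lp_add [OF assms(1,2) Lp_uminus [OF assms(1,3)]] by simp

lemma lp_norm_minus_commute: "1 \<le> p \<Longrightarrow> lp_norm p (f - g) = lp_norm p (g - f)"
  using lp_norm_uminus [of p "f - g"] by simp

lemma lp_norm_diff_triangle:
  assumes "1 \<le> p" "f \<in> Lp p" "g \<in> Lp p" "h \<in> Lp p"
  shows "lp_norm p (f - h) \<le> lp_norm p (f - g) + lp_norm p (g - h)"
  using lp_norm_triangle [OF assms(1) Lp_diff [OF assms(1-3)] Lp_diff [OF assms(1,3,4)]] by simp

lemma lp_norm_le_add_diff: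
  assumes "1 \<le> p" "f \<in> Lp p" "g \<in> Lp p"
  shows "lp_norm p f \<le> lp_norm p g + lp_norm p (f - g)"
  using lp_norm_triangle [OF assms(1,3) Lp_diff [OF assms]] by simp

lemma conjugate_exponent:
  fixes p q :: real
  assumes "1 < p" "1 / p + 1 / q = 1"
  shows "1 < q" "1 / q + 1 / p = 1"
proof -
  have "0 < 1 / p" "1 / p < 1" using assms by auto
  then have "0 < 1 / q" "1 / q < 1" using assms by linarith+
  then show "1 < q" by (simp add: divide_simps split: if_splits)
  show "1 / q + 1 / p = 1" using assms by simp
qed

section \<open>Hoelder's inequality and bounded multipliers\<close>

lemma Holder:
  assumes p: "1 < p" "1 / p + 1 / q = 1" and f: "f \<in> Lp p" and g: "g \<in> Lp q"
  shows "f * g \<in> Lp 1" "lp_norm 1 (f * g) \<le> lp_norm p f * lp_norm q g"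
proof -
  note q = conjugate_exponent(1) [OF p]
  \<comment> \<open>The scales are left free: 1 and 1 give integrability of the product, the two
    norms give the sharp bound.\<close>
  have young: "AE t in circle_measure. norm (rep (f * g) t) \<le> \<alpha> * \<beta> * (norm (rep f t) powr p / \<alpha> powr p / p + norm (rep g t) powr q / \<beta> powr q / q)"
    if "0 < \<alpha>" "0 < \<beta>" for \<alpha> \<beta>
    using rep_mult [of f g]
  proof eventually_elim
    case (elim t)
    have "norm (rep f t) / \<alpha> * (norm (rep g t) / \<beta>) \<le> (norm (rep f t) / \<alpha>) powr p / p + (norm (rep g t) / \<beta>) powr q / q"
      using p q that by (intro Youngs_inequality) auto
    then have "\<alpha> * \<beta> * (norm (rep f t) / \<alpha> * (norm (rep g t) / \<beta>)) \<le> \<alpha> * \<beta> * ((norm (rep f t) / \<alpha>) powr p / p + (norm (rep g t) / \<beta>) powr q / q)"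
      using that by (intro mult_left_mono) auto
    then show ?case using that by (simp add: elim norm_mult powr_divide)
  qed
  have int: "integrable circle_measure (\<lambda>t. \<alpha> * \<beta> * (norm (rep f t) powr p / \<alpha> powr p / p + norm (rep g t) powr q / \<beta> powr q / q))" for \<alpha> \<beta>
    using f g unfolding Lp_iff by auto
  show 1: "f * g \<in> Lp 1"
    unfolding Lp_1_iff using young [of 1 1] by (intro Bochner_Integration.integrable_bound [OF int [of 1 1]])
      (auto elim!: eventually_mono)
  show "lp_norm 1 (f * g) \<le> lp_norm p f * lp_norm q g"
  proof (cases "lp_norm p f = 0 \<or> lp_norm q g = 0")
    case True
    then have "f = 0 \<or> g = 0" using lp_norm_eq_0 [of p f] lp_norm_eq_0 [of q g] p q f g by auto
    then show ?thesis by auto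
  next
    case False
    define \<alpha> \<beta> where "\<alpha> = lp_norm p f" and "\<beta> = lp_norm q g"
    have pos: "0 < \<alpha>" "0 < \<beta>" using False unfolding \<alpha>_def \<beta>_def by (auto simp: less_le)
    have "lp_norm 1 (f * g) \<le> (\<integral>t. \<alpha> * \<beta> * (norm (rep f t) powr p / \<alpha> powr p / p + norm (rep g t) powr q / \<beta> powr q / q) \<partial>circle_measure)"
      unfolding lp_norm_one_eq using 1 young [OF pos] int by (intro integral_mono_AE) (auto simp: Lp_1_iff)
    also have "\<dots> = \<alpha> * \<beta> * (lp_integral p f / \<alpha> powr p / p + lp_integral q g / \<beta> powr q / q)"
      using f g unfolding Lp_iff lp_integral_def by simp
    also have "\<dots> = \<alpha> * \<beta>"
      using pos p q by (simp add: lp_integral_eq_lp_norm \<alpha>_def [symmetric] \<beta>_def [symmetric])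
    finally show ?thesis by (simp add: \<alpha>_def \<beta>_def)
  qed
qed

lemma LinfE:
  assumes "f \<in> Linf"
  obtains C where "0 < C" "AE t in circle_measure. norm (rep f t) \<le> C"
proof -
  obtain C where C: "AE t in circle_measure. norm (rep f t) \<le> C"
    using assms by (auto simp: Linf_def essentially_bounded.rep_eq)
  show ?thesis
    by (rule that [of "max C 1"]) (use C in \<open>auto elim!: eventually_mono\<close>)
qed

lemma LinfI: "AE t in circle_measure. norm (rep f t) \<le> C \<Longrightarrow> f \<in> Linf"
  by (auto simp: Linf_def essentially_bounded.rep_eq)

lemma Linf_mult_bound:
  assumes "1 \<le> p" "a \<in> Linf"
  obtains C where "0 < C" "\<And>f. f \<in> Lp p \<Longrightarrow> a * f \<in> Lp p"
    "\<And>f. f \<in> Lp p \<Longrightarrow> lp_norm p (a * f) \<le> C * lp_norm p f"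
proof -
  obtain C where C: "0 < C" "AE t in circle_measure. norm (rep a t) \<le> C"
    using assms(2) by (rule LinfE)
  have *: "AE t in circle_measure. norm (rep (a * f) t) \<le> C * norm (rep f t)" for f
    using rep_mult [of a f] C(2) by eventually_elim (simp add: norm_mult mult_right_mono)
  show ?thesis
    using C(1) by (intro that [of C] Lp_dominated [OF assms(1) _ *]) auto
qed

lemma Lp_Linf_mult: "1 \<le> p \<Longrightarrow> a \<in> Linf \<Longrightarrow> f \<in> Lp p \<Longrightarrow> a * f \<in> Lp p"
  by (meson Linf_mult_bound)

lemma Linf_mult:
  assumes "a \<in> Linf" "b \<in> Linf"
  shows "a * b \<in> Linf"
proof -
  obtain C D where *: "AE t in circle_measure. norm (rep a t) \<le> C" "AE t in circle_measure. norm (rep b t) \<le> D" "0 < C" "0 < D"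
    using LinfE [OF assms(1)] LinfE [OF assms(2)] by metis
  have "AE t in circle_measure. norm (rep (a * b) t) \<le> C * D"
    using *(1,2) rep_mult [of a b] by eventually_elim (use * in \<open>simp add: norm_mult mult_mono\<close>)
  then show ?thesis by (rule LinfI)
qed

lemma Linf_tilde:
  assumes "a \<in> Linf"
  shows "tilde a \<in> Linf"
proof -
  obtain C where *: "AE t in circle_measure. norm (rep a t) \<le> C"
    using assms by (auto elim: LinfE)
  have "AE t in circle_measure. norm (rep a (cnj t)) \<le> C"
    by (rule AE_circle_measure_reflect(2) [OF _ *]) measurable
  then have "AE t in circle_measure. norm (rep (tilde a) t) \<le> C"
    using rep_tilde [of a] by eventually_elim simp
  then show ?thesis by (rule LinfI)
qed

lemma Linf_tpow [simp]: "tpow n \<in> Linf"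
proof (rule LinfI)
  show "AE t in circle_measure. norm (rep (tpow n) t) \<le> 1"
    using rep_tpow [of n] AE_circle_norm by eventually_elim (simp add: norm_power_int)
qed

lemma Linf_const [simp]: "const_fun z \<in> Linf"
  by (rule LinfI [of _ "norm z"]) (use rep_const [of z] in \<open>auto elim!: eventually_mono\<close>)

lemma Linf_1 [simp]: "1 \<in> Linf"
  using Linf_const [of 1] by simp

lemma Linf_subset_Lp:
  assumes "f \<in> Linf" "0 < p"
  shows "f \<in> Lp p"
proof -
  obtain C where *: "AE t in circle_measure. norm (rep f t) \<le> C"
    using assms by (auto elim: LinfE)
  have "AE t in circle_measure. norm (norm (rep f t) powr p) \<le> C powr p"
    using * by eventually_elim (use assms in \<open>auto intro: powr_mono2\<close>)
  then show ?thesis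
    unfolding Lp_iff by (intro circle.integrable_const_bound) auto
qed

lemma lp_integral_one: "lp_integral p 1 = 1"
proof -
  have "lp_integral p 1 = (\<integral>t. 1 \<partial>circle_measure)"
    unfolding lp_integral_def by (intro integral_cong_AE) (use rep_one in \<open>auto elim!: eventually_mono\<close>)
  then show ?thesis by (simp add: measure_circle_measure)
qed

lemma lp_norm_one [simp]: "lp_norm p 1 = 1"
  by (simp add: lp_norm_eq lp_integral_one)

lemma Lp_subset_L1:
  assumes "1 \<le> p" "f \<in> Lp p"
  shows "f \<in> Lp 1" "lp_norm 1 f \<le> lp_norm p f"
proof -
  have "f \<in> Lp 1 \<and> lp_norm 1 f \<le> lp_norm p f"
  proof (cases "p = 1")
    case False
    define q where "q = p / (p - 1)"
    have "1 < p" "1 / p + 1 / q = 1" using assms False by (auto simp: q_def field_simps)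
    from Holder [OF this assms(2), of 1] show ?thesis
      using \<open>1 < p\<close> by (auto simp: Linf_subset_Lp q_def)
  qed (use assms in simp)
  then show "f \<in> Lp 1" "lp_norm 1 f \<le> lp_norm p f" by auto
qed

lemma Lp_tilde: "f \<in> Lp p \<Longrightarrow> tilde f \<in> Lp p" and lp_integral_tilde: "lp_integral p (tilde f) = lp_integral p f"
proof -
  have "AE t in circle_measure. norm (rep (tilde f) t) powr p = norm (rep f (cnj t)) powr p"
    using rep_tilde [of f] by eventually_elim simp
  then have "integrable circle_measure (\<lambda>t. norm (rep (tilde f) t) powr p) = integrable circle_measure (\<lambda>t. norm (rep f (cnj t)) powr p)"
    "lp_integral p (tilde f) = (\<integral>t. norm (rep f (cnj t)) powr p \<partial>circle_measure)"
    unfolding lp_integral_def by (intro integrable_cong_AE integral_cong_AE; auto)+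
  then show "f \<in> Lp p \<Longrightarrow> tilde f \<in> Lp p" "lp_integral p (tilde f) = lp_integral p f"
    using integrable_circle_cnj [of "\<lambda>t. norm (rep f t) powr p"] integral_circle_cnj [of "\<lambda>t. norm (rep f t) powr p"]
    by (auto simp: Lp_iff lp_integral_def)
qed

lemma lp_norm_tilde: "lp_norm p (tilde f) = lp_norm p f"
  by (simp add: lp_norm_eq lp_integral_tilde)

lemma Lp_flip_J: "1 \<le> p \<Longrightarrow> f \<in> Lp p \<Longrightarrow> flip_J f \<in> Lp p"
  by (simp add: flip_J_eq Lp_Linf_mult Lp_tilde)

lemma fcoeff_integrable:
  assumes "f \<in> Lp 1"
  shows "integrable circle_measure (\<lambda>t. rep f t * t powi n)"
proof (rule Bochner_Integration.integrable_bound [OF integrable_norm])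
  show "integrable circle_measure (rep f)" using assms by (simp add: Lp_1_iff)
  show "AE t in circle_measure. norm (rep f t * t powi n) \<le> norm (norm (rep f t))"
    using AE_circle_norm by eventually_elim (simp add: norm_mult norm_power_int)
qed auto

lemma norm_fcoeff_le:
  assumes "f \<in> Lp 1"
  shows "norm (fcoeff f n) \<le> lp_norm 1 f"
proof -
  have "norm (fcoeff f n) \<le> (\<integral>t. norm (rep f t * t powi - n) \<partial>circle_measure)"
    unfolding fcoeff_eq by (rule integral_norm_bound)
  also have "\<dots> = (\<integral>t. norm (rep f t) \<partial>circle_measure)"
  proof (intro integral_cong_AE)
    show "AE t in circle_measure. norm (rep f t * t powi - n) = norm (rep f t)"
      using AE_circle_norm by eventually_elim (simp add: norm_mult norm_power_int)
  qed auto
  finally show ?thesis by (simp add: lp_norm_one_eq)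
qed

lemma fcoeff_add:
  assumes "f \<in> Lp 1" "g \<in> Lp 1"
  shows "fcoeff (f + g) n = fcoeff f n + fcoeff g n"
proof -
  have "fcoeff (f + g) n = (\<integral>t. rep f t * t powi - n + rep g t * t powi - n \<partial>circle_measure)"
    unfolding fcoeff_eq
    by (intro integral_cong_AE) (use rep_add [of f g] in \<open>auto elim!: eventually_mono simp: algebra_simps\<close>)
  then show ?thesis
    using fcoeff_integrable [OF assms(1)] fcoeff_integrable [OF assms(2)] by (simp add: fcoeff_eq)
qed

lemma fcoeff_uminus: "fcoeff (- f) n = - fcoeff f n"
  using fcoeff_cscale [of "-1" f n] by simp

lemma fcoeff_diff:
  assumes "f \<in> Lp 1" "g \<in> Lp 1"
  shows "fcoeff (f - g) n = fcoeff f n - fcoeff g n"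
  using fcoeff_add [OF assms(1), of "- g" n] assms(2) by (simp add: fcoeff_uminus Lp_uminus)

lemma fcoeff_tendsto:
  assumes "1 \<le> p" "\<And>k. f k \<in> Lp p" "g \<in> Lp p" "(\<lambda>k. lp_norm p (f k - g)) \<longlonglongrightarrow> 0"
  shows "(\<lambda>k. fcoeff (f k) n) \<longlonglongrightarrow> fcoeff g n"
proof (rule LIM_zero_cancel, rule Lim_null_comparison [OF always_eventually assms(4)], rule allI)
  fix k
  have "f k \<in> Lp 1" "g \<in> Lp 1" "lp_norm 1 (f k - g) \<le> lp_norm p (f k - g)" "f k - g \<in> Lp 1"
    using Lp_subset_L1 [of p] assms Lp_diff [of p "f k" g] by auto
  then show "norm (fcoeff (f k) n - fcoeff g n) \<le> lp_norm p (f k - g)"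
    using norm_fcoeff_le [of "f k - g" n] by (simp add: fcoeff_diff)
qed

section \<open>Fatou's lemma and completeness\<close>

lemma Lp_Fatou:
  assumes p: "1 \<le> p" and "\<And>k. f k \<in> Lp p" "\<And>k. lp_norm p (f k) \<le> C"
    and lim: "AE t in circle_measure. (\<lambda>k. rep (f k) t) \<longlonglongrightarrow> rep g t"
  shows "g \<in> Lp p" "lp_norm p g \<le> C"
proof -
  have C: "0 \<le> C" using assms(3) [of 0] lp_norm_nonneg order_trans by blast
  have "(\<integral>\<^sup>+t. ennreal (norm (rep g t) powr p) \<partial>circle_measure)
      = (\<integral>\<^sup>+t. liminf (\<lambda>k. ennreal (norm (rep (f k) t) powr p)) \<partial>circle_measure)"
  proof (intro nn_integral_cong_AE, use lim in eventually_elim)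
    case (elim t)
    then have "(\<lambda>k. ennreal (norm (rep (f k) t) powr p)) \<longlonglongrightarrow> ennreal (norm (rep g t) powr p)"
      using p by (intro tendsto_ennrealI tendsto_powr' tendsto_norm) (auto simp: powr_def intro!: tendsto_intros)
    then show ?case by (rule lim_imp_Liminf [OF trivial_limit_sequentially, symmetric])
  qed
  also have "\<dots> \<le> liminf (\<lambda>k. \<integral>\<^sup>+t. ennreal (norm (rep (f k) t) powr p) \<partial>circle_measure)"
    by (rule nn_integral_liminf) measurable
  also have "\<dots> = liminf (\<lambda>k. ennreal (lp_integral p (f k)))"
    using assms(2) unfolding lp_integral_def Lp_iff by (subst nn_integral_eq_integral) auto
  also have "\<dots> \<le> liminf (\<lambda>k::nat. ennreal (C powr p))"
    using p assms(3) by (intro Liminf_mono always_eventually allI ennreal_leI)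
      (auto simp: lp_integral_eq_lp_norm intro!: powr_mono2)
  finally have le: "(\<integral>\<^sup>+t. ennreal (norm (rep g t) powr p) \<partial>circle_measure) \<le> ennreal (C powr p)"
    by (simp add: Liminf_const)
  then show g: "g \<in> Lp p"
    unfolding Lp_iff by (intro integrableI_bounded) (auto simp: le_less_trans)
  have "ennreal (lp_integral p g) = (\<integral>\<^sup>+t. ennreal (norm (rep g t) powr p) \<partial>circle_measure)"
    using g unfolding lp_integral_def Lp_iff by (subst nn_integral_eq_integral) auto
  with le have "lp_integral p g \<le> C powr p" by (metis ennreal_le_iff powr_ge_zero)
  then show "lp_norm p g \<le> C" using p C by (intro lp_norm_leI) auto
qed

text \<open>The almost everywhere convergent subsequence belongs to the conclusion because the
  factorization later compares radial means with boundary values pointwise.\<close>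

lemma Lp_complete:
  assumes p: "1 \<le> p" and f: "\<And>k. f k \<in> Lp p"
    and cauchy: "\<And>e. 0 < e \<Longrightarrow> \<exists>N. \<forall>m\<ge>N. \<forall>n\<ge>N. lp_norm p (f m - f n) < e"
  obtains g r where "g \<in> Lp p" "(\<lambda>k. lp_norm p (f k - g)) \<longlonglongrightarrow> 0"
    "strict_mono r" "AE t in circle_measure. (\<lambda>k. rep (f (r k)) t) \<longlonglongrightarrow> rep g t"
proof -
  have int: "integrable circle_measure (rep (f k))" for k
    using Lp_subset_L1(1) [OF p f] by (simp add: Lp_1_iff)
  have L1: "(\<integral>t. norm (rep (f m) t - rep (f n) t) \<partial>circle_measure) \<le> lp_norm p (f m - f n)" for m n
  proof -
    have "(\<integral>t. norm (rep (f m) t - rep (f n) t) \<partial>circle_measure) = lp_norm 1 (f m - f n)"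
      unfolding lp_norm_one_eq
      by (intro integral_cong_AE) (use rep_diff [of "f m" "f n"] in \<open>auto elim!: eventually_mono\<close>)
    then show ?thesis using Lp_subset_L1(2) [OF p Lp_diff [OF p f f]] by simp
  qed
  obtain r where r: "strict_mono r" and AEc: "AE t in circle_measure. Cauchy (\<lambda>i. rep (f (r i)) t)"
  proof (rule cauchy_L1_AE_cauchy_subseq [of circle_measure "\<lambda>k. rep (f k)", OF int])
    fix e :: real assume "0 < e"
    then show "\<exists>N. \<forall>i\<ge>N. \<forall>j\<ge>N. (\<integral>t. norm (rep (f i) t - rep (f j) t) \<partial>circle_measure) < e"
      using cauchy L1 by (meson le_less_trans)
  qed
  define g where "g = cls (\<lambda>t. lim (\<lambda>i. rep (f (r i)) t))"
  have "AE t in circle_measure. rep g t = lim (\<lambda>i. rep (f (r i)) t)"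
    unfolding g_def by (rule rep_cls) measurable
  with AEc have lim: "AE t in circle_measure. (\<lambda>i. rep (f (r i)) t) \<longlonglongrightarrow> rep g t"
    by eventually_elim (simp add: Cauchy_convergent_iff convergent_LIMSEQ_iff)
  \<comment> \<open>Fatou along the subsequence started at N: as r (i + N) \<ge> i + N, each of its
    terms is already within e of f m.\<close>
  have *: "lp_norm p (f m - g) \<le> e \<and> f m - g \<in> Lp p"
    if N: "\<forall>m\<ge>N. \<forall>n\<ge>N. lp_norm p (f m - f n) < e" and m: "m \<ge> N" for m N e
  proof -
    have "AE t in circle_measure. \<forall>i. rep (f m - f (r (i + N))) t = rep (f m) t - rep (f (r (i + N))) t"
      unfolding AE_all_countable using rep_diff by blast
    then have "AE t in circle_measure. (\<lambda>i. rep (f m - f (r (i + N))) t) \<longlonglongrightarrow> rep (f m - g) t"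
      using lim rep_diff [of "f m" g]
    proof eventually_elim
      case (elim t)
      from elim(2) have "(\<lambda>i. rep (f (r (i + N))) t) \<longlonglongrightarrow> rep g t" by (rule LIMSEQ_ignore_initial_segment)
      then show ?case using elim by (auto intro!: tendsto_intros)
    qed
    moreover have "lp_norm p (f m - f (r (i + N))) \<le> e" for i
      using N m seq_suble [OF r, of "i + N"] by (simp add: less_imp_le)
    ultimately show ?thesis
      using Lp_Fatou [OF p, of "\<lambda>i. f m - f (r (i + N))" e "f m - g"] Lp_diff [OF p f f] by blast
  qed
  obtain N where "\<forall>m\<ge>N. \<forall>n\<ge>N. lp_norm p (f m - f n) < 1" using cauchy [of 1] by auto
  from * [OF this order_refl] have "f N - g \<in> Lp p" by simp
  from Lp_diff [OF p f this, of N] have g: "g \<in> Lp p" by simp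
  have "(\<lambda>k. lp_norm p (f k - g)) \<longlonglongrightarrow> 0"
  proof (rule LIMSEQ_I)
    fix e :: real assume "0 < e"
    then obtain N where "\<forall>m\<ge>N. \<forall>n\<ge>N. lp_norm p (f m - f n) < e / 2" using cauchy [of "e / 2"] by auto
    from * [OF this] have "\<forall>m\<ge>N. lp_norm p (f m - g) \<le> e / 2" by blast
    then have "\<forall>m\<ge>N. norm (lp_norm p (f m - g) - 0) < e" using \<open>0 < e\<close> by (auto intro: le_less_trans)
    then show "\<exists>N. \<forall>m\<ge>N. norm (lp_norm p (f m - g) - 0) < e" by blast
  qed
  with g r lim show ?thesis by (intro that)
qed

section \<open>Density of trigonometric polynomials\<close>

abbreviation trig :: "circle_fun set" where
  "trig \<equiv> circ.span (range tpow)"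

lemma trig_subset_Linf: "trig \<subseteq> Linf"
proof (rule circ.span_minimal)
  show "circ.subspace Linf"
  proof (rule circ.subspaceI)
    fix x y assume "x \<in> Linf" "y \<in> Linf"
    then obtain C D where *: "AE t in circle_measure. norm (rep x t) \<le> C" "AE t in circle_measure. norm (rep y t) \<le> D"
      using LinfE by metis
    have "AE t in circle_measure. norm (rep (x + y) t) \<le> C + D"
      using * rep_add [of x y] by eventually_elim (metis norm_triangle_mono)
    then show "x + y \<in> Linf" by (rule LinfI)
  qed (auto simp: cscale_def intro: Linf_mult simp flip: const_fun_0)
qed auto

lemma trig_subset_Lp: "0 < p \<Longrightarrow> u \<in> trig \<Longrightarrow> u \<in> Lp p"
  using trig_subset_Linf Linf_subset_Lp by blast

lemma tpow_in_trig [simp]: "tpow n \<in> trig"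
  by (rule circ.span_base) simp

lemma const_in_trig [simp]: "const_fun z \<in> trig"
  using circ.span_scale [OF tpow_in_trig [of 0], of z] by (simp add: cscale_def)

lemma cscale_mult_left: "cscale z f * g = cscale z (f * g)"
  and cscale_mult_right: "f * cscale z g = cscale z (f * g)"
  by (simp_all add: cscale_def ac_simps)

lemma span_tpow_mult:
  assumes "\<And>m n. m \<in> A \<Longrightarrow> n \<in> A \<Longrightarrow> m + n \<in> A"
    and "u \<in> circ.span (tpow ` A)" "v \<in> circ.span (tpow ` A)"
  shows "u * v \<in> circ.span (tpow ` A)"
  using assms(2)
proof (induction rule: circ.span_induct)
  show "circ.subspace {u. u * v \<in> circ.span (tpow ` A)}"
    by (rule circ.subspaceI) (auto simp: distrib_right cscale_mult_left intro: circ.span_add circ.span_scale circ.span_zero)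
  fix w assume "w \<in> tpow ` A"
  then obtain m where m: "w = tpow m" "m \<in> A" by auto
  show "w * v \<in> circ.span (tpow ` A)"
    using assms(3)
  proof (induction rule: circ.span_induct)
    show "circ.subspace {u. w * u \<in> circ.span (tpow ` A)}"
      by (rule circ.subspaceI) (auto simp: distrib_left cscale_mult_right intro: circ.span_add circ.span_scale circ.span_zero)
  qed (use m assms(1) in \<open>auto simp: tpow_mult_tpow intro: circ.span_base\<close>)
qed

lemma trig_mult: "u \<in> trig \<Longrightarrow> v \<in> trig \<Longrightarrow> u * v \<in> trig"
  by (rule span_tpow_mult) auto

definition trig_closure :: "real \<Rightarrow> circle_fun set" where
  "trig_closure p = {f \<in> Lp p. \<forall>e>0. \<exists>u\<in>trig. lp_norm p (f - u) < e}"

lemma trig_closure_add: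
  assumes p: "1 \<le> p" and f: "f \<in> trig_closure p" and g: "g \<in> trig_closure p"
  shows "f + g \<in> trig_closure p"
  unfolding trig_closure_def
proof (safe)
  show fg: "f + g \<in> Lp p" using f g p by (auto simp: trig_closure_def intro: Lp_add)
  fix e :: real assume "0 < e"
  then have "0 < e / 2" by simp
  then obtain u v where uv: "u \<in> trig" "v \<in> trig" "lp_norm p (f - u) < e / 2" "lp_norm p (g - v) < e / 2"
    using f g unfolding trig_closure_def by blast
  have "f - u \<in> Lp p" "g - v \<in> Lp p"
    using f g uv p trig_subset_Lp [of p] by (auto simp: trig_closure_def intro: Lp_diff)
  from lp_norm_triangle [OF p this] uv have "lp_norm p ((f + g) - (u + v)) < e"
    by (simp add: algebra_simps)
  moreover have "u + v \<in> trig" using uv by (intro circ.span_add)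
  ultimately show "\<exists>u\<in>trig. lp_norm p (f + g - u) < e" by blast
qed

lemma trig_closure_cscale:
  assumes p: "1 \<le> p" and f: "f \<in> trig_closure p"
  shows "cscale z f \<in> trig_closure p"
  unfolding trig_closure_def
proof (safe)
  show "cscale z f \<in> Lp p" using f p by (auto simp: trig_closure_def intro: Lp_cscale)
  fix e :: real assume e: "0 < e"
  then have "0 < e / (norm z + 1)" by (simp add: add_nonneg_pos)
  then obtain u where u: "u \<in> trig" "lp_norm p (f - u) < e / (norm z + 1)"
    using f unfolding trig_closure_def by blast
  have "lp_norm p (cscale z f - cscale z u) = norm z * lp_norm p (f - u)"
    using lp_norm_cscale [OF p] by (simp flip: circ.scale_right_diff_distrib)
  also have "\<dots> \<le> (norm z + 1) * lp_norm p (f - u)" by (intro mult_right_mono) auto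
  also have "\<dots> < e"
    using u(2) pos_less_divide_eq [of "norm z + 1" "lp_norm p (f - u)" e] by (simp add: mult.commute add_nonneg_pos)
  finally show "\<exists>u\<in>trig. lp_norm p (cscale z f - u) < e" using u(1) circ.span_scale by blast
qed

lemma trig_closure_approx:
  assumes p: "1 \<le> p" and f: "f \<in> Lp p"
    and approx: "\<And>e. 0 < e \<Longrightarrow> \<exists>g\<in>trig_closure p. lp_norm p (f - g) < e"
  shows "f \<in> trig_closure p"
  unfolding trig_closure_def
proof (safe intro!: f)
  fix e :: real assume "0 < e"
  then have e: "0 < e / 2" by simp
  obtain g where g: "g \<in> trig_closure p" "lp_norm p (f - g) < e / 2" using approx [OF e] by blast
  obtain u where u: "u \<in> trig" "lp_norm p (g - u) < e / 2" using g(1) e unfolding trig_closure_def by blast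
  have "lp_norm p (f - u) \<le> lp_norm p (f - g) + lp_norm p (g - u)"
    using g u p f trig_subset_Lp [of p] by (intro lp_norm_diff_triangle) (auto simp: trig_closure_def)
  with g u show "\<exists>u\<in>trig. lp_norm p (f - u) < e" by force
qed

lemma trig_closure_sum:
  assumes "1 \<le> p" "\<And>i. i \<in> I \<Longrightarrow> f i \<in> trig_closure p"
  shows "(\<Sum>i\<in>I. f i) \<in> trig_closure p"
  using assms(2)
proof (induction I rule: infinite_finite_induct)
  case (insert x F)
  then show ?case using trig_closure_add [OF assms(1)] by simp
qed (auto simp: trig_closure_def intro!: bexI [of _ 0] circ.span_zero)

lemma rep_sum: "finite I \<Longrightarrow> AE t in circle_measure. rep (\<Sum>i\<in>I. f i) t = (\<Sum>i\<in>I. rep (f i) t)"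
proof (induction I rule: finite_induct)
  case (insert x F)
  from insert(3) rep_add [of "f x" "\<Sum>i\<in>F. f i"] show ?case
    by eventually_elim (use insert(1,2) in simp)
qed (simp add: rep_zero)

lemma lp_norm_le_const:
  assumes "1 \<le> p" "0 \<le> C" "AE t in circle_measure. norm (rep f t) \<le> C"
  shows "f \<in> Lp p" "lp_norm p f \<le> C"
proof -
  have "AE t in circle_measure. norm (rep f t) \<le> C * norm (rep 1 t)"
    using assms(3) rep_one by eventually_elim simp
  from Lp_dominated [OF assms(1) _ this assms(2)] show "f \<in> Lp p" "lp_norm p f \<le> C"
    using assms by (auto simp: Linf_subset_Lp)
qed

text \<open>Stone-Weierstrass for the algebra of real continuous functions on the circle that agree
  almost everywhere with a trigonometric polynomial. Real and imaginary part of t belong to it and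
  separate points; real functions make closure under conjugation a non-issue.\<close>

lemma continuous_in_trig_closure:
  fixes \<phi> :: "complex \<Rightarrow> real"
  assumes p: "1 \<le> p" and cont: "continuous_on UNIV \<phi>"
  shows "cls (\<lambda>t. of_real (\<phi> t)) \<in> trig_closure p"
proof -
  define S where "S = sphere (0::complex) 1"
  define R where "R = (\<lambda>f :: complex \<Rightarrow> real. continuous_on S f \<and>
    (\<exists>u\<in>trig. AE t in circle_measure. rep u t = of_real (f t)))"
  have meas: "(\<lambda>t. complex_of_real (\<phi> t)) \<in> borel_measurable borel"
    by (intro borel_measurable_continuous_onI continuous_on_of_real cont)
  have approx: "\<exists>u\<in>trig. AE t in circle_measure. norm (of_real (\<phi> t) - rep u t) \<le> e" if "0 < e" for e
  proof -
    have "\<exists>g. R g \<and> (\<forall>x\<in>S. \<bar>\<phi> x - g x\<bar> < e)"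
    proof (rule Stone_Weierstrass_HOL)
      show "compact S" "0 < e" using that by (auto simp: S_def)
      show "continuous_on S \<phi>" using cont continuous_on_subset by blast
      show "R (\<lambda>x. c)" for c
        unfolding R_def by (intro conjI continuous_intros bexI [of _ "const_fun (of_real c)"] rep_const const_in_trig)
      show "continuous_on S f" if "R f" for f using that by (simp add: R_def)
      show "R (\<lambda>x. f x + g x)" if fg: "R f \<and> R g" for f g
      proof -
        obtain u v where uv: "u \<in> trig" "AE t in circle_measure. rep u t = of_real (f t)"
          "v \<in> trig" "AE t in circle_measure. rep v t = of_real (g t)"
          using fg unfolding R_def by blast
        have "AE t in circle_measure. rep (u + v) t = of_real (f t + g t)"
          using uv(2,4) rep_add [of u v] by eventually_elim simp
        then show ?thesis using fg uv circ.span_add unfolding R_def by (blast intro: continuous_on_add)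
      qed
      show "R (\<lambda>x. f x * g x)" if fg: "R f \<and> R g" for f g
      proof -
        obtain u v where uv: "u \<in> trig" "AE t in circle_measure. rep u t = of_real (f t)"
          "v \<in> trig" "AE t in circle_measure. rep v t = of_real (g t)"
          using fg unfolding R_def by blast
        have "AE t in circle_measure. rep (u * v) t = of_real (f t * g t)"
          using uv(2,4) rep_mult [of u v] by eventually_elim simp
        then show ?thesis using fg uv trig_mult unfolding R_def by (blast intro: continuous_on_mult)
      qed
      have Re: "R Re"
      proof -
        have "AE t in circle_measure. rep (cscale (1 / 2) (tpow 1 + tpow (- 1))) t = of_real (Re t)"
          using rep_cscale [of "1 / 2" "tpow 1 + tpow (- 1)"] rep_add [of "tpow 1" "tpow (- 1)"]
            rep_tpow [of 1] rep_tpow [of "- 1"] AE_circle_inverse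
          by eventually_elim (simp add: power_int_minus complex_eq_iff)
        then show ?thesis unfolding R_def
          by (intro conjI continuous_intros bexI [of _ "cscale (1 / 2) (tpow 1 + tpow (- 1))"] circ.span_add circ.span_scale) auto
      qed
      have Im: "R Im"
      proof -
        have "AE t in circle_measure. rep (cscale (1 / (2 * \<i>)) (tpow 1 - tpow (- 1))) t = of_real (Im t)"
          using rep_cscale [of "1 / (2 * \<i>)" "tpow 1 - tpow (- 1)"] rep_diff [of "tpow 1" "tpow (- 1)"]
            rep_tpow [of 1] rep_tpow [of "- 1"] AE_circle_inverse
          by eventually_elim (simp add: power_int_minus complex_eq_iff Re_divide Im_divide)
        then show ?thesis unfolding R_def
          by (intro conjI continuous_intros bexI [of _ "cscale (1 / (2 * \<i>)) (tpow 1 - tpow (- 1))"] circ.span_diff circ.span_scale) auto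
      qed
      show "\<exists>f. R f \<and> f x \<noteq> f y" if "x \<in> S \<and> y \<in> S \<and> x \<noteq> y" for x y
        using that Re Im complex_eq_iff by blast
    qed
    then obtain g u where g: "\<forall>x\<in>S. \<bar>\<phi> x - g x\<bar> < e" and u: "u \<in> trig" "AE t in circle_measure. rep u t = of_real (g t)"
      unfolding R_def by blast
    have "AE t in circle_measure. norm (of_real (\<phi> t) - rep u t) \<le> e"
      using u(2) AE_circle_norm
    proof eventually_elim
      case (elim t)
      then have "t \<in> S" by (simp add: S_def)
      with g have "\<bar>\<phi> t - g t\<bar> < e" by blast
      then show ?case by (simp add: elim flip: of_real_diff)
    qed
    with u(1) show ?thesis by blast
  qed
  have approx': "\<exists>u\<in>trig. lp_norm p (cls (\<lambda>t. of_real (\<phi> t)) - u) \<le> e \<and> cls (\<lambda>t. of_real (\<phi> t)) - u \<in> Lp p"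
    if e: "0 < e" for e
  proof -
    obtain u where u: "u \<in> trig" "AE t in circle_measure. norm (of_real (\<phi> t) - rep u t) \<le> e"
      using approx [OF e] by blast
    have "AE t in circle_measure. norm (rep (cls (\<lambda>t. of_real (\<phi> t)) - u) t) \<le> e"
      using u(2) rep_diff [of "cls (\<lambda>t. of_real (\<phi> t))" u] rep_cls [OF meas] by eventually_elim simp
    from lp_norm_le_const [OF p _ this] e u(1) show ?thesis by auto
  qed
  show ?thesis unfolding trig_closure_def
  proof safe
    obtain u where "u \<in> trig" "cls (\<lambda>t. of_real (\<phi> t)) - u \<in> Lp p" using approx' [of 1] by auto
    then show "cls (\<lambda>t. of_real (\<phi> t)) \<in> Lp p"
      using Lp_add [OF p, of "cls (\<lambda>t. of_real (\<phi> t)) - u" u] trig_subset_Lp [of p u] p by simp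
    fix e :: real assume "0 < e"
    then show "\<exists>u\<in>trig. lp_norm p (cls (\<lambda>t. of_real (\<phi> t)) - u) < e"
      using approx' [of "e / 2"] by force
  qed
qed

text \<open>Regularity of the measure squeezes A between a compact K and an open U; a Urysohn
  function for K and U differs from the indicator only on U - K, and there by at most one.\<close>

lemma indicator_in_trig_closure:
  assumes p: "1 \<le> p" and A [measurable]: "A \<in> sets borel"
  shows "cls (indicator A) \<in> trig_closure p"
proof -
  let ?m = "measure circle_measure"
  have ind: "AE t in circle_measure. rep (cls (indicator A)) t = indicator A t"
    by (rule rep_cls) measurable
  show ?thesis
  proof (rule trig_closure_approx [OF p])
    have "AE t in circle_measure. norm (rep (cls (indicator A)) t) \<le> 1"
      using ind by eventually_elim (simp add: indicator_def)
    from lp_norm_le_const(1) [OF p _ this] show "cls (indicator A) \<in> Lp p" by simp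
    fix e :: real assume e: "0 < e"
    \<comment> \<open>The set U - K gets measure below 2 d, which is half of e^p.\<close>
    define d where "d = e powr p / 4"
    have d: "0 < d" using e by (simp add: d_def)
    have inner: "emeasure circle_measure A = (SUP K \<in> {K. K \<subseteq> A \<and> compact K}. emeasure circle_measure K)"
      by (rule inner_regular) (auto simp: emeasure_circle_measure)
    \<comment> \<open>Subtraction in \<open>ennreal\<close> is truncated, so strictness fails for a
      null set; that case is served by the empty K.\<close>
    have less: "emeasure circle_measure A = 0 \<or> emeasure circle_measure A - d < emeasure circle_measure A"
    proof -
      have "emeasure circle_measure A < top" by (simp add: circle.emeasure_eq_measure)
      with d ennreal_between [of "ennreal d" "emeasure circle_measure A"] show ?thesis
        by (auto simp: zero_less_iff_neq_zero)
    qed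
    obtain K where K: "K \<subseteq> A" "compact K" "emeasure circle_measure A \<le> emeasure circle_measure K + d"
    proof (cases "emeasure circle_measure A = 0")
      case True
      then show thesis by (intro that [of "{}"]) auto
    next
      case False
      with less have "emeasure circle_measure A - d < (SUP K \<in> {K. K \<subseteq> A \<and> compact K}. emeasure circle_measure K)"
        unfolding inner [symmetric] by simp
      then obtain K where "K \<subseteq> A" "compact K" "emeasure circle_measure A - d < emeasure circle_measure K"
        by (auto simp: less_SUP_iff)
      then show thesis by (metis that ennreal_minus_le_iff less_imp_le add.commute)
    qed
    have "emeasure circle_measure A = (INF U \<in> {U. A \<subseteq> U \<and> open U}. emeasure circle_measure U)"
      by (rule outer_regular) (auto simp: emeasure_circle_measure)
    moreover have "emeasure circle_measure A < emeasure circle_measure A + d"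
      using d circle.emeasure_finite [of A] by (simp add: ennreal_add_left_cancel_less [of _ 0, simplified] top.not_eq_extremum)
    ultimately obtain U where U: "A \<subseteq> U" "open U" "emeasure circle_measure U < emeasure circle_measure A + d"
      by (auto simp: INF_less_iff)
    have [measurable]: "K \<in> sets borel" "U \<in> sets borel" using K U by (auto intro: borel_compact)
    have "?m A \<le> ?m K + d" "?m U < ?m A + d"
      using K(3) U(3) d by (auto simp: circle.emeasure_eq_measure ennreal_less_iff simp flip: ennreal_plus)
    moreover have "?m (U - K) = ?m U - ?m K"
      using K U by (intro circle.finite_measure_Diff) auto
    ultimately have UK: "?m (U - K) < 2 * d" by simp
    obtain \<phi> :: "complex \<Rightarrow> real" where \<phi>: "continuous_on UNIV \<phi>" "\<And>x. \<phi> x \<in> closed_segment 0 1"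
      "\<And>x. x \<in> - U \<Longrightarrow> \<phi> x = 0" "\<And>x. x \<in> K \<Longrightarrow> \<phi> x = 1"
    proof (rule Urysohn [of "- U" K "0::real" 1])
      show "closed (- U)" "closed K" "- U \<inter> K = {}" using K U by (auto simp: compact_imp_closed)
    qed auto
    have \<phi>01: "0 \<le> \<phi> x" "\<phi> x \<le> 1" for x using \<phi>(2) [of x] by (auto simp: closed_segment_eq_real_ivl)
    let ?g = "cls (\<lambda>t. of_real (\<phi> t))"
    have meas: "(\<lambda>t. complex_of_real (\<phi> t)) \<in> borel_measurable borel"
      by (intro borel_measurable_continuous_onI continuous_on_of_real \<phi>(1))
    have le: "AE t in circle_measure. norm (rep (cls (indicator A) - ?g) t) powr p \<le> indicator (U - K) t"
      using ind rep_cls [OF meas] rep_diff [of "cls (indicator A)" ?g]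
    proof eventually_elim
      case (elim t)
      have "norm (indicator A t - complex_of_real (\<phi> t)) \<le> indicator (U - K) t"
      proof -
        have "indicator A t - complex_of_real (\<phi> t) = of_real (indicator A t - \<phi> t)"
          by (simp add: indicator_def)
        then have "norm (indicator A t - complex_of_real (\<phi> t)) = \<bar>indicator A t - \<phi> t\<bar>"
          by (simp only: norm_of_real)
        also have "\<dots> \<le> indicator (U - K) t"
          using \<phi>01 [of t] \<phi>(3,4) [of t] K(1) U(1) by (auto simp: indicator_def)
        finally show ?thesis .
      qed
      then have "norm (rep (cls (indicator A) - ?g) t) \<le> indicator (U - K) t"
        using elim by simp
      then have "norm (rep (cls (indicator A) - ?g) t) powr p \<le> (indicator (U - K) t :: real) powr p"
        using p by (intro powr_mono2) auto
      also have "indicator (U - K) t powr p = (indicator (U - K) t :: real)"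
        by (simp add: indicator_def)
      finally show ?case .
    qed
    have "lp_integral p (cls (indicator A) - ?g) \<le> (\<integral>t. indicator (U - K) t \<partial>circle_measure)"
      unfolding lp_integral_def
      by (intro integral_mono_AE' le) (auto simp: circle.emeasure_eq_measure)
    also have "\<dots> = ?m (U - K)" by simp
    also have "\<dots> < e powr p"
      using UK e measure_nonneg [of circle_measure "U - K"] unfolding d_def by linarith
    finally have "lp_integral p (cls (indicator A) - ?g) < e powr p" .
    then have "lp_norm p (cls (indicator A) - ?g) < (e powr p) powr (1 / p)"
      unfolding lp_norm_eq using p by (intro powr_less_mono2) auto
    then show "\<exists>g\<in>trig_closure p. lp_norm p (cls (indicator A) - g) < e"
      using continuous_in_trig_closure [OF p \<phi>(1)] e p by (intro bexI [of _ ?g]) (simp add: powr_powr)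
  qed
qed

lemma trig_dense:
  assumes p: "1 \<le> p" and f: "f \<in> Lp p" and e: "0 < e"
  obtains u where "u \<in> trig" "lp_norm p (f - u) < e"
proof -
  have "f \<in> trig_closure p"
  proof (rule trig_closure_approx [OF p f])
    fix e :: real assume e: "0 < e"
    obtain F where F: "\<And>i. simple_function circle_measure (F i)"
      "\<And>t. (\<lambda>i. F i t) \<longlonglongrightarrow> rep f t" "\<And>i t. dist (F i t) 0 \<le> 2 * dist (rep f t) 0"
      using borel_measurable_implies_sequence_metric [of "rep f" circle_measure 0] by auto
    have [measurable]: "F i \<in> borel_measurable borel" for i
      using borel_measurable_simple_function [OF F(1) [of i]] by simp
    have cls_F: "AE t in circle_measure. rep (cls (F i)) t = F i t" for i
      by (rule rep_cls) measurable
    have in_closure: "cls (F i) \<in> trig_closure p" for i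
    proof -
      have fin: "finite (range (F i))" using F(1) [of i] by (simp add: simple_function_def)
      have [measurable]: "F i -` {y} \<in> sets borel" for y
        using F(1) [of i] measurable_sets_borel [of "F i" borel "{y}"] by simp
      have "cls (F i) = (\<Sum>y\<in>range (F i). cscale y (cls (indicator (F i -` {y}))))"
      proof (rule cls_eqI)
        have "AE t in circle_measure. \<forall>y\<in>range (F i). rep (cscale y (cls (indicator (F i -` {y})))) t = y * indicator (F i -` {y}) t"
        proof (subst AE_finite_all [OF fin], rule ballI)
          fix y
          have "AE t in circle_measure. rep (cls (indicator (F i -` {y}))) t = indicator (F i -` {y}) t"
            by (rule rep_cls) measurable
          with rep_cscale [of y "cls (indicator (F i -` {y}))"]
          show "AE t in circle_measure. rep (cscale y (cls (indicator (F i -` {y})))) t = y * indicator (F i -` {y}) t"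
            by eventually_elim simp
        qed
        with rep_sum [OF fin, of "\<lambda>y. cscale y (cls (indicator (F i -` {y})))"]
        show "AE t in circle_measure. rep (\<Sum>y\<in>range (F i). cscale y (cls (indicator (F i -` {y})))) t = F i t"
        proof eventually_elim
          case (elim t)
          then have "rep (\<Sum>y\<in>range (F i). cscale y (cls (indicator (F i -` {y})))) t = (\<Sum>y\<in>range (F i). if y = F i t then y else 0)"
            by (auto intro!: sum.cong simp: indicator_def)
          also have "\<dots> = F i t" using fin by (simp add: sum.delta)
          finally show ?case .
        qed
      qed simp
      then show ?thesis
        by (auto intro!: trig_closure_sum trig_closure_cscale indicator_in_trig_closure p)
    qed
    \<comment> \<open>The simple functions satisfy |F i| \<le> 2 |f|, so 3^p |f|^p
      dominates.\<close>
    have "(\<lambda>i. \<integral>t. norm (F i t - rep f t) powr p \<partial>circle_measure) \<longlonglongrightarrow> (\<integral>t. 0 \<partial>circle_measure)"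
    proof (rule integral_dominated_convergence)
      show "integrable circle_measure (\<lambda>t. 3 powr p * norm (rep f t) powr p)"
        using f by (simp add: Lp_iff)
      show "AE t in circle_measure. (\<lambda>i. norm (F i t - rep f t) powr p) \<longlonglongrightarrow> 0"
      proof (rule AE_I2)
        fix t
        have "(\<lambda>i. norm (F i t - rep f t)) \<longlonglongrightarrow> 0"
          using F(2) [of t] by (simp add: LIM_zero tendsto_norm_zero)
        then show "(\<lambda>i. norm (F i t - rep f t) powr p) \<longlonglongrightarrow> 0"
          using p by (intro tendsto_zero_powrI [of _ _ _ p]) auto
      qed
      show "AE t in circle_measure. norm (norm (F i t - rep f t) powr p) \<le> 3 powr p * norm (rep f t) powr p" for i
      proof (rule AE_I2)
        fix t
        have "norm (F i t - rep f t) \<le> 3 * norm (rep f t)"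
          using F(3) [of i t] norm_triangle_ineq4 [of "F i t" "rep f t"] by simp
        then have "norm (F i t - rep f t) powr p \<le> (3 * norm (rep f t)) powr p"
          using p by (intro powr_mono2) auto
        then show "norm (norm (F i t - rep f t) powr p) \<le> 3 powr p * norm (rep f t) powr p"
          by (simp add: powr_mult)
      qed
    qed measurable
    then have "(\<lambda>i. \<integral>t. norm (F i t - rep f t) powr p \<partial>circle_measure) \<longlonglongrightarrow> 0" by simp
    moreover have "(\<integral>t. norm (F i t - rep f t) powr p \<partial>circle_measure) = lp_integral p (f - cls (F i))" for i
      unfolding lp_integral_def
    proof (intro integral_cong_AE)
      show "AE t in circle_measure. norm (F i t - rep f t) powr p = norm (rep (f - cls (F i)) t) powr p"
        using cls_F [of i] rep_diff [of f "cls (F i)"] by eventually_elim (simp add: norm_minus_commute)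
    qed measurable
    ultimately have "(\<lambda>i. lp_integral p (f - cls (F i))) \<longlonglongrightarrow> 0" by simp
    moreover have "0 < e powr p" using e by simp
    ultimately obtain i where "norm (lp_integral p (f - cls (F i)) - 0) < e powr p" using LIMSEQ_D by blast
    then have "lp_norm p (f - cls (F i)) < (e powr p) powr (1 / p)"
      unfolding lp_norm_eq using p by (intro powr_less_mono2) auto
    then show "\<exists>g\<in>trig_closure p. lp_norm p (f - g) < e"
      using in_closure [of i] e p by (intro bexI [of _ "cls (F i)"]) (simp_all add: powr_powr)
  qed
  with e that show ?thesis unfolding trig_closure_def by blast
qed

section \<open>Poisson means and uniqueness of Fourier coefficients\<close>

text \<open>The Cauchy integral of f in the disc. The coefficients with indices at most 0 enter
  through \<open>cauchy_series (tilde f)\<close> at the conjugate point, so the constant term is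
  counted twice when both are added.\<close>

definition cauchy_series :: "circle_fun \<Rightarrow> complex \<Rightarrow> complex" where
  "cauchy_series f z = (\<Sum>n. fcoeff f (int n) * z ^ n)"

lemma summable_cauchy_series:
  assumes "\<And>n::nat. norm (a n :: complex) \<le> C" "norm z < 1"
  shows "summable (\<lambda>n. norm (a n * z ^ n))"
proof (rule summable_comparison_test')
  show "summable (\<lambda>n. C * norm z ^ n)"
    using assms by (intro summable_mult summable_geometric) auto
  show "norm (norm (a n * z ^ n)) \<le> C * norm z ^ n" for n
    using assms(1) [of n] by (simp add: norm_mult norm_power mult_right_mono)
qed

lemma cauchy_series_sums:
  assumes "f \<in> Lp 1" "norm z < 1"
  shows "(\<lambda>n. fcoeff f (int n) * z ^ n) sums cauchy_series f z"
  unfolding cauchy_series_def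
  using summable_norm_cancel [OF summable_cauchy_series [OF norm_fcoeff_le [OF assms(1)] assms(2)]] by (rule summable_sums)

lemma cauchy_series_integral:
  assumes f: "f \<in> Lp 1" and z: "norm z < 1"
  shows "cauchy_series f z = (\<integral>s. rep f s / (1 - z * cnj s) \<partial>circle_measure)"
    and "integrable circle_measure (\<lambda>s. rep f s / (1 - z * cnj s))"
proof -
  have int: "integrable circle_measure (\<lambda>s. rep f s * s powi (- int n) * z ^ n)" for n
    using fcoeff_integrable [OF f, of "- int n"] by simp
  have norm_eq: "(\<integral>s. norm (rep f s * s powi (- int n) * z ^ n) \<partial>circle_measure) = lp_norm 1 f * norm z ^ n" for n
  proof -
    have "(\<integral>s. norm (rep f s * s powi (- int n) * z ^ n) \<partial>circle_measure) = (\<integral>s. norm (rep f s) * norm z ^ n \<partial>circle_measure)"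
    proof (intro integral_cong_AE)
      show "AE s in circle_measure. norm (rep f s * s powi (- int n) * z ^ n) = norm (rep f s) * norm z ^ n"
        using AE_circle_norm by eventually_elim (simp add: norm_mult norm_power_int norm_power)
    qed measurable
    then show ?thesis by (simp add: lp_norm_one_eq)
  qed
  have geo: "AE s in circle_measure. summable (\<lambda>n. norm (rep f s * s powi (- int n) * z ^ n)) \<and>
      (\<Sum>n. rep f s * s powi (- int n) * z ^ n) = rep f s / (1 - z * cnj s)"
    using AE_circle_norm AE_circle_inverse
  proof eventually_elim
    case (elim s)
    have *: "rep f s * s powi (- int n) * z ^ n = rep f s * (z * cnj s) ^ n" for n
      using elim by (simp add: power_int_minus power_mult_distrib mult.commute flip: power_inverse)
    have w: "norm (z * cnj s) < 1" using elim z by (simp add: norm_mult)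
    then have "summable (\<lambda>n. norm (rep f s) * norm (z * cnj s) ^ n)"
      by (intro summable_mult summable_geometric) simp
    moreover have "(\<lambda>n. rep f s * (z * cnj s) ^ n) sums (rep f s * (1 / (1 - z * cnj s)))"
      by (intro sums_mult geometric_sums w)
    ultimately show ?case unfolding * by (auto simp: sums_iff norm_mult norm_power power_mult_distrib)
  qed
  have sum: "summable (\<lambda>n. \<integral>s. norm (rep f s * s powi (- int n) * z ^ n) \<partial>circle_measure)"
    unfolding norm_eq using z by (intro summable_mult summable_geometric) auto
  have ae: "AE s in circle_measure. summable (\<lambda>n. norm (rep f s * s powi (- int n) * z ^ n))"
    using geo by eventually_elim simp
  have "integrable circle_measure (\<lambda>s. \<Sum>n. rep f s * s powi (- int n) * z ^ n)"
    by (rule integrable_suminf [OF int ae sum])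
  also have "?this \<longleftrightarrow> integrable circle_measure (\<lambda>s. rep f s / (1 - z * cnj s))"
    by (intro integrable_cong_AE) (use geo in \<open>auto elim!: eventually_mono\<close>)
  finally show "integrable circle_measure (\<lambda>s. rep f s / (1 - z * cnj s))" .
  have "(\<integral>s. (\<Sum>n. rep f s * s powi (- int n) * z ^ n) \<partial>circle_measure) = (\<integral>s. rep f s / (1 - z * cnj s) \<partial>circle_measure)"
    by (intro integral_cong_AE) (use geo in \<open>auto elim!: eventually_mono\<close>)
  with integral_suminf [OF int ae sum] show "cauchy_series f z = (\<integral>s. rep f s / (1 - z * cnj s) \<partial>circle_measure)"
    by (simp add: cauchy_series_def fcoeff_eq)
qed

lemma cauchy_series_conj_integral:
  assumes f: "f \<in> Lp 1" and z: "norm z < 1"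
  shows "cauchy_series (tilde f) (cnj z) = (\<integral>s. rep f s / (1 - cnj z * s) \<partial>circle_measure)"
    and "integrable circle_measure (\<lambda>s. rep f s / (1 - cnj z * s))"
proof -
  have z': "norm (cnj z) < 1" using z by simp
  note c = cauchy_series_integral [OF Lp_tilde [OF f] z']
  have ae: "AE s in circle_measure. rep (tilde f) s / (1 - cnj z * cnj s) = rep f (cnj s) / (1 - cnj z * cnj s)"
    using rep_tilde [of f] by eventually_elim simp
  have "integrable circle_measure (\<lambda>s. rep f (cnj s) / (1 - cnj z * cnj s))"
    using c(2) integrable_cong_AE [OF _ _ ae] by simp
  then show "integrable circle_measure (\<lambda>s. rep f s / (1 - cnj z * s))"
    using integrable_circle_cnj [of "\<lambda>s. rep f s / (1 - cnj z * s)"] by simp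
  have "cauchy_series (tilde f) (cnj z) = (\<integral>s. rep f (cnj s) / (1 - cnj z * cnj s) \<partial>circle_measure)"
    unfolding c(1) by (intro integral_cong_AE ae) auto
  then show "cauchy_series (tilde f) (cnj z) = (\<integral>s. rep f s / (1 - cnj z * s) \<partial>circle_measure)"
    using integral_circle_cnj [of "\<lambda>s. rep f s / (1 - cnj z * s)"] by simp
qed

section \<open>The Poisson kernel and its means\<close>

definition poisson_kernel :: "complex \<Rightarrow> complex \<Rightarrow> real" where
  "poisson_kernel z s = (1 - (norm z)\<^sup>2) / (norm (1 - z * cnj s))\<^sup>2"

lemma poisson_kernel_borel [measurable]:
  assumes [measurable]: "f \<in> borel_measurable M" "g \<in> borel_measurable M"
  shows "(\<lambda>x. poisson_kernel (f x) (g x)) \<in> borel_measurable M"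
  unfolding poisson_kernel_def by measurable

lemma poisson_kernel_bounds:
  assumes s: "norm s = 1" and z: "norm z < 1"
  shows "(1 - norm z) / (1 + norm z) \<le> poisson_kernel z s" "poisson_kernel z s \<le> (1 + norm z) / (1 - norm z)" "0 < poisson_kernel z s"
proof -
  let ?r = "norm z" and ?d = "norm (1 - z * cnj s)"
  have d: "1 - ?r \<le> ?d" "?d \<le> 1 + ?r"
    using norm_triangle_ineq2 [of 1 "z * cnj s"] norm_triangle_ineq4 [of 1 "z * cnj s"] s by (simp_all add: norm_mult)
  have d0: "0 < ?d" using d(1) z by linarith
  have num: "1 - ?r\<^sup>2 = (1 - ?r) * (1 + ?r)" by (simp add: power2_eq_square algebra_simps)
  have pos: "0 < 1 - ?r\<^sup>2" unfolding num using z by (intro mult_pos_pos) (auto simp: add_pos_nonneg)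
  show "0 < poisson_kernel z s" using pos d0 by (simp add: poisson_kernel_def)
  have "(1 - ?r) / (1 + ?r) = (1 - ?r\<^sup>2) / (1 + ?r)\<^sup>2"
    unfolding num using norm_ge_zero [of z] by (simp add: power2_eq_square add_pos_nonneg less_imp_neq [symmetric])
  also have "\<dots> \<le> (1 - ?r\<^sup>2) / ?d\<^sup>2"
    using pos d d0 by (intro divide_left_mono power_mono) auto
  finally show "(1 - ?r) / (1 + ?r) \<le> poisson_kernel z s" by (simp add: poisson_kernel_def)
  have "(1 - ?r\<^sup>2) / ?d\<^sup>2 \<le> (1 - ?r\<^sup>2) / (1 - ?r)\<^sup>2"
    using pos d d0 z by (intro divide_left_mono power_mono) auto
  also have "\<dots> = (1 + ?r) / (1 - ?r)"
    unfolding num using z by (simp add: power2_eq_square)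
  finally show "poisson_kernel z s \<le> (1 + ?r) / (1 - ?r)" by (simp add: poisson_kernel_def)
qed

lemma poisson_kernel_eq:
  assumes s: "norm s = 1" and z: "norm z < 1"
  shows "complex_of_real (poisson_kernel z s) = 1 / (1 - z * cnj s) + 1 / (1 - cnj z * s) - 1"
proof -
  have "norm (z * cnj s) < 1" using s z by (simp add: norm_mult)
  then have nz: "1 - z * cnj s \<noteq> 0" by auto
  then have nz': "1 - cnj z * s \<noteq> 0" by (metis complex_cnj_cnj complex_cnj_diff complex_cnj_mult complex_cnj_one complex_cnj_zero)
  have "s * cnj s = 1" using s by (simp add: complex_norm_square [symmetric])
  \<comment> \<open>With w = z cnj(s) and w' its conjugate, |s| = 1 gives w w' = |z|^2. The kernel
    is then (1 - w w') / ((1 - w)(1 - w')), which splits into two geometric kernels minus the shared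
    constant term.\<close>
  then have "(z * cnj s) * (cnj z * s) = z * cnj z" by (simp add: ac_simps)
  moreover have "complex_of_real ((norm (1 - z * cnj s))\<^sup>2) = (1 - z * cnj s) * (1 - cnj z * s)"
    by (simp only: complex_norm_square complex_cnj_diff complex_cnj_mult complex_cnj_one complex_cnj_cnj)
  moreover have "complex_of_real (1 - (norm z)\<^sup>2) = 1 - z * cnj z"
    by (simp only: of_real_diff complex_norm_square of_real_1)
  ultimately have "complex_of_real (poisson_kernel z s) = (1 - (z * cnj s) * (cnj z * s)) / ((1 - z * cnj s) * (1 - cnj z * s))"
    unfolding poisson_kernel_def of_real_divide by simp
  also have "\<dots> = 1 / (1 - z * cnj s) + 1 / (1 - cnj z * s) - 1"
  proof -
    have "(1 - w * w') / ((1 - w) * (1 - w')) = 1 / (1 - w) + 1 / (1 - w') - 1"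
      if "1 - w \<noteq> 0" "1 - w' \<noteq> 0" for w w' :: complex
      using that by (simp add: divide_simps) (simp add: algebra_simps)
    from this [OF nz nz'] show ?thesis .
  qed
  finally show ?thesis .
qed

text \<open>In the contraction estimate this turns the integral over the base point into the
  integral over the circle variable, whose value is known to be one.\<close>

lemma poisson_kernel_sym: "norm s = 1 \<Longrightarrow> norm t = 1 \<Longrightarrow> poisson_kernel (of_real r * t) s = poisson_kernel (of_real r * s) t"
proof -
  assume "norm s = 1" "norm t = 1"
  moreover have "norm (1 - of_real r * t * cnj s) = norm (cnj (1 - of_real r * t * cnj s))" by (simp only: complex_mod_cnj)
  ultimately show ?thesis by (simp add: poisson_kernel_def norm_mult ac_simps)
qed

lemma poisson_integral:
  assumes f: "f \<in> Lp 1" and z: "norm z < 1"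
  shows "(\<integral>s. rep f s * of_real (poisson_kernel z s) \<partial>circle_measure) = cauchy_series f z + cauchy_series (tilde f) (cnj z) - fcoeff f 0"
    and "integrable circle_measure (\<lambda>s. rep f s * of_real (poisson_kernel z s))"
proof -
  let ?g = "\<lambda>s. rep f s / (1 - z * cnj s) + rep f s / (1 - cnj z * s) - rep f s"
  note c = cauchy_series_integral [OF f z] cauchy_series_conj_integral [OF f z]
  have int: "integrable circle_measure (rep f)" using f by (simp add: Lp_1_iff)
  have ae: "AE s in circle_measure. rep f s * of_real (poisson_kernel z s) = ?g s"
    using AE_circle_norm by eventually_elim (simp add: poisson_kernel_eq z algebra_simps)
  have "integrable circle_measure ?g" using c int by auto
  also have "?this \<longleftrightarrow> integrable circle_measure (\<lambda>s. rep f s * of_real (poisson_kernel z s))"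
    by (intro integrable_cong_AE) (use ae in \<open>auto elim!: eventually_mono\<close>)
  finally show "integrable circle_measure (\<lambda>s. rep f s * of_real (poisson_kernel z s))" .
  have "(\<integral>s. rep f s * of_real (poisson_kernel z s) \<partial>circle_measure) = (\<integral>s. ?g s \<partial>circle_measure)"
    by (intro integral_cong_AE ae) auto
  then show "(\<integral>s. rep f s * of_real (poisson_kernel z s) \<partial>circle_measure) = cauchy_series f z + cauchy_series (tilde f) (cnj z) - fcoeff f 0"
    using c int by (simp add: fcoeff_eq [of _ 0])
qed

lemma cauchy_series_tpow: "cauchy_series (tpow n) z = (if 0 \<le> n then z ^ nat n else 0)"
proof -
  have "cauchy_series (tpow n) z = (\<Sum>k. if k = nat n then (if 0 \<le> n then z ^ nat n else 0) else 0)"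
    unfolding cauchy_series_def fcoeff_tpow by (intro suminf_cong) auto
  also have "\<dots> = (if 0 \<le> n then z ^ nat n else 0)"
    by (subst suminf_finite [of "{nat n}"]) auto
  finally show ?thesis .
qed

lemma poisson_kernel_integral_one:
  assumes z: "norm z < 1"
  shows "(\<integral>s. poisson_kernel z s \<partial>circle_measure) = 1" "integrable circle_measure (poisson_kernel z)"
proof -
  have one: "1 \<in> Lp 1" by (simp add: Linf_subset_Lp)
  have ae: "AE s in circle_measure. rep 1 s * of_real (poisson_kernel z s) = complex_of_real (poisson_kernel z s)"
    using rep_one by eventually_elim simp
  have "integrable circle_measure (\<lambda>s. complex_of_real (poisson_kernel z s))"
    using poisson_integral(2) [OF one z] integrable_cong_AE [OF _ _ ae] by simp
  then show "integrable circle_measure (poisson_kernel z)"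
    using complex_of_real_integrable_eq [of circle_measure "poisson_kernel z"] by blast
  have "(\<integral>s. rep 1 s * of_real (poisson_kernel z s) \<partial>circle_measure) = 1"
    unfolding poisson_integral(1) [OF one z] using cauchy_series_tpow [of 0] by (simp add: fcoeff_one tilde_tpow [of 0, simplified])
  moreover have "(\<integral>s. rep 1 s * of_real (poisson_kernel z s) \<partial>circle_measure) = (\<integral>s. complex_of_real (poisson_kernel z s) \<partial>circle_measure)"
    by (intro integral_cong_AE ae) auto
  ultimately have "complex_of_real (\<integral>s. poisson_kernel z s \<partial>circle_measure) = 1" by simp
  then show "(\<integral>s. poisson_kernel z s \<partial>circle_measure) = 1" by simp
qed

definition poisson :: "real \<Rightarrow> circle_fun \<Rightarrow> circle_fun" where
  "poisson r f = cls (\<lambda>t. \<integral>s. rep f s * of_real (poisson_kernel (of_real r * t) s) \<partial>circle_measure)"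

lemma rep_poisson:
  assumes "f \<in> Lp 1" "0 \<le> r" "r < 1"
  shows "AE t in circle_measure. rep (poisson r f) t = cauchy_series f (of_real r * t) + cauchy_series (tilde f) (of_real r * cnj t) - fcoeff f 0"
proof -
  have "AE t in circle_measure. rep (poisson r f) t = (\<integral>s. rep f s * of_real (poisson_kernel (of_real r * t) s) \<partial>circle_measure)"
    unfolding poisson_def by (rule rep_cls) measurable
  with AE_circle_norm show ?thesis
  proof eventually_elim
    case (elim t)
    then have "norm (of_real r * t) < 1" using assms by (simp add: norm_mult)
    then show ?case unfolding elim using poisson_integral [OF assms(1)] by simp
  qed
qed

text \<open>Jensen's inequality for a probability density: integrate the tangent of x^p at
  \<open>y\<close>, the mean of |f| against the kernel. The slope term has mean zero.\<close>

lemma poisson_jensen: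
  assumes p: "1 \<le> p" and f: "f \<in> Lp p" and z: "norm z < 1"
  shows "norm (\<integral>s. rep f s * of_real (poisson_kernel z s) \<partial>circle_measure) powr p
      \<le> (\<integral>s. norm (rep f s) powr p * poisson_kernel z s \<partial>circle_measure)"
    and "integrable circle_measure (\<lambda>s. norm (rep f s) powr p * poisson_kernel z s)"
proof -
  have f1: "f \<in> Lp 1" using p f by (rule Lp_subset_L1)
  define B where "B = (1 + norm z) / (1 - norm z)"
  have pk: "AE s in circle_measure. norm (poisson_kernel z s) \<le> B"
    using AE_circle_norm by eventually_elim (use poisson_kernel_bounds [OF _ z] in \<open>force simp: B_def\<close>)
  have pk0: "AE s in circle_measure. 0 \<le> poisson_kernel z s"
    using AE_circle_norm by eventually_elim (use poisson_kernel_bounds [OF _ z] in \<open>auto intro: less_imp_le\<close>)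
  have B: "0 \<le> B" using z by (simp add: B_def)
  have bnd: "integrable circle_measure (\<lambda>s. g s * poisson_kernel z s)" if "integrable circle_measure g" for g :: "complex \<Rightarrow> real"
  proof (rule Bochner_Integration.integrable_bound)
    show "integrable circle_measure (\<lambda>s. B * norm (g s))" using that by auto
    show "AE s in circle_measure. norm (g s * poisson_kernel z s) \<le> norm (B * norm (g s))"
      using pk by eventually_elim (use B in \<open>simp add: abs_mult mult.commute [of "\<bar>g _\<bar>"] mult_right_mono\<close>)
    show "(\<lambda>s. g s * poisson_kernel z s) \<in> borel_measurable circle_measure" 
      using borel_measurable_integrable [OF that] by measurable
  qed
  have i1: "integrable circle_measure (\<lambda>s. norm (rep f s) * poisson_kernel z s)"
    using f1 by (intro bnd) (simp add: Lp_1_iff)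
  show ip: "integrable circle_measure (\<lambda>s. norm (rep f s) powr p * poisson_kernel z s)"
    using f by (intro bnd) (simp add: Lp_iff)
  define y where "y = (\<integral>s. norm (rep f s) * poisson_kernel z s \<partial>circle_measure)"
  have y0: "0 \<le> y" unfolding y_def by (rule integral_nonneg_AE) (use pk0 in \<open>auto elim!: eventually_mono\<close>)
  have "norm (\<integral>s. rep f s * of_real (poisson_kernel z s) \<partial>circle_measure) \<le> (\<integral>s. norm (rep f s * of_real (poisson_kernel z s)) \<partial>circle_measure)"
    by (rule integral_norm_bound)
  also have "\<dots> = y" unfolding y_def
    by (intro integral_cong_AE) (use pk0 in \<open>auto elim!: eventually_mono simp: norm_mult\<close>)
  finally have "norm (\<integral>s. rep f s * of_real (poisson_kernel z s) \<partial>circle_measure) powr p \<le> y powr p"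
    using p by (intro powr_mono2) auto
  also have "y powr p = (\<integral>s. (y powr p - p * y powr (p - 1) * y) * poisson_kernel z s + (p * y powr (p - 1)) * (norm (rep f s) * poisson_kernel z s) \<partial>circle_measure)"
    using i1 poisson_kernel_integral_one [OF z] by (simp add: y_def [symmetric])
  also have "\<dots> \<le> (\<integral>s. norm (rep f s) powr p * poisson_kernel z s \<partial>circle_measure)"
  proof (rule integral_mono_AE [OF _ ip])
    show "integrable circle_measure (\<lambda>s. (y powr p - p * y powr (p - 1) * y) * poisson_kernel z s + (p * y powr (p - 1)) * (norm (rep f s) * poisson_kernel z s))"
      using i1 poisson_kernel_integral_one [OF z] by auto
    show "AE s in circle_measure. (y powr p - p * y powr (p - 1) * y) * poisson_kernel z s + (p * y powr (p - 1)) * (norm (rep f s) * poisson_kernel z s) \<le> norm (rep f s) powr p * poisson_kernel z s"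
      using pk0
    proof eventually_elim
      case (elim s)
      have "(y powr p + p * y powr (p - 1) * (norm (rep f s) - y)) * poisson_kernel z s \<le> norm (rep f s) powr p * poisson_kernel z s"
        using elim p y0 by (intro mult_right_mono powr_tangent) auto
      then show ?case by (simp add: algebra_simps)
    qed
  qed
  finally show "norm (\<integral>s. rep f s * of_real (poisson_kernel z s) \<partial>circle_measure) powr p \<le> (\<integral>s. norm (rep f s) powr p * poisson_kernel z s \<partial>circle_measure)" .
qed

lemma AE_mult_nonneg:
  fixes g h :: "complex \<Rightarrow> real"
  assumes "AE s in circle_measure. 0 \<le> h s" "\<And>s. 0 \<le> g s"
  shows "AE s in circle_measure. 0 \<le> g s * h s"
  using assms(1) by eventually_elim (simp add: assms(2))

text \<open>Pointwise Jensen followed by an exchange of integrations; the kernel has mass one in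
  either variable. Nonnegative integrals are used so that the exchange needs no prior integrability
  on the product.\<close>

lemma poisson_contraction:
  assumes p: "1 \<le> p" and f: "f \<in> Lp p" and r: "0 \<le> r" "r < 1"
  shows "poisson r f \<in> Lp p" "lp_norm p (poisson r f) \<le> lp_norm p f"
proof -
  have rt: "norm t = 1 \<Longrightarrow> norm (of_real r * t) < 1" for t :: complex using r by (simp add: norm_mult)
  have ae: "AE t in circle_measure. rep (poisson r f) t = (\<integral>s. rep f s * of_real (poisson_kernel (of_real r * t) s) \<partial>circle_measure)"
    unfolding poisson_def by (rule rep_cls) measurable
  have pk0: "norm t = 1 \<Longrightarrow> AE s in circle_measure. 0 \<le> poisson_kernel (of_real r * t) s" for t
    using AE_circle_norm by eventually_elim (use poisson_kernel_bounds(3) [OF _ rt] in \<open>auto intro: less_imp_le\<close>)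
  have "(\<integral>\<^sup>+t. ennreal (norm (rep (poisson r f) t) powr p) \<partial>circle_measure)
      \<le> (\<integral>\<^sup>+t. (\<integral>\<^sup>+s. ennreal (norm (rep f s) powr p * poisson_kernel (of_real r * t) s) \<partial>circle_measure) \<partial>circle_measure)"
  proof (intro nn_integral_mono_AE, use ae AE_circle_norm in eventually_elim)
    case (elim t)
    have "ennreal (norm (rep (poisson r f) t) powr p) \<le> ennreal (\<integral>s. norm (rep f s) powr p * poisson_kernel (of_real r * t) s \<partial>circle_measure)"
      unfolding elim(1) using poisson_jensen(1) [OF p f rt] elim by (intro ennreal_leI) auto
    also have "\<dots> = (\<integral>\<^sup>+s. ennreal (norm (rep f s) powr p * poisson_kernel (of_real r * t) s) \<partial>circle_measure)"
      using poisson_jensen(2) [OF p f rt] elim AE_mult_nonneg [OF pk0 [OF elim(2)]]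
      by (intro nn_integral_eq_integral [symmetric]) auto
    finally show ?case .
  qed
  also have "\<dots> = (\<integral>\<^sup>+s. (\<integral>\<^sup>+t. ennreal (norm (rep f s) powr p * poisson_kernel (of_real r * t) s) \<partial>circle_measure) \<partial>circle_measure)"
    by (rule circle_pair.Fubini' [symmetric]) measurable
  also have "\<dots> = (\<integral>\<^sup>+s. ennreal (norm (rep f s) powr p) \<partial>circle_measure)"
  proof (intro nn_integral_cong_AE, use AE_circle_norm in eventually_elim)
    case (elim s)
    have "(\<integral>\<^sup>+t. ennreal (norm (rep f s) powr p * poisson_kernel (of_real r * t) s) \<partial>circle_measure)
        = (\<integral>\<^sup>+t. ennreal (norm (rep f s) powr p * poisson_kernel (of_real r * s) t) \<partial>circle_measure)"
      by (intro nn_integral_cong_AE) (use AE_circle_norm elim in \<open>auto elim!: eventually_mono simp: poisson_kernel_sym\<close>)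
    also have "\<dots> = ennreal (\<integral>t. norm (rep f s) powr p * poisson_kernel (of_real r * s) t \<partial>circle_measure)"
      using poisson_kernel_integral_one [OF rt [OF elim]] AE_mult_nonneg [OF pk0 [OF elim], of "\<lambda>_. norm (rep f s) powr p"]
      by (intro nn_integral_eq_integral) auto
    finally show ?case using poisson_kernel_integral_one [OF rt [OF elim]] by simp
  qed
  also have "\<dots> = ennreal (lp_integral p f)"
    unfolding lp_integral_def using f by (intro nn_integral_eq_integral) (auto simp: Lp_iff)
  finally have le: "(\<integral>\<^sup>+t. ennreal (norm (rep (poisson r f) t) powr p) \<partial>circle_measure) \<le> ennreal (lp_integral p f)" .
  then show 1: "poisson r f \<in> Lp p"
    unfolding Lp_iff by (intro integrableI_bounded) (auto simp: le_less_trans)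
  have "ennreal (lp_integral p (poisson r f)) = (\<integral>\<^sup>+t. ennreal (norm (rep (poisson r f) t) powr p) \<partial>circle_measure)"
    using 1 unfolding lp_integral_def Lp_iff by (subst nn_integral_eq_integral) auto
  with le have "lp_integral p (poisson r f) \<le> lp_integral p f" by (metis ennreal_le_iff lp_integral_nonneg)
  then show "lp_norm p (poisson r f) \<le> lp_norm p f"
    unfolding lp_norm_eq using p by (intro powr_mono2) auto
qed

lemma cauchy_series_add:
  assumes "f \<in> Lp 1" "g \<in> Lp 1" "norm z < 1"
  shows "cauchy_series (f + g) z = cauchy_series f z + cauchy_series g z"
proof -
  have "(\<lambda>n. fcoeff (f + g) (int n) * z ^ n) sums (cauchy_series f z + cauchy_series g z)"
    using sums_add [OF cauchy_series_sums [OF assms(1,3)] cauchy_series_sums [OF assms(2,3)]] assms by (simp add: fcoeff_add distrib_right)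
  from sums_unique2 [OF cauchy_series_sums [OF Lp_add [OF order_refl assms(1,2)] assms(3)] this] show ?thesis .
qed

lemma cauchy_series_cscale:
  assumes "f \<in> Lp 1" "norm z < 1"
  shows "cauchy_series (cscale w f) z = w * cauchy_series f z"
proof -
  have "(\<lambda>n. fcoeff (cscale w f) (int n) * z ^ n) sums (w * cauchy_series f z)"
    using sums_mult [OF cauchy_series_sums [OF assms], of w] by (simp add: fcoeff_cscale mult.assoc)
  from sums_unique2 [OF cauchy_series_sums [OF Lp_cscale [OF order_refl assms(1)] assms(2)] this] show ?thesis .
qed

lemma tilde_cscale: "tilde (cscale z f) = cscale z (tilde f)"
  by (simp add: cscale_def tilde_mult)

lemma poisson_add:
  assumes "f \<in> Lp 1" "g \<in> Lp 1" "0 \<le> r" "r < 1"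
  shows "poisson r (f + g) = poisson r f + poisson r g"
  unfolding circle_fun_eq_iff
  using rep_poisson [OF assms(1,3,4)] rep_poisson [OF assms(2,3,4)] rep_poisson [OF Lp_add [OF order_refl assms(1,2)] assms(3,4)]
    rep_add [of "poisson r f" "poisson r g"] AE_circle_norm
proof eventually_elim
  case (elim t)
  have "norm (of_real r * t) < 1" "norm (of_real r * cnj t) < 1" using elim assms by (simp_all add: norm_mult)
  then show ?case using elim assms by (simp add: cauchy_series_add tilde_add Lp_tilde fcoeff_add)
qed

lemma poisson_cscale:
  assumes "f \<in> Lp 1" "0 \<le> r" "r < 1"
  shows "poisson r (cscale z f) = cscale z (poisson r f)"
  unfolding circle_fun_eq_iff
  using rep_poisson [OF assms] rep_poisson [OF Lp_cscale [OF order_refl assms(1), of z] assms(2,3)]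
    rep_cscale [of z "poisson r f"] AE_circle_norm
proof eventually_elim
  case (elim t)
  have "norm (of_real r * t) < 1" "norm (of_real r * cnj t) < 1" using elim assms by (simp_all add: norm_mult)
  then show ?case using elim assms by (simp add: cauchy_series_cscale tilde_cscale Lp_tilde fcoeff_cscale ring_distribs)
qed

lemma poisson_diff:
  assumes "f \<in> Lp 1" "g \<in> Lp 1" "0 \<le> r" "r < 1"
  shows "poisson r (f - g) = poisson r f - poisson r g"
  using poisson_add [OF Lp_diff [OF _ assms(1,2)] assms(2-4)] by (simp add: algebra_simps)

lemma poisson_tpow:
  assumes "0 \<le> r" "r < 1"
  shows "poisson r (tpow n) = cscale (of_real (r ^ nat \<bar>n\<bar>)) (tpow n)"
  unfolding circle_fun_eq_iff
  using rep_poisson [OF Linf_subset_Lp [OF Linf_tpow zero_less_one] assms, of n]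
    rep_cscale [of "of_real (r ^ nat \<bar>n\<bar>)" "tpow n"] rep_tpow [of n] AE_circle_inverse
proof eventually_elim
  case (elim t)
  have "t powi n = (if n \<ge> 0 then t ^ nat n else cnj t ^ nat (- n))"
    using elim by (auto simp: power_int_def)
  then show ?case using elim by (auto simp: cauchy_series_tpow fcoeff_tpow power_mult_distrib)
qed

definition radius :: "nat \<Rightarrow> real" where
  "radius k = 1 - inverse (real (Suc k))"

lemma radius: "0 \<le> radius k" "radius k < 1" "radius \<longlonglongrightarrow> 1"
proof -
  show "0 \<le> radius k" "radius k < 1" by (simp_all add: radius_def field_simps)
  have "(\<lambda>k. 1 - inverse (real (Suc k))) \<longlonglongrightarrow> 1 - 0"
    by (intro tendsto_intros LIMSEQ_inverse_real_of_nat)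
  then show "radius \<longlonglongrightarrow> 1" by (simp add: radius_def [abs_def])
qed

lemma lp_norm_tpow [simp]: "1 \<le> p \<Longrightarrow> lp_norm p (tpow n) \<le> 1"
proof -
  assume p: "1 \<le> p"
  have "AE t in circle_measure. norm (rep (tpow n) t) \<le> 1"
    using rep_tpow [of n] AE_circle_norm by eventually_elim (simp add: norm_power_int)
  from lp_norm_le_const(2) [OF p _ this] show ?thesis by simp
qed

text \<open>Explicit on monomials, hence true on trigonometric polynomials; the contraction property
  carries it to their closure, with three errors of size e/3.\<close>

lemma poisson_tendsto:
  assumes p: "1 \<le> p" and f: "f \<in> Lp p"
  shows "(\<lambda>k. lp_norm p (poisson (radius k) f - f)) \<longlonglongrightarrow> 0"
proof -
  note L1 = Lp_subset_L1(1) [OF p]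
  have trig: "u \<in> Lp p \<and> (\<lambda>k. lp_norm p (poisson (radius k) u - u)) \<longlonglongrightarrow> 0" if "u \<in> trig" for u
    using that
  proof (induction rule: circ.span_induct)
    show "circ.subspace {u. u \<in> Lp p \<and> (\<lambda>k. lp_norm p (poisson (radius k) u - u)) \<longlonglongrightarrow> 0}"
    proof (rule circ.subspaceI; clarsimp)
      have "poisson (radius k) 0 = 0" for k
        using poisson_cscale [of 0 "radius k" 0] radius by simp
      then show "(\<lambda>k. lp_norm p (poisson (radius k) 0)) \<longlonglongrightarrow> 0" by simp
    next
      fix x y assume x: "x \<in> Lp p" "(\<lambda>k. lp_norm p (poisson (radius k) x - x)) \<longlonglongrightarrow> 0"
        and y: "y \<in> Lp p" "(\<lambda>k. lp_norm p (poisson (radius k) y - y)) \<longlonglongrightarrow> 0"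
      have "(\<lambda>k. lp_norm p (poisson (radius k) (x + y) - (x + y))) \<longlonglongrightarrow> 0"
      proof (rule tendsto_0_le [where K = 1])
        show "(\<lambda>k. lp_norm p (poisson (radius k) x - x) + lp_norm p (poisson (radius k) y - y)) \<longlonglongrightarrow> 0"
          using tendsto_add [OF x(2) y(2)] by simp
        have "lp_norm p ((poisson (radius k) x - x) + (poisson (radius k) y - y)) \<le> lp_norm p (poisson (radius k) x - x) + lp_norm p (poisson (radius k) y - y)" for k
          using x y radius p by (intro lp_norm_triangle Lp_diff poisson_contraction) auto
        then show "\<forall>\<^sub>F k in sequentially. norm (lp_norm p (poisson (radius k) (x + y) - (x + y))) \<le> norm (lp_norm p (poisson (radius k) x - x) + lp_norm p (poisson (radius k) y - y)) * 1"
          using x y L1 radius by (auto simp: poisson_add algebra_simps)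
      qed
      then show "x + y \<in> Lp p \<and> (\<lambda>k. lp_norm p (poisson (radius k) (x + y) - (x + y))) \<longlonglongrightarrow> 0"
        using x y p by (simp add: Lp_add)
    next
      fix c x assume x: "x \<in> Lp p" "(\<lambda>k. lp_norm p (poisson (radius k) x - x)) \<longlonglongrightarrow> 0"
      have "lp_norm p (poisson (radius k) (cscale c x) - cscale c x) = norm c * lp_norm p (poisson (radius k) x - x)" for k
        using x L1 radius p by (simp add: poisson_cscale lp_norm_cscale flip: circ.scale_right_diff_distrib)
      with x p show "cscale c x \<in> Lp p \<and> (\<lambda>k. lp_norm p (poisson (radius k) (cscale c x) - cscale c x)) \<longlonglongrightarrow> 0"
        using tendsto_mult_right_zero [OF x(2)] by (simp add: Lp_cscale)
    qed
    fix u assume "u \<in> range tpow"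
    then obtain n where u: "u = tpow n" by auto
    have "(\<lambda>k. lp_norm p (poisson (radius k) u - u)) \<longlonglongrightarrow> 0"
    proof (rule tendsto_0_le [where K = 1])
      have "(\<lambda>k. radius k ^ nat \<bar>n\<bar> - 1) \<longlonglongrightarrow> 1 ^ nat \<bar>n\<bar> - 1"
        by (intro tendsto_intros radius)
      then show "(\<lambda>k. radius k ^ nat \<bar>n\<bar> - 1) \<longlonglongrightarrow> 0" by simp
      have "lp_norm p (poisson (radius k) u - u) \<le> \<bar>radius k ^ nat \<bar>n\<bar> - 1\<bar>" for k
      proof -
        have "poisson (radius k) u - u = cscale (of_real (radius k ^ nat \<bar>n\<bar> - 1)) u"
          using radius by (simp add: u poisson_tpow circ.scale_left_diff_distrib)
        then have "lp_norm p (poisson (radius k) u - u) = \<bar>radius k ^ nat \<bar>n\<bar> - 1\<bar> * lp_norm p u"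
          using p by (simp only: lp_norm_cscale norm_of_real)
        also have "\<dots> \<le> \<bar>radius k ^ nat \<bar>n\<bar> - 1\<bar> * 1"
          using p by (intro mult_left_mono) (auto simp: u)
        finally show ?thesis by simp
      qed
      then show "\<forall>\<^sub>F k in sequentially. norm (lp_norm p (poisson (radius k) u - u)) \<le> norm (radius k ^ nat \<bar>n\<bar> - 1) * 1"
        by simp
    qed
    then show "u \<in> Lp p \<and> (\<lambda>k. lp_norm p (poisson (radius k) u - u)) \<longlonglongrightarrow> 0"
      using p by (simp add: u Linf_subset_Lp)
  qed
  show ?thesis
  proof (rule LIMSEQ_I)
    fix e :: real assume e: "0 < e"
    obtain u where u: "u \<in> trig" "lp_norm p (f - u) < e / 3"
      using trig_dense [OF p f, of "e / 3"] e by auto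
    have uL: "u \<in> Lp p" using trig u by blast
    obtain N where N: "\<And>k. k \<ge> N \<Longrightarrow> lp_norm p (poisson (radius k) u - u) < e / 3"
      using LIMSEQ_D [OF conjunct2 [OF trig [OF u(1)]], of "e / 3"] e by auto
    have "lp_norm p (poisson (radius k) f - f) < e" if "k \<ge> N" for k
    proof -
      have P: "poisson (radius k) f \<in> Lp p" "poisson (radius k) u \<in> Lp p"
        using poisson_contraction(1) p f uL radius by blast+
      have "lp_norm p (poisson (radius k) f - poisson (radius k) u) = lp_norm p (poisson (radius k) (f - u))"
        using poisson_diff L1 f uL radius by metis
      also have "\<dots> < e / 3"
        using poisson_contraction(2) [OF p Lp_diff [OF p f uL] radius(1,2) [of k]] u(2) by simp
      finally have "lp_norm p (poisson (radius k) f - poisson (radius k) u) < e / 3" .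
      moreover have "lp_norm p (poisson (radius k) f - f) \<le> lp_norm p (poisson (radius k) f - poisson (radius k) u) + lp_norm p (poisson (radius k) u - f)"
        by (rule lp_norm_diff_triangle [OF p P(1,2) f])
      moreover have "lp_norm p (poisson (radius k) u - f) \<le> lp_norm p (poisson (radius k) u - u) + lp_norm p (u - f)"
        by (rule lp_norm_diff_triangle [OF p P(2) uL f])
      moreover note N [OF that] u(2) lp_norm_minus_commute [OF p, of u f]
      ultimately show ?thesis by linarith
    qed
    then show "\<exists>no. \<forall>n\<ge>no. norm (lp_norm p (poisson (radius n) f - f) - 0) < e" by auto
  qed
qed

text \<open>The Poisson means depend only on the coefficients, so all of them vanish, and they
  converge to f.\<close>

lemma fcoeff_unique:
  assumes f: "f \<in> Lp 1" and 0: "\<And>n. fcoeff f n = 0"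
  shows "f = 0"
proof -
  have "poisson (radius k) f = 0" for k
    unfolding circle_fun_eq_iff
    using rep_poisson [OF f radius(1,2)] rep_zero by eventually_elim (simp add: cauchy_series_def 0 fcoeff_tilde)
  then have "lp_norm 1 (- f) = 0"
    using poisson_tendsto [OF _ f] LIMSEQ_unique by fastforce
  then show ?thesis using f lp_norm_eq_0 [of 1 f] by (simp add: lp_norm_uminus)
qed

lemma fcoeff_eqI:
  assumes "f \<in> Lp 1" "g \<in> Lp 1" "\<And>n. fcoeff f n = fcoeff g n"
  shows "f = g"
  using fcoeff_unique [OF Lp_diff [OF _ assms(1,2)]] assms by (simp add: fcoeff_diff)

section \<open>The theorem of M. Riesz\<close>

definition power_sum :: "(nat \<Rightarrow> complex) \<Rightarrow> circle_fun" where
  "power_sum a = cls (\<lambda>t. \<Sum>n. a n * t ^ n)"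

lemma rep_power_sum: "AE t in circle_measure. rep (power_sum a) t = (\<Sum>n. a n * t ^ n)"
  unfolding power_sum_def by (rule rep_cls) measurable

lemma summable_power_sum:
  assumes "summable (\<lambda>n. norm (a n :: complex))" "norm t = 1"
  shows "summable (\<lambda>n. norm (a n * t ^ n))" "summable (\<lambda>n. a n * t ^ n)"
  using assms summable_norm_cancel [of "\<lambda>n. a n * t ^ n"] by (auto simp: norm_mult norm_power)

lemma power_sum_Linf:
  assumes "summable (\<lambda>n. norm (a n))"
  shows "power_sum a \<in> Linf"
proof (rule LinfI)
  show "AE t in circle_measure. norm (rep (power_sum a) t) \<le> (\<Sum>n. norm (a n))"
    using rep_power_sum [of a] AE_circle_norm
  proof eventually_elim
    case (elim t)
    have "norm (\<Sum>n. a n * t ^ n) \<le> (\<Sum>n. norm (a n * t ^ n))"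
      by (rule summable_norm [OF summable_power_sum(1) [OF assms elim(2)]])
    then show ?case using elim by (simp add: norm_mult norm_power)
  qed
qed

text \<open>Absolute summability permits exchanging sum and integral. At index 0 this is the
  bilinear pairing in which the duality arguments below are carried out.\<close>

lemma fcoeff_power_sum_mult:
  assumes a: "summable (\<lambda>n. norm (a n))" and g: "g \<in> Lp 1"
  shows "fcoeff (power_sum a * g) k = (\<Sum>n. a n * fcoeff g (k - int n))"
proof -
  let ?h = "\<lambda>n t. a n * (rep g t * t powi (int n - k))"
  have int: "integrable circle_measure (?h n)" for n
    using fcoeff_integrable [OF g, of "int n - k"] by simp
  have norm_eq: "(\<integral>t. norm (?h n t) \<partial>circle_measure) = norm (a n) * lp_norm 1 g" for n
  proof -
    have "(\<integral>t. norm (?h n t) \<partial>circle_measure) = (\<integral>t. norm (a n) * norm (rep g t) \<partial>circle_measure)"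
    proof (intro integral_cong_AE)
      show "AE t in circle_measure. norm (?h n t) = norm (a n) * norm (rep g t)"
        using AE_circle_norm by eventually_elim (simp add: norm_mult norm_power_int)
    qed measurable
    then show ?thesis by (simp add: lp_norm_one_eq)
  qed
  have ae: "AE t in circle_measure. summable (\<lambda>n. norm (?h n t)) \<and> (\<Sum>n. ?h n t) = rep (power_sum a * g) t * t powi (- k)"
    using rep_power_sum [of a] rep_mult [of "power_sum a" g] AE_circle_norm
  proof eventually_elim
    case (elim t)
    have "t \<noteq> 0" using elim by auto
    have *: "?h n t = (a n * t ^ n) * (rep g t * t powi (- k))" for n
      using \<open>t \<noteq> 0\<close> power_int_add [of t "int n" "- k"] by (simp add: ac_simps)
    have "summable (\<lambda>n. norm (a n * t ^ n) * norm (rep g t * t powi (- k)))"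
      by (intro summable_mult2 summable_power_sum(1) [OF a elim(3)])
    then show ?case unfolding * using suminf_mult2 [OF summable_power_sum(2) [OF a elim(3)], of "rep g t * t powi (- k)"]
      elim by (simp only: norm_mult) (simp add: ac_simps)
  qed
  have 1: "AE t in circle_measure. summable (\<lambda>n. norm (?h n t))" using ae by eventually_elim simp
  have 2: "summable (\<lambda>n. \<integral>t. norm (?h n t) \<partial>circle_measure)"
    unfolding norm_eq by (intro summable_mult2 a)
  have "fcoeff (power_sum a * g) k = (\<integral>t. (\<Sum>n. ?h n t) \<partial>circle_measure)"
    unfolding fcoeff_eq
  proof (intro integral_cong_AE)
    show "AE t in circle_measure. rep (power_sum a * g) t * t powi - k = (\<Sum>n. ?h n t)"
      using ae by eventually_elim metis
  qed measurable
  also have "\<dots> = (\<Sum>n. \<integral>t. ?h n t \<partial>circle_measure)"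
    by (rule integral_suminf [OF int 1 2])
  finally show ?thesis by (simp add: fcoeff_eq)
qed

lemma fcoeff_power_sum:
  assumes a: "summable (\<lambda>n. norm (a n))"
  shows "fcoeff (power_sum a) k = (if 0 \<le> k then a (nat k) else 0)"
proof -
  have "fcoeff (power_sum a) k = (\<Sum>n. a n * fcoeff 1 (k - int n))"
    using fcoeff_power_sum_mult [OF a, of 1 k] by (simp add: Linf_subset_Lp)
  also have "\<dots> = (\<Sum>n. if n = nat k then (if 0 \<le> k then a (nat k) else 0) else 0)"
    by (intro suminf_cong) (auto simp: fcoeff_one)
  also have "\<dots> = (if 0 \<le> k then a (nat k) else 0)"
    by (subst suminf_finite [of "{nat k}"]) auto
  finally show ?thesis .
qed

lemma power_sum_partial_tendsto:
  assumes p: "1 \<le> p" and a: "summable (\<lambda>n. norm (a n))"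
  shows "(\<lambda>N. lp_norm p ((\<Sum>n<N. cscale (a n) (tpow (int n))) - power_sum a)) \<longlonglongrightarrow> 0"
proof (rule tendsto_0_le [where K = 1])
  show "(\<lambda>N. \<Sum>n. norm (a (n + N))) \<longlonglongrightarrow> 0"
    using suminf_exist_split2 [OF a] by simp
  have "lp_norm p ((\<Sum>n<N. cscale (a n) (tpow (int n))) - power_sum a) \<le> (\<Sum>n. norm (a (n + N)))" for N
  proof (rule lp_norm_le_const(2) [OF p])
    show "0 \<le> (\<Sum>n. norm (a (n + N)))"
      using a by (intro suminf_nonneg) (simp_all add: summable_iff_shift [of "\<lambda>n. norm (a n)"])
    have "AE t in circle_measure. \<forall>n. rep (cscale (a n) (tpow (int n))) t = a n * t ^ n"
      unfolding AE_all_countable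
    proof
      fix n show "AE t in circle_measure. rep (cscale (a n) (tpow (int n))) t = a n * t ^ n"
        using rep_cscale [of "a n" "tpow (int n)"] rep_tpow [of "int n"] by eventually_elim simp
    qed
    then show "AE t in circle_measure. norm (rep ((\<Sum>n<N. cscale (a n) (tpow (int n))) - power_sum a) t) \<le> (\<Sum>n. norm (a (n + N)))"
      using rep_power_sum [of a] rep_diff [of "\<Sum>n<N. cscale (a n) (tpow (int n))" "power_sum a"]
        rep_sum [OF finite_lessThan, of "\<lambda>n. cscale (a n) (tpow (int n))" N] AE_circle_norm
    proof eventually_elim
      case (elim t)
      have "rep ((\<Sum>n<N. cscale (a n) (tpow (int n))) - power_sum a) t = - (\<Sum>n. a (n + N) * t ^ (n + N))"
        using elim suminf_split_initial_segment [OF summable_power_sum(2) [OF a elim(5)], of N] by simp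
      also have "norm \<dots> \<le> (\<Sum>n. norm (a (n + N) * t ^ (n + N)))"
        unfolding norm_minus_cancel using summable_power_sum(1) [OF a elim(5)]
        by (intro summable_norm) (subst summable_iff_shift [of "\<lambda>n. norm (a n * t ^ n)"])
      finally show ?case using elim by (simp add: norm_mult norm_power)
    qed
  qed
  then show "\<forall>\<^sub>F N in sequentially. norm (lp_norm p ((\<Sum>n<N. cscale (a n) (tpow (int n))) - power_sum a)) \<le> norm (\<Sum>n. norm (a (n + N))) * 1"
    by (intro always_eventually allI) (simp add: order_trans [OF _ abs_ge_self])
qed

text \<open>The mean value property for classes: on a smaller circle the Taylor series converges
  absolutely, so its constant term is the zeroth Fourier coefficient.\<close>

lemma holomorphic_circle_mean:
  assumes G: "G holomorphic_on ball 0 1" and r: "0 \<le> r" "r < 1"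
  obtains u where "u \<in> Linf" "AE t in circle_measure. rep u t = G (of_real r * t)" "fcoeff u 0 = G 0"
proof -
  define b where "b n = (deriv ^^ n) G 0 / fact n" for n
  have sums: "(\<lambda>n. b n * w ^ n) sums G w" if "norm w < 1" for w
    using holomorphic_power_series [OF G, of w] that by (simp add: b_def)
  \<comment> \<open>A radius strictly between r and 1: convergence at R makes the series absolutely
    convergent at r.\<close>
  define R where "R = (r + 1) / 2"
  have R: "r < R" "R < 1" using r by (auto simp: R_def)
  define a where "a n = b n * of_real r ^ n" for n
  have "summable (\<lambda>n. norm (b n * of_real r ^ n))"
  proof (rule powser_insidea)
    show "summable (\<lambda>n. b n * of_real R ^ n)" using sums [of "of_real R"] R r by (auto simp: sums_iff)
    show "norm (of_real r :: complex) < norm (of_real R :: complex)" using R r by simp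
  qed
  then have a: "summable (\<lambda>n. norm (a n))" by (simp add: a_def)
  have ae: "AE t in circle_measure. rep (power_sum a) t = G (of_real r * t)"
    using rep_power_sum [of a] AE_circle_norm
  proof eventually_elim
    case (elim t)
    have "norm (of_real r * t) < 1" using elim r by (simp add: norm_mult)
    from sums [OF this] elim(1) show ?case by (simp add: a_def sums_iff power_mult_distrib mult.assoc)
  qed
  have "fcoeff (power_sum a) 0 = b 0" by (simp add: fcoeff_power_sum [OF a] a_def)
  also have "\<dots> = G 0" by (simp add: b_def)
  finally show ?thesis by (rule that [OF power_sum_Linf [OF a] ae])
qed

text \<open>Calderon's inequality: when \<open>z\<close> runs through the values of an analytic function with positive real
  part on a circle, the mean value property turns the last term into a number of known sign.\<close>

lemma powr_le_Re_powr:
  fixes p :: real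
  assumes p: "1 < p" "p \<le> 2"
  shows "\<exists>A\<ge>0. \<exists>B\<ge>0. \<forall>z. 0 < Re z \<longrightarrow> norm z powr p \<le> A * Re z powr p - B * Re (z powr of_real p)"
proof -
  \<comment> \<open>The midpoint of pi/(2p) and pi/2, which differ because p > 1. Then p times this
    angle exceeds pi/2, and p \<le> 2 keeps it at most pi, so its cosine is negative.\<close>
  define \<theta>\<^sub>0 where "\<theta>\<^sub>0 = (pi / (2 * p) + pi / 2) / 2"
  have "pi / (2 * p) < pi / 2" using p by (simp add: field_simps)
  then have \<theta>\<^sub>0: "pi / (2 * p) < \<theta>\<^sub>0" "\<theta>\<^sub>0 < pi / 2" by (auto simp: \<theta>\<^sub>0_def)
  then have "pi / 2 < p * \<theta>\<^sub>0" using p by (simp add: field_simps)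
  have "0 < pi / (2 * p)" using p by simp
  then have \<theta>\<^sub>0_pos: "0 < \<theta>\<^sub>0" using \<theta>\<^sub>0 by linarith
  have "p * \<theta>\<^sub>0 \<le> 2 * (pi / 2)" using \<theta>\<^sub>0 \<theta>\<^sub>0_pos p by (intro mult_mono) auto
  then have le_pi: "p * \<theta>\<^sub>0 \<le> pi" by simp
  have neg: "cos (p * \<theta>\<^sub>0) < 0"
    using cos_monotone_0_pi [of "pi / 2" "p * \<theta>\<^sub>0"] \<open>pi / 2 < p * \<theta>\<^sub>0\<close> le_pi by simp
  have cos0: "0 < cos \<theta>\<^sub>0" using \<theta>\<^sub>0 \<theta>\<^sub>0_pos by (intro cos_gt_zero) auto
  \<comment> \<open>Beyond the critical angle \<open>B\<close> alone makes the right side at least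
    1; below it cos \<theta> is bounded away from 0 and \<open>A\<close> pays for the 1 and for the
    at most B that is subtracted.\<close>
  define B where "B = - 1 / cos (p * \<theta>\<^sub>0)"
  define A where "A = (1 + B) / cos \<theta>\<^sub>0 powr p"
  have B: "0 < B" using neg by (simp add: B_def divide_neg_neg)
  then have A: "0 < A" using cos0 by (simp add: A_def)
  have angle: "1 \<le> A * cos \<theta> powr p - B * cos (p * \<theta>)" if \<theta>: "0 \<le> \<theta>" "\<theta> < pi / 2" for \<theta>
  proof (cases "\<theta> \<le> \<theta>\<^sub>0")
    case True
    have "cos \<theta>\<^sub>0 \<le> cos \<theta>" using True \<theta> \<theta>\<^sub>0 by (intro cos_monotone_0_pi_le) auto
    then have "A * cos \<theta>\<^sub>0 powr p \<le> A * cos \<theta> powr p"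
      using A cos0 p by (intro mult_left_mono powr_mono2) auto
    moreover have "A * cos \<theta>\<^sub>0 powr p = 1 + B" using cos0 by (simp add: A_def)
    moreover have "B * cos (p * \<theta>) \<le> B * 1" using B by (intro mult_left_mono) auto
    ultimately show ?thesis by simp
  next
    case False
    have "p * \<theta> \<le> 2 * (pi / 2)" using \<theta> p by (intro mult_mono) auto
    then have "cos (p * \<theta>) \<le> cos (p * \<theta>\<^sub>0)"
      using False p \<theta>\<^sub>0_pos by (intro cos_monotone_0_pi_le) auto
    then have "B * cos (p * \<theta>) \<le> B * cos (p * \<theta>\<^sub>0)" using B by (intro mult_left_mono) auto
    also have "\<dots> = -1" using neg by (simp add: B_def)
    finally have "B * cos (p * \<theta>) \<le> -1" .
    moreover have "0 \<le> A * cos \<theta> powr p" using A by simp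
    ultimately show ?thesis by linarith
  qed
  show ?thesis
  proof (intro exI conjI allI impI)
    fix z :: complex assume z: "0 < Re z"
    then have z0: "z \<noteq> 0" by auto
    define \<theta> where "\<theta> = Im (Ln z)"
    have \<theta>: "\<bar>\<theta>\<bar> < pi / 2" using z z0 Re_Ln_pos_lt unfolding \<theta>_def by blast
    have Re_z: "Re z = norm z * cos \<bar>\<theta>\<bar>"
    proof -
      have "Re z = Re (exp (Ln z))" using z0 by simp
      also have "\<dots> = exp (Re (Ln z)) * cos (Im (Ln z))" by (simp add: Re_exp)
      finally show ?thesis using z0 by (simp add: \<theta>_def)
    qed
    have powr: "Re (z powr of_real p) = norm z powr p * cos (p * \<bar>\<theta>\<bar>)"
    proof -
      have "cos (p * \<theta>) = cos (p * \<bar>\<theta>\<bar>)" by (simp add: abs_if)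
      then show ?thesis using z0 by (simp add: powr_def Re_exp \<theta>_def)
    qed
    have "norm z powr p * 1 \<le> norm z powr p * (A * cos \<bar>\<theta>\<bar> powr p - B * cos (p * \<bar>\<theta>\<bar>))"
      using angle [of "\<bar>\<theta>\<bar>"] \<theta> by (intro mult_left_mono) auto
    also have "\<dots> = A * Re z powr p - B * Re (z powr of_real p)"
      unfolding Re_z powr using z0 by (simp add: powr_mult algebra_simps)
    finally show "norm z powr p \<le> A * Re z powr p - B * Re (z powr of_real p)" by simp
  qed (use A B in auto)
qed

text \<open>The Poisson means of the analytic part of \<open>f\<close>, which exist before the Riesz projection does.\<close>

definition analytic_poisson :: "real \<Rightarrow> circle_fun \<Rightarrow> circle_fun" where
  "analytic_poisson r f = power_sum (\<lambda>n. fcoeff f (int n) * of_real r ^ n)"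

lemma analytic_poisson_summable:
  assumes "f \<in> Lp 1" "0 \<le> r" "r < 1"
  shows "summable (\<lambda>n. norm (fcoeff f (int n) * of_real r ^ n))"
  using summable_cauchy_series [of "\<lambda>n. fcoeff f (int n)" "lp_norm 1 f" "of_real r"] norm_fcoeff_le [OF assms(1)] assms by simp

lemma rep_analytic_poisson:
  assumes "f \<in> Lp 1" "0 \<le> r" "r < 1"
  shows "AE t in circle_measure. rep (analytic_poisson r f) t = cauchy_series f (of_real r * t)"
  unfolding analytic_poisson_def using rep_power_sum [of "\<lambda>n. fcoeff f (int n) * of_real r ^ n"]
  by eventually_elim (simp add: cauchy_series_def power_mult_distrib mult.assoc)

lemma analytic_poisson_Linf: "f \<in> Lp 1 \<Longrightarrow> 0 \<le> r \<Longrightarrow> r < 1 \<Longrightarrow> analytic_poisson r f \<in> Linf"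
  unfolding analytic_poisson_def by (intro power_sum_Linf analytic_poisson_summable)

lemma analytic_poisson_Lp: "f \<in> Lp 1 \<Longrightarrow> 0 \<le> r \<Longrightarrow> r < 1 \<Longrightarrow> 0 < p \<Longrightarrow> analytic_poisson r f \<in> Lp p"
  using analytic_poisson_Linf Linf_subset_Lp by blast

lemma fcoeff_analytic_poisson:
  assumes "f \<in> Lp 1" "0 \<le> r" "r < 1"
  shows "fcoeff (analytic_poisson r f) k = (if 0 \<le> k then fcoeff f k * of_real r ^ nat k else 0)"
  using fcoeff_power_sum [OF analytic_poisson_summable [OF assms]] by (simp add: analytic_poisson_def)

lemma analytic_poisson_add:
  assumes "f \<in> Lp 1" "g \<in> Lp 1" "0 \<le> r" "r < 1"
  shows "analytic_poisson r (f + g) = analytic_poisson r f + analytic_poisson r g"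
  by (rule fcoeff_eqI) (use assms in \<open>simp_all add: analytic_poisson_Lp Lp_add fcoeff_add fcoeff_analytic_poisson distrib_right\<close>)

lemma analytic_poisson_cscale:
  assumes "f \<in> Lp 1" "0 \<le> r" "r < 1"
  shows "analytic_poisson r (cscale z f) = cscale z (analytic_poisson r f)"
  by (rule fcoeff_eqI) (use assms in \<open>simp_all add: analytic_poisson_Lp Lp_cscale fcoeff_cscale fcoeff_analytic_poisson\<close>)

text \<open>The means of f are Poisson means of any analytic part g of f. Uniform bounds for them
  therefore pass to g, because Poisson means converge.\<close>

lemma analytic_poisson_eq_poisson:
  assumes "f \<in> Lp 1" "g \<in> Lp 1" "\<And>n. n < 0 \<Longrightarrow> fcoeff g n = 0" "\<And>n. 0 \<le> n \<Longrightarrow> fcoeff f n = fcoeff g n"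
    and r: "0 \<le> r" "r < 1"
  shows "analytic_poisson r f = poisson r g"
proof -
  have "cauchy_series (tilde g) z = fcoeff g 0" for z
  proof -
    have "cauchy_series (tilde g) z = (\<Sum>n. if n = 0 then fcoeff g 0 else 0)"
      unfolding cauchy_series_def by (intro suminf_cong) (auto simp: fcoeff_tilde assms(3))
    also have "\<dots> = fcoeff g 0" by (subst suminf_finite [of "{0}"]) auto
    finally show ?thesis .
  qed
  moreover have "cauchy_series f z = cauchy_series g z" for z by (simp add: cauchy_series_def assms(4))
  ultimately have *: "cauchy_series (tilde g) z = fcoeff g 0" "cauchy_series f z = cauchy_series g z" for z by blast+
  show ?thesis
    unfolding circle_fun_eq_iff
    using rep_analytic_poisson [OF assms(1) r] rep_poisson [OF assms(2) r] by eventually_elim (simp add: *)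
qed


lemma fcoeff_nonneg_fun:
  assumes f: "f \<in> Lp 1" and g: "AE t in circle_measure. rep f t = of_real (g t)"
    and [measurable]: "g \<in> borel_measurable borel"
  shows "fcoeff f 0 = of_real (\<integral>t. g t \<partial>circle_measure)" "integrable circle_measure g"
proof -
  have "integrable circle_measure (\<lambda>t. complex_of_real (g t))"
    using f g integrable_cong_AE [of "rep f" circle_measure "\<lambda>t. complex_of_real (g t)"] by (simp add: Lp_1_iff)
  then show int: "integrable circle_measure g" using complex_of_real_integrable_eq by blast
  have "fcoeff f 0 = (\<integral>t. complex_of_real (g t) \<partial>circle_measure)"
    unfolding fcoeff_eq by (intro integral_cong_AE) (use g in \<open>auto elim!: eventually_mono\<close>)
  then show "fcoeff f 0 = of_real (\<integral>t. g t \<partial>circle_measure)" by simp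
qed

lemma analytic_poisson_bound_nonneg:
  assumes p: "1 < p" "p \<le> 2"
  shows "\<exists>C\<ge>0. \<forall>f\<in>Lp p. \<forall>g r. g \<in> borel_measurable borel \<and> (\<forall>t. 0 \<le> g t) \<and>
    (AE t in circle_measure. rep f t = complex_of_real (g t)) \<and> 0 \<le> r \<and> r < 1 \<longrightarrow>
    lp_norm p (analytic_poisson r f) \<le> C * lp_norm p f"
proof -
  obtain A B where AB: "0 \<le> A" "0 \<le> B"
    "\<forall>z. 0 < Re z \<longrightarrow> norm z powr p \<le> A * Re z powr p - B * Re (z powr of_real p)"
    using powr_le_Re_powr [OF p] by blast
  \<comment> \<open>Below, \<open>analytic_poisson r f\<close> is (x + c0) / 2 with the norm of x at
    most A^(1/p) times that of f, and c0 at most the norm of f.\<close>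
  define C where "C = (A powr (1 / p) + 1) / 2"
  have bound: "lp_norm p (analytic_poisson r f) \<le> C * lp_norm p f"
    if fp: "f \<in> Lp p" and gm [measurable]: "g \<in> borel_measurable borel" and g0: "\<And>t. 0 \<le> g t"
      and fg: "AE t in circle_measure. rep f t = complex_of_real (g t)" and r: "0 \<le> r" "r < 1" for f g r
  proof -
    have p1: "1 \<le> p" using p by simp
    have f: "f \<in> Lp 1" using Lp_subset_L1(1) [OF p1 fp] .
    define c0 where "c0 = (\<integral>t. g t \<partial>circle_measure)"
    have c0: "fcoeff f 0 = of_real c0" unfolding c0_def by (rule fcoeff_nonneg_fun(1) [OF f fg gm])
    have g_int: "integrable circle_measure g" by (rule fcoeff_nonneg_fun(2) [OF f fg gm])
    have "0 \<le> c0" unfolding c0_def using g0 by simp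
    have c0_le: "c0 \<le> lp_norm p f"
      using norm_fcoeff_le [OF f, of 0] Lp_subset_L1(2) [OF p1 fp] \<open>0 \<le> c0\<close> by (simp add: c0)
    \<comment> \<open>The holomorphic function whose real part is the Poisson integral of f and
      whose value at 0 is the real number c0.\<close>
    define F where "F z = 2 * cauchy_series f z - of_real c0" for z
    have Re_F: "complex_of_real (Re (F z)) = (\<integral>s. rep f s * of_real (poisson_kernel z s) \<partial>circle_measure)"
      and Re_F_ge: "(1 - norm z) / (1 + norm z) * c0 \<le> Re (F z)" if z: "norm z < 1" for z
    proof -
      have "cauchy_series (tilde f) (cnj z) = cnj (cauchy_series f z)"
      proof -
        have "cauchy_series (tilde f) (cnj z) = (\<integral>s. cnj (rep f s / (1 - z * cnj s)) \<partial>circle_measure)"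
          unfolding cauchy_series_conj_integral(1) [OF f z]
          by (intro integral_cong_AE) (use fg in \<open>auto elim!: eventually_mono\<close>)
        also have "\<dots> = cnj (cauchy_series f z)"
          unfolding cauchy_series_integral(1) [OF f z] by (rule Bochner_Integration.integral_cnj)
        finally show ?thesis .
      qed
      then show 1: "complex_of_real (Re (F z)) = (\<integral>s. rep f s * of_real (poisson_kernel z s) \<partial>circle_measure)"
        unfolding poisson_integral(1) [OF f z] by (simp add: F_def c0 complex_eq_iff)
      have ae: "AE s in circle_measure. rep f s * of_real (poisson_kernel z s) = complex_of_real (g s * poisson_kernel z s)"
        using fg by eventually_elim simp
      have "(\<integral>s. rep f s * of_real (poisson_kernel z s) \<partial>circle_measure) = (\<integral>s. complex_of_real (g s * poisson_kernel z s) \<partial>circle_measure)"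
        by (intro integral_cong_AE ae) auto
      with 1 have Re_eq: "Re (F z) = (\<integral>s. g s * poisson_kernel z s \<partial>circle_measure)"
        unfolding integral_complex_of_real of_real_eq_iff by simp
      have int: "integrable circle_measure (\<lambda>s. g s * poisson_kernel z s)"
        using poisson_integral(2) [OF f z] integrable_cong_AE [OF _ _ ae] complex_of_real_integrable_eq [of circle_measure "\<lambda>s. g s * poisson_kernel z s"] by simp
      have "(1 - norm z) / (1 + norm z) * c0 = (\<integral>s. g s * ((1 - norm z) / (1 + norm z)) \<partial>circle_measure)"
        by (simp add: c0_def)
      also have "\<dots> \<le> (\<integral>s. g s * poisson_kernel z s \<partial>circle_measure)"
      proof (rule integral_mono_AE [OF _ int])
        show "AE s in circle_measure. g s * ((1 - norm z) / (1 + norm z)) \<le> g s * poisson_kernel z s"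
          using AE_circle_norm by eventually_elim (intro mult_left_mono g0 poisson_kernel_bounds z)
        show "integrable circle_measure (\<lambda>s. g s * ((1 - norm z) / (1 + norm z)))"
          by (intro integrable_mult_left g_int)
      qed
      finally show "(1 - norm z) / (1 + norm z) * c0 \<le> Re (F z)" unfolding Re_eq .
    qed
    show ?thesis
    \<comment> \<open>A mean c0 = 0 forces f = 0. Otherwise the lower bound for the kernel makes Re
      F strictly positive, so the principal power F^p is holomorphic.\<close>
    proof (cases "c0 = 0")
      case True
      then have "AE t in circle_measure. g t = 0"
        unfolding c0_def using g0 g_int by (subst (asm) integral_nonneg_eq_0_iff_AE) auto
      then have "f = 0" unfolding circle_fun_eq_iff using fg rep_zero by eventually_elim simp
      then have "analytic_poisson r f = 0" using analytic_poisson_cscale [OF f r, of 0] by simp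
      then show ?thesis by (simp add: C_def)
    next
      case False
      with \<open>0 \<le> c0\<close> have c0_pos: "0 < c0" by simp
      have F_pos: "0 < Re (F z)" if z: "norm z < 1" for z
      proof -
        have "0 < (1 - norm z) / (1 + norm z) * c0"
          using z c0_pos norm_ge_zero [of z] by (intro mult_pos_pos divide_pos_pos) linarith+
        with Re_F_ge [OF z] show ?thesis by linarith
      qed
      have "cauchy_series f holomorphic_on ball 0 1"
        by (rule power_series_holomorphic [where a = "\<lambda>n. fcoeff f (int n)"]) (simp add: cauchy_series_sums [OF f])
      then have F_holo: "F holomorphic_on ball 0 1" unfolding F_def [abs_def] by (intro holomorphic_intros)
      have "(\<lambda>z. F z powr of_real p) holomorphic_on ball 0 1"
      proof (rule holomorphic_on_powr [OF F_holo holomorphic_on_const])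
        show "F z \<notin> \<real>\<^sub>\<le>\<^sub>0" if "z \<in> ball 0 1" for z
          using F_pos [of z] that by (auto simp: complex_nonpos_Reals_iff)
      qed
      then obtain u where u: "u \<in> Linf" "AE t in circle_measure. rep u t = F (of_real r * t) powr of_real p"
        "fcoeff u 0 = F 0 powr of_real p"
        using holomorphic_circle_mean [OF _ r, of "\<lambda>z. F z powr of_real p" thesis] by simp
      have "cauchy_series f 0 = of_real c0"
        by (subst cauchy_series_def, subst suminf_finite [of "{0}"]) (auto simp: c0)
      then have F0: "F 0 = of_real c0" by (simp add: F_def)
      define x where "x = cscale 2 (analytic_poisson r f) - const_fun (of_real c0)"
      have x: "x \<in> Lp p" unfolding x_def using analytic_poisson_Lp [OF f r, of p] p1
        by (intro Lp_diff Lp_cscale) (auto simp: Linf_subset_Lp)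
      have rep_x: "AE t in circle_measure. rep x t = F (of_real r * t)"
        using rep_diff [of "cscale 2 (analytic_poisson r f)" "const_fun (of_real c0)"] rep_cscale [of 2 "analytic_poisson r f"]
          rep_analytic_poisson [OF f r] rep_const [of "of_real c0"]
        unfolding x_def by eventually_elim (simp add: F_def)
      have P: "poisson r f \<in> Lp p" "lp_norm p (poisson r f) \<le> lp_norm p f"
        using poisson_contraction [OF p1 fp r] by auto
      have "AE t in circle_measure. rep (poisson r f) t = (\<integral>s. rep f s * of_real (poisson_kernel (of_real r * t) s) \<partial>circle_measure)"
        unfolding poisson_def by (rule rep_cls) measurable
      then have pw: "AE t in circle_measure. norm (rep x t) powr p \<le> A * norm (rep (poisson r f) t) powr p - B * Re (rep u t)"
        using rep_x u(2) AE_circle_norm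
      proof eventually_elim
        case (elim t)
        have z: "norm (of_real r * t) < 1" using elim r by (simp add: norm_mult)
        have "norm (rep (poisson r f) t) = Re (F (of_real r * t))"
          unfolding elim(1) Re_F [OF z, symmetric] using F_pos [OF z] by simp
        then show ?case using AB(3) [rule_format, OF F_pos [OF z]] elim by simp
      qed
      have u_int: "integrable circle_measure (rep u)" using u(1) Linf_subset_Lp [of u 1] by (simp add: Lp_1_iff)
      have "lp_integral p x \<le> (\<integral>t. A * norm (rep (poisson r f) t) powr p - B * Re (rep u t) \<partial>circle_measure)"
        unfolding lp_integral_def
      proof (rule integral_mono_AE [OF _ _ pw])
        show "integrable circle_measure (\<lambda>t. norm (rep x t) powr p)" using x by (simp only: Lp_iff)
        show "integrable circle_measure (\<lambda>t. A * norm (rep (poisson r f) t) powr p - B * Re (rep u t))"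
          using P(1) u_int unfolding Lp_iff by (intro Bochner_Integration.integrable_diff integrable_mult_right integrable_Re)
      qed
      also have "\<dots> = A * lp_integral p (poisson r f) - B * Re (fcoeff u 0)"
        using P(1) u_int by (simp add: lp_integral_def Lp_iff fcoeff_eq)
      also have "\<dots> \<le> A * lp_integral p (poisson r f)"
      proof -
        have "Re (fcoeff u 0) = c0 powr p"
          unfolding u(3) F0 using c0_pos by (simp add: powr_Reals_eq)
        then show ?thesis using AB(2) by simp
      qed
      also have "\<dots> \<le> A * lp_norm p f powr p"
        using P(2) AB(1) p1 by (simp add: lp_integral_eq_lp_norm mult_left_mono powr_mono2)
      also have "\<dots> = (A powr (1 / p) * lp_norm p f) powr p"
        using AB(1) p1 by (simp add: powr_mult powr_powr)
      finally have "lp_norm p x \<le> A powr (1 / p) * lp_norm p f"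
        using p1 by (intro lp_norm_leI) auto
      moreover have const: "lp_norm p (const_fun (of_real c0)) \<le> lp_norm p f"
        using lp_norm_cscale [OF p1, of "of_real c0" 1] c0_le \<open>0 \<le> c0\<close> by (simp add: cscale_def)
      moreover have "analytic_poisson r f = cscale (1 / 2) (x + const_fun (of_real c0))" by (simp add: x_def)
      then have "lp_norm p (analytic_poisson r f) = 1 / 2 * lp_norm p (x + const_fun (of_real c0))"
        using lp_norm_cscale [OF p1] by simp
      moreover have "lp_norm p (x + const_fun (of_real c0)) \<le> lp_norm p x + lp_norm p (const_fun (of_real c0))"
        using p1 x by (intro lp_norm_triangle) (auto simp: Linf_subset_Lp)
      ultimately show ?thesis by (simp add: C_def field_simps)
    qed
  qed
  show ?thesis
  proof (rule exI [of _ C], intro conjI ballI allI impI)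
    show "0 \<le> C" by (simp add: C_def)
  qed (elim conjE, rule bound, assumption+, erule spec, assumption+)
qed

lemma nonneg_part:
  assumes p: "1 \<le> p" and f: "f \<in> Lp p" and [measurable]: "h \<in> borel_measurable borel" and h: "\<And>z::complex. \<bar>h z\<bar> \<le> norm z"
  defines "x \<equiv> cls (\<lambda>t. complex_of_real (max 0 (h (rep f t))))"
  shows "x \<in> Lp p" "lp_norm p x \<le> lp_norm p f"
    "AE t in circle_measure. rep x t = complex_of_real (max 0 (h (rep f t)))"
proof -
  show ae: "AE t in circle_measure. rep x t = complex_of_real (max 0 (h (rep f t)))"
    unfolding x_def by (rule rep_cls) measurable
  have "AE t in circle_measure. norm (rep x t) \<le> 1 * norm (rep f t)"
    using ae
  proof eventually_elim
    case (elim t)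
    have "\<bar>max 0 (h (rep f t))\<bar> \<le> norm (rep f t)" using h [of "rep f t"] by linarith
    then show ?case unfolding elim by (simp only: norm_of_real mult_1)
  qed
  from Lp_dominated [OF p f this] show "x \<in> Lp p" "lp_norm p x \<le> lp_norm p f" by auto
qed

lemma analytic_poisson_bound_le2:
  assumes p: "1 < p" "p \<le> 2"
  shows "\<exists>C\<ge>0. \<forall>f\<in>Lp p. \<forall>r. 0 \<le> r \<and> r < 1 \<longrightarrow> lp_norm p (analytic_poisson r f) \<le> C * lp_norm p f"
proof -
  obtain C where C: "0 \<le> C" "\<forall>f\<in>Lp p. \<forall>g r. g \<in> borel_measurable borel \<and> (\<forall>t. 0 \<le> g t) \<and>
    (AE t in circle_measure. rep f t = complex_of_real (g t)) \<and> 0 \<le> r \<and> r < 1 \<longrightarrow>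
    lp_norm p (analytic_poisson r f) \<le> C * lp_norm p f"
    using analytic_poisson_bound_nonneg [OF p] by blast
  have p1: "1 \<le> p" using p by simp
  have "lp_norm p (analytic_poisson r f) \<le> (4 * C) * lp_norm p f" if f: "f \<in> Lp p" and r: "0 \<le> r" "r < 1" for f r
  proof -
    define part where "part h = cls (\<lambda>t. complex_of_real (max 0 (h (rep f t))))" for h :: "complex \<Rightarrow> real"
    have bounds: "part h \<in> Lp p \<and> lp_norm p (analytic_poisson r (part h)) \<le> C * lp_norm p f \<and>
        (AE t in circle_measure. rep (part h) t = complex_of_real (max 0 (h (rep f t))))"
      if [measurable]: "h \<in> borel_measurable borel" and h: "\<And>z::complex. \<bar>h z\<bar> \<le> norm z" for h
    proof -
      note * = nonneg_part [OF p1 f that, folded part_def]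
      have "lp_norm p (analytic_poisson r (part h)) \<le> C * lp_norm p (part h)"
        using C(2) [rule_format, OF *(1), of "\<lambda>t. max 0 (h (rep f t))" r] *(3) r by simp
      also have "\<dots> \<le> C * lp_norm p f" using C(1) *(2) by (intro mult_left_mono) auto
      finally show ?thesis using * by blast
    qed
    define f1 f2 f3 f4 where "f1 = part Re" and "f2 = part (\<lambda>z. - Re z)" and "f3 = part Im" and "f4 = part (\<lambda>z. - Im z)"
    have b: "f1 \<in> Lp p \<and> lp_norm p (analytic_poisson r f1) \<le> C * lp_norm p f \<and> (AE t in circle_measure. rep f1 t = complex_of_real (max 0 (Re (rep f t))))"
      "f2 \<in> Lp p \<and> lp_norm p (analytic_poisson r f2) \<le> C * lp_norm p f \<and> (AE t in circle_measure. rep f2 t = complex_of_real (max 0 (- Re (rep f t))))"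
      "f3 \<in> Lp p \<and> lp_norm p (analytic_poisson r f3) \<le> C * lp_norm p f \<and> (AE t in circle_measure. rep f3 t = complex_of_real (max 0 (Im (rep f t))))"
      "f4 \<in> Lp p \<and> lp_norm p (analytic_poisson r f4) \<le> C * lp_norm p f \<and> (AE t in circle_measure. rep f4 t = complex_of_real (max 0 (- Im (rep f t))))"
      unfolding f1_def f2_def f3_def f4_def
      by (intro bounds; simp add: abs_Re_le_cmod abs_Im_le_cmod)+
    have L1: "f1 \<in> Lp 1" "f2 \<in> Lp 1" "f3 \<in> Lp 1" "f4 \<in> Lp 1" using b Lp_subset_L1(1) [OF p1] by blast+
    have dec: "f = f1 + cscale (-1) f2 + (cscale \<i> f3 + cscale (-\<i>) f4)"
    proof -
      have "AE t in circle_measure. rep f1 t = complex_of_real (max 0 (Re (rep f t))) \<and> rep f2 t = complex_of_real (max 0 (- Re (rep f t)))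
        \<and> rep f3 t = complex_of_real (max 0 (Im (rep f t))) \<and> rep f4 t = complex_of_real (max 0 (- Im (rep f t)))"
        using b by auto
      then show ?thesis
        unfolding circle_fun_eq_iff
        using rep_add [of "f1 + cscale (-1) f2" "cscale \<i> f3 + cscale (-\<i>) f4"] rep_add [of f1 "cscale (-1) f2"]
          rep_add [of "cscale \<i> f3" "cscale (-\<i>) f4"] rep_cscale [of "-1" f2] rep_cscale [of \<i> f3] rep_cscale [of "-\<i>" f4]
        by eventually_elim (simp add: complex_eq_iff max_def)
    qed
    have "analytic_poisson r f = analytic_poisson r f1 + cscale (-1) (analytic_poisson r f2) + (cscale \<i> (analytic_poisson r f3) + cscale (-\<i>) (analytic_poisson r f4))"
      using L1 r by (subst dec) (simp only: analytic_poisson_add analytic_poisson_cscale Lp_add Lp_cscale order_refl)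
    also have "lp_norm p \<dots> \<le> (lp_norm p (analytic_poisson r f1) + lp_norm p (cscale (-1) (analytic_poisson r f2))) + (lp_norm p (cscale \<i> (analytic_poisson r f3)) + lp_norm p (cscale (-\<i>) (analytic_poisson r f4)))"
      using L1 r p1 by (intro order_trans [OF lp_norm_triangle] add_mono order_refl lp_norm_triangle Lp_add Lp_cscale analytic_poisson_Lp) auto
    also have "\<dots> \<le> 4 * C * lp_norm p f" unfolding lp_norm_cscale [OF p1] using b by simp
    finally show ?thesis .
  qed
  with C(1) show ?thesis by (intro exI [of _ "4 * C"]) auto
qed

text \<open>Tested on the extremal function conj(x) |x|^(p-2), which has modulus |x|^(p-1) and is
  bounded together with x. Hence bounded test functions suffice, and these have means for all
  exponents.\<close>

lemma converse_Holder:
  assumes p: "1 < p" "1 / p + 1 / q = 1" and x: "x \<in> Linf" and C: "0 \<le> C"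
    and le: "\<And>y. y \<in> Linf \<Longrightarrow> norm (fcoeff (x * y) 0) \<le> C * lp_norm q y"
  shows "lp_norm p x \<le> C"
proof -
  have q: "1 < q" "(p - 1) * q = p" "1 / q = 1 - 1 / p"
  proof -
    show "1 < q" by (rule conjugate_exponent(1) [OF p])
    then show "(p - 1) * q = p" "1 / q = 1 - 1 / p" using p by (simp_all add: field_simps)
  qed
  define y where "y = cls (\<lambda>t. cnj (rep x t) * of_real (norm (rep x t) powr (p - 2)))"
  have rep_y: "AE t in circle_measure. rep y t = cnj (rep x t) * of_real (norm (rep x t) powr (p - 2))"
    unfolding y_def by (rule rep_cls) measurable
  have norm_y: "AE t in circle_measure. norm (rep y t) = norm (rep x t) powr (p - 1)"
    using rep_y
  proof eventually_elim
    case (elim t)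
    show ?case
      by (cases "rep x t = 0") (use powr_mult_base [of "norm (rep x t)" "p - 2"] in \<open>auto simp: elim norm_mult\<close>)
  qed
  obtain D where D: "0 < D" "AE t in circle_measure. norm (rep x t) \<le> D" using x by (rule LinfE)
  have y: "y \<in> Linf"
  proof (rule LinfI)
    show "AE t in circle_measure. norm (rep y t) \<le> D powr (p - 1)"
      using norm_y D(2) by eventually_elim (use p in \<open>simp add: powr_mono2\<close>)
  qed
  have "fcoeff (x * y) 0 = (\<integral>t. complex_of_real (norm (rep x t) powr p) \<partial>circle_measure)"
    unfolding fcoeff_eq
  proof (intro integral_cong_AE)
    show "AE t in circle_measure. rep (x * y) t * t powi - 0 = complex_of_real (norm (rep x t) powr p)"
      using rep_mult [of x y] rep_y
    proof eventually_elim
      case (elim t)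
      have "rep (x * y) t = of_real ((norm (rep x t))\<^sup>2 * norm (rep x t) powr (p - 2))"
        unfolding elim by (simp only: mult.assoc [symmetric] of_real_mult complex_norm_square)
      also have "(norm (rep x t))\<^sup>2 * norm (rep x t) powr (p - 2) = norm (rep x t) powr p"
        by (cases "rep x t = 0") (auto simp flip: powr_numeral powr_add)
      finally show ?case by simp
    qed
  qed measurable
  then have eq: "fcoeff (x * y) 0 = of_real (lp_integral p x)" by (simp add: lp_integral_def)
  have "lp_integral q y = lp_integral p x"
    unfolding lp_integral_def
    by (intro integral_cong_AE) (use norm_y q in \<open>auto elim!: eventually_mono simp: powr_powr\<close>)
  then have "lp_integral p x \<le> C * lp_integral p x powr (1 - 1 / p)"
    using le [OF y] q by (simp add: eq lp_norm_eq)
  show ?thesis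
  proof (cases "lp_integral p x = 0")
    case False
    then have pos: "0 < lp_integral p x" by (simp add: less_le)
    have "lp_integral p x = lp_integral p x powr (1 / p) * lp_integral p x powr (1 - 1 / p)"
      using pos by (simp flip: powr_add)
    with \<open>lp_integral p x \<le> C * lp_integral p x powr (1 - 1 / p)\<close> have "lp_integral p x powr (1 / p) * lp_integral p x powr (1 - 1 / p) \<le> C * lp_integral p x powr (1 - 1 / p)"
      by simp
    then show ?thesis using pos by (simp add: lp_norm_eq)
  qed (use C in \<open>simp add: lp_norm_eq\<close>)
qed

text \<open>Both sides are the sum of f_n r^n y_(-n): up to reflection, forming the mean is its own
  transpose. This moves the estimate for exponents at most 2 to their conjugates.\<close>

lemma analytic_poisson_duality:
  assumes f: "f \<in> Lp 1" and y: "y \<in> Linf" and r: "0 \<le> r" "r < 1"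
  shows "fcoeff (analytic_poisson r f * y) 0 = fcoeff (f * tilde (analytic_poisson r (tilde y))) 0"
proof -
  have y1: "y \<in> Lp 1" "tilde y \<in> Lp 1" using y Linf_subset_Lp Linf_tilde zero_less_one by blast+
  have "fcoeff (f * tilde (analytic_poisson r (tilde y))) 0 = fcoeff (tilde (analytic_poisson r (tilde y) * tilde f)) 0"
    by (simp add: tilde_mult mult.commute)
  also have "\<dots> = fcoeff (analytic_poisson r (tilde y) * tilde f) 0" by (simp add: fcoeff_tilde)
  also have "\<dots> = (\<Sum>n. fcoeff (tilde y) (int n) * of_real r ^ n * fcoeff (tilde f) (0 - int n))"
    unfolding analytic_poisson_def by (rule fcoeff_power_sum_mult [OF analytic_poisson_summable [OF y1(2) r] Lp_tilde [OF f]])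
  also have "\<dots> = (\<Sum>n. fcoeff f (int n) * of_real r ^ n * fcoeff y (0 - int n))"
    by (simp add: fcoeff_tilde ac_simps)
  also have "\<dots> = fcoeff (analytic_poisson r f * y) 0"
    unfolding analytic_poisson_def by (rule fcoeff_power_sum_mult [OF analytic_poisson_summable [OF f r] y1(1), symmetric])
  finally show ?thesis by simp
qed

lemma analytic_poisson_bound:
  assumes p: "1 < p"
  shows "\<exists>C\<ge>0. \<forall>f\<in>Lp p. \<forall>r. 0 \<le> r \<and> r < 1 \<longrightarrow> lp_norm p (analytic_poisson r f) \<le> C * lp_norm p f"
proof (cases "p \<le> 2")
  case True
  show ?thesis by (rule analytic_poisson_bound_le2 [OF p True])
next
  case False
  define q where "q = p / (p - 1)"
  have q: "1 < q" "q \<le> 2" "1 / p + 1 / q = 1" using False by (auto simp: q_def field_simps)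
  obtain C where C: "0 \<le> C" "\<forall>f\<in>Lp q. \<forall>r. 0 \<le> r \<and> r < 1 \<longrightarrow> lp_norm q (analytic_poisson r f) \<le> C * lp_norm q f"
    using analytic_poisson_bound_le2 [OF q(1,2)] by blast
  have "lp_norm p (analytic_poisson r f) \<le> C * lp_norm p f" if f: "f \<in> Lp p" and r: "0 \<le> r" "r < 1" for f r
  proof (rule converse_Holder [OF p q(3)])
    have f1: "f \<in> Lp 1" using Lp_subset_L1(1) [of p f] p f by simp
    show "analytic_poisson r f \<in> Linf" by (rule analytic_poisson_Linf [OF f1 r])
    show "0 \<le> C * lp_norm p f" using C by simp
    fix y assume y: "y \<in> Linf"
    have yq: "tilde y \<in> Lp q" "tilde y \<in> Lp 1" using y q Linf_tilde Linf_subset_Lp by auto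
    define v where "v = tilde (analytic_poisson r (tilde y))"
    have v: "v \<in> Lp q" using analytic_poisson_Lp [OF yq(2) r, of q] q by (simp add: v_def Lp_tilde)
    have "norm (fcoeff (analytic_poisson r f * y) 0) = norm (fcoeff (f * v) 0)"
      by (simp add: analytic_poisson_duality [OF f1 y r] v_def)
    also have "\<dots> \<le> lp_norm p f * lp_norm q v"
      using norm_fcoeff_le Holder [OF p q(3) f v] order_trans by blast
    also have "\<dots> \<le> lp_norm p f * (C * lp_norm q (tilde y))"
      using C(2) yq(1) r by (intro mult_left_mono) (auto simp: v_def lp_norm_tilde)
    finally show "norm (fcoeff (analytic_poisson r f * y) 0) \<le> C * lp_norm p f * lp_norm q y"
      by (simp add: lp_norm_tilde ac_simps)
  qed
  with C(1) show ?thesis by blast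
qed

section \<open>Hardy spaces and the Riesz projection\<close>

lemma hardy_Lp: "f \<in> hardy p \<Longrightarrow> f \<in> Lp p" and fcoeff_hardy: "f \<in> hardy p \<Longrightarrow> n < 0 \<Longrightarrow> fcoeff f n = 0"
  by (auto simp: hardy_def)

lemma hardyI: "f \<in> Lp p \<Longrightarrow> (\<And>n. n < 0 \<Longrightarrow> fcoeff f n = 0) \<Longrightarrow> f \<in> hardy p"
  by (auto simp: hardy_def)

lemma hardy_L1: "1 \<le> p \<Longrightarrow> f \<in> hardy p \<Longrightarrow> f \<in> Lp 1"
  using Lp_subset_L1(1) hardy_Lp by blast

lemma hardy_add: "1 \<le> p \<Longrightarrow> f \<in> hardy p \<Longrightarrow> g \<in> hardy p \<Longrightarrow> f + g \<in> hardy p"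
  using hardy_L1 [of p f] hardy_L1 [of p g] by (auto simp: hardy_def fcoeff_add Lp_add)

lemma hardy_cscale: "1 \<le> p \<Longrightarrow> f \<in> hardy p \<Longrightarrow> cscale z f \<in> hardy p"
  by (auto simp: hardy_def fcoeff_cscale Lp_cscale)

lemma hardy_0 [simp]: "0 \<in> hardy p"
  by (auto simp: hardy_def)

lemma subspace_hardy: "1 \<le> p \<Longrightarrow> circ.subspace (hardy p)"
  by (rule circ.subspaceI) (auto intro: hardy_add hardy_cscale)

lemma hardy_diff: "1 \<le> p \<Longrightarrow> f \<in> hardy p \<Longrightarrow> g \<in> hardy p \<Longrightarrow> f - g \<in> hardy p"
  by (rule circ.subspace_diff [OF subspace_hardy])

text \<open>An a priori bound for any analytic part, proved before one is known to exist. It is what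
  makes the analytic parts of approximating polynomials a Cauchy sequence.\<close>

lemma analytic_part_bound:
  assumes p: "1 < p"
  shows "\<exists>C\<ge>0. \<forall>f\<in>Lp p. \<forall>g\<in>hardy p. (\<forall>n\<ge>0. fcoeff g n = fcoeff f n) \<longrightarrow> lp_norm p g \<le> C * lp_norm p f"
proof -
  obtain C where C: "0 \<le> C" "\<forall>f\<in>Lp p. \<forall>r. 0 \<le> r \<and> r < 1 \<longrightarrow> lp_norm p (analytic_poisson r f) \<le> C * lp_norm p f"
    using analytic_poisson_bound [OF p] by blast
  have "lp_norm p g \<le> C * lp_norm p f" if f: "f \<in> Lp p" and g: "g \<in> hardy p" and eq: "\<And>n. 0 \<le> n \<Longrightarrow> fcoeff g n = fcoeff f n" for f g
  proof -
    have p1: "1 \<le> p" using p by simp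
    have gL: "g \<in> Lp p" using g by (rule hardy_Lp)
    have "analytic_poisson (radius k) f = poisson (radius k) g" for k
      using Lp_subset_L1(1) [OF p1] f gL fcoeff_hardy [OF g] eq radius by (intro analytic_poisson_eq_poisson) auto
    then have le: "lp_norm p (poisson (radius k) g) \<le> C * lp_norm p f" for k
      using C(2) f radius(1,2) [of k] by metis
    have "lp_norm p g \<le> C * lp_norm p f + lp_norm p (poisson (radius k) g - g)" for k
      using lp_norm_le_add_diff [OF p1 gL, of "poisson (radius k) g"] le [of k]
        lp_norm_minus_commute [OF p1, of g "poisson (radius k) g"] poisson_contraction(1) [OF p1 gL radius(1,2)]
      by simp
    moreover have "(\<lambda>k. C * lp_norm p f + lp_norm p (poisson (radius k) g - g)) \<longlonglongrightarrow> C * lp_norm p f + 0"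
      by (intro tendsto_intros poisson_tendsto p1 gL)
    ultimately show ?thesis by (intro LIMSEQ_le_const [where X = "\<lambda>k. C * lp_norm p f + lp_norm p (poisson (radius k) g - g)"]) auto
  qed
  with C(1) show ?thesis by blast
qed

lemma trig_analytic_part:
  assumes "u \<in> trig" "1 \<le> p"
  obtains v where "v \<in> hardy p" "v \<in> circ.span (tpow ` {0..})" "\<And>n. 0 \<le> n \<Longrightarrow> fcoeff v n = fcoeff u n"
proof -
  have "u \<in> Lp 1 \<and> (\<exists>v \<in> hardy p \<inter> circ.span (tpow ` {0..}). \<forall>n\<ge>0. fcoeff v n = fcoeff u n)" using assms(1)
  proof (induction rule: circ.span_induct_alt)
    case base
    show ?case by (intro conjI bexI [of _ 0]) (auto intro: circ.span_zero)
  next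
    case (step c x y)
    then obtain m v where x: "x = tpow m" and v: "v \<in> hardy p" "v \<in> circ.span (tpow ` {0..})" "\<And>n. 0 \<le> n \<Longrightarrow> fcoeff v n = fcoeff y n"
      by auto
    have y1: "y \<in> Lp 1" using step(2) by simp
    have "\<exists>v \<in> hardy p \<inter> circ.span (tpow ` {0..}). \<forall>n\<ge>0. fcoeff v n = fcoeff (cscale c x + y) n"
    proof (cases "0 \<le> m")
      case True
      then have tm: "cscale c (tpow m) \<in> circ.span (tpow ` {0..})"
        by (intro circ.span_scale circ.span_base) simp
      have tm': "cscale c (tpow m) \<in> hardy p"
        using assms(2) True by (auto simp: hardy_def fcoeff_cscale fcoeff_tpow Linf_subset_Lp intro!: Lp_cscale)
      show ?thesis
        using tm tm' v y1 hardy_L1 [OF assms(2)] assms(2)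
        by (intro bexI [of _ "cscale c (tpow m) + v"])
          (auto simp: x fcoeff_add hardy_add Linf_subset_Lp Lp_cscale intro: circ.span_add)
    next
      case False
      then show ?thesis
        using v y1 by (intro bexI [of _ v]) (auto simp: x fcoeff_add fcoeff_cscale fcoeff_tpow Linf_subset_Lp Lp_cscale)
    qed
    then show ?case using y1 by (simp add: x Lp_add Lp_cscale Linf_subset_Lp)
  qed
  with that show ?thesis by blast
qed

text \<open>The analytic part is the limit of the analytic parts of trigonometric polynomials that
  tend to f. The approximation stays in the statement: for f in H^p it yields density of
  polynomials.\<close>

lemma analytic_part_exists:
  assumes p: "1 < p" and f: "f \<in> Lp p"
  shows "\<exists>g\<in>hardy p. (\<forall>n\<ge>0. fcoeff g n = fcoeff f n) \<and>
    (\<forall>e>0. \<exists>v\<in>hardy p \<inter> circ.span (tpow ` {0..}). lp_norm p (g - v) < e)"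
proof -
  have p1: "1 \<le> p" using p by simp
  obtain C where C: "0 \<le> C" "\<forall>f\<in>Lp p. \<forall>g\<in>hardy p. (\<forall>n\<ge>0. fcoeff g n = fcoeff f n) \<longrightarrow> lp_norm p g \<le> C * lp_norm p f"
    using analytic_part_bound [OF p] by blast
  have "\<exists>u\<in>trig. lp_norm p (f - u) < inverse (real (Suc k))" for k
    using trig_dense [OF p1 f, of "inverse (real (Suc k))"] by auto
  then obtain u where u: "\<And>k. u k \<in> trig" "\<And>k. lp_norm p (f - u k) < inverse (real (Suc k))" by metis
  have uL: "u k \<in> Lp p" for k using u(1) trig_subset_Lp p by simp
  have "\<exists>v. v \<in> hardy p \<and> v \<in> circ.span (tpow ` {0..}) \<and> (\<forall>n\<ge>0. fcoeff v n = fcoeff (u k) n)" for k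
    by (rule trig_analytic_part [OF u(1) [of k] p1]) blast
  then obtain v where v: "\<And>k. v k \<in> hardy p" "\<And>k. v k \<in> circ.span (tpow ` {0..})" "\<And>k n. 0 \<le> n \<Longrightarrow> fcoeff (v k) n = fcoeff (u k) n" by metis
  have vL: "v k \<in> Lp p" for k using v(1) by (rule hardy_Lp)
  have L1: "u k \<in> Lp 1" "v k \<in> Lp 1" "f \<in> Lp 1" for k using Lp_subset_L1(1) [OF p1] uL vL f by blast+
  have u_lim: "(\<lambda>k. lp_norm p (u k - f)) \<longlonglongrightarrow> 0"
  proof (rule tendsto_sandwich [OF _ _ tendsto_const LIMSEQ_inverse_real_of_nat])
    have "lp_norm p (u k - f) \<le> inverse (real (Suc k))" for k
      using u(2) [of k] lp_norm_minus_commute [OF p1, of f "u k"] by linarith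
    then show "\<forall>\<^sub>F k in sequentially. lp_norm p (u k - f) \<le> inverse (real (Suc k))" by simp
  qed simp
  have diff_le: "lp_norm p (v m - v n) \<le> C * (lp_norm p (u m - f) + lp_norm p (u n - f))" for m n
  proof -
    have "lp_norm p (v m - v n) \<le> C * lp_norm p (u m - u n)"
      using L1 v by (intro C(2) [rule_format] Lp_diff p1 uL hardy_diff) (auto simp: fcoeff_diff)
    also have "\<dots> \<le> C * (lp_norm p (u m - f) + lp_norm p (f - u n))"
      by (intro mult_left_mono lp_norm_diff_triangle p1 uL f C(1))
    finally show ?thesis using lp_norm_minus_commute [OF p1, of f "u n"] by simp
  qed
  obtain g where g: "g \<in> Lp p" "(\<lambda>k. lp_norm p (v k - g)) \<longlonglongrightarrow> 0"
  proof (rule Lp_complete [of p v, OF p1 vL])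
    fix e :: real assume e: "0 < e"
    then have "0 < e / (C + 1) / 2" using C(1) by simp
    from LIMSEQ_D [OF u_lim this] obtain N where N: "\<And>n. n \<ge> N \<Longrightarrow> lp_norm p (u n - f) < e / (C + 1) / 2" by auto
    have "lp_norm p (v m - v n) < e" if "m \<ge> N" "n \<ge> N" for m n
    proof -
      have "lp_norm p (v m - v n) \<le> C * (lp_norm p (u m - f) + lp_norm p (u n - f))" by (rule diff_le)
      also have "\<dots> \<le> C * (e / (C + 1) / 2 + e / (C + 1) / 2)"
        using N [OF that(1)] N [OF that(2)] C(1) by (intro mult_left_mono) auto
      also have "\<dots> = e * (C / (C + 1))" by (simp only: field_sum_of_halves) simp
      also have "\<dots> < e * 1" using e C(1) by (intro mult_strict_left_mono) auto
      finally show ?thesis by simp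
    qed
    then show "\<exists>N. \<forall>m\<ge>N. \<forall>n\<ge>N. lp_norm p (v m - v n) < e" by blast
  qed
  have lim: "(\<lambda>k. fcoeff (v k) n) \<longlonglongrightarrow> fcoeff g n" "(\<lambda>k. fcoeff (u k) n) \<longlonglongrightarrow> fcoeff f n" for n
    using fcoeff_tendsto [OF p1 vL g] fcoeff_tendsto [OF p1 uL f u_lim] by auto
  show ?thesis
  proof (rule bexI [of _ g], intro conjI allI impI)
    show "g \<in> hardy p"
    proof (rule hardyI [OF g(1)])
      fix n :: int assume "n < 0"
      then show "fcoeff g n = 0" using LIMSEQ_unique [OF lim(1) [of n], of 0] by (simp add: fcoeff_hardy [OF v(1)])
    qed
    show "fcoeff g n = fcoeff f n" if "0 \<le> n" for n
      using LIMSEQ_unique [OF lim(1) [of n]] lim(2) [of n] by (simp add: v(3) [OF that])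
    fix e :: real assume "0 < e"
    from LIMSEQ_D [OF g(2) this] obtain k where "lp_norm p (v k - g) < e" by auto
    then show "\<exists>v\<in>hardy p \<inter> circ.span (tpow ` {0..}). lp_norm p (g - v) < e"
      using v lp_norm_minus_commute [OF p1, of g] by auto
  qed
qed

text \<open>The projection is computed by exhibiting an H^1 function with the correct coefficients.
  Nothing is asked of f itself, which is convenient for products.\<close>

lemma riesz_P_eqI:
  assumes "g \<in> hardy 1" "\<And>n. 0 \<le> n \<Longrightarrow> fcoeff g n = fcoeff f n"
  shows "riesz_P f = g"
  unfolding riesz_P_def
proof (rule the_equality)
  fix h assume h: "h \<in> hardy 1 \<and> (\<forall>n\<ge>0. fcoeff h n = fcoeff f n)"
  show "h = g"
  proof (rule fcoeff_eqI)
    fix n show "fcoeff h n = fcoeff g n"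
      using h assms by (cases "0 \<le> n") (auto simp: fcoeff_hardy)
  qed (use h assms hardy_Lp in auto)
qed (use assms in auto)

lemma hardy_subset_hardy_1: "1 \<le> p \<Longrightarrow> f \<in> hardy p \<Longrightarrow> f \<in> hardy 1"
  using hardy_L1 by (auto simp: hardy_def)

theorem riesz_P:
  assumes p: "1 < p" and f: "f \<in> Lp p"
  shows riesz_P_hardy: "riesz_P f \<in> hardy p"
    and fcoeff_riesz_P: "fcoeff (riesz_P f) n = (if 0 \<le> n then fcoeff f n else 0)"
proof -
  obtain g where g: "g \<in> hardy p" "\<And>n. 0 \<le> n \<Longrightarrow> fcoeff g n = fcoeff f n"
    using analytic_part_exists [OF p f] by blast
  have "riesz_P f = g"
    using hardy_subset_hardy_1 [of p] g p by (intro riesz_P_eqI) auto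
  with g show "riesz_P f \<in> hardy p" "fcoeff (riesz_P f) n = (if 0 \<le> n then fcoeff f n else 0)"
    by (auto simp: fcoeff_hardy)
qed

theorem riesz_P_bound:
  assumes p: "1 < p"
  shows "\<exists>C\<ge>0. \<forall>f\<in>Lp p. lp_norm p (riesz_P f) \<le> C * lp_norm p f"
proof -
  obtain C where C: "0 \<le> C" "\<forall>f\<in>Lp p. \<forall>g\<in>hardy p. (\<forall>n\<ge>0. fcoeff g n = fcoeff f n) \<longrightarrow> lp_norm p g \<le> C * lp_norm p f"
    using analytic_part_bound [OF p] by blast
  have "lp_norm p (riesz_P f) \<le> C * lp_norm p f" if f: "f \<in> Lp p" for f
    using C(2) f riesz_P_hardy [OF p f] fcoeff_riesz_P [OF p f] by simp
  with C(1) show ?thesis by blast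
qed

lemma hardy_poly_dense:
  assumes p: "1 < p" and f: "f \<in> hardy p" and e: "0 < e"
  obtains v where "v \<in> hardy p" "v \<in> circ.span (tpow ` {0..})" "lp_norm p (f - v) < e"
proof -
  obtain g where g: "g \<in> hardy p" "\<forall>n\<ge>0. fcoeff g n = fcoeff f n"
    "\<forall>e>0. \<exists>v\<in>hardy p \<inter> circ.span (tpow ` {0..}). lp_norm p (g - v) < e"
    using analytic_part_exists [OF p hardy_Lp [OF f]] by blast
  have "g = f"
  proof (rule fcoeff_eqI)
    show "g \<in> Lp 1" "f \<in> Lp 1" using hardy_L1 [of p] p f g by auto
    show "fcoeff g n = fcoeff f n" for n using f g by (cases "0 \<le> n") (auto simp: fcoeff_hardy)
  qed
  with g(3) e that show ?thesis by blast
qed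

section \<open>Toeplitz operators and their index\<close>

lemma fcoeff_mult_tpow: "fcoeff (f * tpow k) n = fcoeff f (n - k)"
  using fcoeff_tpow_mult [of k f n] by (simp add: mult.commute)

lemma toeplitz_hardy: "1 < p \<Longrightarrow> a \<in> Linf \<Longrightarrow> f \<in> hardy p \<Longrightarrow> toeplitz a f \<in> hardy p"
  by (simp add: toeplitz_def riesz_P_hardy Lp_Linf_mult hardy_Lp)

lemma fcoeff_toeplitz:
  "1 < p \<Longrightarrow> a \<in> Linf \<Longrightarrow> f \<in> hardy p \<Longrightarrow> fcoeff (toeplitz a f) n = (if 0 \<le> n then fcoeff (a * f) n else 0)"
  by (simp add: toeplitz_def fcoeff_riesz_P Lp_Linf_mult hardy_Lp)

lemma hardy_eqI:
  assumes "1 \<le> p" "f \<in> hardy p" "g \<in> hardy p" "\<And>n. 0 \<le> n \<Longrightarrow> fcoeff f n = fcoeff g n"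
  shows "f = g"
proof (rule fcoeff_eqI)
  show "fcoeff f n = fcoeff g n" for n using assms by (cases "0 \<le> n") (auto simp: fcoeff_hardy)
qed (use assms hardy_L1 in auto)

lemma toeplitz_eqI:
  assumes "1 \<le> p" "g \<in> hardy p" "\<And>n. 0 \<le> n \<Longrightarrow> fcoeff g n = fcoeff (a * f) n"
  shows "toeplitz a f = g"
  unfolding toeplitz_def by (rule riesz_P_eqI [OF hardy_subset_hardy_1 [OF assms(1,2)] assms(3)])

lemma toeplitz_add:
  assumes "1 < p" "a \<in> Linf" "f \<in> hardy p" "g \<in> hardy p"
  shows "toeplitz a (f + g) = toeplitz a f + toeplitz a g"
proof (rule toeplitz_eqI [of p])
  have af: "a * f \<in> Lp 1" "a * g \<in> Lp 1"
    using hardy_L1 [of p f] hardy_L1 [of p g] assms by (simp_all add: Lp_Linf_mult)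
  have T: "toeplitz a f \<in> hardy p" "toeplitz a g \<in> hardy p" using assms by (auto intro: toeplitz_hardy)
  then show "toeplitz a f + toeplitz a g \<in> hardy p" using assms by (intro hardy_add) auto
  fix n :: int assume "0 \<le> n"
  then show "fcoeff (toeplitz a f + toeplitz a g) n = fcoeff (a * (f + g)) n"
    using T af assms hardy_L1 [of p] by (simp add: fcoeff_add fcoeff_toeplitz [of p] distrib_left)
qed (use assms in simp)

lemma toeplitz_cscale:
  assumes "1 < p" "a \<in> Linf" "f \<in> hardy p"
  shows "toeplitz a (cscale z f) = cscale z (toeplitz a f)"
  by (rule toeplitz_eqI [of p])
    (use assms in \<open>auto simp: fcoeff_cscale fcoeff_toeplitz [of p] cscale_mult_right intro!: hardy_cscale toeplitz_hardy\<close>)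

lemma toeplitz_diff:
  assumes "1 < p" "a \<in> Linf" "f \<in> hardy p" "g \<in> hardy p"
  shows "toeplitz a (f - g) = toeplitz a f - toeplitz a g"
  using toeplitz_add [OF assms(1,2) hardy_diff [OF _ assms(3,4)] assms(4)] assms(1) by (simp add: algebra_simps)

lemma toeplitz_0 [simp]: "toeplitz a 0 = 0"
  by (rule toeplitz_eqI [of 1]) auto

lemma subspace_toeplitz_image:
  assumes "1 < p" "a \<in> Linf"
  shows "circ.subspace (toeplitz a ` hardy p)"
proof (rule circ.subspaceI)
  show "0 \<in> toeplitz a ` hardy p" by (rule image_eqI [of _ _ 0]) simp_all
  show "x + y \<in> toeplitz a ` hardy p" if "x \<in> toeplitz a ` hardy p" "y \<in> toeplitz a ` hardy p" for x y
    using that toeplitz_add [OF assms, symmetric] hardy_add [of p] assms by force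
  show "cscale c x \<in> toeplitz a ` hardy p" if "x \<in> toeplitz a ` hardy p" for c x
    using that toeplitz_cscale [OF assms, symmetric] hardy_cscale [of p] assms by force
qed

lemma toeplitz_bound:
  assumes p: "1 < p" and a: "a \<in> Linf"
  shows "\<exists>C\<ge>0. \<forall>f\<in>hardy p. lp_norm p (toeplitz a f) \<le> C * lp_norm p f"
proof -
  obtain C where C: "0 \<le> C" "\<forall>f\<in>Lp p. lp_norm p (riesz_P f) \<le> C * lp_norm p f"
    using riesz_P_bound [OF p] by blast
  have p1: "1 \<le> p" using p by simp
  obtain D where D: "0 < D" "\<And>f. f \<in> Lp p \<Longrightarrow> a * f \<in> Lp p" "\<And>f. f \<in> Lp p \<Longrightarrow> lp_norm p (a * f) \<le> D * lp_norm p f"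
    by (rule Linf_mult_bound [OF p1 a]) blast
  have "lp_norm p (toeplitz a f) \<le> (C * D) * lp_norm p f" if f: "f \<in> hardy p" for f
  proof -
    have "lp_norm p (toeplitz a f) \<le> C * lp_norm p (a * f)"
      using C(2) D(2) hardy_Lp [OF f] by (simp add: toeplitz_def)
    also have "\<dots> \<le> C * (D * lp_norm p f)" using C(1) D(3) hardy_Lp [OF f] by (intro mult_left_mono) auto
    finally show ?thesis by (simp add: mult.assoc)
  qed
  then show ?thesis using C(1) D(1) by (intro exI [of _ "C * D"]) auto
qed

lemma hardy_tpow_mult:
  assumes "1 \<le> p" "f \<in> hardy p" "\<And>n. n < - k \<Longrightarrow> fcoeff f n = 0"
  shows "tpow k * f \<in> hardy p"
  using assms by (intro hardyI) (auto simp: fcoeff_tpow_mult hardy_Lp Lp_Linf_mult)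

lemma toeplitz_tpow_nonneg:
  assumes "1 \<le> p" "f \<in> hardy p" "0 \<le> n"
  shows "toeplitz (tpow n) f = tpow n * f" "tpow n * f \<in> hardy p"
proof -
  show 1: "tpow n * f \<in> hardy p" using assms by (intro hardy_tpow_mult) (auto simp: fcoeff_hardy)
  show "toeplitz (tpow n) f = tpow n * f" by (rule toeplitz_eqI [OF assms(1) 1]) simp
qed

lemma tpow_hardy [simp]: "0 \<le> n \<Longrightarrow> 0 < p \<Longrightarrow> tpow n \<in> hardy p"
  by (auto simp: hardy_def fcoeff_tpow Linf_subset_Lp)

lemma one_hardy [simp]: "0 < p \<Longrightarrow> 1 \<in> hardy p"
  using tpow_hardy [of 0] by simp

lemma toeplitz_tpow_minus:
  assumes "1 < p" "a \<in> Linf" "f \<in> hardy p"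
  shows "toeplitz (tpow (- 1)) (toeplitz a f) = toeplitz (a * tpow (- 1)) f"
proof (rule toeplitz_eqI [of p, symmetric])
  show "toeplitz (tpow (- 1)) (toeplitz a f) \<in> hardy p"
    using assms by (intro toeplitz_hardy) auto
  have "toeplitz a f \<in> hardy p" using assms by (rule toeplitz_hardy)
  then show "fcoeff (toeplitz (tpow (- 1)) (toeplitz a f)) n = fcoeff (a * tpow (- 1) * f) n" if "0 \<le> n" for n
    using assms that fcoeff_tpow_mult [of "- 1" "a * f" n]
    by (simp add: fcoeff_toeplitz [of p] fcoeff_tpow_mult mult.assoc mult.left_commute [of a])
qed (use assms in simp)

lemma hardy_split:
  assumes "1 \<le> p" "x \<in> hardy p"
  obtains y where "y \<in> hardy p" "x = tpow 1 * y + cscale (fcoeff x 0) 1"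
proof -
  define y where "y = tpow (- 1) * (x - cscale (fcoeff x 0) 1)"
  have x': "x - cscale (fcoeff x 0) 1 \<in> hardy p" using assms by (intro hardy_diff hardy_cscale) auto
  have "fcoeff (x - cscale (fcoeff x 0) 1) 0 = 0"
    using hardy_L1 [OF assms] by (simp add: fcoeff_diff Lp_cscale Linf_subset_Lp fcoeff_cscale fcoeff_one)
  then have "fcoeff (x - cscale (fcoeff x 0) 1) n = 0" if "n < 1" for n
    using fcoeff_hardy [OF x', of n] that by (cases "n = 0") auto
  then have "y \<in> hardy p" unfolding y_def using assms x' by (intro hardy_tpow_mult) auto
  moreover have "x = tpow 1 * y + cscale (fcoeff x 0) 1" by (simp add: y_def tpow_mult_tpow_left)
  ultimately show ?thesis by (rule that)
qed

text \<open>N + 1 vectors in a quotient spanned by N = \<open>card B\<close> elements are dependent.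
  Coinciding components \<open>y\<close> are treated apart, since linear dependence is a property of
  the set of values and not of the family.\<close>

lemma finite_codim_combination:
  assumes B: "spans_modulo V W B" and W: "circ.subspace W" and x: "\<And>i::nat. x i \<in> V"
  obtains N c where "\<exists>i\<le>N. c i \<noteq> 0" "(\<Sum>i\<le>N. cscale (c i) (x i)) \<in> W"
proof -
  have fin: "finite B" and V: "V \<subseteq> circ.span (W \<union> B)" using B by (auto simp: spans_modulo_def)
  have "\<exists>w y. w \<in> W \<and> y \<in> circ.span B \<and> x i = w + y" for i
  proof -
    have "x i \<in> circ.span (W \<union> B)" using V x by blast
    then show ?thesis unfolding circ.span_Un circ.span_eq_iff [THEN iffD2, OF W] by blast
  qed
  then obtain w y where wy: "\<And>i. w i \<in> W" "\<And>i. y i \<in> circ.span B" "\<And>i. x i = w i + y i" by metis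
  define N where "N = card B"
  show ?thesis
  proof (cases "inj_on y {..N}")
    case False
    then obtain i j where ij: "i \<le> N" "j \<le> N" "i \<noteq> j" "y i = y j" by (auto simp: inj_on_def)
    define c :: "nat \<Rightarrow> complex" where "c k = (if k = i then 1 else 0) - (if k = j then 1 else 0)" for k
    have "(\<Sum>k\<le>N. cscale (c k) (x k)) = x i - x j"
      using ij unfolding c_def by (simp add: circ.scale_left_diff_distrib sum_subtractf if_distrib [of "\<lambda>z. cscale z _"] cong: if_cong)
    also have "\<dots> = w i - w j" using ij by (simp add: wy(3))
    also have "\<dots> \<in> W" using wy(1) W by (intro circ.subspace_diff)
    finally show ?thesis using ij by (intro that [of N c]) (auto simp: c_def)
  next
    case True
    have "circ.dependent (y ` {..N})"
    proof (rule ccontr)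
      assume "circ.independent (y ` {..N})"
      then have "card (y ` {..N}) \<le> card B"
        using circ.independent_span_bound [OF fin] wy(2) by blast
      then show False using True by (simp add: card_image N_def)
    qed
    then obtain u where u: "\<exists>v\<in>y ` {..N}. u v \<noteq> 0" "(\<Sum>v\<in>y ` {..N}. cscale (u v) v) = 0"
      by (auto simp: circ.dependent_finite)
    have "(\<Sum>i\<le>N. cscale (u (y i)) (y i)) = 0"
      using u(2) sum.reindex [OF True, of "\<lambda>v. cscale (u v) v"] by simp
    then have "(\<Sum>i\<le>N. cscale (u (y i)) (x i)) = (\<Sum>i\<le>N. cscale (u (y i)) (w i))"
      by (simp add: wy(3) circ.scale_right_distrib sum.distrib)
    also have "\<dots> \<in> W" by (intro circ.subspace_sum circ.subspace_scale W wy(1))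
    finally show ?thesis using u(1) by (intro that [of N "\<lambda>i. u (y i)"]) auto
  qed
qed

text \<open>The backward shift lowers the degree by one and keeps the leading coefficient. Induction
  gives all lower monomials, and subtracting them isolates the top one.\<close>

lemma shift_invariant_tpow:
  fixes p :: real and a :: "nat \<Rightarrow> complex"
  assumes p: "1 < p" and R: "circ.subspace R" and shift: "\<And>y. y \<in> R \<Longrightarrow> toeplitz (tpow (- 1)) y \<in> R"
    and a: "a d \<noteq> 0" "(\<Sum>i\<le>d. cscale (a i) (tpow (int i))) \<in> R" and k: "k \<le> d"
  shows "tpow (int k) \<in> R"
  using a k
proof (induction d arbitrary: a k)
  case 0
  then have "cscale (1 / a 0) (cscale (a 0) 1) \<in> R" using R circ.subspace_scale by fastforce
  then show ?case using 0 by simp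
next
  case (Suc d)
  have poly: "(\<Sum>i\<le>m. cscale (b i) (tpow (int i))) \<in> hardy p" for m and b :: "nat \<Rightarrow> complex"
    using p by (intro circ.subspace_sum [OF subspace_hardy] hardy_cscale) auto
  have fc: "fcoeff (\<Sum>i\<le>m. cscale (b i) (tpow (int i))) n = (\<Sum>i\<le>m. if int i = n then b i else 0)" for m n and b :: "nat \<Rightarrow> complex"
  proof (induction m)
    case (Suc m)
    then show ?case
      using poly [of b m] p hardy_L1 [of p] by (simp add: fcoeff_add Lp_cscale Linf_subset_Lp fcoeff_cscale fcoeff_tpow)
  qed (simp add: fcoeff_cscale fcoeff_one)
  have "toeplitz (tpow (- 1)) (\<Sum>i\<le>Suc d. cscale (a i) (tpow (int i))) = (\<Sum>i\<le>d. cscale (a (Suc i)) (tpow (int i)))"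
  proof (rule toeplitz_eqI [of p])
    show "fcoeff (\<Sum>i\<le>d. cscale (a (Suc i)) (tpow (int i))) n = fcoeff (tpow (- 1) * (\<Sum>i\<le>Suc d. cscale (a i) (tpow (int i)))) n" if "0 \<le> n" for n
    proof -
      have "fcoeff (tpow (- 1) * (\<Sum>i\<le>Suc d. cscale (a i) (tpow (int i)))) n = (\<Sum>i\<le>Suc d. if int i = n + 1 then a i else 0)"
        by (simp only: fcoeff_tpow_mult fc) simp
      also have "\<dots> = (\<Sum>i\<le>d. if int i = n then a (Suc i) else 0)"
        using that by (subst sum.atMost_Suc_shift) (auto intro!: sum.cong)
      finally show ?thesis by (simp only: fc)
    qed
  qed (use p poly in auto)
  then have "(\<Sum>i\<le>d. cscale (a (Suc i)) (tpow (int i))) \<in> R" using shift [OF Suc.prems(2)] by simp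
  then have IH: "tpow (int k) \<in> R" if "k \<le> d" for k using Suc.IH [of "\<lambda>i. a (Suc i)"] Suc.prems(1) that by blast
  show ?case
  proof (cases "k \<le> d")
    case False
    then have k: "k = Suc d" using Suc.prems by simp
    have "(\<Sum>i\<le>d. cscale (a i) (tpow (int i))) \<in> R"
      using IH R by (intro circ.subspace_sum circ.subspace_scale) auto
    from circ.subspace_diff [OF R Suc.prems(2) this] have "cscale (a (Suc d)) (tpow (int (Suc d))) \<in> R" by simp
    then have "cscale (1 / a (Suc d)) (cscale (a (Suc d)) (tpow (int (Suc d)))) \<in> R" by (rule circ.subspace_scale [OF R])
    then show ?thesis using Suc.prems(1) by (simp add: k)
  qed (use IH in simp)
qed

text \<open>Coburn's lemma without duality: a nontrivial kernel makes the range invariant under the backward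
  shift, and a closed shift-invariant subspace of finite codimension is everything.\<close>

lemma coburn:
  assumes p: "1 < p" and g: "g \<in> Linf" and closed: "lp_closed_in p (hardy p) (toeplitz g ` hardy p)"
    and B: "spans_modulo (hardy p) (toeplitz g ` hardy p) B"
    and f0: "f0 \<in> hardy p" "toeplitz g f0 = 0" "f0 \<noteq> 0"
  shows "toeplitz g ` hardy p = hardy p"
proof -
  have p1: "1 \<le> p" using p by simp
  let ?R = "toeplitz g ` hardy p"
  have sub: "circ.subspace ?R" using subspace_toeplitz_image [OF p g] .
  have "\<exists>m::nat. fcoeff f0 (int m) \<noteq> 0"
  proof (rule ccontr)
    assume "\<nexists>m::nat. fcoeff f0 (int m) \<noteq> 0"
    then have "fcoeff f0 n = fcoeff 0 n" if "0 \<le> n" for n using that zero_le_imp_eq_int by auto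
    then have "f0 = 0" using hardy_eqI [OF p1 f0(1) hardy_0] by blast
    with f0(3) show False by contradiction
  qed
  then obtain m :: nat where m: "fcoeff f0 (int m) \<noteq> 0" "\<And>k. k < m \<Longrightarrow> fcoeff f0 (int k) = 0"
    using exists_least_iff [of "\<lambda>m::nat. fcoeff f0 (int m) \<noteq> 0"] by blast
  have low: "fcoeff f0 n = 0" if "n < int m" for n
  proof (cases "0 \<le> n")
    case True
    then show ?thesis using m(2) [of "nat n"] that by simp
  qed (use fcoeff_hardy [OF f0(1)] in simp)
  \<comment> \<open>The zero of order m at the origin is divided out and the value at 0 normalised.
    The result stays in the kernel, because the coefficients of g f are those of g f0 from index m
    on.\<close>
  define f where "f = cscale (1 / fcoeff f0 (int m)) (tpow (- int m) * f0)"
  have f: "f \<in> hardy p" unfolding f_def using p1 f0(1) low by (intro hardy_cscale hardy_tpow_mult) auto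
  have f_0: "fcoeff f 0 = 1" using m(1) by (simp add: f_def fcoeff_cscale fcoeff_tpow_mult)
  have ker: "toeplitz g f = 0"
  proof (rule toeplitz_eqI [OF p1 hardy_0])
    fix n :: int assume n: "0 \<le> n"
    have "g * f = cscale (1 / fcoeff f0 (int m)) (tpow (- int m) * (g * f0))"
      by (simp add: f_def cscale_def ac_simps)
    then have "fcoeff (g * f) n = 1 / fcoeff f0 (int m) * fcoeff (toeplitz g f0) (n + int m)"
      using n f0(1) p g by (simp add: fcoeff_cscale fcoeff_tpow_mult fcoeff_toeplitz [of p])
    then show "fcoeff 0 n = fcoeff (g * f) n" by (simp add: f0(2))
  qed
  have shift: "toeplitz (tpow (- 1)) y \<in> ?R" if y: "y \<in> ?R" for y
  proof -
    obtain x where x: "x \<in> hardy p" "y = toeplitz g x" using y by blast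
    \<comment> \<open>Subtracting a multiple of the kernel element removes the constant term of x
      without changing its image; then the backward shift of the image is the image of the backward
      shift.\<close>
    define x' where "x' = x - cscale (fcoeff x 0) f"
    have x': "x' \<in> hardy p" unfolding x'_def using p1 x f by (intro hardy_diff hardy_cscale)
    have "fcoeff x' 0 = 0"
      using hardy_L1 [OF p1 x(1)] hardy_L1 [OF p1 f] by (simp add: x'_def fcoeff_diff fcoeff_cscale f_0 Lp_cscale)
    then have "fcoeff x' n = 0" if "n < 1" for n
      using fcoeff_hardy [OF x', of n] that by (cases "n = 0") auto
    then have x'': "tpow (- 1) * x' \<in> hardy p" using p1 x' by (intro hardy_tpow_mult) auto
    have "toeplitz g x' = y"
      unfolding x'_def using p g x f by (simp add: toeplitz_diff [of p] toeplitz_cscale [of p] hardy_cscale ker)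
    then have "toeplitz (tpow (- 1)) y = toeplitz (g * tpow (- 1)) x'"
      using toeplitz_tpow_minus [OF p g x'] by simp
    also have "\<dots> = toeplitz g (tpow (- 1) * x')" by (simp add: toeplitz_def mult.assoc)
    finally show ?thesis using x'' by blast
  qed
  \<comment> \<open>Finite codimension puts a nonzero combination of t^n, ..., t^(n+N) into the
    range. Its degree n + d is at least n, so backward shifts bring it down to t^n.\<close>
  have "tpow (int n) \<in> ?R" for n
  proof -
    obtain N c where Nc: "\<exists>i\<le>N. c i \<noteq> 0" "(\<Sum>i\<le>N. cscale (c i) (tpow (int (n + i)))) \<in> ?R"
    proof (rule finite_codim_combination [OF B sub, of "\<lambda>i. tpow (int (n + i))"])
      show "tpow (int (n + i)) \<in> hardy p" for i using p by simp
    qed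
    define d where "d = Max {i. i \<le> N \<and> c i \<noteq> 0}"
    have fin: "finite {i. i \<le> N \<and> c i \<noteq> 0}" by simp
    have d: "d \<le> N" "c d \<noteq> 0" using Max_in [OF fin] Nc(1) by (auto simp: d_def)
    have above: "c i = 0" if "i \<le> N" "d < i" for i
      using Max_ge [OF fin, of i] that unfolding d_def by (metis (mono_tags, lifting) mem_Collect_eq not_le)
    define a where "a j = (if n \<le> j then c (j - n) else 0)" for j
    have "(\<Sum>j\<le>n + d. cscale (a j) (tpow (int j))) = (\<Sum>j\<in>{n..n + d}. cscale (a j) (tpow (int j)))"
      by (rule sum.mono_neutral_right) (auto simp: a_def)
    also have "\<dots> = (\<Sum>i\<in>{..d}. cscale (c i) (tpow (int (n + i))))"
      by (rule sum.reindex_bij_witness [of _ "\<lambda>i. n + i" "\<lambda>j. j - n"]) (auto simp: a_def)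
    also have "\<dots> = (\<Sum>i\<le>N. cscale (c i) (tpow (int (n + i))))"
      using d(1) above by (intro sum.mono_neutral_left) (auto simp: not_le)
    finally have "(\<Sum>j\<le>n + d. cscale (a j) (tpow (int j))) \<in> ?R" using Nc(2) by simp
    then show ?thesis
      using d by (intro shift_invariant_tpow [OF p sub shift, of a "n + d"]) (auto simp: a_def)
  qed
  then have "tpow ` {0..} \<subseteq> ?R" by (auto dest!: zero_le_imp_eq_int)
  then have poly: "circ.span (tpow ` {0..}) \<subseteq> ?R" using sub by (rule circ.span_minimal)
  show ?thesis
  proof
    show "?R \<subseteq> hardy p" using toeplitz_hardy [OF p g] by blast
    show "hardy p \<subseteq> ?R"
    proof
      fix f assume f: "f \<in> hardy p"
      have "\<exists>v. v \<in> ?R \<and> lp_norm p (v - f) < inverse (real (Suc k))" for k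
      proof -
        obtain v where "v \<in> circ.span (tpow ` {0..})" "lp_norm p (f - v) < inverse (real (Suc k))"
          using hardy_poly_dense [OF p f, of "inverse (real (Suc k))"] by auto
        then show ?thesis using poly lp_norm_minus_commute [OF p1, of f v] by auto
      qed
      then obtain h where h: "\<And>k. h k \<in> ?R" "\<And>k. lp_norm p (h k - f) < inverse (real (Suc k))" by metis
      have "(\<lambda>k. lp_norm p (h k - f)) \<longlonglongrightarrow> 0"
        by (rule tendsto_sandwich [OF _ _ tendsto_const LIMSEQ_inverse_real_of_nat])
          (use h(2) in \<open>auto intro!: always_eventually less_imp_le simp del: of_nat_Suc\<close>)
      then show "f \<in> ?R" using closed h(1) f unfolding lp_closed_in_def by blast
    qed
  qed
qed

section \<open>Codimension, and how an index changes with a power of t\<close>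

lemma codim_in_le: "spans_modulo V W B \<Longrightarrow> codim_in V W \<le> card B"
  unfolding codim_in_def by (rule Least_le) blast

lemma codim_in_attained:
  assumes "spans_modulo V W B"
  obtains B' where "spans_modulo V W B'" "card B' = codim_in V W"
proof -
  have "\<exists>m B'. spans_modulo V W B' \<and> card B' = m" using assms by blast
  from LeastI_ex [OF this] that show ?thesis unfolding codim_in_def by blast
qed

lemma codim_in_self [simp]: "codim_in V V = 0"
  using codim_in_le [of V V "{}"] circ.span_superset by (auto simp: spans_modulo_def)

lemma codim_in_eq_0:
  assumes "spans_modulo V W B" "codim_in V W = 0" "circ.subspace W"
  shows "V \<subseteq> W"
proof -
  obtain B' where "spans_modulo V W B'" "card B' = 0" using codim_in_attained [OF assms(1)] assms(2) by metis
  then have "V \<subseteq> circ.span W" by (auto simp: spans_modulo_def)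
  then show ?thesis using circ.span_eq_iff [THEN iffD2, OF assms(3)] by simp
qed

lemma codim_in_insert:
  assumes B: "spans_modulo V W B" and W: "circ.subspace W" and v: "v \<in> V" "v \<notin> W"
  shows "\<exists>B'. spans_modulo V (circ.span (insert v W)) B'"
    and "codim_in V W = Suc (codim_in V (circ.span (insert v W)))"
proof -
  let ?W' = "circ.span (insert v W)"
  have span_W: "circ.span W = W" using W by (simp add: circ.span_eq_iff)
  have span': "circ.span (?W' \<union> C) = circ.span (insert v (W \<union> C))" for C
  proof
    show "circ.span (?W' \<union> C) \<subseteq> circ.span (insert v (W \<union> C))"
      by (intro circ.span_minimal Un_least circ.subspace_span) (auto intro: circ.span_mono [THEN subsetD] circ.span_base)
    show "circ.span (insert v (W \<union> C)) \<subseteq> circ.span (?W' \<union> C)"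
      by (intro circ.span_mono) (auto intro: circ.span_base)
  qed
  obtain B0 where B0: "spans_modulo V W B0" "card B0 = codim_in V W" using codim_in_attained [OF B] by blast
  then have fin: "finite B0" and B0V: "B0 \<subseteq> V" and V: "V \<subseteq> circ.span (W \<union> B0)" by (auto simp: spans_modulo_def)
  have "\<exists>b\<in>B0. b \<in> circ.span (insert v (W \<union> (B0 - {b})))"
  proof -
    have "v \<in> circ.span (W \<union> B0)" using V v by blast
    then obtain w y where wy: "w \<in> W" "y \<in> circ.span B0" "v = w + y" unfolding circ.span_Un span_W by blast
    have "y \<noteq> 0" using wy v(2) by auto
    obtain u where u: "y = (\<Sum>b\<in>B0. cscale (u b) b)" using wy(2) fin by (auto simp: circ.span_finite)
    obtain b where b: "b \<in> B0" "u b \<noteq> 0"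
    proof (rule ccontr)
      assume "\<not> thesis"
      then have "\<forall>b\<in>B0. u b = 0" using that by blast
      then show False using u \<open>y \<noteq> 0\<close> by simp
    qed
    have "y = cscale (u b) b + (\<Sum>b\<in>B0 - {b}. cscale (u b) b)" unfolding u using fin b(1) by (rule sum.remove)
    then have eq: "b = cscale (1 / u b) (v - w - (\<Sum>b\<in>B0 - {b}. cscale (u b) b))"
      using wy(3) b(2) by simp
    have "cscale (1 / u b) (v - w - (\<Sum>b\<in>B0 - {b}. cscale (u b) b)) \<in> circ.span (insert v (W \<union> (B0 - {b})))"
      using wy(1) by (intro circ.span_scale circ.span_diff circ.span_sum) (auto intro: circ.span_base circ.span_scale)
    with eq have "b \<in> circ.span (insert v (W \<union> (B0 - {b})))" by simp
    with b(1) show ?thesis by blast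
  qed
  then obtain b where b: "b \<in> B0" "b \<in> circ.span (insert v (W \<union> (B0 - {b})))" by blast
  have "spans_modulo V ?W' (B0 - {b})"
  proof -
    have "W \<union> B0 \<subseteq> circ.span (insert v (W \<union> (B0 - {b})))" using b(2) by (auto intro: circ.span_base)
    then have "circ.span (W \<union> B0) \<subseteq> circ.span (?W' \<union> (B0 - {b}))"
      unfolding span' by (intro circ.span_minimal circ.subspace_span)
    with V fin B0V show ?thesis by (auto simp: spans_modulo_def)
  qed
  then show ex: "\<exists>B'. spans_modulo V ?W' B'" by blast
  have "codim_in V ?W' \<le> card (B0 - {b})" by (rule codim_in_le) fact
  then have 1: "Suc (codim_in V ?W') \<le> codim_in V W" using b(1) fin B0(2) card_Suc_Diff1 [of B0 b] by simp
  obtain B' where B': "spans_modulo V ?W' B'" "card B' = codim_in V ?W'" using ex codim_in_attained by blast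
  have "spans_modulo V W (insert v B')"
    using B'(1) v(1) span' [of B'] by (auto simp: spans_modulo_def)
  then have "codim_in V W \<le> card (insert v B')" by (rule codim_in_le)
  also have "\<dots> \<le> Suc (card B')" by (simp add: card_insert_le_m1 card_insert_if spans_modulo_def)
  finally show "codim_in V W = Suc (codim_in V ?W')" using 1 B'(2) by simp
qed

text \<open>As W is closed, v has a positive distance \<delta> from it. So the coefficients of v
  along a convergent sequence are themselves Cauchy, and what remains converges inside W.\<close>

lemma lp_closed_in_insert:
  assumes p: "1 \<le> p" and V: "V \<subseteq> Lp p" "circ.subspace V" and closed: "lp_closed_in p V W" and W: "circ.subspace W" "W \<subseteq> V"
    and v: "v \<in> V" "v \<notin> W"
  shows "lp_closed_in p V (circ.span (insert v W))"
  unfolding lp_closed_in_def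
proof (intro allI impI, elim conjE)
  fix h :: "nat \<Rightarrow> circle_fun" and f
  assume h: "\<forall>k. h k \<in> circ.span (insert v W)" and f: "f \<in> V" and lim: "(\<lambda>k. lp_norm p (h k - f)) \<longlonglongrightarrow> 0"
  have "\<exists>a. h k - cscale a v \<in> W" for k
    using h circ.span_eq_iff [THEN iffD2, OF W(1)] by (auto simp: circ.span_insert)
  then obtain a where a: "\<And>k. h k - cscale (a k) v \<in> W" by metis
  have hV: "h k \<in> V" for k
    using h circ.span_minimal [OF _ V(2), of "insert v W"] v W by blast
  obtain \<delta> where \<delta>: "0 < \<delta>" "\<And>w. w \<in> W \<Longrightarrow> \<delta> \<le> lp_norm p (w - v)"
  proof (rule ccontr)
    assume neg: "\<not> thesis"
    have "\<exists>w\<in>W. lp_norm p (w - v) < inverse (real (Suc k))" for k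
    proof (rule ccontr)
      assume "\<not> (\<exists>w\<in>W. lp_norm p (w - v) < inverse (real (Suc k)))"
      then have "\<And>w. w \<in> W \<Longrightarrow> inverse (real (Suc k)) \<le> lp_norm p (w - v)" by (meson not_le)
      moreover have "0 < inverse (real (Suc k))" by simp
      ultimately show False using neg that by blast
    qed
    then obtain w where w: "\<And>k. w k \<in> W" "\<And>k. lp_norm p (w k - v) < inverse (real (Suc k))" by metis
    have "(\<lambda>k. lp_norm p (w k - v)) \<longlonglongrightarrow> 0"
      by (rule tendsto_sandwich [OF _ _ tendsto_const LIMSEQ_inverse_real_of_nat])
        (use w(2) in \<open>auto intro!: always_eventually less_imp_le simp del: of_nat_Suc\<close>)
    then show False using closed w(1) v unfolding lp_closed_in_def by blast
  qed
  have diff: "\<delta> * norm (a m - a n) \<le> lp_norm p (h m - h n)" for m n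
  proof (cases "a m = a n")
    case False
    define w where "w = (h m - cscale (a m) v) - (h n - cscale (a n) v)"
    have w: "cscale (- 1 / (a m - a n)) w \<in> W" unfolding w_def by (intro circ.subspace_scale [OF W(1)] circ.subspace_diff [OF W(1) a a])
    have "h m - h n = cscale (- (a m - a n)) (cscale (- 1 / (a m - a n)) w - v)"
    proof -
      have "cscale (- e) (cscale (- 1 / e) w - v) = w + cscale e v" if "e \<noteq> 0" for e
        using that by (simp add: circ.scale_right_diff_distrib)
      from this [of "a m - a n"] False have "cscale (- (a m - a n)) (cscale (- 1 / (a m - a n)) w - v) = w + cscale (a m - a n) v"
        by simp
      then show ?thesis unfolding w_def circ.scale_left_diff_distrib by simp
    qed
    then have "lp_norm p (h m - h n) = norm (a m - a n) * lp_norm p (cscale (- 1 / (a m - a n)) w - v)"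
      using lp_norm_cscale [OF p] by (metis norm_minus_cancel)
    moreover have "norm (a m - a n) * \<delta> \<le> norm (a m - a n) * lp_norm p (cscale (- 1 / (a m - a n)) w - v)"
      by (intro mult_left_mono \<delta> w) auto
    ultimately show ?thesis by (simp add: mult.commute)
  qed simp
  have "Cauchy a"
  proof (rule CauchyI)
    fix e :: real assume "0 < e"
    then have "0 < \<delta> * e / 2" using \<delta> by simp
    from LIMSEQ_D [OF lim this] obtain N where N: "\<And>k. k \<ge> N \<Longrightarrow> lp_norm p (h k - f) < \<delta> * e / 2" by auto
    have "norm (a m - a n) < e" if "m \<ge> N" "n \<ge> N" for m n
    proof -
      have "\<delta> * norm (a m - a n) \<le> lp_norm p (h m - f) + lp_norm p (f - h n)"
        using diff [of m n] lp_norm_diff_triangle [OF p, of "h m" f "h n"] hV f V(1) by force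
      also have "\<dots> < \<delta> * e"
        using N [OF that(1)] N [OF that(2)] lp_norm_minus_commute [OF p, of f "h n"] by simp
      finally show ?thesis using \<delta>(1) by simp
    qed
    then show "\<exists>M. \<forall>m\<ge>M. \<forall>n\<ge>M. norm (a m - a n) < e" by blast
  qed
  then obtain l where l: "a \<longlonglongrightarrow> l" using Cauchy_convergent_iff convergent_def by blast
  have "(\<lambda>k. lp_norm p ((h k - cscale (a k) v) - (f - cscale l v))) \<longlonglongrightarrow> 0"
  proof (rule tendsto_sandwich [of "\<lambda>_. 0"])
    have "(\<lambda>k. norm (a k - l) * lp_norm p v) \<longlonglongrightarrow> 0 * lp_norm p v"
      using l by (intro tendsto_intros) (simp add: LIM_zero tendsto_norm_zero)
    from tendsto_add [OF lim this] show "(\<lambda>k. lp_norm p (h k - f) + norm (a k - l) * lp_norm p v) \<longlonglongrightarrow> 0" by simp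
    show "\<forall>\<^sub>F k in sequentially. lp_norm p ((h k - cscale (a k) v) - (f - cscale l v)) \<le> lp_norm p (h k - f) + norm (a k - l) * lp_norm p v"
    proof (intro always_eventually allI)
      fix k
      have "(h k - cscale (a k) v) - (f - cscale l v) = (h k - f) + cscale (- (a k - l)) v"
        by (simp add: circ.scale_left_diff_distrib algebra_simps)
      also have "lp_norm p \<dots> \<le> lp_norm p (h k - f) + lp_norm p (cscale (- (a k - l)) v)"
        using hV f v V(1) by (intro lp_norm_triangle p Lp_diff Lp_cscale) auto
      finally show "lp_norm p ((h k - cscale (a k) v) - (f - cscale l v)) \<le> lp_norm p (h k - f) + norm (a k - l) * lp_norm p v"
        by (simp only: lp_norm_cscale [OF p] norm_minus_cancel)
    qed
  qed (auto intro: always_eventually)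
  moreover have "f - cscale l v \<in> V" using f v V(2) by (intro circ.subspace_diff circ.subspace_scale)
  ultimately have "f - cscale l v \<in> W"
    using closed [unfolded lp_closed_in_def, rule_format, of "\<lambda>k. h k - cscale (a k) v" "f - cscale l v"] a by blast
  then show "f \<in> circ.span (insert v W)"
    unfolding circ.span_insert circ.span_eq_iff [THEN iffD2, OF W(1)] by blast
qed

text \<open>H^p consists of t H^p and the constants, and T(g/t) acts on t x as T(g) acts on
  x.\<close>

lemma toeplitz_image_tpow_minus:
  assumes p: "1 < p" and g: "g \<in> Linf"
  shows "toeplitz (g * tpow (- 1)) ` hardy p = circ.span (insert (toeplitz (g * tpow (- 1)) 1) (toeplitz g ` hardy p))"
    and "x \<in> hardy p \<Longrightarrow> toeplitz (g * tpow (- 1)) (tpow 1 * x) = toeplitz g x"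
proof -
  let ?g = "g * tpow (- 1)" and ?v = "toeplitz (g * tpow (- 1)) 1"
  have p1: "1 \<le> p" using p by simp
  have g': "?g \<in> Linf" using g by (intro Linf_mult) auto
  show shift: "toeplitz ?g (tpow 1 * x) = toeplitz g x" if "x \<in> hardy p" for x
    by (simp add: toeplitz_def mult.assoc tpow_mult_tpow_left)
  show "toeplitz ?g ` hardy p = circ.span (insert ?v (toeplitz g ` hardy p))"
  proof
    show "circ.span (insert ?v (toeplitz g ` hardy p)) \<subseteq> toeplitz ?g ` hardy p"
    proof (rule circ.span_minimal [OF _ subspace_toeplitz_image [OF p g']])
      show "insert ?v (toeplitz g ` hardy p) \<subseteq> toeplitz ?g ` hardy p"
        using shift toeplitz_tpow_nonneg(2) [OF p1, of _ 1] p by (auto simp flip: shift)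
    qed
    show "toeplitz ?g ` hardy p \<subseteq> circ.span (insert ?v (toeplitz g ` hardy p))"
    proof
      fix y assume "y \<in> toeplitz ?g ` hardy p"
      then obtain x where x: "x \<in> hardy p" "y = toeplitz ?g x" by blast
      obtain x' where x': "x' \<in> hardy p" "x = tpow 1 * x' + cscale (fcoeff x 0) 1" using hardy_split [OF p1 x(1)] .
      have "y = toeplitz ?g (tpow 1 * x' + cscale (fcoeff x 0) 1)" using x(2) x'(2) by metis
      also have "\<dots> = toeplitz g x' + cscale (fcoeff x 0) ?v"
        using p g' x'(1) p1 toeplitz_tpow_nonneg(2) [OF p1 x'(1), of 1]
        by (simp add: toeplitz_add [of p] toeplitz_cscale [of p] hardy_cscale shift)
      also have "\<dots> \<in> circ.span (insert ?v (toeplitz g ` hardy p))"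
        using x'(1) by (intro circ.span_add circ.span_scale circ.span_base) auto
      finally show "y \<in> circ.span (insert ?v (toeplitz g ` hardy p))" .
    qed
  qed
qed

text \<open>The range gains one dimension unless v = T(g/t) 1 lies in it already. In that case
  T(g/t) has the same range and a nonzero kernel element 1 - t u, so Coburn's lemma makes it onto,
  against the positive codimension. The same fact v outside the range keeps the kernel
  trivial.\<close>

lemma toeplitz_index_step:
  assumes p: "1 < p" and g: "g \<in> Linf" and inj: "ker_on (hardy p) (toeplitz g) = {0}"
    and closed: "lp_closed_in p (hardy p) (toeplitz g ` hardy p)"
    and B: "spans_modulo (hardy p) (toeplitz g ` hardy p) B"
    and codim: "codim_in (hardy p) (toeplitz g ` hardy p) = Suc m"
  defines "g' \<equiv> g * tpow (- 1)"
  shows "ker_on (hardy p) (toeplitz g') = {0}" "lp_closed_in p (hardy p) (toeplitz g' ` hardy p)"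
    "\<exists>B. spans_modulo (hardy p) (toeplitz g' ` hardy p) B" "codim_in (hardy p) (toeplitz g' ` hardy p) = m"
proof -
  let ?R = "toeplitz g ` hardy p" and ?v = "toeplitz g' 1"
  have p1: "1 \<le> p" using p by simp
  have g': "g' \<in> Linf" unfolding g'_def using g by (intro Linf_mult) auto
  have sub: "circ.subspace ?R" using subspace_toeplitz_image [OF p g] .
  have R': "toeplitz g' ` hardy p = circ.span (insert ?v ?R)"
    unfolding g'_def by (rule toeplitz_image_tpow_minus [OF p g])
  have shift: "toeplitz g' (tpow 1 * x) = toeplitz g x" if "x \<in> hardy p" for x
    unfolding g'_def by (rule toeplitz_image_tpow_minus(2) [OF p g that])
  have t: "tpow 1 * x \<in> hardy p" if "x \<in> hardy p" for x using toeplitz_tpow_nonneg(2) [OF p1 that, of 1] by simp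
  have vV: "?v \<in> hardy p" using toeplitz_hardy [OF p g'] p by simp
  have vR: "?v \<notin> ?R"
  proof
    assume v: "?v \<in> ?R"
    then obtain u where u: "u \<in> hardy p" "?v = toeplitz g u" by blast
    define x where "x = 1 - tpow 1 * u"
    have x: "x \<in> hardy p" unfolding x_def using p t u by (intro hardy_diff) auto
    have "fcoeff x 0 = 1"
      using hardy_L1 [OF p1 t [OF u(1)]] fcoeff_hardy [OF u(1), of "-1"]
      by (simp add: x_def fcoeff_diff Linf_subset_Lp fcoeff_one fcoeff_tpow_mult)
    then have "x \<noteq> 0" by auto
    have "toeplitz g' x = ?v - toeplitz g' (tpow 1 * u)"
      unfolding x_def using p g' t u by (intro toeplitz_diff [of p]) auto
    then have "toeplitz g' x = 0" using u shift by simp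
    have "toeplitz g' ` hardy p = ?R"
      unfolding R' using v sub by (simp add: insert_absorb circ.span_eq_iff)
    with coburn [OF p g' _ _ x \<open>toeplitz g' x = 0\<close> \<open>x \<noteq> 0\<close>, of B] closed B
    have "?R = hardy p" by simp
    with codim show False by simp
  qed
  show "lp_closed_in p (hardy p) (toeplitz g' ` hardy p)"
    unfolding R' using hardy_Lp toeplitz_hardy [OF p g]
    by (intro lp_closed_in_insert p1 subspace_hardy closed sub vV vR) auto
  show "\<exists>B. spans_modulo (hardy p) (toeplitz g' ` hardy p) B"
    "codim_in (hardy p) (toeplitz g' ` hardy p) = m"
    unfolding R' using codim_in_insert [OF B sub vV vR] codim by auto
  show "ker_on (hardy p) (toeplitz g') = {0}"
  proof -
    have "x = 0" if x: "x \<in> hardy p" "toeplitz g' x = 0" for x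
    proof -
      obtain x' where x': "x' \<in> hardy p" "x = tpow 1 * x' + cscale (fcoeff x 0) 1" using hardy_split [OF p1 x(1)] .
      have "toeplitz g' (tpow 1 * x' + cscale (fcoeff x 0) 1) = 0" using x(2) x'(2) by metis
      then have *: "toeplitz g x' + cscale (fcoeff x 0) ?v = 0"
        using p p1 g' t x'(1) by (simp add: toeplitz_add [of p] toeplitz_cscale [of p] hardy_cscale shift)
      have x0: "fcoeff x 0 = 0"
      proof (rule ccontr)
        assume nz: "fcoeff x 0 \<noteq> 0"
        have "cscale (fcoeff x 0) ?v = - toeplitz g x'" using * by (simp add: eq_neg_iff_add_eq_0 add.commute)
        also have "\<dots> \<in> ?R" using x'(1) by (intro circ.subspace_neg [OF sub]) blast
        finally have "cscale (1 / fcoeff x 0) (cscale (fcoeff x 0) ?v) \<in> ?R"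
          by (rule circ.subspace_scale [OF sub])
        then show False using nz vR by simp
      qed
      then have "x' \<in> ker_on (hardy p) (toeplitz g)" using * x'(1) by (simp add: ker_on_def)
      then have "x' = 0" using inj by simp
      then show "x = 0" using x'(2) x0 by simp
    qed
    then show ?thesis by (auto simp: ker_on_def)
  qed
qed

lemma toeplitz_index_iterate:
  assumes p: "1 < p" and "g \<in> Linf" "ker_on (hardy p) (toeplitz g) = {0}"
    "lp_closed_in p (hardy p) (toeplitz g ` hardy p)" "spans_modulo (hardy p) (toeplitz g ` hardy p) B"
    "codim_in (hardy p) (toeplitz g ` hardy p) = m"
  shows "bij_betw (toeplitz (g * tpow (- int m))) (hardy p) (hardy p)"
  using assms(2-)
proof (induction m arbitrary: g B)
  case 0
  have "hardy p \<subseteq> toeplitz g ` hardy p"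
    by (rule codim_in_eq_0 [OF 0(4,5) subspace_toeplitz_image [OF p 0(1)]])
  then have "toeplitz g ` hardy p = hardy p" using toeplitz_hardy [OF p 0(1)] by blast
  moreover have "inj_on (toeplitz g) (hardy p)"
  proof (rule inj_onI)
    fix x y assume xy: "x \<in> hardy p" "y \<in> hardy p" "toeplitz g x = toeplitz g y"
    then have "x - y \<in> ker_on (hardy p) (toeplitz g)"
      using p 0(1) by (simp add: ker_on_def toeplitz_diff [of p] hardy_diff)
    then show "x = y" using 0(2) by simp
  qed
  ultimately show ?case by (simp add: bij_betw_def)
next
  case (Suc m)
  note step = toeplitz_index_step [OF p Suc.prems(1-5)]
  obtain B' where B': "spans_modulo (hardy p) (toeplitz (g * tpow (- 1)) ` hardy p) B'" using step(3) by blast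
  have "bij_betw (toeplitz (g * tpow (- 1) * tpow (- int m))) (hardy p) (hardy p)"
    by (rule Suc.IH [OF Linf_mult [OF Suc.prems(1) Linf_tpow] step(1,2) B' step(4)])
  also have "g * tpow (- 1) * tpow (- int m) = g * tpow (- int (Suc m))"
    by (simp add: mult.assoc tpow_mult_tpow)
  finally show ?case .
qed

text \<open>By Coburn's lemma a nonzero kernel would give nonnegative index. So the kernel is
  trivial, and the index is minus the codimension that the iteration counts down to 0.\<close>

lemma toeplitz_negative_index:
  assumes p: "1 < p" and g: "g \<in> Linf" and F: "fredholm p (hardy p) (toeplitz g)" and ind: "ind_T p g < 0"
  shows "bij_betw (toeplitz (g * tpow (ind_T p g))) (hardy p) (hardy p)"
proof -
  obtain B where B: "spans_modulo (hardy p) (toeplitz g ` hardy p) B" and closed: "lp_closed_in p (hardy p) (toeplitz g ` hardy p)"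
    using F by (auto simp: fredholm_def)
  have ker: "ker_on (hardy p) (toeplitz g) = {0}"
  proof (rule ccontr)
    assume "ker_on (hardy p) (toeplitz g) \<noteq> {0}"
    moreover have "0 \<in> ker_on (hardy p) (toeplitz g)" by (simp add: ker_on_def)
    ultimately obtain f where "f \<in> hardy p" "toeplitz g f = 0" "f \<noteq> 0" unfolding ker_on_def by blast
    from coburn [OF p g closed B this] ind show False by (simp add: index_on_def)
  qed
  have "circ.dim {0} = 0" using circ.dim_span_eq_card_independent [OF circ.independent_empty] by simp
  then have "ind_T p g = - int (codim_in (hardy p) (toeplitz g ` hardy p))" by (simp add: index_on_def ker)
  with toeplitz_index_iterate [OF p g ker closed B refl] show ?thesis by simp
qed

lemma index_bij:
  assumes "bij_betw (toeplitz g) (hardy p) (hardy p)"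
  shows "ind_T p g = 0"
proof -
  have "ker_on (hardy p) (toeplitz g) = {0}"
    using assms toeplitz_0 [of g] inj_onD [of "toeplitz g" "hardy p" _ 0] by (auto simp: ker_on_def bij_betw_def)
  moreover have "circ.dim {0} = 0" using circ.dim_span_eq_card_independent [OF circ.independent_empty] by simp
  ultimately show ?thesis using assms by (simp add: index_on_def bij_betw_def)
qed

lemma index_bij_tpow_minus:
  assumes p: "1 < p" and g: "g \<in> Linf" and bij: "bij_betw (toeplitz g) (hardy p) (hardy p)"
  shows "ind_T p (g * tpow (- 1)) = 1"
    and "x \<in> ker_on (hardy p) (toeplitz (g * tpow (- 1))) \<Longrightarrow> x \<noteq> 0 \<Longrightarrow>
      ker_on (hardy p) (toeplitz (g * tpow (- 1))) = range (\<lambda>z. cscale z x)"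
proof -
  let ?g = "g * tpow (- 1)" and ?v = "toeplitz (g * tpow (- 1)) 1"
  let ?K = "ker_on (hardy p) (toeplitz ?g)"
  have p1: "1 \<le> p" using p by simp
  have g': "?g \<in> Linf" using g by (intro Linf_mult) auto
  have im: "toeplitz g ` hardy p = hardy p" and inj: "inj_on (toeplitz g) (hardy p)" using bij by (auto simp: bij_betw_def)
  have t: "tpow 1 * x \<in> hardy p" if "x \<in> hardy p" for x using toeplitz_tpow_nonneg(2) [OF p1 that, of 1] by simp
  have shift: "toeplitz ?g (tpow 1 * x) = toeplitz g x" if "x \<in> hardy p" for x
    by (rule toeplitz_image_tpow_minus(2) [OF p g that])
  have vV: "?v \<in> hardy p" using toeplitz_hardy [OF p g'] p by simp
  have im': "toeplitz ?g ` hardy p = hardy p"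
  proof
    show "toeplitz ?g ` hardy p \<subseteq> hardy p" using toeplitz_hardy [OF p g'] by blast
    show "hardy p \<subseteq> toeplitz ?g ` hardy p"
    proof
      fix y assume "y \<in> hardy p"
      then obtain x where "x \<in> hardy p" "y = toeplitz g x" using im by blast
      then show "y \<in> toeplitz ?g ` hardy p" using t [of x] shift [of x] by (intro image_eqI [of _ _ "tpow 1 * x"]) simp_all
    qed
  qed
  obtain u where u: "u \<in> hardy p" "toeplitz g u = ?v" using im vV by (metis imageE)
  \<comment> \<open>The constant 1 corrected by the element of t H^p with the same image. Its value
    at 0 is one, and subtracting the matching multiple of it brings any kernel element into t H^p,
    where T(g) is injective.\<close>
  define e where "e = 1 - tpow 1 * u"
  have e: "e \<in> hardy p" unfolding e_def using p t u by (intro hardy_diff) auto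
  have e0: "fcoeff e 0 = 1"
    using hardy_L1 [OF p1 t [OF u(1)]] fcoeff_hardy [OF u(1), of "-1"]
    by (simp add: e_def fcoeff_diff Linf_subset_Lp fcoeff_one fcoeff_tpow_mult)
  have "toeplitz ?g e = ?v - toeplitz ?g (tpow 1 * u)"
    unfolding e_def using p g' t u by (intro toeplitz_diff [of p]) auto
  then have eK: "e \<in> ?K" using u shift e by (simp add: ker_on_def)
  have K: "x = cscale (fcoeff x 0) e" if "x \<in> ?K" for x
  proof -
    have x: "x \<in> hardy p" "toeplitz ?g x = 0" using that by (auto simp: ker_on_def)
    define y where "y = x - cscale (fcoeff x 0) e"
    have y: "y \<in> hardy p" unfolding y_def using p1 x e by (intro hardy_diff hardy_cscale)
    have "fcoeff y 0 = 0"
      using hardy_L1 [OF p1 x(1)] hardy_L1 [OF p1 e] by (simp add: y_def fcoeff_diff fcoeff_cscale e0 Lp_cscale)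
    obtain y' where y': "y' \<in> hardy p" "y = tpow 1 * y' + cscale (fcoeff y 0) 1" using hardy_split [OF p1 y] .
    then have y'': "y = tpow 1 * y'" by (simp add: \<open>fcoeff y 0 = 0\<close>)
    have "toeplitz ?g y = 0"
      unfolding y_def using p p1 g' x e eK by (simp add: toeplitz_diff [of p] toeplitz_cscale [of p] hardy_cscale ker_on_def)
    then have "toeplitz g y' = toeplitz g 0" using shift [OF y'(1)] y'' by simp
    then have "y' = 0" using inj_onD [OF inj] y'(1) by simp
    then show ?thesis using y'' by (simp add: y_def)
  qed
  have sub: "cscale z e \<in> ?K" for z
    using eK p p1 g' by (simp add: ker_on_def hardy_cscale toeplitz_cscale [of p])
  have K_eq: "?K = range (\<lambda>z. cscale z e)" using K sub by blast
  have "e \<noteq> 0" using e0 by auto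
  then have "circ.independent {e}" by simp
  have "circ.dim ?K = circ.dim {e}"
    unfolding K_eq circ.span_singleton [symmetric] by (rule circ.dim_span)
  also have "\<dots> = 1" using circ.dim_eq_card_independent [OF \<open>circ.independent {e}\<close>] by simp
  finally show "ind_T p ?g = 1" by (simp add: index_on_def im')
  show "?K = range (\<lambda>z. cscale z x)" if x: "x \<in> ?K" "x \<noteq> 0"
  proof -
    have xe: "x = cscale (fcoeff x 0) e" using K x by blast
    then have nz: "fcoeff x 0 \<noteq> 0" using x(2) by auto
    have "range (\<lambda>z. cscale z e) = range (\<lambda>z. cscale z x)"
    proof
      show "range (\<lambda>z. cscale z e) \<subseteq> range (\<lambda>z. cscale z x)"
      proof safe
        fix z
        have "cscale z e = cscale (z / fcoeff x 0) (cscale (fcoeff x 0) e)" using nz by simp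
        then show "cscale z e \<in> range (\<lambda>z. cscale z x)" using xe by (metis rangeI)
      qed
      show "range (\<lambda>z. cscale z x) \<subseteq> range (\<lambda>z. cscale z e)"
      proof safe
        fix z
        have "cscale z x = cscale (z * fcoeff x 0) e" using xe by (metis circ.scale_scale)
        then show "cscale z x \<in> range (\<lambda>z. cscale z e)" by blast
      qed
    qed
    with K_eq show ?thesis by simp
  qed
qed

section \<open>Bounded inverses\<close>

lemma hardy_complete:
  assumes p: "1 \<le> p" and f: "\<And>k. f k \<in> hardy p"
    and cauchy: "\<And>e. 0 < e \<Longrightarrow> \<exists>N. \<forall>m\<ge>N. \<forall>n\<ge>N. lp_norm p (f m - f n) < e"
  shows "\<exists>g\<in>hardy p. (\<lambda>k. lp_norm p (f k - g)) \<longlonglongrightarrow> 0"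
proof -
  have fL: "f k \<in> Lp p" for k using f by (rule hardy_Lp)
  obtain g where g: "g \<in> Lp p" "(\<lambda>k. lp_norm p (f k - g)) \<longlonglongrightarrow> 0"
    by (rule Lp_complete [OF p fL cauchy])
  have "g \<in> hardy p"
  proof (rule hardyI [OF g(1)])
    fix n :: int assume "n < 0"
    then show "fcoeff g n = 0"
      using LIMSEQ_unique [OF fcoeff_tendsto [OF p fL g, of n], of 0] by (simp add: fcoeff_hardy [OF f])
  qed
  with g(2) show ?thesis by blast
qed

lemma Metric_space_hardy:
  assumes p: "1 \<le> p"
  shows "Metric_space (hardy p) (\<lambda>f g. lp_norm p (f - g))"
proof
  show "lp_norm p (x - y) = lp_norm p (y - x)" for x y by (rule lp_norm_minus_commute [OF p])
  show "(lp_norm p (x - y) = 0) = (x = y)" if "x \<in> hardy p" "y \<in> hardy p" for x y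
    using lp_norm_eq_0 [OF p Lp_diff [OF p hardy_Lp [OF that(1)] hardy_Lp [OF that(2)]]] by auto
  show "lp_norm p (x - z) \<le> lp_norm p (x - y) + lp_norm p (y - z)"
    if "x \<in> hardy p" "y \<in> hardy p" "z \<in> hardy p" for x y z
    using that by (intro lp_norm_diff_triangle p hardy_Lp)
qed simp

lemma hardy_Baire:
  assumes p: "1 \<le> p" and cover: "hardy p \<subseteq> (\<Union>n::nat. B n)"
  shows "\<exists>n y0 r. y0 \<in> hardy p \<and> 0 < r \<and>
    (\<forall>y\<in>hardy p. lp_norm p (y0 - y) < r \<longrightarrow> (\<forall>e>0. \<exists>z\<in>B n \<inter> hardy p. lp_norm p (y - z) < e))"
proof -
  interpret Metric_space "hardy p" "\<lambda>f g. lp_norm p (f - g)" by (rule Metric_space_hardy [OF p])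
  have complete: mcomplete
    unfolding mcomplete_def
  proof (intro allI impI)
    fix \<sigma> assume \<sigma>: "MCauchy \<sigma>"
    have "\<exists>g\<in>hardy p. (\<lambda>k. lp_norm p (\<sigma> k - g)) \<longlonglongrightarrow> 0"
    proof (rule hardy_complete [OF p])
      show "\<sigma> k \<in> hardy p" for k using \<sigma> unfolding MCauchy_def by blast
      show "\<exists>N. \<forall>m\<ge>N. \<forall>n\<ge>N. lp_norm p (\<sigma> m - \<sigma> n) < e" if "0 < e" for e
        using \<sigma> that unfolding MCauchy_def by metis
    qed
    moreover have "\<forall>\<^sub>F k in sequentially. \<sigma> k \<in> hardy p"
      using \<sigma> unfolding MCauchy_def by (intro always_eventually allI) blast
    ultimately show "\<exists>x. limitin mtopology \<sigma> x sequentially"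
      unfolding limitin_metric_dist_null by blast
  qed
  define \<C> where "\<C> = range (\<lambda>n. mtopology closure_of (B n \<inter> hardy p))"
  have "\<exists>T\<in>\<C>. mtopology interior_of T \<noteq> {}"
  proof (rule ccontr)
    assume "\<not> (\<exists>T\<in>\<C>. mtopology interior_of T \<noteq> {})"
    then have int: "mtopology interior_of T = {}" if "T \<in> \<C>" for T using that by blast
    have "mtopology interior_of \<Union>\<C> = {}"
    proof (rule metric_Baire_category_alt [OF complete])
      show "countable \<C>" unfolding \<C>_def by simp
      show "closedin mtopology T \<and> mtopology interior_of T = {}" if T: "T \<in> \<C>" for T
        using int [OF T] T unfolding \<C>_def by (metis closedin_closure_of imageE)
    qed
    moreover have "hardy p \<subseteq> \<Union>\<C>"
    proof
      fix y assume y: "y \<in> hardy p"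
      then obtain n where "y \<in> B n" using cover by blast
      then have "y \<in> mtopology closure_of (B n \<inter> hardy p)"
        using y closure_of_subset [of "B n \<inter> hardy p" mtopology] by auto
      then show "y \<in> \<Union>\<C>" by (auto simp: \<C>_def)
    qed
    then have "mtopology interior_of (hardy p) \<subseteq> mtopology interior_of \<Union>\<C>" by (rule interior_of_mono)
    moreover have "mtopology interior_of (hardy p) = hardy p"
      using interior_of_topspace [of mtopology] by simp
    ultimately show False using hardy_0 by blast
  qed
  then obtain n y0 where y0: "y0 \<in> mtopology interior_of (mtopology closure_of (B n \<inter> hardy p))"
    by (auto simp: \<C>_def)
  then obtain r where r: "y0 \<in> hardy p" "0 < r" "mball y0 r \<subseteq> mtopology closure_of (B n \<inter> hardy p)"
    by (auto simp: in_interior_of_mball)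
  have "\<forall>e>0. \<exists>z\<in>B n \<inter> hardy p. lp_norm p (y - z) < e" if "y \<in> hardy p" "lp_norm p (y0 - y) < r" for y
  proof -
    have "y \<in> mtopology closure_of (B n \<inter> hardy p)" using r that by auto
    then show ?thesis by (auto simp: metric_closure_of)
  qed
  with r(1,2) show ?thesis by (intro exI conjI ballI impI)
qed

text \<open>The open mapping theorem for a surjective Toeplitz operator: Baire's theorem gives approximate
  solutions with a uniform bound, and summing the corrections gives exact ones.\<close>

lemma toeplitz_open_mapping:
  assumes p: "1 < p" and g: "g \<in> Linf" and surj: "toeplitz g ` hardy p = hardy p"
  shows "\<exists>K\<ge>0. \<forall>y\<in>hardy p. \<exists>x\<in>hardy p. toeplitz g x = y \<and> lp_norm p x \<le> K * lp_norm p y"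
proof -
  have p1: "1 \<le> p" using p by simp
  let ?T = "toeplitz g"
  note T_diff = toeplitz_diff [OF p g] and T_scale = toeplitz_cscale [OF p g] and T_add = toeplitz_add [OF p g]
  note V_diff = hardy_diff [OF p1] and V_scale = hardy_cscale [OF p1] and V_add = hardy_add [OF p1]
  note tri = lp_norm_triangle [OF p1] and sc = lp_norm_cscale [OF p1]
  define B where "B n = ?T ` {x \<in> hardy p. lp_norm p x \<le> real n}" for n :: nat
  have "hardy p \<subseteq> (\<Union>n. B n)"
  proof
    fix y assume "y \<in> hardy p"
    then obtain x where x: "x \<in> hardy p" "y = ?T x" using surj by blast
    moreover obtain n :: nat where "lp_norm p x \<le> real n" using real_arch_simple by blast
    ultimately show "y \<in> (\<Union>n. B n)" unfolding B_def by blast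
  qed
  from hardy_Baire [OF p1 this] obtain n y0 r where y0: "y0 \<in> hardy p" "0 < r"
    and near: "\<And>y e. y \<in> hardy p \<Longrightarrow> lp_norm p (y0 - y) < r \<Longrightarrow> 0 < e \<Longrightarrow> \<exists>z\<in>B n \<inter> hardy p. lp_norm p (y - z) < e"
    by blast
  \<comment> \<open>The difference of approximate preimages of y0 + y and of y0: this moves the ball
    to the origin and doubles the bound n.\<close>
  have small: "\<exists>x\<in>hardy p. lp_norm p x \<le> 2 * real n \<and> lp_norm p (y - ?T x) < e"
    if y: "y \<in> hardy p" "lp_norm p y < r" and e: "0 < e" for y e
  proof -
    have "lp_norm p (y0 - (y0 + y)) < r" using y(2) lp_norm_uminus [OF p1, of y] by simp
    from near [OF V_add [OF y0(1) y(1)] this, of "e / 2"] e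
    obtain x1 where x1: "x1 \<in> hardy p" "lp_norm p x1 \<le> real n" "lp_norm p (y0 + y - ?T x1) < e / 2"
      by (auto simp: B_def)
    have "lp_norm p (y0 - y0) < r" using y0(2) by simp
    from near [OF y0(1) this, of "e / 2"] e
    obtain x2 where x2: "x2 \<in> hardy p" "lp_norm p x2 \<le> real n" "lp_norm p (y0 - ?T x2) < e / 2"
      by (auto simp: B_def)
    have T: "?T x1 \<in> hardy p" "?T x2 \<in> hardy p" using x1 x2 toeplitz_hardy [OF p g] by auto
    have "lp_norm p (x1 - x2) \<le> 2 * real n"
      using lp_norm_triangle [OF p1 hardy_Lp [OF x1(1)] Lp_uminus [OF p1 hardy_Lp [OF x2(1)]]] x1 x2
      by (simp add: lp_norm_uminus [OF p1])
    moreover have "lp_norm p (y - ?T (x1 - x2)) < e"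
    proof -
      have "y - ?T (x1 - x2) = (y0 + y - ?T x1) + - (y0 - ?T x2)" using x1 x2 by (simp add: T_diff)
      also have "lp_norm p \<dots> \<le> lp_norm p (y0 + y - ?T x1) + lp_norm p (- (y0 - ?T x2))"
        using T y0 y by (intro tri Lp_uminus p1 hardy_Lp V_diff V_add) auto
      finally show ?thesis using x1(3) x2(3) lp_norm_uminus [OF p1, of "y0 - ?T x2"] by simp
    qed
    ultimately show ?thesis using x1 x2 V_diff by blast
  qed
  \<comment> \<open>A vector y is scaled to norm r/2 and solved up to r/4 by some x of norm at most
    2 n; scaling back multiplies by 2/r times the norm of y.\<close>
  define K where "K = 4 * real n / r"
  have K: "0 \<le> K" using y0(2) by (simp add: K_def)
  have approx: "\<exists>x\<in>hardy p. lp_norm p x \<le> K * lp_norm p y \<and> lp_norm p (y - ?T x) \<le> lp_norm p y / 2"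
    if y: "y \<in> hardy p" for y
  proof (cases "lp_norm p y = 0")
    case True
    then have "y = 0" using lp_norm_eq_0 [OF p1 hardy_Lp [OF y]] by simp
    then show ?thesis by (intro bexI [of _ 0]) auto
  next
    case False
    then have N: "0 < lp_norm p y" by (simp add: less_le)
    define s where "s = r / (2 * lp_norm p y)"
    have s: "0 < s" using N y0(2) by (simp add: s_def)
    have sN: "s * lp_norm p y = r / 2" using N by (simp add: s_def)
    have "lp_norm p (cscale (of_real s) y) < r" using s sN y0(2) by (simp add: sc)
    from small [OF V_scale [OF y] this, of "r / 4"] y0(2)
    obtain x where x: "x \<in> hardy p" "lp_norm p x \<le> 2 * real n" "lp_norm p (cscale (of_real s) y - ?T x) < r / 4"
      by auto
    define x' where "x' = cscale (of_real (1 / s)) x"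
    have x': "x' \<in> hardy p" unfolding x'_def by (rule V_scale [OF x(1)])
    have inv_s: "1 / s = 2 * lp_norm p y / r" by (simp add: s_def)
    have "lp_norm p x' = (1 / s) * lp_norm p x" using s by (simp add: x'_def sc norm_divide)
    also have "\<dots> \<le> (1 / s) * (2 * real n)" using s x(2) by (intro mult_left_mono) auto
    also have "\<dots> = K * lp_norm p y" unfolding inv_s by (simp add: K_def)
    finally have 1: "lp_norm p x' \<le> K * lp_norm p y" .
    have "y - ?T x' = cscale (of_real (1 / s)) (cscale (of_real s) y - ?T x)"
      using s x(1) by (simp add: x'_def T_scale circ.scale_right_diff_distrib flip: of_real_mult)
    then have "lp_norm p (y - ?T x') = (1 / s) * lp_norm p (cscale (of_real s) y - ?T x)"
      using s by (simp add: sc norm_divide)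
    also have "\<dots> \<le> (1 / s) * (r / 4)" using s x(3) by (intro mult_left_mono) auto
    also have "\<dots> = lp_norm p y / 2" unfolding inv_s using y0(2) by simp
    finally show ?thesis using x' 1 by blast
  qed
  then obtain S where S: "\<And>y. y \<in> hardy p \<Longrightarrow> S y \<in> hardy p" "\<And>y. y \<in> hardy p \<Longrightarrow> lp_norm p (S y) \<le> K * lp_norm p y"
    "\<And>y. y \<in> hardy p \<Longrightarrow> lp_norm p (y - ?T (S y)) \<le> lp_norm p y / 2"
    by metis
  obtain D where D: "0 \<le> D" "\<forall>f\<in>hardy p. lp_norm p (?T f) \<le> D * lp_norm p f"
    using toeplitz_bound [OF p g] by blast
  have "\<exists>x\<in>hardy p. ?T x = y \<and> lp_norm p x \<le> (2 * K + 1) * lp_norm p y" if y: "y \<in> hardy p" for y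
  proof (cases "lp_norm p y = 0")
    case True
    then have "y = 0" using lp_norm_eq_0 [OF p1 hardy_Lp [OF y]] by simp
    then show ?thesis by (intro bexI [of _ 0]) auto
  next
    case False
    then have Npos: "0 < lp_norm p y" by (simp add: less_le)
    \<comment> \<open>The remainder after k corrections. Its norm halves each time, so the partial
      sums \<open>X\<close> of the corrections form a Cauchy sequence.\<close>
    define z where "z k = ((\<lambda>y. y - ?T (S y)) ^^ k) y" for k
    have z: "z k \<in> hardy p" for k
      unfolding z_def by (induction k) (use y S(1) toeplitz_hardy [OF p g] in \<open>auto intro!: V_diff\<close>)
    have z_Suc: "z (Suc k) = z k - ?T (S (z k))" for k by (simp add: z_def)
    have z_norm: "lp_norm p (z k) \<le> lp_norm p y * (1 / 2) ^ k" for k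
    proof (induction k)
      case (Suc k)
      have "lp_norm p (z (Suc k)) \<le> lp_norm p (z k) / 2" unfolding z_Suc by (rule S(3) [OF z])
      with Suc show ?case by simp
    qed (simp add: z_def)
    define X where "X k = (\<Sum>j<k. S (z j))" for k
    have X: "X k \<in> hardy p" for k unfolding X_def by (intro circ.subspace_sum [OF subspace_hardy [OF p1]] S(1) z)
    have TX: "?T (X k) = y - z k" for k
    proof (induction k)
      case (Suc k)
      have "?T (X (Suc k)) = ?T (X k) + ?T (S (z k))" using X S(1) z by (simp add: X_def T_add [symmetric])
      then show ?case using Suc z_Suc by simp
    qed (simp add: X_def z_def)
    have S_norm: "lp_norm p (S (z j)) \<le> K * lp_norm p y * (1 / 2) ^ j" for j
      using order_trans [OF S(2) [OF z] mult_left_mono [OF z_norm K]] by (simp add: mult.assoc)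
    have tail: "lp_norm p (X (m + k) - X m) \<le> 2 * K * lp_norm p y * ((1 / 2) ^ m - (1 / 2) ^ (m + k))" for m k
    proof (induction k)
      case (Suc k)
      have "X (m + Suc k) - X m = (X (m + k) - X m) + S (z (m + k))" by (simp add: X_def)
      also have "lp_norm p \<dots> \<le> lp_norm p (X (m + k) - X m) + lp_norm p (S (z (m + k)))"
        by (intro tri hardy_Lp V_diff X S(1) z)
      also have "\<dots> \<le> 2 * K * lp_norm p y * ((1 / 2) ^ m - (1 / 2) ^ (m + k)) + K * lp_norm p y * (1 / 2) ^ (m + k)"
        by (intro add_mono Suc S_norm)
      also have "\<dots> = 2 * K * lp_norm p y * ((1 / 2) ^ m - (1 / 2) ^ (m + Suc k))" by (simp add: algebra_simps)
      finally show ?case .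
    qed simp
    define M where "M = 2 * K * lp_norm p y"
    have M: "0 \<le> M" using K by (simp add: M_def)
    have tail': "lp_norm p (X n - X m) \<le> M * (1 / 2) ^ m" if "m \<le> n" for m n
    proof -
      have "lp_norm p (X n - X m) \<le> M * ((1 / 2) ^ m - (1 / 2) ^ n)" using tail [of m "n - m"] that by (simp add: M_def)
      also have "\<dots> \<le> M * (1 / 2) ^ m" using M by (intro mult_left_mono) auto
      finally show ?thesis .
    qed
    have pow: "(\<lambda>m. M * (1 / 2 :: real) ^ m) \<longlonglongrightarrow> 0"
      by (intro tendsto_mult_right_zero LIMSEQ_power_zero) simp
    have "\<exists>x\<in>hardy p. (\<lambda>k. lp_norm p (X k - x)) \<longlonglongrightarrow> 0"
    proof (rule hardy_complete [OF p1 X])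
      fix e :: real assume e: "0 < e"
      from LIMSEQ_D [OF pow, of e] e obtain N where N: "\<And>m. m \<ge> N \<Longrightarrow> norm (M * (1 / 2 :: real) ^ m - 0) < e" by blast
      have "lp_norm p (X m - X n) < e" if "m \<ge> N" "n \<ge> N" for m n
      proof -
        have "lp_norm p (X m - X n) \<le> M * (1 / 2) ^ min m n"
          using tail' [of n m] tail' [of m n] lp_norm_minus_commute [OF p1, of "X m" "X n"] by (cases "n \<le> m") auto
        also have "\<dots> < e" using N [of "min m n"] that M by simp
        finally show ?thesis .
      qed
      then show "\<exists>N. \<forall>m\<ge>N. \<forall>n\<ge>N. lp_norm p (X m - X n) < e" by blast
    qed
    then obtain x where x: "x \<in> hardy p" "(\<lambda>k. lp_norm p (X k - x)) \<longlonglongrightarrow> 0" by blast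
    have "lp_norm p (y - ?T x) \<le> lp_norm p y * (1 / 2) ^ k + D * lp_norm p (X k - x)" for k
    proof -
      have "y - ?T x = z k + ?T (X k - x)" using TX [of k] X x(1) by (simp add: T_diff)
      also have "lp_norm p \<dots> \<le> lp_norm p (z k) + lp_norm p (?T (X k - x))"
        using z X x(1) by (intro tri hardy_Lp toeplitz_hardy [OF p g] V_diff)
      also have "\<dots> \<le> lp_norm p y * (1 / 2) ^ k + D * lp_norm p (X k - x)"
        using z_norm D(2) V_diff [OF X x(1)] by (intro add_mono) auto
      finally show ?thesis .
    qed
    moreover have "(\<lambda>k. lp_norm p y * (1 / 2) ^ k + D * lp_norm p (X k - x)) \<longlonglongrightarrow> lp_norm p y * 0 + D * 0"
      by (intro tendsto_intros LIMSEQ_power_zero x(2)) simp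
    ultimately have "lp_norm p (y - ?T x) \<le> 0"
      by (intro LIMSEQ_le_const [where X = "\<lambda>k. lp_norm p y * (1 / 2) ^ k + D * lp_norm p (X k - x)"]) auto
    then have "y - ?T x = 0"
      using lp_norm_eq_0 [OF p1 hardy_Lp [OF V_diff [OF y toeplitz_hardy [OF p g x(1)]]]] lp_norm_nonneg [of p "y - ?T x"] by linarith
    \<comment> \<open>The partial sums are bounded by 2 K times the norm of y. One partial sum that
      is closer to x than the norm of y accounts for the extra 1.\<close>
    moreover have "lp_norm p x \<le> (2 * K + 1) * lp_norm p y"
    proof -
      from LIMSEQ_D [OF x(2) Npos] obtain k where k: "lp_norm p (X k - x) < lp_norm p y" by auto
      have "X 0 = 0" by (simp add: X_def)
      then have "lp_norm p (X k) \<le> M" using tail' [of 0 k] by simp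
      moreover have "lp_norm p x \<le> lp_norm p (X k) + lp_norm p (x - X k)"
        by (rule lp_norm_le_add_diff [OF p1 hardy_Lp [OF x(1)] hardy_Lp [OF X]])
      ultimately show ?thesis using k lp_norm_minus_commute [OF p1, of x "X k"] by (simp add: M_def algebra_simps)
    qed
    ultimately show ?thesis using x(1) by (intro bexI [of _ x]) auto
  qed
  then show ?thesis using K by (intro exI [of _ "2 * K + 1"]) auto
qed

lemma toeplitz_inv:
  assumes "bij_betw (toeplitz g) (hardy p) (hardy p)" "y \<in> hardy p"
  shows "toeplitz_inv p g y \<in> hardy p" "toeplitz g (toeplitz_inv p g y) = y"
  using assms by (auto simp: toeplitz_inv_def bij_betw_def intro!: inv_into_into f_inv_into_f)

lemma toeplitz_inv_eqI:
  assumes "bij_betw (toeplitz g) (hardy p) (hardy p)" "x \<in> hardy p" "toeplitz g x = y"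
  shows "toeplitz_inv p g y = x"
  using assms inv_into_f_f by (auto simp: toeplitz_inv_def bij_betw_def)

lemma bounded_toeplitz_inv:
  assumes p: "1 < p" and g: "g \<in> Linf" and bij: "bij_betw (toeplitz g) (hardy p) (hardy p)"
  shows "bounded_operator p (hardy p) (toeplitz_inv p g)"
proof -
  have p1: "1 \<le> p" using p by simp
  note inv = toeplitz_inv [OF bij]
  obtain K where K: "0 \<le> K" "\<forall>y\<in>hardy p. \<exists>x\<in>hardy p. toeplitz g x = y \<and> lp_norm p x \<le> K * lp_norm p y"
    using toeplitz_open_mapping [OF p g] bij by (auto simp: bij_betw_def)
  show ?thesis
    unfolding bounded_operator_def
  proof (intro conjI ballI allI)
    show "\<exists>C. \<forall>y\<in>hardy p. lp_norm p (toeplitz_inv p g y) \<le> C * lp_norm p y"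
      using K(2) toeplitz_inv_eqI [OF bij] by metis
    show "toeplitz_inv p g (x + y) = toeplitz_inv p g x + toeplitz_inv p g y" if "x \<in> hardy p" "y \<in> hardy p" for x y
      using that by (intro toeplitz_inv_eqI [OF bij]) (simp_all add: inv hardy_add [OF p1] toeplitz_add [OF p g])
    show "toeplitz_inv p g (cscale z x) = cscale z (toeplitz_inv p g x)" if "x \<in> hardy p" for z x
      using that by (intro toeplitz_inv_eqI [OF bij]) (simp_all add: inv hardy_cscale [OF p1] toeplitz_cscale [OF p g])
  qed (rule inv)
qed

section \<open>Wiener--Hopf factorization\<close>

lemma norm_fcoeff_mult_le:
  assumes "1 < p" "1 / p + 1 / q = 1" "f \<in> Lp p" "g \<in> Lp q"
  shows "norm (fcoeff (f * g) n) \<le> lp_norm p f * lp_norm q g"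
  using norm_fcoeff_le [OF Holder(1) [OF assms], of n] Holder(2) [OF assms] by simp

text \<open>Density of polynomials, packaged for identities: take for L the difference of two
  bounded functionals that are to be shown equal.\<close>

lemma hardy_functional_eq_0:
  assumes p: "1 < p" and L: "\<And>f g. f \<in> hardy p \<Longrightarrow> g \<in> hardy p \<Longrightarrow> L (f + g) = L f + L g"
    "\<And>z f. f \<in> hardy p \<Longrightarrow> L (cscale z f) = z * L f"
    "\<And>f. f \<in> hardy p \<Longrightarrow> norm (L f) \<le> C * lp_norm p f"
    "\<And>n. 0 \<le> n \<Longrightarrow> L (tpow n) = (0 :: complex)" and f: "f \<in> hardy p"
  shows "L f = 0"
proof (rule ccontr)
  assume neg: "L f \<noteq> 0"
  have p1: "1 \<le> p" using p by simp
  have C: "0 < C"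
  proof (rule ccontr)
    assume "\<not> 0 < C"
    then have "C * lp_norm p f \<le> 0" by (simp add: mult_nonpos_nonneg)
    with L(3) [OF f] have "norm (L f) \<le> 0" by linarith
    with neg show False by simp
  qed
  have poly: "v \<in> hardy p \<and> L v = 0" if "v \<in> circ.span (tpow ` {0..})" for v
    using that
  proof (induction rule: circ.span_induct)
    show "circ.subspace {v. v \<in> hardy p \<and> L v = 0}"
    proof (rule circ.subspaceI)
      show "0 \<in> {v. v \<in> hardy p \<and> L v = 0}" using L(2) [OF hardy_0, of 0] by simp
    qed (auto simp: L(1,2) intro: hardy_add [OF p1] hardy_cscale [OF p1])
  qed (use L(4) p in auto)
  have "0 < norm (L f) / C" using neg C by simp
  then obtain v where v: "v \<in> hardy p" "v \<in> circ.span (tpow ` {0..})" "lp_norm p (f - v) < norm (L f) / C"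
    using hardy_poly_dense [OF p f] by metis
  have "L f = L (f - v) + L v" using L(1) [OF hardy_diff [OF p1 f v(1)] v(1)] by simp
  then have "norm (L f) \<le> C * lp_norm p (f - v)" using L(3) [OF hardy_diff [OF p1 f v(1)]] poly [OF v(2)] by simp
  also have "\<dots> < norm (L f)" using v(3) C by (simp add: field_simps)
  finally show False by simp
qed

text \<open>For fixed g and fixed n \<le> 0 the defect is a bounded functional of f, so only
  monomials f have to be checked, where it is a coefficient of g.\<close>

lemma hardy_mult:
  assumes p: "1 < p" "1 / p + 1 / q = 1" and f: "f \<in> hardy p" and g: "g \<in> hardy q"
  shows "f * g \<in> hardy 1" "fcoeff (f * g) 0 = fcoeff f 0 * fcoeff g 0"
proof -
  have p1: "1 \<le> p" using p by simp
  have gL: "g \<in> Lp q" using g by (rule hardy_Lp)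
  have fg: "f * g \<in> Lp 1" if "f \<in> hardy p" for f using Holder(1) [OF p hardy_Lp [OF that] gL] .
  have *: "fcoeff (f * g) n - (if n = 0 then fcoeff f 0 * fcoeff g 0 else 0) = 0" if n: "n \<le> 0" for n
  proof (rule hardy_functional_eq_0 [OF p(1) _ _ _ _ f, of "\<lambda>f. fcoeff (f * g) n - (if n = 0 then fcoeff f 0 * fcoeff g 0 else 0)"
        "lp_norm q g + norm (fcoeff g 0)"])
    fix f f' assume "f \<in> hardy p" "f' \<in> hardy p"
    then show "fcoeff ((f + f') * g) n - (if n = 0 then fcoeff (f + f') 0 * fcoeff g 0 else 0)
      = fcoeff (f * g) n - (if n = 0 then fcoeff f 0 * fcoeff g 0 else 0) + (fcoeff (f' * g) n - (if n = 0 then fcoeff f' 0 * fcoeff g 0 else 0))"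
      using fg hardy_L1 [OF p1] by (simp add: distrib_right fcoeff_add)
  next
    fix z f assume "f \<in> hardy p"
    then show "fcoeff (cscale z f * g) n - (if n = 0 then fcoeff (cscale z f) 0 * fcoeff g 0 else 0)
      = z * (fcoeff (f * g) n - (if n = 0 then fcoeff f 0 * fcoeff g 0 else 0))"
      by (simp add: cscale_mult_left fcoeff_cscale right_diff_distrib mult.assoc)
  next
    fix f assume f: "f \<in> hardy p"
    have "norm (fcoeff (f * g) n - (if n = 0 then fcoeff f 0 * fcoeff g 0 else 0))
        \<le> norm (fcoeff (f * g) n) + norm (if n = 0 then fcoeff f 0 * fcoeff g 0 else 0)"
      by (rule norm_triangle_ineq4)
    also have "\<dots> \<le> lp_norm p f * lp_norm q g + lp_norm p f * norm (fcoeff g 0)"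
    proof (intro add_mono norm_fcoeff_mult_le p hardy_Lp f g)
      have "norm (fcoeff f 0) \<le> lp_norm p f"
        using norm_fcoeff_le [OF hardy_L1 [OF p1 f], of 0] Lp_subset_L1(2) [OF p1 hardy_Lp [OF f]] by simp
      then show "norm (if n = 0 then fcoeff f 0 * fcoeff g 0 else 0) \<le> lp_norm p f * norm (fcoeff g 0)"
        by (simp add: norm_mult mult_right_mono)
    qed
    finally show "norm (fcoeff (f * g) n - (if n = 0 then fcoeff f 0 * fcoeff g 0 else 0)) \<le> (lp_norm q g + norm (fcoeff g 0)) * lp_norm p f"
      by (simp add: algebra_simps)
  next
    fix k :: int assume "0 \<le> k"
    then show "fcoeff (tpow k * g) n - (if n = 0 then fcoeff (tpow k) 0 * fcoeff g 0 else 0) = 0"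
      using n by (auto simp: fcoeff_tpow_mult fcoeff_tpow fcoeff_hardy [OF g])
  qed
  show "f * g \<in> hardy 1"
  proof (rule hardyI [OF fg [OF f]])
    show "fcoeff (f * g) n = 0" if "n < 0" for n using * [of n] that by simp
  qed
  show "fcoeff (f * g) 0 = fcoeff f 0 * fcoeff g 0" using * [of 0] by simp
qed

lemma conj_hardy_iff: "f \<in> conj_hardy p \<longleftrightarrow> tilde f \<in> hardy p"
proof
  assume f: "f \<in> conj_hardy p"
  then show "tilde f \<in> hardy p" by (auto simp: conj_hardy_def fcoeff_tilde intro!: hardyI Lp_tilde)
next
  assume f: "tilde f \<in> hardy p"
  have "fcoeff f n = 0" if "0 < n" for n using fcoeff_hardy [OF f, of "- n"] that by (simp add: fcoeff_tilde)
  moreover have "f \<in> Lp p" using Lp_tilde [OF hardy_Lp [OF f]] by simp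
  ultimately show "f \<in> conj_hardy p" by (simp add: conj_hardy_def)
qed

lemma Lp_AE_subseq:
  assumes p: "1 \<le> p" and f: "\<And>k. f k \<in> Lp p" and g: "g \<in> Lp p" and lim: "(\<lambda>k. lp_norm p (f k - g)) \<longlonglongrightarrow> 0"
  shows "\<exists>r. strict_mono r \<and> (AE t in circle_measure. (\<lambda>k. rep (f (r k)) t) \<longlonglongrightarrow> rep g t)"
proof -
  obtain g' r where g': "g' \<in> Lp p" "(\<lambda>k. lp_norm p (f k - g')) \<longlonglongrightarrow> 0" and r: "strict_mono r"
    "AE t in circle_measure. (\<lambda>k. rep (f (r k)) t) \<longlonglongrightarrow> rep g' t"
  proof (rule Lp_complete [OF p f])
    fix e :: real assume "0 < e"
    then have "0 < e / 2" by simp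
    from LIMSEQ_D [OF lim this] obtain N where N: "\<And>k. k \<ge> N \<Longrightarrow> lp_norm p (f k - g) < e / 2" by auto
    have "lp_norm p (f m - f n) < e" if "m \<ge> N" "n \<ge> N" for m n
      using lp_norm_diff_triangle [OF p f g f, of m n] N [OF that(1)] N [OF that(2)] lp_norm_minus_commute [OF p, of g "f n"] by simp
    then show "\<exists>N. \<forall>m\<ge>N. \<forall>n\<ge>N. lp_norm p (f m - f n) < e" by blast
  qed
  have "g' = g"
  proof (rule fcoeff_eqI)
    show "g' \<in> Lp 1" "g \<in> Lp 1" using Lp_subset_L1(1) [OF p] g g' by auto
    show "fcoeff g' n = fcoeff g n" for n
      using LIMSEQ_unique [OF fcoeff_tendsto [OF p f g'] fcoeff_tendsto [OF p f g lim]] .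
  qed
  with r show ?thesis by blast
qed

text \<open>Where z = 0 the reciprocals \<open>x k\<close> would tend to infinity. By Fatou the
  lower limit of |x k|^q has finite integral, so this happens on a null set only; off it,
  reciprocals converge and inherit the bound.\<close>

lemma reciprocal_Fatou:
  assumes q: "1 \<le> q" and x: "\<And>k. x k \<in> Lp q" "\<And>k. lp_norm q (x k) \<le> C"
    and xy: "AE t in circle_measure. \<forall>k. rep (x k) t * rep (y k) t = 1"
    and lim: "AE t in circle_measure. (\<lambda>k. rep (y k) t) \<longlonglongrightarrow> rep z t"
  shows "AE t in circle_measure. rep z t \<noteq> 0"
    and "AE t in circle_measure. (\<lambda>k. rep (x k) t) \<longlonglongrightarrow> rep (inverse z) t"
    and "inverse z \<in> Lp q" "lp_norm q (inverse z) \<le> C"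
proof -
  have "(\<integral>\<^sup>+t. liminf (\<lambda>k. ennreal (norm (rep (x k) t) powr q)) \<partial>circle_measure)
      \<le> liminf (\<lambda>k. \<integral>\<^sup>+t. ennreal (norm (rep (x k) t) powr q) \<partial>circle_measure)"
    by (rule nn_integral_liminf) measurable
  also have "\<dots> = liminf (\<lambda>k. ennreal (lp_integral q (x k)))"
    using x(1) unfolding lp_integral_def Lp_iff by (subst nn_integral_eq_integral) auto
  also have "\<dots> \<le> liminf (\<lambda>k::nat. ennreal (C powr q))"
    using q x(2) by (intro Liminf_mono always_eventually allI ennreal_leI) (auto simp: lp_integral_eq_lp_norm intro!: powr_mono2)
  also have "\<dots> < \<infinity>" by (simp add: Liminf_const)
  finally have "(\<integral>\<^sup>+t. liminf (\<lambda>k. ennreal (norm (rep (x k) t) powr q)) \<partial>circle_measure) \<noteq> \<infinity>" by simp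
  then have fin: "AE t in circle_measure. liminf (\<lambda>k. ennreal (norm (rep (x k) t) powr q)) \<noteq> \<infinity>"
    by (intro nn_integral_PInf_AE) measurable
  show nz: "AE t in circle_measure. rep z t \<noteq> 0"
    using fin xy lim
  proof eventually_elim
    case (elim t)
    show "rep z t \<noteq> 0"
    proof
      assume "rep z t = 0"
      then have "(\<lambda>k. rep (y k) t) \<longlonglongrightarrow> 0" using elim by simp
      moreover have y_eq: "rep (y k) t = inverse (rep (x k) t)" and xnz: "rep (x k) t \<noteq> 0" for k
        using elim(2) by (auto simp: inverse_unique dest: spec [of _ k])
      ultimately have "(\<lambda>k. norm (inverse (rep (x k) t))) \<longlonglongrightarrow> 0" by (simp add: tendsto_norm_zero)
      then have "filterlim (\<lambda>k. inverse (norm (rep (x k) t))) (at_right 0) sequentially"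
        using xnz by (intro tendsto_imp_filterlim_at_right) (auto simp: norm_inverse)
      then have "filterlim (\<lambda>k. inverse (inverse (norm (rep (x k) t)))) at_top sequentially"
        by (rule filterlim_compose [OF filterlim_inverse_at_top_right])
      then have "filterlim (\<lambda>k. norm (rep (x k) t)) at_top sequentially" by simp
      then have "filterlim (\<lambda>k. norm (rep (x k) t) powr q) at_top sequentially"
      proof (rule filterlim_at_top_mono)
        have "\<forall>\<^sub>F k in sequentially. 1 \<le> norm (rep (x k) t)"
          using \<open>filterlim (\<lambda>k. norm (rep (x k) t)) at_top sequentially\<close> by (simp add: filterlim_at_top)
        then show "\<forall>\<^sub>F k in sequentially. norm (rep (x k) t) \<le> norm (rep (x k) t) powr q"
          by eventually_elim (use q powr_mono [of 1 q] in force)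
      qed
      then have "(\<lambda>k. ennreal (norm (rep (x k) t) powr q)) \<longlonglongrightarrow> \<infinity>"
        by (simp add: ennreal_tendsto_top_eq_at_top)
      then show False using elim(1) lim_imp_Liminf [OF trivial_limit_sequentially] by auto
    qed
  qed
  show conv: "AE t in circle_measure. (\<lambda>k. rep (x k) t) \<longlonglongrightarrow> rep (inverse z) t"
    using nz xy lim rep_inverse [of z]
  proof eventually_elim
    case (elim t)
    have "rep (x k) t = inverse (rep (y k) t)" for k
      using elim(2) by (metis inverse_unique mult.commute)
    then show ?case using tendsto_inverse [OF elim(3,1)] elim(4) by simp
  qed
  show "inverse z \<in> Lp q" "lp_norm q (inverse z) \<le> C" using Lp_Fatou [OF q x conv] by auto
qed

text \<open>A bound in L^q with q > 1 gives uniform integrability. The differences are cut at height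
  M: the lower part is handled by dominated convergence, and the excess is at most M^(1-q) |d|^q,
  which is small on average for large M.\<close>

lemma fcoeff_tendsto_of_AE:
  assumes q: "1 < q" and x: "\<And>k. x k \<in> Lp q" "\<And>k. lp_norm q (x k) \<le> C" and z: "z \<in> Lp q" "lp_norm q z \<le> C"
    and lim: "AE t in circle_measure. (\<lambda>k. rep (x k) t) \<longlonglongrightarrow> rep z t"
  shows "(\<lambda>k. fcoeff (x k) n) \<longlonglongrightarrow> fcoeff z n"
proof -
  have q1: "1 \<le> q" using q by simp
  define d where "d k = x k - z" for k
  have d: "d k \<in> Lp q" "d k \<in> Lp 1" for k
    unfolding d_def using x z by (auto intro!: Lp_diff Lp_subset_L1(1) [OF q1] q1)
  have "AE t in circle_measure. \<forall>k. rep (d k) t = rep (x k) t - rep z t"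
    unfolding AE_all_countable d_def using rep_diff by blast
  with lim have d_lim: "AE t in circle_measure. (\<lambda>k. norm (rep (d k) t)) \<longlonglongrightarrow> 0"
  proof eventually_elim
    case (elim t)
    then show ?case by (simp add: LIM_zero tendsto_norm_zero)
  qed
  have C: "0 \<le> C" using z(2) lp_norm_nonneg order_trans by blast
  have d_norm: "lp_norm q (d k) \<le> 2 * C" for k
    using lp_norm_triangle [OF q1 x(1) Lp_uminus [OF q1 z(1)], of k] x(2) [of k] z(2) by (simp add: d_def lp_norm_uminus [OF q1])
  have "(\<lambda>k. lp_norm 1 (d k)) \<longlonglongrightarrow> 0"
  proof (rule LIMSEQ_I)
    fix e :: real assume e: "0 < e"
    have "((\<lambda>M::real. (2 * C) powr q * M powr (1 - q)) \<longlongrightarrow> (2 * C) powr q * 0) at_top"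
      using q by (intro tendsto_intros tendsto_neg_powr) (auto intro: filterlim_ident)
    then have "((\<lambda>M::real. (2 * C) powr q * M powr (1 - q)) \<longlongrightarrow> 0) at_top" by simp
    then have "\<forall>\<^sub>F M in at_top. (2 * C) powr q * M powr (1 - q) < e / 2"
      using e by (intro order_tendstoD(2)) auto
    then have "\<forall>\<^sub>F M::real in at_top. 0 < M \<and> (2 * C) powr q * M powr (1 - q) < e / 2"
      using eventually_gt_at_top [of "0::real"] by eventually_elim simp
    then obtain M :: real where M: "0 < M" "(2 * C) powr q * M powr (1 - q) < e / 2"
      using eventually_happens' [OF trivial_limit_at_top_linorder] by blast
    have int_min: "integrable circle_measure (\<lambda>t. min (norm (rep (d k) t)) M)" for k
      using M(1) by (intro circle.integrable_const_bound [of _ M]) auto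
    have "(\<lambda>k. \<integral>t. min (norm (rep (d k) t)) M \<partial>circle_measure) \<longlonglongrightarrow> (\<integral>t. 0 \<partial>circle_measure)"
    proof (rule integral_dominated_convergence [where w = "\<lambda>_. M"])
      show "AE t in circle_measure. (\<lambda>k. min (norm (rep (d k) t)) M) \<longlonglongrightarrow> 0"
        using d_lim
      proof eventually_elim
        case (elim t)
        have "(\<lambda>k. min (norm (rep (d k) t)) M) \<longlonglongrightarrow> min 0 M" by (intro tendsto_intros elim)
        then show ?case using M(1) by simp
      qed
      show "AE t in circle_measure. norm (min (norm (rep (d k) t)) M) \<le> M" for k using M(1) by (intro AE_I2) auto
    qed auto
    then have "(\<lambda>k. \<integral>t. min (norm (rep (d k) t)) M \<partial>circle_measure) \<longlonglongrightarrow> 0" by simp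
    from LIMSEQ_D [OF this, of "e / 2"] e obtain N
      where N: "\<And>k. k \<ge> N \<Longrightarrow> norm ((\<integral>t. min (norm (rep (d k) t)) M \<partial>circle_measure) - 0) < e / 2" by auto
    have "norm (lp_norm 1 (d k) - 0) < e" if k: "k \<ge> N" for k
    proof -
      have pw: "norm (rep (d k) t) \<le> min (norm (rep (d k) t)) M + M powr (1 - q) * norm (rep (d k) t) powr q" for t
      proof (cases "norm (rep (d k) t) \<le> M")
        case False
        then have pos: "0 < norm (rep (d k) t)" using M(1) by linarith
        have "norm (rep (d k) t) = norm (rep (d k) t) powr (1 - q) * norm (rep (d k) t) powr q"
          using pos by (simp flip: powr_add)
        also have "\<dots> \<le> M powr (1 - q) * norm (rep (d k) t) powr q"
          using False M(1) q by (intro mult_right_mono powr_mono2') auto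
        finally show ?thesis using M(1) pos by (auto simp: min_def)
      qed simp
      have "lp_norm 1 (d k) \<le> (\<integral>t. min (norm (rep (d k) t)) M + M powr (1 - q) * norm (rep (d k) t) powr q \<partial>circle_measure)"
        unfolding lp_norm_one_eq
      proof (rule integral_mono [OF _ _ pw])
        show "integrable circle_measure (\<lambda>t. norm (rep (d k) t))" using d(2) [of k] by (intro integrable_norm) (simp add: Lp_1_iff)
        show "integrable circle_measure (\<lambda>t. min (norm (rep (d k) t)) M + M powr (1 - q) * norm (rep (d k) t) powr q)"
          using int_min d(1) [of k] by (auto simp: Lp_iff)
      qed
      also have "\<dots> = (\<integral>t. min (norm (rep (d k) t)) M \<partial>circle_measure) + M powr (1 - q) * lp_integral q (d k)"
        using int_min d(1) [of k] by (simp add: Lp_iff lp_integral_def)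
      also have "M powr (1 - q) * lp_integral q (d k) \<le> M powr (1 - q) * (2 * C) powr q"
        using d_norm [of k] q by (intro mult_left_mono) (auto simp: lp_integral_eq_lp_norm intro!: powr_mono2)
      finally show ?thesis using N [OF k] M(2) by (simp add: mult.commute)
    qed
    then show "\<exists>N. \<forall>k\<ge>N. norm (lp_norm 1 (d k) - 0) < e" by blast
  qed
  then show ?thesis
    using x z Lp_subset_L1(1) [OF q1] by (intro fcoeff_tendsto [of 1]) (auto simp: d_def)
qed


lemma riesz_P_add:
  assumes "1 < p" "f \<in> Lp p" "g \<in> Lp p"
  shows "riesz_P (f + g) = riesz_P f + riesz_P g"
proof (rule riesz_P_eqI)
  have h: "riesz_P f \<in> hardy 1" "riesz_P g \<in> hardy 1"
    using riesz_P_hardy [OF assms(1)] assms hardy_subset_hardy_1 [of p] by auto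
  then show "riesz_P f + riesz_P g \<in> hardy 1" by (intro hardy_add) auto
  have "f \<in> Lp 1" "g \<in> Lp 1" using Lp_subset_L1(1) [of p] assms by auto
  with h show "fcoeff (riesz_P f + riesz_P g) n = fcoeff (f + g) n" if "0 \<le> n" for n
    using that by (simp add: fcoeff_add hardy_Lp fcoeff_riesz_P [OF assms(1,2)] fcoeff_riesz_P [OF assms(1,3)])
qed

lemma riesz_P_cscale:
  assumes "1 < p" "f \<in> Lp p"
  shows "riesz_P (cscale z f) = cscale z (riesz_P f)"
proof (rule riesz_P_eqI)
  show "cscale z (riesz_P f) \<in> hardy 1"
    using riesz_P_hardy [OF assms] hardy_subset_hardy_1 [of p] assms by (intro hardy_cscale) auto
qed (simp add: fcoeff_cscale fcoeff_riesz_P [OF assms])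

text \<open>The mirror image of analyticity of products. Index 0 also vanishes, since the reflection
  of w is 0 at the origin.\<close>

lemma fcoeff_mult_neg:
  assumes p: "1 < p" "1 / p + 1 / q = 1" and f: "tilde f \<in> hardy p" and w: "w \<in> Lp q" "\<And>n. 0 \<le> n \<Longrightarrow> fcoeff w n = 0"
    and n: "0 \<le> n"
  shows "fcoeff (f * w) n = 0"
proof -
  have tw: "tilde w \<in> hardy q" using w by (intro hardyI Lp_tilde) (auto simp: fcoeff_tilde)
  have "fcoeff (f * w) n = fcoeff (tilde f * tilde w) (- n)"
    using fcoeff_tilde [of "f * w" "- n"] by (simp add: tilde_mult)
  also have "\<dots> = 0"
    using fcoeff_hardy [OF hardy_mult(1) [OF p f tw], of "- n"] hardy_mult(2) [OF p f tw] n w(2) [of 0]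
    by (cases "n = 0") (auto simp: fcoeff_tilde)
  finally show ?thesis .
qed

section \<open>Construction of the factors when T(G) is invertible\<close>

locale invertible_toeplitz =
  fixes p q :: real and G :: circle_fun
  assumes p: "1 < p" "1 / p + 1 / q = 1" and G: "G \<in> Linf" and bij: "bij_betw (toeplitz G) (hardy p) (hardy p)"
begin

definition A :: "circle_fun \<Rightarrow> circle_fun" where "A = toeplitz_inv p G"
text \<open>T(G) h = 1 says that G h is 1 plus negative frequencies. So G h is the candidate for the
  minus-factor and 1/h the one for the plus-factor.\<close>

definition h :: circle_fun where "h = A 1"
definition gm :: circle_fun where "gm = G * h"
text \<open>The candidate minus-factor, reflected into H^p so that it has a power series in the
  disc.\<close>

definition \<gamma> :: circle_fun where "\<gamma> = tilde gm"

lemma p1: "1 \<le> p" and q: "1 < q" "1 \<le> q" "1 / q + 1 / p = 1"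
  using p conjugate_exponent [OF p] by auto

lemma A_hardy: "y \<in> hardy p \<Longrightarrow> A y \<in> hardy p" and toeplitz_A: "y \<in> hardy p \<Longrightarrow> toeplitz G (A y) = y"
  using toeplitz_inv [OF bij] by (auto simp: A_def)

lemma A_eqI: "x \<in> hardy p \<Longrightarrow> toeplitz G x = y \<Longrightarrow> A y = x"
  using toeplitz_inv_eqI [OF bij] by (simp add: A_def)

lemma A_add: "x \<in> hardy p \<Longrightarrow> y \<in> hardy p \<Longrightarrow> A (x + y) = A x + A y"
  and A_cscale: "x \<in> hardy p \<Longrightarrow> A (cscale z x) = cscale z (A x)"
  using bounded_toeplitz_inv [OF p(1) G bij] by (auto simp: bounded_operator_def A_def)

text \<open>Up to the factor h(0) this is integration against the reciprocal of \<open>gm\<close>,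
  as \<open>L_eq\<close> shows once that reciprocal is known to be integrable. Until then only its
  boundedness can be used.\<close>

definition L :: "circle_fun \<Rightarrow> complex" where "L y = fcoeff (A y) 0"

lemma L_add: "x \<in> hardy p \<Longrightarrow> y \<in> hardy p \<Longrightarrow> L (x + y) = L x + L y"
  by (simp add: L_def A_add fcoeff_add hardy_L1 [OF p1 A_hardy])

lemma L_cscale: "x \<in> hardy p \<Longrightarrow> L (cscale z x) = z * L x"
  by (simp add: L_def A_cscale fcoeff_cscale)

lemma L_bound: "\<exists>K\<ge>0. \<forall>y\<in>hardy p. norm (L y) \<le> K * lp_norm p y"
proof -
  obtain K where K: "\<forall>y\<in>hardy p. lp_norm p (A y) \<le> K * lp_norm p y"
    using bounded_toeplitz_inv [OF p(1) G bij] by (auto simp: bounded_operator_def A_def)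
  have "norm (L y) \<le> max K 0 * lp_norm p y" if y: "y \<in> hardy p" for y
  proof -
    have "norm (L y) \<le> lp_norm p (A y)"
      unfolding L_def using norm_fcoeff_le [OF hardy_L1 [OF p1 A_hardy [OF y]]] Lp_subset_L1(2) [OF p1 hardy_Lp [OF A_hardy [OF y]]] order_trans by blast
    also have "\<dots> \<le> K * lp_norm p y" using K y by blast
    also have "\<dots> \<le> max K 0 * lp_norm p y" by (intro mult_right_mono) auto
    finally show ?thesis .
  qed
  then show ?thesis by (intro exI [of _ "max K 0"]) auto
qed

lemma L_0: "L 0 = 0"
  using L_cscale [OF hardy_0, of 0] by simp

lemma L_sum: "finite I \<Longrightarrow> (\<And>i. i \<in> I \<Longrightarrow> f i \<in> hardy p) \<Longrightarrow> L (\<Sum>i\<in>I. f i) = (\<Sum>i\<in>I. L (f i))"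
  by (induction I rule: finite_induct) (auto simp: L_0 L_add circ.subspace_sum [OF subspace_hardy [OF p1]])

lemma power_sum_hardy: "summable (\<lambda>n. norm (b n)) \<Longrightarrow> power_sum b \<in> hardy p"
  using p(1) by (intro hardyI Linf_subset_Lp power_sum_Linf) (auto simp: fcoeff_power_sum)

lemma L_power_sum:
  assumes b: "summable (\<lambda>n. norm (b n))"
  shows "(\<lambda>n. b n * L (tpow (int n))) sums L (power_sum b)"
proof -
  obtain K where K: "0 \<le> K" "\<forall>y\<in>hardy p. norm (L y) \<le> K * lp_norm p y" using L_bound by blast
  define S where "S N = (\<Sum>n<N. cscale (b n) (tpow (int n)))" for N
  have t: "cscale (b n) (tpow (int n)) \<in> hardy p" for n using p by (intro hardy_cscale p1) auto
  have S: "S N \<in> hardy p" for N unfolding S_def by (intro circ.subspace_sum [OF subspace_hardy [OF p1]] t)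
  have LS: "L (S N) = (\<Sum>n<N. b n * L (tpow (int n)))" for N
    unfolding S_def L_sum [OF finite_lessThan t] using p by (intro sum.cong refl L_cscale) simp
  have lim: "(\<lambda>N. K * lp_norm p (S N - power_sum b)) \<longlonglongrightarrow> 0"
    unfolding S_def by (intro tendsto_mult_right_zero power_sum_partial_tendsto [OF p1 b])
  have le: "norm (L (S N) - L (power_sum b)) \<le> K * lp_norm p (S N - power_sum b)" for N
  proof -
    have d: "S N - power_sum b \<in> hardy p" by (rule hardy_diff [OF p1 S power_sum_hardy [OF b]])
    have "L (S N) - L (power_sum b) = L (S N - power_sum b)" using L_add [OF d power_sum_hardy [OF b]] by simp
    then show ?thesis using K(2) d by simp
  qed
  have "(\<lambda>N. L (S N) - L (power_sum b)) \<longlonglongrightarrow> 0"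
    by (rule Lim_null_comparison [OF always_eventually lim]) (simp add: le)
  then show ?thesis unfolding sums_def LS [symmetric] by (rule LIM_zero_cancel)
qed

lemma h_hardy: "h \<in> hardy p" and toeplitz_h: "toeplitz G h = 1"
  using A_hardy toeplitz_A p by (auto simp: h_def)

lemma fcoeff_gm: "0 \<le> n \<Longrightarrow> fcoeff gm n = (if n = 0 then 1 else 0)"
  using fcoeff_toeplitz [OF p(1) G h_hardy, of n] by (simp add: toeplitz_h gm_def fcoeff_one)

lemma gm_Lp: "gm \<in> Lp p"
  unfolding gm_def by (rule Lp_Linf_mult [OF p1 G hardy_Lp [OF h_hardy]])

lemma \<gamma>_hardy: "\<gamma> \<in> hardy p" and \<gamma>_0: "fcoeff \<gamma> 0 = 1"
  unfolding \<gamma>_def by (auto intro!: hardyI Lp_tilde gm_Lp simp: fcoeff_tilde fcoeff_gm)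

text \<open>The product is t^n gm, and cutting off its negative frequencies leaves a polynomial with
  the coefficients of \<gamma>. Applying the inverse of T(G) and evaluating at 0 gives a recursion
  for L on monomials.\<close>

lemma toeplitz_tpow_h:
  "toeplitz G (tpow (int n) * h) = (\<Sum>j\<le>n. cscale (fcoeff \<gamma> (int j)) (tpow (int (n - j))))"
proof (rule toeplitz_eqI [OF p1])
  have t: "cscale z (tpow (int m)) \<in> hardy p" for z m using p by (intro hardy_cscale p1) auto
  show "(\<Sum>j\<le>n. cscale (fcoeff \<gamma> (int j)) (tpow (int (n - j)))) \<in> hardy p"
    by (intro circ.subspace_sum [OF subspace_hardy [OF p1]] t)
  have fc: "fcoeff (\<Sum>j\<in>I. cscale (fcoeff \<gamma> (int j)) (tpow (int (n - j)))) k = (\<Sum>j\<in>I. fcoeff \<gamma> (int j) * (if k = int (n - j) then 1 else 0))" if "finite I" for I k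
    using that
  proof (induction I rule: finite_induct)
    case (insert x F)
    have "(\<Sum>j\<in>F. cscale (fcoeff \<gamma> (int j)) (tpow (int (n - j)))) \<in> hardy p"
      by (intro circ.subspace_sum [OF subspace_hardy [OF p1]] t)
    then show ?case using insert hardy_L1 [OF p1] t by (simp add: fcoeff_add fcoeff_cscale fcoeff_tpow)
  qed simp
  fix k :: int assume k: "0 \<le> k"
  have "fcoeff (G * (tpow (int n) * h)) k = fcoeff \<gamma> (int n - k)"
    using fcoeff_tpow_mult [of "int n" gm k] by (simp add: gm_def \<gamma>_def fcoeff_tilde ac_simps)
  moreover have "(\<Sum>j\<le>n. fcoeff \<gamma> (int j) * (if k = int (n - j) then 1 else 0)) = fcoeff \<gamma> (int n - k)"
  proof (cases "k \<le> int n")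
    case True
    then have "(\<Sum>j\<le>n. fcoeff \<gamma> (int j) * (if k = int (n - j) then 1 else 0)) = (\<Sum>j\<le>n. if j = n - nat k then fcoeff \<gamma> (int j) else 0)"
      using k by (intro sum.cong) auto
    also have "\<dots> = fcoeff \<gamma> (int n - k)" using True k by (simp add: of_nat_diff)
    finally show ?thesis .
  next
    case False
    then have "(\<Sum>j\<le>n. fcoeff \<gamma> (int j) * (if k = int (n - j) then 1 else 0)) = 0"
      by (intro sum.neutral) auto
    then show ?thesis using False by (simp add: fcoeff_hardy [OF \<gamma>_hardy])
  qed
  ultimately show "fcoeff (\<Sum>j\<le>n. cscale (fcoeff \<gamma> (int j)) (tpow (int (n - j)))) k = fcoeff (G * (tpow (int n) * h)) k"
    using fc [OF finite_atMost, of n k] by (metis (no_types, lifting))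
qed

text \<open>So \<open>L (tpow n) / fcoeff h 0\<close> are the coefficients of the formal reciprocal of \<open>\<gamma>\<close>.\<close>

lemma L_convolution: "(\<Sum>j\<le>n. fcoeff \<gamma> (int j) * L (tpow (int (n - j)))) = (if n = 0 then fcoeff h 0 else 0)"
proof -
  have t: "tpow (int m) \<in> hardy p" for m using p by simp
  have th: "tpow (int n) * h \<in> hardy p" using toeplitz_tpow_nonneg(2) [OF p1 h_hardy] by simp
  have "(\<Sum>j\<le>n. fcoeff \<gamma> (int j) * L (tpow (int (n - j)))) = L (\<Sum>j\<le>n. cscale (fcoeff \<gamma> (int j)) (tpow (int (n - j))))"
    using t p1 by (subst L_sum) (auto simp: L_cscale intro: hardy_cscale)
  also have "\<dots> = fcoeff (tpow (int n) * h) 0"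
    unfolding L_def by (subst A_eqI [OF th toeplitz_tpow_h]) simp
  also have "\<dots> = (if n = 0 then fcoeff h 0 else 0)"
    by (simp add: fcoeff_tpow_mult fcoeff_hardy [OF h_hardy])
  finally show ?thesis .
qed

text \<open>With h(0) = 0 the recursion makes L vanish on all monomials, hence everywhere; but L
  takes the value 1 at T(G) 1.\<close>

lemma h_0: "fcoeff h 0 \<noteq> 0"
proof
  assume 0: "fcoeff h 0 = 0"
  have Lt: "L (tpow (int n)) = 0" for n
  proof (induction n rule: less_induct)
    case (less n)
    have "0 = (\<Sum>j\<le>n. fcoeff \<gamma> (int j) * L (tpow (int (n - j))))" using L_convolution [of n] 0 by simp
    also have "\<dots> = fcoeff \<gamma> (int 0) * L (tpow (int (n - 0))) + (\<Sum>j\<in>{..n} - {0}. fcoeff \<gamma> (int j) * L (tpow (int (n - j))))"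
      by (rule sum.remove) auto
    also have "(\<Sum>j\<in>{..n} - {0}. fcoeff \<gamma> (int j) * L (tpow (int (n - j)))) = 0"
    proof (intro sum.neutral ballI)
      fix j assume "j \<in> {..n} - {0}"
      then have "n - j < n" by auto
      from less [OF this] show "fcoeff \<gamma> (int j) * L (tpow (int (n - j))) = 0" by (simp only: mult_zero_right)
    qed
    finally show ?case by (simp add: \<gamma>_0)
  qed
  obtain K where K: "\<forall>y\<in>hardy p. norm (L y) \<le> K * lp_norm p y" using L_bound by blast
  have one: "1 \<in> hardy p" using p by simp
  have "L (toeplitz G 1) = 0"
  proof (rule hardy_functional_eq_0 [OF p(1) L_add L_cscale])
    show "norm (L f) \<le> K * lp_norm p f" if "f \<in> hardy p" for f using K that by blast
    show "L (tpow n) = 0" if "0 \<le> n" for n using Lt [of "nat n"] that by simp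
    show "toeplitz G 1 \<in> hardy p" by (rule toeplitz_hardy [OF p(1) G one])
  qed
  moreover have "L (toeplitz G 1) = 1" unfolding L_def by (subst A_eqI [OF one refl]) (simp add: fcoeff_one)
  ultimately show False by simp
qed

definition a :: "nat \<Rightarrow> complex" where "a n = L (tpow (int n)) / fcoeff h 0"

lemma a_bounded: "\<exists>K. \<forall>n. norm (a n) \<le> K"
proof -
  obtain K where K: "0 \<le> K" "\<forall>y\<in>hardy p. norm (L y) \<le> K * lp_norm p y" using L_bound by blast
  have "norm (a n) \<le> K / norm (fcoeff h 0)" for n
  proof -
    have "norm (L (tpow (int n))) \<le> K * lp_norm p (tpow (int n))" using K(2) p by simp
    also have "\<dots> \<le> K * 1" using K(1) p1 by (intro mult_left_mono) auto
    finally show ?thesis by (simp add: a_def norm_divide divide_right_mono)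
  qed
  then show ?thesis by blast
qed

lemma summable_a: "0 \<le> r \<Longrightarrow> r < 1 \<Longrightarrow> summable (\<lambda>n. norm (a n * of_real r ^ n))"
  using a_bounded summable_cauchy_series [of a _ "of_real r"] by auto

text \<open>Abel means of the formal reciprocal of \<gamma>, at a stage where its boundary values
  are not yet known to exist.\<close>

definition \<psi> :: "real \<Rightarrow> circle_fun" where "\<psi> r = power_sum (\<lambda>n. a n * of_real r ^ n)"

lemma \<psi>_mult_\<gamma>:
  assumes r: "0 \<le> r" "r < 1"
  shows "AE t in circle_measure. rep (\<psi> r) t * rep (analytic_poisson r \<gamma>) t = 1"
  using rep_power_sum [of "\<lambda>n. a n * of_real r ^ n"] rep_analytic_poisson [OF hardy_L1 [OF p1 \<gamma>_hardy] r] AE_circle_norm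
  unfolding \<psi>_def
proof eventually_elim
  case (elim t)
  define z where "z = of_real r * t"
  have z: "norm z < 1" using elim r by (simp add: z_def norm_mult)
  obtain K where K: "\<And>n. norm (a n) \<le> K" using a_bounded by blast
  have s1: "summable (\<lambda>n. norm (fcoeff \<gamma> (int n) * z ^ n))"
    by (rule summable_cauchy_series [OF norm_fcoeff_le [OF hardy_L1 [OF p1 \<gamma>_hardy]] z])
  have s2: "summable (\<lambda>n. norm (a n * z ^ n))" by (rule summable_cauchy_series [OF K z])
  have "cauchy_series \<gamma> z * (\<Sum>n. a n * z ^ n) = (\<Sum>n. \<Sum>j\<le>n. (fcoeff \<gamma> (int j) * z ^ j) * (a (n - j) * z ^ (n - j)))"
    unfolding cauchy_series_def by (rule Cauchy_product [OF s1 s2])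
  also have "\<dots> = (\<Sum>n. if n = 0 then 1 else 0)"
  proof (intro suminf_cong)
    fix n
    have "(\<Sum>j\<le>n. (fcoeff \<gamma> (int j) * z ^ j) * (a (n - j) * z ^ (n - j)))
        = (\<Sum>j\<le>n. z ^ n / fcoeff h 0 * (fcoeff \<gamma> (int j) * L (tpow (int (n - j)))))"
    proof (intro sum.cong refl)
      fix j assume "j \<in> {..n}"
      then have "z ^ n = z ^ j * z ^ (n - j)" by (simp flip: power_add)
      then show "fcoeff \<gamma> (int j) * z ^ j * (a (n - j) * z ^ (n - j)) = z ^ n / fcoeff h 0 * (fcoeff \<gamma> (int j) * L (tpow (int (n - j))))"
        unfolding a_def by (simp only: times_divide_eq_left times_divide_eq_right ac_simps)
    qed
    also have "\<dots> = z ^ n / fcoeff h 0 * (if n = 0 then fcoeff h 0 else 0)"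
      unfolding sum_distrib_left [symmetric] L_convolution ..
    finally show "(\<Sum>j\<le>n. (fcoeff \<gamma> (int j) * z ^ j) * (a (n - j) * z ^ (n - j))) = (if n = 0 then 1 else 0)"
      using h_0 by simp
  qed
  also have "\<dots> = (1 :: complex)" by (subst suminf_finite [of "{0}"]) auto
  finally have eq: "cauchy_series \<gamma> z * (\<Sum>n. a n * z ^ n) = 1" .
  have "(\<Sum>n. a n * of_real r ^ n * t ^ n) = (\<Sum>n. a n * z ^ n)"
    by (simp add: z_def power_mult_distrib mult.assoc)
  with elim(1,2) have "rep (power_sum (\<lambda>n. a n * of_real r ^ n)) t * rep (analytic_poisson r \<gamma>) t = (\<Sum>n. a n * z ^ n) * cauchy_series \<gamma> z"
    unfolding z_def by metis
  also have "\<dots> = 1" using eq by (simp only: mult.commute)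
  finally show ?case .
qed

text \<open>Pairing with a bounded y gives L of the analytic mean of the reflected y, divided by
  h(0). The constant is the bound K for L times the bound D for analytic means, over |h(0)|.\<close>

lemma \<psi>_bound: "\<exists>C. \<forall>r. 0 \<le> r \<and> r < 1 \<longrightarrow> lp_norm q (\<psi> r) \<le> C"
proof -
  obtain K where K: "0 \<le> K" "\<forall>y\<in>hardy p. norm (L y) \<le> K * lp_norm p y" using L_bound by blast
  obtain D where D: "0 \<le> D" "\<forall>f\<in>Lp p. \<forall>r. 0 \<le> r \<and> r < 1 \<longrightarrow> lp_norm p (analytic_poisson r f) \<le> D * lp_norm p f"
    using analytic_poisson_bound [OF p(1)] by blast
  define C where "C = K * D / norm (fcoeff h 0)"
  have "lp_norm q (\<psi> r) \<le> C" if r: "0 \<le> r" "r < 1" for r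
  proof (rule converse_Holder [OF q(1,3)])
    show "\<psi> r \<in> Linf" unfolding \<psi>_def by (rule power_sum_Linf [OF summable_a [OF r]])
    show "0 \<le> C" using K D by (simp add: C_def)
    fix y assume y: "y \<in> Linf"
    have yp: "y \<in> Lp 1" "tilde y \<in> Lp 1" "tilde y \<in> Lp p" using y Linf_tilde Linf_subset_Lp p by auto
    have b: "summable (\<lambda>n. norm (fcoeff (tilde y) (int n) * of_real r ^ n))" by (rule analytic_poisson_summable [OF yp(2) r])
    have ad: "analytic_poisson r (tilde y) \<in> hardy p" unfolding analytic_poisson_def by (rule power_sum_hardy [OF b])
    have "fcoeff (\<psi> r * y) 0 = (\<Sum>n. a n * of_real r ^ n * fcoeff y (0 - int n))"
      unfolding \<psi>_def by (rule fcoeff_power_sum_mult [OF summable_a [OF r] yp(1)])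
    also have "\<dots> = (\<Sum>n. fcoeff (tilde y) (int n) * of_real r ^ n * L (tpow (int n)) / fcoeff h 0)"
      by (simp add: a_def fcoeff_tilde ac_simps)
    also have "\<dots> = L (analytic_poisson r (tilde y)) / fcoeff h 0"
      unfolding analytic_poisson_def using sums_divide [OF L_power_sum [OF b], of "fcoeff h 0"] by (simp add: sums_iff)
    finally have "norm (fcoeff (\<psi> r * y) 0) = norm (L (analytic_poisson r (tilde y))) / norm (fcoeff h 0)" by (simp add: norm_divide)
    also have "\<dots> \<le> K * (D * lp_norm p y) / norm (fcoeff h 0)"
    proof (intro divide_right_mono norm_ge_zero)
      have "norm (L (analytic_poisson r (tilde y))) \<le> K * lp_norm p (analytic_poisson r (tilde y))" using K(2) ad by blast
      also have "\<dots> \<le> K * (D * lp_norm p (tilde y))" using D(2) yp(3) r K(1) by (intro mult_left_mono) auto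
      finally show "norm (L (analytic_poisson r (tilde y))) \<le> K * (D * lp_norm p y)" by (simp add: lp_norm_tilde)
    qed
    finally show "norm (fcoeff (\<psi> r * y) 0) \<le> C * lp_norm p y" by (simp add: C_def)
  qed
  then show ?thesis by blast
qed

text \<open>The analytic means of \<gamma> are its Poisson means and converge almost everywhere
  along some radii. Their reciprocals are the functions \<psi>, bounded in L^q, so the limit is
  nonzero almost everywhere and its reciprocal inherits the bound and the coefficients.\<close>

lemma inverse_\<gamma>: "\<gamma> * inverse \<gamma> = 1" "inverse \<gamma> \<in> hardy q" "fcoeff (inverse \<gamma>) (int n) = a n"
proof -
  have \<gamma>L: "\<gamma> \<in> Lp p" "\<gamma> \<in> Lp 1" using hardy_Lp [OF \<gamma>_hardy] hardy_L1 [OF p1 \<gamma>_hardy] by auto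
  obtain C where C: "\<forall>r. 0 \<le> r \<and> r < 1 \<longrightarrow> lp_norm q (\<psi> r) \<le> C" using \<psi>_bound by blast
  have eq: "analytic_poisson (radius k) \<gamma> = poisson (radius k) \<gamma>" for k
    using \<gamma>L(2) fcoeff_hardy [OF \<gamma>_hardy] radius by (intro analytic_poisson_eq_poisson) auto
  have ad: "analytic_poisson (radius k) \<gamma> \<in> Lp p" for k using p \<gamma>L radius by (intro analytic_poisson_Lp) auto
  have "(\<lambda>k. lp_norm p (analytic_poisson (radius k) \<gamma> - \<gamma>)) \<longlonglongrightarrow> 0"
    unfolding eq by (rule poisson_tendsto [OF p1 \<gamma>L(1)])
  from Lp_AE_subseq [OF p1 ad \<gamma>L(1) this] obtain r where r: "strict_mono r"
    "AE t in circle_measure. (\<lambda>k. rep (analytic_poisson (radius (r k)) \<gamma>) t) \<longlonglongrightarrow> rep \<gamma> t" by blast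
  define x where "x k = \<psi> (radius (r k))" for k
  have xL: "x k \<in> Lp q" for k
    unfolding x_def \<psi>_def using q by (intro Linf_subset_Lp power_sum_Linf summable_a radius) auto
  have x_norm: "lp_norm q (x k) \<le> C" for k using C radius by (simp add: x_def)
  have xy: "AE t in circle_measure. \<forall>k. rep (x k) t * rep (analytic_poisson (radius (r k)) \<gamma>) t = 1"
    unfolding AE_all_countable x_def using \<psi>_mult_\<gamma> radius by blast
  note F = reciprocal_Fatou [OF q(2) xL x_norm xy r(2)]
  show "\<gamma> * inverse \<gamma> = 1"
    unfolding circle_fun_eq_iff
    using F(1) rep_mult [of \<gamma> "inverse \<gamma>"] rep_inverse [of \<gamma>] rep_one by eventually_elim simp
  have lim: "(\<lambda>k. fcoeff (x k) n) \<longlonglongrightarrow> fcoeff (inverse \<gamma>) n" for n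
    by (rule fcoeff_tendsto_of_AE [OF q(1) xL x_norm F(3,4,2)])
  have fx: "fcoeff (x k) n = (if 0 \<le> n then a (nat n) * of_real (radius (r k)) ^ nat n else 0)" for k n
    unfolding x_def \<psi>_def using summable_a [OF radius(1,2)] by (simp add: fcoeff_power_sum)
  show "inverse \<gamma> \<in> hardy q"
  proof (rule hardyI [OF F(3)])
    show "fcoeff (inverse \<gamma>) n = 0" if "n < 0" for n using LIMSEQ_unique [OF lim [of n], of 0] that by (simp add: fx)
  qed
  have "(\<lambda>k. a n * of_real (radius (r k)) ^ n) \<longlonglongrightarrow> a n * of_real 1 ^ n"
    using LIMSEQ_subseq_LIMSEQ [OF radius(3) r(1)] by (intro tendsto_intros) (simp add: o_def)
  then show "fcoeff (inverse \<gamma>) (int n) = a n" using LIMSEQ_unique [OF lim [of "int n"]] by (simp add: fx)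
qed

lemma gm_eq: "gm = tilde \<gamma>" and inverse_gm_eq: "inverse gm = tilde (inverse \<gamma>)"
  by (simp_all add: \<gamma>_def tilde_inverse)

lemma gm_inverse: "gm * inverse gm = 1"
proof -
  have "tilde (\<gamma> * inverse \<gamma>) = tilde 1" by (simp add: inverse_\<gamma>)
  then show ?thesis using tilde_const [of 1] by (simp add: tilde_mult \<gamma>_def tilde_inverse)
qed

lemma inverse_gm_Lp: "inverse gm \<in> Lp q"
  unfolding inverse_gm_eq by (rule Lp_tilde [OF hardy_Lp [OF inverse_\<gamma>(2)]])

lemma fcoeff_inverse_gm: "fcoeff (inverse gm) k = (if k \<le> 0 then a (nat (- k)) else 0)"
  using inverse_\<gamma>(3) [of "nat (- k)"] fcoeff_hardy [OF inverse_\<gamma>(2), of "- k"] by (auto simp: inverse_gm_eq fcoeff_tilde)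

lemma h_inverse: "h * inverse h = 1" "inverse h = G * inverse gm"
proof -
  have 1: "h * (G * inverse gm) = 1" using gm_inverse by (simp add: gm_def ac_simps)
  then show "inverse h = G * inverse gm" by (rule inverse_circle_unique)
  with 1 show "h * inverse h = 1" by simp
qed

text \<open>On monomials this is how the coefficients \<open>a\<close> were chosen; both sides are
  bounded, so density does the rest.\<close>

lemma L_eq: "f \<in> hardy p \<Longrightarrow> L f = fcoeff h 0 * fcoeff (inverse gm * f) 0"
proof -
  assume f: "f \<in> hardy p"
  obtain K where K: "0 \<le> K" "\<forall>y\<in>hardy p. norm (L y) \<le> K * lp_norm p y" using L_bound by blast
  define h0 where "h0 = fcoeff h 0"
  have iL: "inverse gm * f \<in> Lp 1" if "f \<in> hardy p" for f
    by (rule Holder(1) [OF q(1,3) inverse_gm_Lp hardy_Lp [OF that]])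
  have "L f - h0 * fcoeff (inverse gm * f) 0 = 0"
  proof (rule hardy_functional_eq_0 [OF p(1) _ _ _ _ f, of "\<lambda>f. L f - h0 * fcoeff (inverse gm * f) 0" "K + norm h0 * lp_norm q (inverse gm)"])
    show "L (f + g) - h0 * fcoeff (inverse gm * (f + g)) 0 = L f - h0 * fcoeff (inverse gm * f) 0 + (L g - h0 * fcoeff (inverse gm * g) 0)"
      if "f \<in> hardy p" "g \<in> hardy p" for f g
      using that iL by (simp add: L_add distrib_left fcoeff_add)
    show "L (cscale z f) - h0 * fcoeff (inverse gm * cscale z f) 0 = z * (L f - h0 * fcoeff (inverse gm * f) 0)"
      if "f \<in> hardy p" for z f
      using that by (simp add: L_cscale cscale_mult_right fcoeff_cscale right_diff_distrib)
    show "norm (L f - h0 * fcoeff (inverse gm * f) 0) \<le> (K + norm h0 * lp_norm q (inverse gm)) * lp_norm p f" if f: "f \<in> hardy p" for f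
    proof -
      have "norm (L f - h0 * fcoeff (inverse gm * f) 0) \<le> norm (L f) + norm (h0 * fcoeff (inverse gm * f) 0)" by (rule norm_triangle_ineq4)
      also have "\<dots> \<le> K * lp_norm p f + norm h0 * (lp_norm q (inverse gm) * lp_norm p f)"
        unfolding norm_mult using K(2) f
        by (intro add_mono mult_left_mono norm_fcoeff_mult_le [OF q(1,3) inverse_gm_Lp hardy_Lp [OF f]]) auto
      finally show ?thesis by (simp add: algebra_simps)
    qed
    show "L (tpow n) - h0 * fcoeff (inverse gm * tpow n) 0 = 0" if "0 \<le> n" for n
      using that h_0 by (simp add: fcoeff_mult_tpow fcoeff_inverse_gm h0_def a_def)
  qed
  then show ?thesis by (simp add: h0_def)
qed

text \<open>For n < 0 the coefficient is the mean of G t^(-n) / gm. The negative frequencies of G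
  t^(-n) contribute nothing to it, and the analytic part contributes L(T(G) t^(-n)) / h(0), where
  L(T(G) t^(-n)) is the value of t^(-n) at 0, that is, 0.\<close>

lemma inverse_h_hardy: "inverse h \<in> hardy q"
proof (rule hardyI)
  show "inverse h \<in> Lp q" unfolding h_inverse(2) by (rule Lp_Linf_mult [OF q(2) G inverse_gm_Lp])
  fix n :: int assume n: "n < 0"
  have t: "tpow (- n) \<in> hardy p" using n p by simp
  define w where "w = G * tpow (- n) - toeplitz G (tpow (- n))"
  have Tt: "toeplitz G (tpow (- n)) \<in> hardy p" by (rule toeplitz_hardy [OF p(1) G t])
  have Gt: "G * tpow (- n) \<in> Lp p" by (rule Lp_Linf_mult [OF p1 G hardy_Lp [OF t]])
  have w: "w \<in> Lp p" unfolding w_def by (rule Lp_diff [OF p1 Gt hardy_Lp [OF Tt]])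
  have "fcoeff w k = 0" if "0 \<le> k" for k
    using that Lp_subset_L1(1) [OF p1 Gt] hardy_L1 [OF p1 Tt] fcoeff_toeplitz [OF p(1) G t, of k] by (simp add: w_def fcoeff_diff)
  then have w0: "fcoeff (inverse gm * w) 0 = 0"
    using inverse_\<gamma>(2) by (intro fcoeff_mult_neg [OF q(1,3) _ w]) (auto simp: inverse_gm_eq)
  have "fcoeff h 0 * fcoeff (inverse gm * toeplitz G (tpow (- n))) 0 = L (toeplitz G (tpow (- n)))"
    by (rule L_eq [OF Tt, symmetric])
  also have "\<dots> = fcoeff (tpow (- n)) 0" unfolding L_def by (subst A_eqI [OF t refl]) simp
  finally have "fcoeff (inverse gm * toeplitz G (tpow (- n))) 0 = 0" using h_0 n by (simp add: fcoeff_tpow)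
  moreover have "inverse h * tpow (- n) = inverse gm * w + inverse gm * toeplitz G (tpow (- n))"
    by (simp add: h_inverse w_def algebra_simps)
  ultimately have "fcoeff (inverse h * tpow (- n)) 0 = 0"
    using w0 Holder(1) [OF q(1,3) inverse_gm_Lp w] Holder(1) [OF q(1,3) inverse_gm_Lp hardy_Lp [OF Tt]] by (simp add: fcoeff_add)
  then show "fcoeff (inverse h) n = 0" by (simp add: fcoeff_mult_tpow)
qed

text \<open>With v and w the parts P and Q of t^k / gm, one has G h v = gm v = t^k - gm w, and gm w
  has only negative frequencies.\<close>

lemma A_tpow: "0 \<le> k \<Longrightarrow> A (tpow k) = h * riesz_P (inverse gm * tpow k)"
proof (rule A_eqI)
  assume k: "0 \<le> k"
  have gt: "inverse gm * tpow k \<in> Lp q" using Lp_Linf_mult [OF q(2) Linf_tpow inverse_gm_Lp, of k] by (simp add: mult.commute)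
  define v where "v = riesz_P (inverse gm * tpow k)"
  have v: "v \<in> hardy q" and fv: "fcoeff v n = (if 0 \<le> n then fcoeff (inverse gm * tpow k) n else 0)" for n
    unfolding v_def using riesz_P_hardy [OF q(1) gt] fcoeff_riesz_P [OF q(1) gt] by auto
  \<comment> \<open>The reciprocal of \<open>gm\<close> has no positive frequencies, so v is a
    polynomial of degree at most k. Being bounded, it keeps h v in L^p.\<close>
  have v_eq: "v = power_sum (\<lambda>n. if int n \<le> k then a (nat k - n) else 0)"
  proof (rule fcoeff_eqI)
    have s: "summable (\<lambda>n. norm (if int n \<le> k then a (nat k - n) else 0))"
      using k by (intro summable_finite [of "{..nat k}"]) auto
    show "v \<in> Lp 1" by (rule hardy_L1 [OF q(2) v])
    show "power_sum (\<lambda>n. if int n \<le> k then a (nat k - n) else 0) \<in> Lp 1" by (rule Linf_subset_Lp [OF power_sum_Linf [OF s]]) simp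
    show "fcoeff v n = fcoeff (power_sum (\<lambda>n. if int n \<le> k then a (nat k - n) else 0)) n" for n
      using k by (auto simp: fv fcoeff_mult_tpow fcoeff_inverse_gm fcoeff_power_sum [OF s] nat_diff_distrib)
  qed
  have vb: "v \<in> Linf" unfolding v_eq using k by (intro power_sum_Linf summable_finite [of "{..nat k}"]) auto
  have "h * v \<in> Lp p" using Lp_Linf_mult [OF p1 vb hardy_Lp [OF h_hardy]] by (simp add: mult.commute)
  then show hv: "h * riesz_P (inverse gm * tpow k) \<in> hardy p"
    unfolding v_def [symmetric] using fcoeff_hardy [OF hardy_mult(1) [OF p h_hardy v]] by (rule hardyI)
  define w where "w = inverse gm * tpow k - v"
  have w: "w \<in> Lp q" unfolding w_def by (rule Lp_diff [OF q(2) gt hardy_Lp [OF v]])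
  have "fcoeff w n = 0" if "0 \<le> n" for n
    using that Lp_subset_L1(1) [OF q(2) gt] hardy_L1 [OF q(2) v] by (simp add: w_def fcoeff_diff fv)
  then have w0: "fcoeff (gm * w) n = 0" if "0 \<le> n" for n
    using that \<gamma>_hardy by (intro fcoeff_mult_neg [OF p _ w]) (auto simp: gm_eq)
  have "gm * w = tpow k - G * (h * v)"
    using gm_inverse by (simp add: w_def right_diff_distrib mult.assoc [symmetric] gm_def)
  then have eq: "G * (h * v) = tpow k - gm * w" by simp
  show "toeplitz G (h * riesz_P (inverse gm * tpow k)) = tpow k"
    unfolding v_def [symmetric]
  proof (rule toeplitz_eqI [OF p1])
    show "tpow k \<in> hardy p" using k p by simp
    show "fcoeff (tpow k) n = fcoeff (G * (h * v)) n" if "0 \<le> n" for n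
      unfolding eq using w0 [OF that] Holder(1) [OF p gm_Lp w] by (simp add: fcoeff_diff Linf_subset_Lp)
  qed
qed

lemma A_poly: "u \<in> circ.span {tpow k | k. k \<ge> 0} \<Longrightarrow> u \<in> hardy p \<and> inverse gm * u \<in> Lp q \<and> A u = h * riesz_P (inverse gm * u)"
proof (induction rule: circ.span_induct)
  show "circ.subspace {u. u \<in> hardy p \<and> inverse gm * u \<in> Lp q \<and> A u = h * riesz_P (inverse gm * u)}"
  proof (rule circ.subspaceI)
    have "riesz_P 0 = 0" by (rule riesz_P_eqI) auto
    moreover have "A 0 = 0" using A_cscale [OF hardy_0, of 0] by simp
    ultimately show "0 \<in> {u. u \<in> hardy p \<and> inverse gm * u \<in> Lp q \<and> A u = h * riesz_P (inverse gm * u)}" by simp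
  qed (auto simp: distrib_left cscale_mult_right A_add A_cscale riesz_P_add [OF q(1)] riesz_P_cscale [OF q(1)]
      intro: hardy_add [OF p1] hardy_cscale [OF p1] Lp_add [OF q(2)] Lp_cscale [OF q(2)])
next
  fix u assume "u \<in> {tpow k | k. k \<ge> 0}"
  then obtain k where k: "u = tpow k" "0 \<le> k" by blast
  have "inverse gm * tpow k \<in> Lp q" using Lp_Linf_mult [OF q(2) Linf_tpow inverse_gm_Lp, of k] by (simp add: mult.commute)
  then show "u \<in> hardy p \<and> inverse gm * u \<in> Lp q \<and> A u = h * riesz_P (inverse gm * u)"
    using k p A_tpow [OF k(2)] by simp
qed

text \<open>The bounded extension asked for by the definition is the inverse of T(G) itself. The
  exponent \<nu> is free because a power of t changes neither factor.\<close>

lemma wh_factorization_h: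
  assumes qp: "q = conj_exponent p"
  shows "wh_factorization p (G * tpow \<nu>) gm \<nu> (inverse h)"
  unfolding wh_factorization_def qp [symmetric]
proof (intro conjI)
  have "gm * tpow \<nu> * inverse h = G * (h * inverse h) * tpow \<nu>" by (simp only: gm_def ac_simps)
  then show "G * tpow \<nu> = gm * tpow \<nu> * inverse h" by (simp add: h_inverse(1))
  show "inverse h * inverse (inverse h) = 1" using h_inverse(1) by (simp add: mult.commute)
  show "gm * inverse gm = 1" by (rule gm_inverse)
  show "inverse h \<in> hardy q" "inverse (inverse h) \<in> hardy p" using inverse_h_hardy h_hardy by simp_all
  show "gm \<in> conj_hardy p" "inverse gm \<in> conj_hardy q" using \<gamma>_hardy inverse_\<gamma>(2) by (simp_all add: conj_hardy_iff inverse_gm_eq) (simp add: gm_eq)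
  show "fcoeff gm 0 = 1" by (simp add: fcoeff_gm)
  show "\<exists>A. bounded_operator p (hardy p) A \<and> (\<forall>u\<in>circ.span {tpow k |k. 0 \<le> k}. A u = inverse (inverse h) * riesz_P (inverse gm * u))"
    using bounded_toeplitz_inv [OF p(1) G bij] A_poly by (intro exI [of _ A]) (auto simp: A_def [symmetric])
qed

end

section \<open>Uniqueness of the factorization and the signature\<close>

lemma wh_factorizationD:
  assumes "wh_factorization p g gm \<nu> gp"
  shows "g = gm * tpow \<nu> * gp" "gp * inverse gp = 1" "gm * inverse gm = 1"
    "gp \<in> hardy (conj_exponent p)" "inverse gp \<in> hardy p"
    "tilde gm \<in> hardy p" "inverse (tilde gm) \<in> hardy (conj_exponent p)" "fcoeff gm 0 = 1"
  using assms by (auto simp: wh_factorization_def conj_hardy_iff tilde_inverse)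

lemma conj_exponent:
  assumes "1 < p"
  shows "1 < conj_exponent p" "1 / p + 1 / conj_exponent p = 1" "1 / conj_exponent p + 1 / p = 1"
  using assms by (auto simp: field_simps)

lemma eq_const_fun:
  assumes "f \<in> Lp 1" "\<And>n. n \<noteq> 0 \<Longrightarrow> fcoeff f n = 0"
  shows "f = const_fun (fcoeff f 0)"
proof (rule fcoeff_eqI [OF assms(1)])
  show "const_fun (fcoeff f 0) \<in> Lp 1" by (simp add: Linf_subset_Lp)
  show "fcoeff f n = fcoeff (const_fun (fcoeff f 0)) n" for n
    using fcoeff_cscale [of "fcoeff f 0" 1 n] assms(2) by (simp add: cscale_def fcoeff_one)
qed

text \<open>The quotient y = gp / gp' is analytic, and t^(\<nu> - \<nu>') y equals gm' / gm, which
  has value 1 at infinity. A positive exponent would make that value 0. With equal exponents y has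
  neither negative nor positive frequencies, so it is the constant 1.\<close>

lemma wh_factorization_unique_le:
  assumes p: "1 < p" and w: "wh_factorization p g gm \<nu> gp" and w': "wh_factorization p g gm' \<nu>' gp'" and le: "\<nu>' \<le> \<nu>"
  shows "gp = gp'"
proof -
  note W = wh_factorizationD [OF w] and W' = wh_factorizationD [OF w']
  note q = conj_exponent [OF p]
  define x where "x = inverse gm * gm'"
  define y where "y = gp * inverse gp'"
  have y: "y \<in> hardy 1" unfolding y_def by (rule hardy_mult(1) [OF q(1,3) W(4) W'(5)])
  have tx_eq: "tilde x = inverse (tilde gm) * tilde gm'" by (simp add: x_def tilde_mult tilde_inverse)
  have tx: "tilde x \<in> hardy 1" unfolding tx_eq by (rule hardy_mult(1) [OF q(1,3) W(7) W'(6)])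
  have one: "fcoeff (tilde gm * inverse (tilde gm)) 0 = 1"
  proof -
    have "tilde gm * inverse (tilde gm) = tilde 1" using W(3) by (simp add: tilde_mult [symmetric] tilde_inverse [symmetric])
    then show ?thesis using fcoeff_tilde [of 1 0] by (simp add: fcoeff_one)
  qed
  have "fcoeff (inverse (tilde gm)) 0 = 1"
    using one hardy_mult(2) [OF p q(2) W(6) W(7)] W(8) by (simp add: fcoeff_tilde)
  then have x0: "fcoeff x 0 = 1"
    using hardy_mult(2) [OF q(1,3) W(7) W'(6)] W'(8) fcoeff_tilde [of x 0] by (simp add: tx_eq fcoeff_tilde)
  have "gm * tpow \<nu> * gp = gm' * tpow \<nu>' * gp'" using W(1) W'(1) by simp
  then have "(inverse gm * gm * (gp' * inverse gp')) * (tpow (- \<nu>') * tpow \<nu>) * gp * inverse gp' = (inverse gm * gm') * (tpow (- \<nu>') * tpow \<nu>') * ((gp' * inverse gp') * (gp' * inverse gp'))"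
    by (metis (no_types, opaque_lifting) mult.assoc mult.commute)
  then have xy: "tpow (\<nu> - \<nu>') * y = x"
    using W(3) W'(2) by (simp add: tpow_mult_tpow x_def y_def mult.commute [of "inverse gm" gm] mult.assoc)
  have "\<nu> = \<nu>'"
  proof (rule ccontr)
    assume "\<nu> \<noteq> \<nu>'"
    with le have "fcoeff y (0 - (\<nu> - \<nu>')) = 0" by (intro fcoeff_hardy [OF y]) simp
    with x0 show False by (simp add: xy [symmetric] fcoeff_tpow_mult)
  qed
  with xy have yx: "y = x" by simp
  have "y = const_fun (fcoeff y 0)"
  proof (rule eq_const_fun [OF hardy_Lp [OF y]])
    fix n :: int assume "n \<noteq> 0"
    then consider "n < 0" | "0 < n" by linarith
    then show "fcoeff y n = 0"
    proof cases
      case 2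
      then show ?thesis using fcoeff_hardy [OF tx, of "- n"] by (simp add: fcoeff_tilde yx)
    qed (rule fcoeff_hardy [OF y])
  qed
  then have "y = 1" using x0 by (simp add: yx)
  have "gp = gp * (gp' * inverse gp')" by (simp add: W'(2))
  also have "\<dots> = y * gp'" by (simp add: y_def ac_simps)
  finally show ?thesis using \<open>y = 1\<close> by simp
qed

lemma plus_factor_eq:
  assumes p: "1 < p" and w: "wh_factorization p g gm \<nu> gp"
  shows "plus_factor p g = gp"
  unfolding plus_factor_def
proof (rule the_equality)
  show "\<exists>gm \<nu>. wh_factorization p g gm \<nu> gp" using w by blast
  fix gp' assume "\<exists>gm \<nu>. wh_factorization p g gm \<nu> gp'"
  then obtain gm' \<nu>' where w': "wh_factorization p g gm' \<nu>' gp'" by blast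
  show "gp' = gp"
    using wh_factorization_unique_le [OF p w w'] wh_factorization_unique_le [OF p w' w] by (cases "\<nu>' \<le> \<nu>") auto
qed

text \<open>The product x of gp and the reflected gm is analytic with value gp(0) at 0. From g(t)
  g(1/t) = 1 follows that the reflection of x is its reciprocal, again a product of an H^q and an
  H^p function. So x has no frequencies but 0, and its constant value squares to 1.\<close>

lemma signature_properties:
  assumes p: "1 < p" and w: "wh_factorization p g gm \<nu> gp" and gg: "g * tilde g = 1"
  shows "gm * tilde gp = const_fun (signature p g)" "signature p g = 1 \<or> signature p g = -1"
proof -
  note W = wh_factorizationD [OF w] and q = conj_exponent [OF p]
  define x where "x = tilde gm * gp"
  have x: "x \<in> hardy 1" unfolding x_def by (rule hardy_mult(1) [OF p q(2) W(6,4)])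
  have x0: "fcoeff x 0 = fcoeff gp 0" unfolding x_def using hardy_mult(2) [OF p q(2) W(6,4)] W(8) by (simp add: fcoeff_tilde)
  have tx: "tilde x = gm * tilde gp" by (simp add: x_def tilde_mult)
  have "x * tilde x = g * tilde g * (tpow \<nu> * tpow (- \<nu>))"
    unfolding W(1) tx by (simp add: x_def tilde_mult ac_simps tpow_mult_tpow tpow_mult_tpow_left)
  then have xx: "x * tilde x = 1" by (simp add: gg tpow_mult_tpow)
  have inv: "tilde x = inverse (tilde gm) * inverse gp"
    using inverse_circle_unique [OF xx] by (simp add: x_def inverse_mult_circle)
  have "tilde x \<in> hardy 1" unfolding inv by (rule hardy_mult(1) [OF q(1,3) W(7,5)])
  have const: "x = const_fun (fcoeff gp 0)"
    unfolding x0 [symmetric]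
  proof (rule eq_const_fun [OF hardy_Lp [OF x]])
    fix n :: int assume "n \<noteq> 0"
    then consider "n < 0" | "0 < n" by linarith
    then show "fcoeff x n = 0"
    proof cases
      case 2
      then show ?thesis using fcoeff_hardy [OF \<open>tilde x \<in> hardy 1\<close>, of "- n"] by (simp add: fcoeff_tilde)
    qed (rule fcoeff_hardy [OF x])
  qed
  have sig: "signature p g = fcoeff gp 0" by (simp add: signature_def plus_factor_eq [OF p w])
  show "gm * tilde gp = const_fun (signature p g)"
    unfolding sig tx [symmetric] by (subst const) simp
  have "const_fun (fcoeff gp 0 * fcoeff gp 0) = 1"
    using xx by (subst (asm) (1 2) const) (simp add: const_fun_mult)
  then have "fcoeff (const_fun (fcoeff gp 0 * fcoeff gp 0)) 0 = fcoeff 1 0" by simp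
  then have "fcoeff gp 0 * fcoeff gp 0 = 1"
    using fcoeff_cscale [of "fcoeff gp 0 * fcoeff gp 0" 1 0] by (simp add: cscale_def fcoeff_one)
  then show "signature p g = 1 \<or> signature p g = -1" unfolding sig by (metis power2_eq_1_iff power2_eq_square)
qed

section \<open>Kernels of Toeplitz plus Hankel operators\<close>

lemma flip_J_add: "flip_J (f + g) = flip_J f + flip_J g"
  and flip_J_diff: "flip_J (f - g) = flip_J f - flip_J g"
  and flip_J_cscale: "flip_J (cscale z f) = cscale z (flip_J f)"
  and flip_J_mult: "flip_J (f * g) = tilde f * flip_J g"
  by (simp_all add: flip_J_eq tilde_add tilde_diff tilde_mult tilde_cscale distrib_left right_diff_distrib cscale_mult_right ac_simps)

lemma flip_J_flip_J [simp]: "flip_J (flip_J f) = f"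
  by (simp add: flip_J_eq tilde_mult tpow_mult_tpow_left)

lemma riesz_P_hardy_id: "1 \<le> p \<Longrightarrow> f \<in> hardy p \<Longrightarrow> riesz_P f = f"
  by (rule riesz_P_eqI [OF hardy_subset_hardy_1]) auto

lemma riesz_P_minus_id: "f \<in> Lp 1 \<Longrightarrow> (\<And>n. 0 \<le> n \<Longrightarrow> fcoeff f n = 0) \<Longrightarrow> riesz_P f = 0"
  by (rule riesz_P_eqI) auto

lemma riesz_P_flip_J:
  assumes "1 \<le> p" "f \<in> hardy p"
  shows "riesz_P (flip_J f) = 0" "riesz_Q (flip_J f) = flip_J f"
proof -
  have "flip_J f \<in> Lp 1" using Lp_flip_J [OF _ hardy_L1 [OF assms]] by simp
  then show "riesz_P (flip_J f) = 0"
    by (rule riesz_P_minus_id) (simp add: fcoeff_flip_J fcoeff_hardy [OF assms(2)])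
  then show "riesz_Q (flip_J f) = flip_J f" by (simp add: riesz_Q_def)
qed

lemma flip_J_riesz_Q_hardy:
  assumes "1 < p" "f \<in> Lp p"
  shows "flip_J (riesz_Q f) \<in> hardy p"
proof (rule hardyI)
  have P: "riesz_P f \<in> hardy p" by (rule riesz_P_hardy [OF assms])
  show "flip_J (riesz_Q f) \<in> Lp p"
    unfolding riesz_Q_def using assms hardy_Lp [OF P] by (intro Lp_flip_J Lp_diff) auto
  show "fcoeff (flip_J (riesz_Q f)) n = 0" if "n < 0" for n
    using that Lp_subset_L1(1) [of p f] hardy_L1 [OF _ P] assms
    by (simp add: fcoeff_flip_J riesz_Q_def fcoeff_diff fcoeff_riesz_P)
qed

lemma riesz_P_eq_0_iff:
  assumes "1 < p" "f \<in> Lp p"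
  shows "riesz_P f = 0 \<longleftrightarrow> (\<exists>g\<in>hardy p. f = flip_J g)"
proof
  assume "riesz_P f = 0"
  then have "f = flip_J (flip_J (riesz_Q f))" by (simp add: riesz_Q_def)
  then show "\<exists>g\<in>hardy p. f = flip_J g" using flip_J_riesz_Q_hardy [OF assms] by blast
next
  assume "\<exists>g\<in>hardy p. f = flip_J g"
  then show "riesz_P f = 0" using riesz_P_flip_J(1) [of p] assms(1) by auto
qed

section \<open>The equation attached to a matching pair\<close>

locale matching =
  fixes p :: real and a b :: circle_fun and \<epsilon> :: complex
  assumes p: "1 < p" and match: "matching_pair a b" and \<epsilon>: "\<epsilon> = 1 \<or> \<epsilon> = -1"
begin

definition c :: circle_fun where "c = sub_c a b"
definition d :: circle_fun where "d = sub_d a b"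
definition ta :: circle_fun where "ta = inverse (tilde a)"

lemma p1: "1 \<le> p" using p by simp

lemma \<epsilon>_mult [simp]: "\<epsilon> * \<epsilon> = 1"
  using \<epsilon> by auto

lemma a_inverse: "a * inverse a = 1" and a_Linf: "a \<in> Linf" "inverse a \<in> Linf"
  and b_Linf: "b \<in> Linf" and ab: "a * tilde a = b * tilde b"
proof -
  obtain a' where a': "a' \<in> Linf" "a * a' = 1" using match by (auto simp: matching_pair_def)
  have inv: "inverse a = a'" by (rule inverse_circle_unique [OF a'(2)])
  show "a * inverse a = 1" "inverse a \<in> Linf" by (simp_all add: inv a')
qed (use match in \<open>auto simp: matching_pair_def\<close>)

lemma tilde_a_inverse: "tilde a * ta = 1"
proof -
  have "tilde (a * inverse a) = tilde 1" by (simp add: a_inverse)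
  then show ?thesis using tilde_const [of 1] by (simp add: ta_def tilde_mult tilde_inverse)
qed

lemma ta_Linf: "ta \<in> Linf"
  unfolding ta_def tilde_inverse [symmetric] by (rule Linf_tilde [OF a_Linf(2)])

lemma b_inverse_eq: "inverse b = tilde b * inverse a * ta"
proof (rule inverse_circle_unique)
  have "b * (tilde b * inverse a * ta) = (b * tilde b) * inverse a * ta" by (simp add: ac_simps)
  also have "\<dots> = (a * inverse a) * (tilde a * ta)" unfolding ab [symmetric] by (simp add: ac_simps)
  finally show "b * (tilde b * inverse a * ta) = 1" by (simp add: a_inverse tilde_a_inverse)
qed

lemma b_inverse: "b * inverse b = 1"
proof -
  have "b * inverse b = (b * tilde b) * inverse a * ta" by (simp add: b_inverse_eq ac_simps)
  also have "\<dots> = (a * inverse a) * (tilde a * ta)" unfolding ab [symmetric] by (simp add: ac_simps)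
  finally show ?thesis by (simp add: a_inverse tilde_a_inverse)
qed

lemma c_eq: "c = a * inverse b" "c = tilde b * ta"
proof -
  show "c = a * inverse b" by (simp add: c_def sub_c_def)
  also have "\<dots> = (a * inverse a) * tilde b * ta" by (simp add: b_inverse_eq ac_simps)
  finally show "c = tilde b * ta" by (simp add: a_inverse)
qed

lemma d_eq: "d = b * ta"
  by (simp add: d_def sub_d_def ta_def)

lemma c_Linf: "c \<in> Linf" and d_Linf: "d \<in> Linf"
  unfolding c_eq(2) d_eq by (intro Linf_mult Linf_tilde b_Linf ta_Linf)+

lemma c_tilde: "c * tilde c = 1"
proof -
  have "tilde c = b * inverse a" unfolding c_eq(2) by (simp add: tilde_mult ta_def tilde_inverse)
  then have "c * tilde c = (a * inverse a) * (b * inverse b)" unfolding c_eq(1) by (simp add: ac_simps)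
  then show ?thesis by (simp add: a_inverse b_inverse)
qed

lemma ker_TH_iff:
  assumes f: "f \<in> hardy p"
  shows "f \<in> ker_TH p \<epsilon> a b \<longleftrightarrow> (\<exists>g\<in>hardy p. c * f + cscale \<epsilon> (flip_J f) = cscale \<epsilon> (ta * g))"
proof -
  have L: "a * f \<in> Lp p" "b * flip_J f \<in> Lp p"
    by (intro Lp_Linf_mult Lp_flip_J p1 a_Linf b_Linf hardy_Lp [OF f])+
  have "toeplitz a f + cscale \<epsilon> (hankel b f) = riesz_P (a * f + cscale \<epsilon> (b * flip_J f))"
    using L p Lp_cscale [OF p1 L(2)]
    by (simp add: toeplitz_def hankel_def riesz_P_flip_J [OF p1 f] riesz_P_add [OF p] riesz_P_cscale [OF p])
  then have "f \<in> ker_TH p \<epsilon> a b \<longleftrightarrow> riesz_P (a * f + cscale \<epsilon> (b * flip_J f)) = 0"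
    using f by (simp add: ker_TH_def ker_on_def)
  also have "\<dots> \<longleftrightarrow> (\<exists>g\<in>hardy p. a * f + cscale \<epsilon> (b * flip_J f) = flip_J g)"
    using L by (intro riesz_P_eq_0_iff p Lp_add p1 Lp_cscale)
  also have "\<dots> \<longleftrightarrow> (\<exists>g\<in>hardy p. c * f + cscale \<epsilon> (flip_J f) = cscale \<epsilon> (ta * g))"
  proof (intro bex_cong refl)
    fix g
    have J: "flip_J (a * f + cscale \<epsilon> (b * flip_J f)) = tilde a * flip_J f + cscale \<epsilon> (tilde b * f)"
      by (simp add: flip_J_add flip_J_cscale flip_J_mult)
    have "a * f + cscale \<epsilon> (b * flip_J f) = flip_J g \<longleftrightarrow> tilde a * flip_J f + cscale \<epsilon> (tilde b * f) = g"
      using J by (metis flip_J_flip_J)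
    also have "\<dots> \<longleftrightarrow> c * f + cscale \<epsilon> (flip_J f) = cscale \<epsilon> (ta * g)"
    proof
      assume "tilde a * flip_J f + cscale \<epsilon> (tilde b * f) = g"
      then have "cscale \<epsilon> (ta * g) = cscale \<epsilon> ((tilde a * ta) * flip_J f + cscale \<epsilon> ((tilde b * ta) * f))"
        by (auto simp: distrib_left cscale_mult_right ac_simps)
      then show "c * f + cscale \<epsilon> (flip_J f) = cscale \<epsilon> (ta * g)"
        by (simp add: tilde_a_inverse c_eq(2) [symmetric] circ.scale_right_distrib add.commute)
    next
      assume "c * f + cscale \<epsilon> (flip_J f) = cscale \<epsilon> (ta * g)"
      then have "cscale \<epsilon> (tilde a * (c * f + cscale \<epsilon> (flip_J f))) = cscale \<epsilon> (tilde a * cscale \<epsilon> (ta * g))" by simp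
      moreover have "tilde a * c = tilde b" unfolding c_eq(2) mult.left_commute [of "tilde a"] tilde_a_inverse by simp
      then have "tilde a * (c * f) = tilde b * f" by (simp flip: mult.assoc)
      moreover have "tilde a * (ta * g) = g" using tilde_a_inverse by (simp flip: mult.assoc)
      ultimately show "tilde a * flip_J f + cscale \<epsilon> (tilde b * f) = g"
        by (simp add: distrib_left cscale_mult_right circ.scale_right_distrib add.commute)
    qed
    finally show "a * f + cscale \<epsilon> (b * flip_J f) = flip_J g \<longleftrightarrow> c * f + cscale \<epsilon> (flip_J f) = cscale \<epsilon> (ta * g)" .
  qed
  finally show ?thesis .
qed

text \<open>Applying J and multiplying by c reproduces the left side up to the sign, since c(t)
  c(1/t) = 1. Comparing the right sides eliminates f.\<close>

lemma c_equation_imp: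
  assumes "c * f + cscale \<epsilon> (flip_J f) = cscale \<epsilon> (ta * g)"
  shows "d * g = cscale \<epsilon> (flip_J g)"
proof -
  have "flip_J (c * f + cscale \<epsilon> (flip_J f)) = flip_J (cscale \<epsilon> (ta * g))" using assms by simp
  then have "tilde c * flip_J f + cscale \<epsilon> f = cscale \<epsilon> (inverse a * flip_J g)"
    by (simp add: flip_J_add flip_J_cscale flip_J_mult ta_def tilde_inverse)
  then have "c * (tilde c * flip_J f + cscale \<epsilon> f) = c * cscale \<epsilon> (inverse a * flip_J g)" by simp
  moreover have "c * (tilde c * flip_J f) = flip_J f" using c_tilde by (simp flip: mult.assoc)
  moreover have "c * (inverse a * flip_J g) = inverse b * flip_J g"
  proof -
    have "c * (inverse a * flip_J g) = (a * inverse a) * inverse b * flip_J g" unfolding c_eq(1) by (simp add: ac_simps)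
    then show ?thesis by (simp add: a_inverse)
  qed
  ultimately have "flip_J f + cscale \<epsilon> (c * f) = cscale \<epsilon> (inverse b * flip_J g)"
    by (simp add: distrib_left cscale_mult_right)
  moreover have "cscale \<epsilon> (c * f + cscale \<epsilon> (flip_J f)) = ta * g" unfolding assms by simp
  then have "flip_J f + cscale \<epsilon> (c * f) = ta * g" by (simp add: circ.scale_right_distrib add.commute)
  ultimately have "ta * g = cscale \<epsilon> (inverse b * flip_J g)" by simp
  then have "b * (ta * g) = b * cscale \<epsilon> (inverse b * flip_J g)" by simp
  moreover have "b * (inverse b * flip_J g) = flip_J g" using b_inverse by (simp flip: mult.assoc)
  ultimately show ?thesis by (simp add: d_eq cscale_mult_right mult.assoc)
qed

text \<open>On the kernel of T(d) the product d s has only negative frequencies, so the involution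
  is s to J(d s). The image of the projection is the set where this involution acts as
  multiplication by \<epsilon>.\<close>

lemma im_proj_sign_iff: "s \<in> im_proj_sign p \<epsilon> d \<longleftrightarrow> s \<in> hardy p \<and> d * s = cscale \<epsilon> (flip_J s)"
proof
  assume s: "s \<in> hardy p \<and> d * s = cscale \<epsilon> (flip_J s)"
  have ds: "d * s \<in> Lp p" using s by (intro Lp_Linf_mult p1 d_Linf hardy_Lp) simp
  have "riesz_P (d * s) = 0"
    using s riesz_P_cscale [OF p Lp_flip_J [OF p1 hardy_Lp], of s] riesz_P_flip_J(1) [OF p1, of s] by simp
  then have ker: "s \<in> ker_on (hardy p) (toeplitz d)" using s by (simp add: ker_on_def toeplitz_def)
  have "proj_P d s = cscale \<epsilon> s"
    using s \<open>riesz_P (d * s) = 0\<close> riesz_P_hardy_id [OF p1, of s] by (simp add: proj_P_def riesz_Q_def flip_J_cscale)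
  then have "proj_sign \<epsilon> d s = s"
    unfolding proj_sign_def
    using circ.scale_left_distrib [of "1 / 2" "1 / 2" s] by (simp only: circ.scale_right_distrib) simp
  with ker show "s \<in> im_proj_sign p \<epsilon> d" unfolding im_proj_sign_def by (metis imageI)
next
  assume "s \<in> im_proj_sign p \<epsilon> d"
  then obtain s0 where s0: "s0 \<in> hardy p" "riesz_P (d * s0) = 0" and s: "s = proj_sign \<epsilon> d s0"
    by (auto simp: im_proj_sign_def ker_on_def toeplitz_def)
  have dd: "d * tilde d = 1"
  proof -
    have "tilde d = tilde b * inverse a" by (simp add: d_eq ta_def tilde_mult tilde_inverse)
    then have "d * tilde d = (b * tilde b) * inverse a * ta" by (simp add: d_eq ac_simps)
    also have "\<dots> = (a * inverse a) * (tilde a * ta)" unfolding ab [symmetric] by (simp add: ac_simps)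
    finally show ?thesis by (simp add: a_inverse tilde_a_inverse)
  qed
  define x where "x = flip_J (d * s0)"
  have x: "x \<in> hardy p"
    using flip_J_riesz_Q_hardy [OF p Lp_Linf_mult [OF p1 d_Linf hardy_Lp [OF s0(1)]]] s0(2) by (simp add: x_def riesz_Q_def)
  have s_eq: "s = cscale (1 / 2) (s0 + cscale \<epsilon> x)"
    using s0 by (simp add: s proj_sign_def proj_P_def riesz_P_hardy_id [OF p1] riesz_Q_def x_def)
  have dx: "d * x = flip_J s0"
    using dd by (simp add: x_def flip_J_mult flip: mult.assoc)
  have Jx: "flip_J x = d * s0" by (simp add: x_def)
  have "d * s = cscale (1 / 2) (d * s0 + cscale \<epsilon> (flip_J s0))"
    by (simp add: s_eq cscale_mult_right distrib_left dx)
  moreover have "cscale \<epsilon> (flip_J s) = cscale (1 / 2) (cscale \<epsilon> (flip_J s0) + d * s0)"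
    by (simp add: s_eq flip_J_cscale flip_J_add Jx circ.scale_right_distrib)
  ultimately have "d * s = cscale \<epsilon> (flip_J s)" by (simp add: add.commute)
  moreover have "s \<in> hardy p" unfolding s_eq using s0(1) x by (intro hardy_cscale hardy_add p1)
  ultimately show "s \<in> hardy p \<and> d * s = cscale \<epsilon> (flip_J s)" by blast
qed

definition kernel0 :: "circle_fun set" where
  "kernel0 = {f \<in> hardy p. c * f + cscale \<epsilon> (flip_J f) = 0}"

lemma kernel0_subset_ker: "kernel0 \<subseteq> ker_on (hardy p) (toeplitz c)"
proof
  fix f assume "f \<in> kernel0"
  then have f: "f \<in> hardy p" "c * f = - cscale \<epsilon> (flip_J f)" by (auto simp: kernel0_def eq_neg_iff_add_eq_0)
  have "riesz_P (c * f) = riesz_P (cscale (- \<epsilon>) (flip_J f))" by (simp add: f(2))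
  also have "\<dots> = 0"
    unfolding riesz_P_cscale [OF p Lp_flip_J [OF p1 hardy_Lp [OF f(1)]]] riesz_P_flip_J(1) [OF p1 f(1)] by simp
  finally show "f \<in> ker_on (hardy p) (toeplitz c)" using f(1) by (simp add: ker_on_def toeplitz_def)
qed

end

section \<open>The general solution when T(c) has nonnegative index\<close>

locale matching_index = matching +
  assumes index: "0 \<le> ind_T p c" and bij: "bij_betw (toeplitz (c * tpow (ind_T p c))) (hardy p) (hardy p)"
begin

abbreviation \<kappa> :: int where "\<kappa> \<equiv> ind_T p c"

text \<open>T(c) sees the coefficients of T(c t^\<kappa>) from index \<kappa> on, and multiplication
  by t^\<kappa> is what places y there.\<close>

lemma rinv:
  assumes y: "y \<in> hardy p"
  shows "toeplitz_rinv p c y \<in> hardy p" "toeplitz c (toeplitz_rinv p c y) = y"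
proof -
  have ty: "tpow \<kappa> * y \<in> hardy p" "toeplitz (tpow \<kappa>) y = tpow \<kappa> * y"
    using toeplitz_tpow_nonneg [OF p1 y index] by auto
  have eq: "toeplitz_rinv p c y = toeplitz_inv p (c * tpow \<kappa>) (tpow \<kappa> * y)" by (simp add: toeplitz_rinv_def ty(2))
  show w: "toeplitz_rinv p c y \<in> hardy p" unfolding eq by (rule toeplitz_inv(1) [OF bij ty(1)])
  have G: "c * tpow \<kappa> \<in> Linf" by (intro Linf_mult c_Linf) simp
  show "toeplitz c (toeplitz_rinv p c y) = y"
  proof (rule toeplitz_eqI [OF p1 y])
    fix n :: int assume n: "0 \<le> n"
    have "fcoeff (c * toeplitz_rinv p c y) n = fcoeff (c * tpow \<kappa> * toeplitz_rinv p c y) (n + \<kappa>)"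
      using fcoeff_tpow_mult [of \<kappa> "c * toeplitz_rinv p c y" "n + \<kappa>"] by (simp add: ac_simps)
    also have "\<dots> = fcoeff (toeplitz (c * tpow \<kappa>) (toeplitz_rinv p c y)) (n + \<kappa>)"
      using fcoeff_toeplitz [OF p G w, of "n + \<kappa>"] n index by simp
    also have "\<dots> = fcoeff (tpow \<kappa> * y) (n + \<kappa>)" unfolding eq by (simp add: toeplitz_inv(2) [OF bij ty(1)])
    finally show "fcoeff y n = fcoeff (c * toeplitz_rinv p c y) n" by (simp add: fcoeff_tpow_mult)
  qed
qed

text \<open>By choice of w, the products c w and \<open>ta * s\<close> have the same analytic part.
  The two projections Q in the definition can therefore be dropped together.\<close>

lemma phi_eq:
  assumes s: "s \<in> hardy p"
  defines "w \<equiv> toeplitz_rinv p c (toeplitz ta s)"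
  shows "phi p \<epsilon> a b s = w - cscale \<epsilon> (flip_J (c * w)) + cscale \<epsilon> (flip_J (ta * s))"
proof -
  have y: "toeplitz ta s \<in> hardy p" by (rule toeplitz_hardy [OF p ta_Linf s])
  have "riesz_P (c * w) = riesz_P (ta * s)" using rinv(2) [OF y] by (simp add: w_def toeplitz_def)
  moreover have "riesz_P w = w" unfolding w_def by (rule riesz_P_hardy_id [OF p1 rinv(1) [OF y]])
  ultimately have "flip_J (riesz_Q (c * riesz_P w)) = flip_J (c * w) - flip_J (riesz_P (ta * s))"
    "flip_J (riesz_Q (ta * s)) = flip_J (ta * s) - flip_J (riesz_P (ta * s))"
    by (simp_all add: riesz_Q_def flip_J_diff)
  then show ?thesis
    unfolding phi_def Let_def c_def [symmetric] ta_def [symmetric] w_def [symmetric]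
    by (simp add: circ.scale_right_diff_distrib)
qed

lemma phi_hardy: "s \<in> hardy p \<Longrightarrow> phi p \<epsilon> a b s \<in> hardy p"
proof -
  assume s: "s \<in> hardy p"
  have y: "toeplitz ta s \<in> hardy p" by (rule toeplitz_hardy [OF p ta_Linf s])
  have "riesz_P (toeplitz_rinv p c (toeplitz ta s)) = toeplitz_rinv p c (toeplitz ta s)"
    by (rule riesz_P_hardy_id [OF p1 rinv(1) [OF y]])
  then show ?thesis
    unfolding phi_def Let_def c_def [symmetric] ta_def [symmetric]
    using rinv(1) [OF y] s
    by (simp add: hardy_add p1 hardy_diff hardy_cscale flip_J_riesz_Q_hardy p Lp_Linf_mult c_Linf ta_Linf hardy_Lp)
qed

text \<open>The part w - \<epsilon> J(c w) solves the homogeneous equation but is in general not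
  analytic; the third term of \<phi> restores analyticity. That term yields \<open>ta * s\<close>
  once through multiplication by c and once through the flip, hence the factor 2.\<close>

lemma phi_equation:
  assumes "s \<in> im_proj_sign p \<epsilon> d"
  shows "c * phi p \<epsilon> a b s + cscale \<epsilon> (flip_J (phi p \<epsilon> a b s)) = cscale 2 (ta * s)"
proof -
  have s: "s \<in> hardy p" and ds: "d * s = cscale \<epsilon> (flip_J s)" using assms by (auto simp: im_proj_sign_iff)
  define w where "w = toeplitz_rinv p c (toeplitz ta s)"
  have phi: "phi p \<epsilon> a b s = w - cscale \<epsilon> (tilde c * flip_J w) + cscale \<epsilon> (inverse a * flip_J s)"
    unfolding phi_eq [OF s] w_def by (simp add: flip_J_mult ta_def tilde_inverse)
  have 1: "c * (tilde c * flip_J w) = flip_J w" using c_tilde by (simp flip: mult.assoc)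
  have "c * (inverse a * flip_J s) = (a * inverse a) * inverse b * flip_J s" unfolding c_eq(1) by (simp add: ac_simps)
  then have 2: "c * (inverse a * flip_J s) = inverse b * flip_J s" by (simp add: a_inverse)
  have "inverse b * (d * s) = (b * inverse b) * (ta * s)" by (simp add: d_eq ac_simps)
  then have 3: "cscale \<epsilon> (inverse b * flip_J s) = ta * s" unfolding ds by (simp add: b_inverse cscale_mult_right)
  have 4: "flip_J (phi p \<epsilon> a b s) = flip_J w - cscale \<epsilon> (c * w) + cscale \<epsilon> (ta * s)"
    unfolding phi by (simp add: flip_J_add flip_J_diff flip_J_cscale flip_J_mult ta_def tilde_inverse)
  have "c * phi p \<epsilon> a b s = c * w - cscale \<epsilon> (flip_J w) + ta * s"
    unfolding phi by (simp add: distrib_left right_diff_distrib cscale_mult_right 1 2 3)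
  moreover have "cscale \<epsilon> (flip_J (phi p \<epsilon> a b s)) = cscale \<epsilon> (flip_J w) - c * w + ta * s"
    unfolding 4 by (simp add: circ.scale_right_distrib circ.scale_right_diff_distrib)
  ultimately have "c * phi p \<epsilon> a b s + cscale \<epsilon> (flip_J (phi p \<epsilon> a b s)) = ta * s + ta * s" by simp
  also have "\<dots> = cscale 2 (ta * s)" using circ.scale_left_distrib [of 1 1 "ta * s"] by simp
  finally show ?thesis .
qed

lemma zero_in_im_proj_sign: "0 \<in> im_proj_sign p \<epsilon> d"
  by (simp add: im_proj_sign_iff flip_J_eq) (metis circ.scale_zero_right mult_zero_right tilde_cscale circ.scale_zero_left)

lemma phi_0: "phi p \<epsilon> a b 0 = 0"
proof -
  have "toeplitz_rinv p c 0 = 0"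
    unfolding toeplitz_rinv_def by (simp add: toeplitz_inv_eqI [OF bij hardy_0])
  moreover have "flip_J 0 = 0" using flip_J_cscale [of 0 0] by simp
  ultimately show ?thesis by (simp add: phi_eq [OF hardy_0])
qed

theorem ker_TH_eq: "ker_TH p \<epsilon> a b = kernel0 + phi p \<epsilon> a b ` im_proj_sign p \<epsilon> d"
proof
  show "ker_TH p \<epsilon> a b \<subseteq> kernel0 + phi p \<epsilon> a b ` im_proj_sign p \<epsilon> d"
  proof
    fix f assume ker: "f \<in> ker_TH p \<epsilon> a b"
    then have f: "f \<in> hardy p" by (simp add: ker_TH_def ker_on_def)
    with ker obtain g where g: "g \<in> hardy p" "c * f + cscale \<epsilon> (flip_J f) = cscale \<epsilon> (ta * g)"
      unfolding ker_TH_iff [OF f] by blast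
    \<comment> \<open>The right side for \<phi>(s) is 2 \<open>ta * s\<close>, and it has to match
      \<epsilon> \<open>ta * g\<close>.\<close>
    define s where "s = cscale (\<epsilon> / 2) g"
    have "d * s = cscale \<epsilon> (flip_J s)"
      using c_equation_imp [OF g(2)] by (simp add: s_def cscale_mult_right flip_J_cscale mult.commute)
    then have s: "s \<in> im_proj_sign p \<epsilon> d" unfolding im_proj_sign_iff s_def using g(1) hardy_cscale [OF p1] by blast
    let ?f = "phi p \<epsilon> a b s"
    have sh: "s \<in> hardy p" using s by (simp add: im_proj_sign_iff)
    have "cscale 2 (ta * s) = cscale \<epsilon> (ta * g)" by (simp add: s_def cscale_mult_right)
    then have "c * (f - ?f) + cscale \<epsilon> (flip_J (f - ?f)) = 0"
      using g(2) phi_equation [OF s] by (simp add: right_diff_distrib flip_J_diff circ.scale_right_diff_distrib algebra_simps)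
    then have "f - ?f \<in> kernel0" using hardy_diff [OF p1 f phi_hardy [OF sh]] by (simp add: kernel0_def)
    moreover have "f = (f - ?f) + ?f" by simp
    ultimately show "f \<in> kernel0 + phi p \<epsilon> a b ` im_proj_sign p \<epsilon> d" using s by (metis imageI set_plus_intro)
  qed
  show "kernel0 + phi p \<epsilon> a b ` im_proj_sign p \<epsilon> d \<subseteq> ker_TH p \<epsilon> a b"
  proof
    fix f assume "f \<in> kernel0 + phi p \<epsilon> a b ` im_proj_sign p \<epsilon> d"
    then obtain f0 s where f0: "f0 \<in> kernel0" and s: "s \<in> im_proj_sign p \<epsilon> d" and f: "f = f0 + phi p \<epsilon> a b s"
      by (auto elim!: set_plus_elim)
    have sh: "s \<in> hardy p" using s by (simp add: im_proj_sign_iff)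
    have fh: "f \<in> hardy p" unfolding f using f0 phi_hardy [OF sh] by (intro hardy_add p1) (auto simp: kernel0_def)
    have "c * f + cscale \<epsilon> (flip_J f) = (c * f0 + cscale \<epsilon> (flip_J f0)) + (c * phi p \<epsilon> a b s + cscale \<epsilon> (flip_J (phi p \<epsilon> a b s)))"
      by (simp add: f distrib_left flip_J_add circ.scale_right_distrib)
    also have "\<dots> = cscale 2 (ta * s)" using f0 by (simp add: kernel0_def phi_equation [OF s])
    also have "\<dots> = cscale \<epsilon> (ta * cscale (2 * \<epsilon>) s)" by (simp add: cscale_mult_right mult.left_commute [of \<epsilon>])
    finally show "f \<in> ker_TH p \<epsilon> a b"
      unfolding ker_TH_iff [OF fh] using hardy_cscale [OF p1 sh] by blast
  qed
qed

text \<open>If \<phi>(s) solves the homogeneous equation, its right side 2 \<open>ta * s\<close> is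
  0, and \<open>ta\<close> is invertible.\<close>

lemma kernel0_inter_phi: "kernel0 \<inter> phi p \<epsilon> a b ` im_proj_sign p \<epsilon> d = {0}"
proof -
  have "0 \<in> kernel0" using flip_J_cscale [of 0 0] by (simp add: kernel0_def)
  moreover have "0 \<in> phi p \<epsilon> a b ` im_proj_sign p \<epsilon> d" using phi_0 zero_in_im_proj_sign by (metis imageI)
  moreover have "phi p \<epsilon> a b s = 0" if "phi p \<epsilon> a b s \<in> kernel0" "s \<in> im_proj_sign p \<epsilon> d" for s
  proof -
    have "cscale 2 (ta * s) = 0" using that phi_equation by (simp add: kernel0_def)
    then have "tilde a * ta * s = 0" by (simp add: mult.assoc)
    then have "s = 0" by (simp add: tilde_a_inverse)
    then show ?thesis by (simp add: phi_0)
  qed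
  ultimately show ?thesis by blast
qed

end

section \<open>Shifting the pair by a power of t\<close>

context matching
begin

lemma matching_shift: "matching_pair (a * tpow (- int n)) (b * tpow (int n))"
  unfolding matching_pair_def
proof (intro conjI)
  show "a * tpow (- int n) \<in> Linf" "b * tpow (int n) \<in> Linf" using a_Linf b_Linf by (auto intro: Linf_mult)
  have "a * tpow (- int n) * (inverse a * tpow (int n)) = (a * inverse a) * (tpow (- int n) * tpow (int n))" by (simp only: ac_simps)
  then have "a * tpow (- int n) * (inverse a * tpow (int n)) = 1" by (simp add: a_inverse tpow_mult_tpow)
  then show "\<exists>a'\<in>Linf. a * tpow (- int n) * a' = 1" using Linf_mult [OF a_Linf(2) Linf_tpow] by blast
  have "a * tpow (- int n) * tilde (a * tpow (- int n)) = (a * tilde a) * (tpow (- int n) * tpow (int n))"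
    by (simp add: tilde_mult ac_simps)
  also have "\<dots> = b * tpow (int n) * tilde (b * tpow (int n))" unfolding ab by (simp add: tilde_mult ac_simps)
  finally show "a * tpow (- int n) * tilde (a * tpow (- int n)) = b * tpow (int n) * tilde (b * tpow (int n))" .
qed

lemma sub_d_shift: "sub_d (a * tpow (- int n)) (b * tpow (int n)) = d"
proof -
  have "sub_d (a * tpow (- int n)) (b * tpow (int n)) = (b * ta) * (tpow (int n) * tpow (- int n))"
    by (simp add: sub_d_def ta_def tilde_mult inverse_mult_circle ac_simps)
  then show ?thesis by (simp add: tpow_mult_tpow d_eq)
qed

lemma sub_c_shift: "sub_c (a * tpow (- int n)) (b * tpow (int n)) = c * tpow (- 2 * int n)"
proof -
  have "sub_c (a * tpow (- int n)) (b * tpow (int n)) = c * (tpow (- int n) * tpow (- int n))"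
    by (simp add: sub_c_def c_eq(1) inverse_mult_circle ac_simps)
  then show ?thesis by (simp add: tpow_mult_tpow)
qed

lemma ker_TH_shift:
  assumes f: "f \<in> hardy p"
  shows "f \<in> ker_TH p \<epsilon> a b \<longleftrightarrow> tpow (int n) * f \<in> ker_TH p \<epsilon> (a * tpow (- int n)) (b * tpow (int n))"
proof -
  interpret M: matching p "a * tpow (- int n)" "b * tpow (int n)" \<epsilon>
    by unfold_locales (use p \<epsilon> matching_shift in auto)
  have tf: "tpow (int n) * f \<in> hardy p" using toeplitz_tpow_nonneg(2) [OF p1 f] by simp
  have ta: "M.ta = tpow (- int n) * ta"
    by (simp add: M.ta_def ta_def tilde_mult inverse_mult_circle mult.commute)
  have "M.c * (tpow (int n) * f) + cscale \<epsilon> (flip_J (tpow (int n) * f)) = tpow (- int n) * (c * f + cscale \<epsilon> (flip_J f))"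
  proof -
    have "M.c * (tpow (int n) * f) = c * (tpow (- 2 * int n) * (tpow (int n) * f))"
      by (simp only: M.c_def sub_c_shift mult.assoc)
    then have "M.c * (tpow (int n) * f) = tpow (- int n) * (c * f)"
      by (simp add: tpow_mult_tpow_left mult.left_commute)
    then show ?thesis by (simp add: flip_J_mult distrib_left cscale_mult_right)
  qed
  moreover have "cscale \<epsilon> (M.ta * g) = tpow (- int n) * cscale \<epsilon> (ta * g)" for g
    by (simp add: ta cscale_mult_right mult.assoc)
  moreover have "tpow (- int n) * x = tpow (- int n) * y \<longleftrightarrow> x = y" for x y
  proof
    assume "tpow (- int n) * x = tpow (- int n) * y"
    then have "tpow (int n) * (tpow (- int n) * x) = tpow (int n) * (tpow (- int n) * y)" by simp
    then show "x = y" by (simp add: tpow_mult_tpow_left)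
  qed simp
  ultimately have "M.c * (tpow (int n) * f) + cscale \<epsilon> (flip_J (tpow (int n) * f)) = cscale \<epsilon> (M.ta * g) \<longleftrightarrow>
      c * f + cscale \<epsilon> (flip_J f) = cscale \<epsilon> (ta * g)" for g by simp
  then show ?thesis unfolding ker_TH_iff [OF f] M.ker_TH_iff [OF tf] by simp
qed

lemma ker_TH_eq_shift_image:
  assumes "ker_TH p \<epsilon> (a * tpow (- int n)) (b * tpow (int n)) = S"
  shows "ker_TH p \<epsilon> a b = toeplitz (tpow (- int n)) ` (S \<inter> toeplitz (tpow (int n)) ` hardy p)"
    and "ker_TH p \<epsilon> a b = {toeplitz (tpow (- int n)) u | u. u \<in> S \<and> (\<forall>k<n. fcoeff u (int k) = 0)}"
proof -
  have T: "toeplitz (tpow (int n)) f = tpow (int n) * f" if "f \<in> hardy p" for f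
    using toeplitz_tpow_nonneg(1) [OF p1 that] by simp
  have unshift: "toeplitz (tpow (- int n)) (tpow (int n) * f) = f" if "f \<in> hardy p" for f
    unfolding toeplitz_def by (simp add: tpow_mult_tpow_left riesz_P_hardy_id [OF p1 that])
  have ker: "f \<in> hardy p" if "f \<in> ker_TH p \<epsilon> a b" for f using that by (simp add: ker_TH_def ker_on_def)
  show 1: "ker_TH p \<epsilon> a b = toeplitz (tpow (- int n)) ` (S \<inter> toeplitz (tpow (int n)) ` hardy p)"
  proof (intro equalityI subsetI)
    fix f assume f: "f \<in> ker_TH p \<epsilon> a b"
    then have "tpow (int n) * f \<in> S" using ker_TH_shift [OF ker [OF f], of n] assms by simp
    then show "f \<in> toeplitz (tpow (- int n)) ` (S \<inter> toeplitz (tpow (int n)) ` hardy p)"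
      using unshift [OF ker [OF f]] T [OF ker [OF f]] ker [OF f] by (intro image_eqI [of _ _ "tpow (int n) * f"]) force+
  next
    fix f assume "f \<in> toeplitz (tpow (- int n)) ` (S \<inter> toeplitz (tpow (int n)) ` hardy p)"
    then obtain g where g: "g \<in> hardy p" "tpow (int n) * g \<in> S" "f = toeplitz (tpow (- int n)) (tpow (int n) * g)" using T by auto
    then show "f \<in> ker_TH p \<epsilon> a b" using ker_TH_shift [OF g(1), of n] assms unshift [OF g(1)] by simp
  qed
  \<comment> \<open>The elements of S are analytic, so vanishing of the coefficients 0, ..., n - 1
    amounts to divisibility by t^n within H^p.\<close>
  have "S \<inter> toeplitz (tpow (int n)) ` hardy p = {u \<in> S. \<forall>k<n. fcoeff u (int k) = 0}"
  proof (intro equalityI subsetI)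
    fix u assume "u \<in> S \<inter> toeplitz (tpow (int n)) ` hardy p"
    then obtain g where "u \<in> S" "g \<in> hardy p" "u = tpow (int n) * g" using T by auto
    then show "u \<in> {u \<in> S. \<forall>k<n. fcoeff u (int k) = 0}" by (simp add: fcoeff_tpow_mult fcoeff_hardy)
  next
    fix u assume "u \<in> {u \<in> S. \<forall>k<n. fcoeff u (int k) = 0}"
    then have u: "u \<in> S" "\<And>k. k < n \<Longrightarrow> fcoeff u (int k) = 0" by auto
    have uh: "u \<in> hardy p" using u(1) assms by (auto simp: ker_TH_def ker_on_def)
    have "fcoeff u m = 0" if "m < int n" for m
      using fcoeff_hardy [OF uh, of m] u(2) [of "nat m"] that by (cases "0 \<le> m") auto
    then have g: "tpow (- int n) * u \<in> hardy p" using uh by (intro hardy_tpow_mult p1) auto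
    have "u = toeplitz (tpow (int n)) (tpow (- int n) * u)" unfolding T [OF g] by (simp add: tpow_mult_tpow_left)
    with u(1) g show "u \<in> S \<inter> toeplitz (tpow (int n)) ` hardy p" by blast
  qed
  then show "ker_TH p \<epsilon> a b = {toeplitz (tpow (- int n)) u | u. u \<in> S \<and> (\<forall>k<n. fcoeff u (int k) = 0)}"
    unfolding 1 by auto
qed

end

theorem theorem6p2:
  fixes p :: real and a b c d :: circle_fun and \<kappa>1 \<kappa>2 :: int and n :: nat and \<epsilon> :: complex
    and \<L> \<Phi> :: "circle_fun set"
  assumes p: "1 < p"
    and ab: "fredholm_matching_pair p a b"
    and c: "c = sub_c a b" and d: "d = sub_d a b"
    and \<kappa>1: "\<kappa>1 = ind_T p c" and \<kappa>2: "\<kappa>2 = ind_T p d"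
    and signs: "\<kappa>1 < 0" "\<kappa>2 \<ge> 0"
    and n: "1 \<ge> 2 * int n + \<kappa>1" "2 * int n + \<kappa>1 \<ge> 0"
    and \<epsilon>: "\<epsilon> = 1 \<or> \<epsilon> = -1"
    and \<Phi>: "\<Phi> = phi p \<epsilon> (a * tpow (- int n)) (b * tpow (int n)) ` im_proj_sign p \<epsilon> d"
    and \<L>: "\<L> = {cscale ((1 - \<epsilon> * signature p c) / 2 * z) (inverse (plus_factor p c)) | z. True}"
  shows "(odd \<kappa>1 \<longrightarrow>
            \<L> \<inter> \<Phi> = {0} \<and>
            ker_TH p \<epsilon> a b =
              toeplitz (tpow (- int n)) ` ((\<L> + \<Phi>) \<inter> toeplitz (tpow (int n)) ` hardy p) \<and>
            ker_TH p \<epsilon> a b =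
              {toeplitz (tpow (- int n)) u | u. u \<in> \<L> + \<Phi> \<and> (\<forall>k<n. fcoeff u (int k) = 0)}) \<and>
         (even \<kappa>1 \<longrightarrow>
            ker_TH p \<epsilon> a b =
              toeplitz (tpow (- int n)) ` (\<Phi> \<inter> toeplitz (tpow (int n)) ` hardy p) \<and>
            ker_TH p \<epsilon> a b =
              {toeplitz (tpow (- int n)) u | u. u \<in> \<Phi> \<and> (\<forall>k<n. fcoeff u (int k) = 0)})"
proof -
  define q where "q = conj_exponent p"
  have q: "1 / p + 1 / q = 1" unfolding q_def by (rule conj_exponent(2) [OF p])
  interpret M0: matching p a b \<epsilon>
    by unfold_locales (use p ab \<epsilon> in \<open>auto simp: fredholm_matching_pair_def\<close>)
  have c0: "M0.c = c" "M0.d = d" by (simp_all add: M0.c_def M0.d_def c d)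
  have cL: "c \<in> Linf" and cc: "c * tilde c = 1" using M0.c_Linf M0.c_tilde by (simp_all add: c0)
  \<comment> \<open>One invertible symbol serves twice: it normalises c, whose factorization it
    provides, and also the shifted \<gamma>, since \<gamma> t^(2n + \<kappa>1) is the same
    function.\<close>
  define G where "G = c * tpow \<kappa>1"
  have GL: "G \<in> Linf" unfolding G_def by (intro Linf_mult cL) simp
  have bij: "bij_betw (toeplitz G) (hardy p) (hardy p)"
    unfolding G_def \<kappa>1 using ab signs(1) \<kappa>1
    by (intro toeplitz_negative_index p cL) (auto simp: fredholm_matching_pair_def c)
  let ?a = "a * tpow (- int n)" and ?b = "b * tpow (int n)"
  define \<gamma> where "\<gamma> = c * tpow (- 2 * int n)"
  interpret M: matching p ?a ?b \<epsilon>
    by unfold_locales (use p \<epsilon> M0.matching_shift in auto)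
  have M_c: "M.c = \<gamma>" and M_d: "M.d = d"
    using M0.sub_c_shift [of n] M0.sub_d_shift [of n] by (simp_all add: M.c_def M.d_def \<gamma>_def c0)
  have index: "ind_T p \<gamma> = 2 * int n + \<kappa>1" and G_eq: "\<gamma> * tpow (2 * int n + \<kappa>1) = G"
  proof -
    show "\<gamma> * tpow (2 * int n + \<kappa>1) = G" by (simp add: \<gamma>_def G_def mult.assoc tpow_mult_tpow)
    consider "2 * int n + \<kappa>1 = 0" | "2 * int n + \<kappa>1 = 1" using n by linarith
    then show "ind_T p \<gamma> = 2 * int n + \<kappa>1"
    proof cases
      case 1
      then have "- 2 * int n = \<kappa>1" by simp
      then have "\<gamma> = G" by (simp only: \<gamma>_def G_def)
      then show ?thesis using index_bij [OF bij] 1 by simp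
    next
      case 2
      then have "\<gamma> = G * tpow (- 1)" 
        unfolding \<gamma>_def G_def mult.assoc tpow_mult_tpow by (intro arg_cong [of _ _ "\<lambda>k. c * tpow k"]) linarith
      then show ?thesis using index_bij_tpow_minus(1) [OF p GL bij] 2 by simp
    qed
  qed
  interpret M: matching_index p ?a ?b \<epsilon>
    by unfold_locales (use n(2) bij index G_eq in \<open>simp_all add: M_c\<close>)
  have \<Phi>': "\<Phi> = phi p \<epsilon> ?a ?b ` im_proj_sign p \<epsilon> M.d" by (simp add: \<Phi> M_d)
  have kernel: "ker_TH p \<epsilon> ?a ?b = M.kernel0 + \<Phi>" unfolding \<Phi>' by (rule M.ker_TH_eq)
  have odd_case: "\<L> \<inter> \<Phi> = {0} \<and> ker_TH p \<epsilon> ?a ?b = \<L> + \<Phi>" if "odd \<kappa>1"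
  proof -
    have "2 * int n + \<kappa>1 \<noteq> 0" using that by (metis add_eq_0_iff dvd_minus_iff dvd_triv_left)
    then have odd: "2 * int n + \<kappa>1 = 1" using n by linarith
    interpret W: invertible_toeplitz p q G by unfold_locales (fact p q GL bij)+
    have "G * tpow (- \<kappa>1) = c" by (simp add: G_def mult.assoc tpow_mult_tpow)
    \<comment> \<open>Since c = G t^(-\<kappa>1), the two symbols share their factors, and the
      plus-factor of c is 1/h.\<close>
    then have w: "wh_factorization p c W.gm (- \<kappa>1) (inverse W.h)"
      using W.wh_factorization_h [OF q_def, of "- \<kappa>1"] by simp
    note D = wh_factorizationD [OF w] and sig = signature_properties [OF p w cc]
    let ?\<sigma> = "signature p c"
    have plus: "plus_factor p c = inverse W.h" by (rule plus_factor_eq [OF p w])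
    define e where "e = W.h"
    have e: "e \<in> hardy p" unfolding e_def by (rule W.h_hardy)
    have "tilde (inverse e) * tilde e = 1"
      using W.h_inverse(1) tilde_const [of 1] by (simp add: e_def tilde_mult [symmetric] mult.commute)
    \<comment> \<open>The reflected plus-factor is the reciprocal of the reflected e, so the
      signature identity expresses the minus-factor through e.\<close>
    then have gm: "W.gm = cscale ?\<sigma> (tilde e)"
      using sig(1) unfolding e_def cscale_def by (metis mult.assoc mult.right_neutral)
    have \<gamma>G: "\<gamma> = G * tpow (- 1)"
    proof -
      have "\<gamma> * tpow 1 * tpow (- 1) = G * tpow (- 1)" using G_eq odd by simp
      then show ?thesis by (simp add: mult.assoc tpow_mult_tpow)
    qed
    have \<gamma>e: "\<gamma> * e = tpow (- 1) * W.gm" by (simp add: \<gamma>G W.gm_def e_def ac_simps)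
    have Je: "flip_J e = tpow (- 1) * tilde e" by (rule flip_J_eq)
    have "e \<noteq> 0" using W.h_0 by (auto simp: e_def)
    \<comment> \<open>Here \<gamma> e = gm / t is the signature times J e, so on the line spanned by
      e the homogeneous equation is the scalar condition that z times (signature + \<epsilon>)
      vanishes.\<close>
    have hom: "\<gamma> * cscale z e + cscale \<epsilon> (flip_J (cscale z e)) = cscale (z * (?\<sigma> + \<epsilon>)) (flip_J e)" for z
      unfolding cscale_mult_right \<gamma>e gm flip_J_cscale Je
      by (simp add: cscale_mult_right distrib_left circ.scale_left_distrib mult.commute)
    have ker: "ker_on (hardy p) (toeplitz \<gamma>) = range (\<lambda>z. cscale z e)"
      unfolding \<gamma>G
    proof (rule index_bij_tpow_minus(2) [OF p GL bij _ \<open>e \<noteq> 0\<close>])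
      have "toeplitz (G * tpow (- 1)) e = 0"
        unfolding \<gamma>G [symmetric]
      proof (rule toeplitz_eqI [OF M0.p1 hardy_0])
        show "fcoeff 0 k = fcoeff (\<gamma> * e) k" if "0 \<le> k" for k
          using that W.fcoeff_gm [of "k + 1"] by (simp add: \<gamma>e fcoeff_tpow_mult)
      qed
      then show "e \<in> ker_on (hardy p) (toeplitz (G * tpow (- 1)))" using e by (simp add: ker_on_def)
    qed
    have "flip_J e \<noteq> 0" using \<open>e \<noteq> 0\<close> by (metis flip_J_flip_J flip_J_cscale circ.scale_zero_left)
    have "M.kernel0 = {cscale z e | z. z * (?\<sigma> + \<epsilon>) = 0}"
    proof (intro equalityI subsetI)
      fix f assume f: "f \<in> M.kernel0"
      then obtain z where z: "f = cscale z e" using M.kernel0_subset_ker ker by (auto simp: M_c)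
      then have "cscale (z * (?\<sigma> + \<epsilon>)) (flip_J e) = 0" using f hom [of z] by (simp add: M.kernel0_def M_c)
      then show "f \<in> {cscale z e | z. z * (?\<sigma> + \<epsilon>) = 0}" using \<open>flip_J e \<noteq> 0\<close> z by (auto simp: circ.scale_eq_0_iff)
    next
      fix f assume "f \<in> {cscale z e | z. z * (?\<sigma> + \<epsilon>) = 0}"
      then obtain z where z: "f = cscale z e" "z * (?\<sigma> + \<epsilon>) = 0" by blast
      then have "\<gamma> * f + cscale \<epsilon> (flip_J f) = 0" using hom [of z] by (simp only: circ.scale_zero_left)
      then show "f \<in> M.kernel0" using e z(1) by (simp add: M.kernel0_def M_c hardy_cscale M0.p1)
    qed
    also have "\<dots> = \<L>"
    proof -
      have L: "\<L> = {cscale ((1 - \<epsilon> * ?\<sigma>) / 2 * z) e | z. True}" by (simp add: \<L> plus e_def)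
      \<comment> \<open>The factor (1 - \<epsilon> \<sigma>) / 2 is 1 when the scalar condition
        holds for all z, and 0 when it forces z = 0.\<close>
      consider "?\<sigma> = - \<epsilon>" | "?\<sigma> = \<epsilon>" using sig(2) \<epsilon> by fastforce
      then show ?thesis
      proof cases
        case 1
        then have *: "(1 - \<epsilon> * ?\<sigma>) / 2 = 1" "?\<sigma> + \<epsilon> = 0" by simp_all
        show ?thesis unfolding L * by simp
      next
        case 2
        then have "1 - \<epsilon> * ?\<sigma> = 0" "?\<sigma> + \<epsilon> \<noteq> 0" using \<epsilon> by auto
        then show ?thesis unfolding L by auto
      qed
    qed
    finally have "M.kernel0 = \<L>" .
    then show ?thesis using kernel M.kernel0_inter_phi by (simp add: \<Phi>')
  qed
  have even_case: "ker_TH p \<epsilon> ?a ?b = \<Phi>" if "even \<kappa>1"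
  proof -
    have "2 * int n + \<kappa>1 \<noteq> 1" using that by (metis dvd_add dvd_triv_left odd_one)
    then have "2 * int n + \<kappa>1 = 0" using n by linarith
    then have "\<gamma> = G" using G_eq by simp
    then have "ker_on (hardy p) (toeplitz \<gamma>) \<subseteq> {0}"
      using bij toeplitz_0 [of G] inj_onD [of "toeplitz G" "hardy p" _ 0] by (auto simp: ker_on_def bij_betw_def)
    then have "M.kernel0 \<subseteq> {0}" using M.kernel0_subset_ker by (auto simp: M_c)
    moreover have "0 \<in> M.kernel0" using M.kernel0_inter_phi by blast
    ultimately have "M.kernel0 = {0}" by blast
    moreover have "{0} + \<Phi> = \<Phi>" by (auto simp: set_plus_def)
    ultimately show ?thesis using kernel by simp
  qed
  show ?thesis
  proof (intro conjI impI)
    assume "odd \<kappa>1"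
    note * = odd_case [OF this]
    show "\<L> \<inter> \<Phi> = {0}" by (rule conjunct1 [OF *])
    show "ker_TH p \<epsilon> a b = toeplitz (tpow (- int n)) ` ((\<L> + \<Phi>) \<inter> toeplitz (tpow (int n)) ` hardy p)"
      and "ker_TH p \<epsilon> a b = {toeplitz (tpow (- int n)) u | u. u \<in> \<L> + \<Phi> \<and> (\<forall>k<n. fcoeff u (int k) = 0)}"
      by (rule M0.ker_TH_eq_shift_image [OF conjunct2 [OF *]])+
  next
    assume "even \<kappa>1"
    note * = even_case [OF this]
    show "ker_TH p \<epsilon> a b = toeplitz (tpow (- int n)) ` (\<Phi> \<inter> toeplitz (tpow (int n)) ` hardy p)"
      and "ker_TH p \<epsilon> a b = {toeplitz (tpow (- int n)) u | u. u \<in> \<Phi> \<and> (\<forall>k<n. fcoeff u (int k) = 0)}"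
      by (rule M0.ker_TH_eq_shift_image [OF *])+
  qed
qed

end
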